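(* Let $d\ge 2$ and let the edge weights $\omega_e$ be i.i.d. with an admissible distribution $F$. Suppose $\mathbb{E}[\omega^p]<\infty$ for some $p>2$, where $\omega\sim F$. Let $\{h_n\}_{n\ge1}$ be a sequence of nonnegative integers with $h_n=o(n^\alpha)$, where $$\alpha<\frac{1}{d+1+2(d-1)/(p-2)}.$$ Then $$\frac{a_n(h_n)-\mathbb{E}[a_n(h_n)]}{\sqrt{\operatorname{Var}(a_n(h_n))}}\Longrightarrow N(0,1)\quad\text{as } n\to\infty .$$ In particular, if $\mathbb{E}[\omega^p]<\infty$ for all $p\ge1$, then the CLT holds when $h_n=o(n^\alpha)$ with $\alpha<1/(d+1)$. If $h_n=O(1)$, then the condition $F(\lambda)<p_c(d)$ in the definition of admissibility is not needed. Moreover, the same results are true with $a_n(h_n)$ replaced by $t_n(h_n)$ and by $T_n(h_n)$.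
   Context: Consider the nearest-neighbor graph on $\mathbb{Z}^d$ with i.i.d. nonnegative edge weights $\omega_e\sim F$. All paths are finite nearest-neighbor paths; the weight (passage time) of a path $\mathcal{P}$ is $\omega(\mathcal{P})=\sum_{e\in\mathcal{P}}\omega_e$. Here $[-h,h]$ and $[0,n]$ mean the sets of integers in these intervals, and $e_1=(1,0,\ldots,0)$. A distribution function $F$ is admissible (in dimension $d$) if it is supported on $[0,\infty)$, is nondegenerate, and $F(\lambda)<p_c(d)$, where $\lambda$ is the smallest point of the support of $F$ and $p_c(d)$ is the critical probability for Bernoulli bond percolation on $\mathbb{Z}^d$. Define - $a_n(h)=\inf\{\omega(\mathcal{P}):\mathcal{P}\text{ a path from }0\text{ to }ne_1\text{ in }\mathbb{Z}\times[-h,h]^{d-1}\}$; - $t_n(h)=\inf\{\omega(\mathcal{P}):\mathcal{P}\text{ a path from }0\text{ to }ne_1\text{ in }[0,n]\times[-h,h]^{d-1}\}$; - $T_n(h)=\inf\{\omega(\mathcal{P}):\mathcal{P}\text{ a path in }[0,n]\times[-h,h]^{d-1}\text{ connecting }\{0\}\times[-h,h]^{d-1}\text{ and }\{n\}\times[-h,h]^{d-1}\}$. $\Longrightarrow$ denotes convergence in distribution. *)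

theory Defs
  imports "HOL-Probability.Probability" "HOL-Library.Landau_Symbols"
begin

(* The lattice Z^d for a dimension d :: nat: integer sequences that vanish from index d on.
   Coordinate 0 is the distinguished direction e_1. *)
type_synonym vertex = "nat \<Rightarrow> int"
type_synonym edge = "vertex set"

definition Zd :: "nat \<Rightarrow> vertex set" where
  "Zd d = {x. \<forall>i\<ge>d. x i = 0}"

definition axis_point :: "int \<Rightarrow> vertex" where
  "axis_point k = (\<lambda>i. if i = 0 then k else 0)"

definition adjacent :: "nat \<Rightarrow> vertex \<Rightarrow> vertex \<Rightarrow> bool" where
  "adjacent d x y \<longleftrightarrow> (\<Sum>i<d. \<bar>x i - y i\<bar>) = 1"

definition lattice_edges :: "nat \<Rightarrow> edge set" where
  "lattice_edges d = {{x, y} | x y. x \<in> Zd d \<and> y \<in> Zd d \<and> adjacent d x y}"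

definition lattice_path :: "nat \<Rightarrow> vertex set \<Rightarrow> vertex list \<Rightarrow> bool" where
  "lattice_path d S xs \<longleftrightarrow> xs \<noteq> [] \<and> set xs \<subseteq> S \<and> successively (adjacent d) xs"

definition path_edges :: "vertex list \<Rightarrow> edge list" where
  "path_edges xs = map (\<lambda>(x, y). {x, y}) (zip xs (tl xs))"

(* Paths need not be self-avoiding; repeated edges are counted with multiplicity.
   For nonnegative weights this does not affect the infima below. *)
definition path_weight :: "(edge \<Rightarrow> real) \<Rightarrow> vertex list \<Rightarrow> real" where
  "path_weight \<omega> xs = (\<Sum>e\<leftarrow>path_edges xs. \<omega> e)"

definition cylinder :: "nat \<Rightarrow> nat \<Rightarrow> vertex set" where
  "cylinder d m = {x \<in> Zd d. \<forall>i\<in>{1..<d}. \<bar>x i\<bar> \<le> int m}"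

definition box :: "nat \<Rightarrow> nat \<Rightarrow> nat \<Rightarrow> vertex set" where
  "box d n m = {x \<in> cylinder d m. 0 \<le> x 0 \<and> x 0 \<le> int n}"

definition fpp_a :: "nat \<Rightarrow> nat \<Rightarrow> nat \<Rightarrow> (edge \<Rightarrow> real) \<Rightarrow> real" where
  "fpp_a d n m \<omega> = Inf {path_weight \<omega> xs | xs. lattice_path d (cylinder d m) xs \<and>
     hd xs = axis_point 0 \<and> last xs = axis_point (int n)}"

definition fpp_t :: "nat \<Rightarrow> nat \<Rightarrow> nat \<Rightarrow> (edge \<Rightarrow> real) \<Rightarrow> real" where
  "fpp_t d n m \<omega> = Inf {path_weight \<omega> xs | xs. lattice_path d (box d n m) xs \<and>
     hd xs = axis_point 0 \<and> last xs = axis_point (int n)}"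

definition fpp_T :: "nat \<Rightarrow> nat \<Rightarrow> nat \<Rightarrow> (edge \<Rightarrow> real) \<Rightarrow> real" where
  "fpp_T d n m \<omega> = Inf {path_weight \<omega> xs | xs. lattice_path d (box d n m) xs \<and>
     hd xs 0 = 0 \<and> last xs 0 = int n}"

definition bond_percolation :: "nat \<Rightarrow> real \<Rightarrow> (edge \<Rightarrow> bool) measure" where
  "bond_percolation d p = (\<Pi>\<^sub>M e\<in>lattice_edges d. measure_pmf (bernoulli_pmf p))"

definition open_cluster :: "nat \<Rightarrow> (edge \<Rightarrow> bool) \<Rightarrow> vertex \<Rightarrow> vertex set" where
  "open_cluster d \<eta> x = {y. \<exists>xs. lattice_path d (Zd d) xs \<and> hd xs = x \<and> last xs = y \<and>
     (\<forall>e\<in>set (path_edges xs). \<eta> e)}"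

definition percolation_prob :: "nat \<Rightarrow> real \<Rightarrow> real" where
  "percolation_prob d p = measure (bond_percolation d p)
     {\<eta> \<in> space (bond_percolation d p). infinite (open_cluster d \<eta> (axis_point 0))}"

definition p_crit :: "nat \<Rightarrow> real" where
  "p_crit d = Sup {p \<in> {0..1}. percolation_prob d p = 0}"

(* A distribution function is represented by its Borel probability measure F on the reals;
   its value at x is cdf F x. *)
definition dist_support :: "real measure \<Rightarrow> real set" where
  "dist_support F = {x. \<forall>U. open U \<and> x \<in> U \<longrightarrow> measure F U > 0}"

definition nonneg_nondegenerate :: "real measure \<Rightarrow> bool" where
  "nonneg_nondegenerate F \<longleftrightarrow>
     real_distribution F \<and> dist_support F \<subseteq> {0..} \<and> \<not> (\<exists>c. measure F {c} = 1)"

(* The minimum exists for such F: the support is closed, nonempty and bounded below. *)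
definition smallest_support_point :: "real measure \<Rightarrow> real" where
  "smallest_support_point F = (LEAST x. x \<in> dist_support F)"

definition admissible :: "nat \<Rightarrow> real measure \<Rightarrow> bool" where
  "admissible d F \<longleftrightarrow>
     nonneg_nondegenerate F \<and> cdf F (smallest_support_point F) < p_crit d"

definition iid_edge_weights ::
    "nat \<Rightarrow> real measure \<Rightarrow> 'a measure \<Rightarrow> (edge \<Rightarrow> 'a \<Rightarrow> real) \<Rightarrow> bool" where
  "iid_edge_weights d F M w \<longleftrightarrow> prob_space M \<and>
     prob_space.indep_vars M (\<lambda>_. borel) w (lattice_edges d) \<and>
     (\<forall>e\<in>lattice_edges d. distr M borel (w e) = F)"

definition satisfies_clt :: "'a measure \<Rightarrow> (nat \<Rightarrow> 'a \<Rightarrow> real) \<Rightarrow> bool" where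
  "satisfies_clt M X \<longleftrightarrow>
     weak_conv_m
       (\<lambda>n. distr M borel
          (\<lambda>x. (X n x - prob_space.expectation M (X n)) / sqrt (prob_space.variance M (X n))))
       std_normal_distribution"

(* The central limit theorem for each of the three passage times, in cylinders of width h n. *)
definition fpp_clts ::
    "nat \<Rightarrow> 'a measure \<Rightarrow> (edge \<Rightarrow> 'a \<Rightarrow> real) \<Rightarrow> (nat \<Rightarrow> nat) \<Rightarrow> bool" where
  "fpp_clts d M w h \<longleftrightarrow>
     satisfies_clt M (\<lambda>n x. fpp_a d n (h n) (\<lambda>e. w e x)) \<and>
     satisfies_clt M (\<lambda>n x. fpp_t d n (h n) (\<lambda>e. w e x)) \<and>
     satisfies_clt M (\<lambda>n x. fpp_T d n (h n) (\<lambda>e. w e x))"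

end

theory Submission
  imports Defs
begin

text \<open>Cut a slab of length \<open>n\<close> in the middle and leave a gap of two or three layers. The crossing time
  of the slab is the sum of the crossing times of the two halves, which are independent and identically
  distributed, up to an error dominated by a sum over \<open>O(h)\<close> edges of the gap. Iterating
  \<open>J \<approx> log\<^sub>2 (n / h)\<close> times exhibits the crossing time as a sum of \<open>2\<^sup>J\<close> independent
  copies plus errors. For a Young function that behaves like \<open>\<bar>x\<bar>\<close> to the power \<open>q\<close> near \<open>0\<close> and to the
  power \<open>p < q\<close> at infinity, the expectation contracts under every halving by almost the factor
  \<open>2 powr (- p / 2)\<close>, as long as the errors are small against the standard deviation \<open>s\<close>. This replaces
  Lyapunov's condition after a bounded number of halvings and gives convergence of the characteristic
  functions.

  What remains is that \<open>s\<^sup>2\<close> is at least of order \<open>n / (h + 1) ^ (d - 1)\<close>. By the Cauchy-Schwarz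
  inequality against the centred number of edges of weight more than \<open>c\<close>, it suffices that every crossing
  contains on average linearly many edges of weight more than some \<open>c' > c\<close>. In a slab of bounded width
  this follows by counting layers all of whose edges are heavy; in general it is the exponential decay of
  connections in subcritical percolation, obtained by the argument of Duminil-Copin and Tassion.

  Finally the three passage times lie between two quantities whose difference is of order \<open>h = o(s)\<close> in
  mean square.\<close>

section \<open>Young functions\<close>

text \<open>The exponent comes from the two powers of the Young function. Write H = h + 1. The error
  of one halving is at most C * H up to an excess whose p-th moment is O(H^(p-1)). Divided by s, the
  first part contributes (H/s)^q and the excess H^(p-1) / s^p. The J halvings multiply both by R^J
  with R slightly above 2, that is, by n / H up to a small power of n. Inserting s^2 >= c n /
  H^(d-1), the excess is negligible for H <= n^a as soon as a (p - 2 + p (d-1)/2) < (p-2)/2, which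
  is a < 1 / (d + 1 + 2 (d-1)/(p-2)). The first part only asks for H / s to be at most a negative
  power of n, which is a < 1 / (d+1), because q may then be taken as large as necessary. The single
  power p would leave (H/s)^p in place of (H/s)^q; this is larger than the bound for the excess by a
  factor H and would lead to a smaller exponent.\<close>

lemma mvt_between:
  fixes f f' :: "real \<Rightarrow> real"
  assumes f: "\<And>x. (f has_real_derivative f' x) (at x)"
  shows "\<exists>z. \<bar>z\<bar> \<le> max \<bar>x\<bar> \<bar>y\<bar> \<and> \<bar>z - x\<bar> \<le> \<bar>y - x\<bar> \<and> f y - f x = (y - x) * f' z"
proof (cases "x = y")
  case False
  then consider "x < y" | "y < x" by linarith
  then show ?thesis
  proof cases
    case 1
    then obtain z where "x < z" "z < y" "f y - f x = (y - x) * f' z" using MVT2[OF 1, of f f'] f by blast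
    then show ?thesis by (intro exI[of _ z]) auto
  next
    case 2
    then obtain z where "y < z" "z < x" "f x - f y = (x - y) * f' z" using MVT2[OF 2, of f f'] f by blast
    then show ?thesis by (intro exI[of _ z]) (auto simp: algebra_simps)
  qed
qed auto

text \<open>\<open>g\<close> is the second derivative of \<open>psi\<close> as a function of the
  absolute value. Monotonicity and doubling of \<open>g\<close> make \<open>psi x\<close> comparable
  to \<open>x^2 * g \<bar>x\<bar>\<close>, so that the estimates can be made on
  \<open>g\<close>.\<close>

locale young =
  fixes g psi psi' :: "real \<Rightarrow> real" and K :: real
  assumes g_nonneg: "\<And>u. 0 \<le> u \<Longrightarrow> 0 \<le> g u"
    and g_mono: "\<And>u v. 0 \<le> u \<Longrightarrow> u \<le> v \<Longrightarrow> g u \<le> g v"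
    and doubling: "\<And>u. 0 \<le> u \<Longrightarrow> g (2 * u) \<le> K * g u"
    and K_pos: "0 < K"
    and psi_deriv: "\<And>x. (psi has_real_derivative psi' x) (at x)"
    and psi'_deriv: "\<And>x. (psi' has_real_derivative g \<bar>x\<bar>) (at x)"
    and psi_0: "psi 0 = 0" and psi'_0: "psi' 0 = 0"
begin

lemma doubling_power: "0 \<le> u \<Longrightarrow> g (2 ^ k * u) \<le> K ^ k * g u"
proof (induction k)
  case (Suc k)
  have "g (2 ^ Suc k * u) = g (2 * (2 ^ k * u))" by (simp add: mult.assoc)
  also have "\<dots> \<le> K * g (2 ^ k * u)" using Suc by (intro doubling) auto
  also have "\<dots> \<le> K * (K ^ k * g u)" using Suc K_pos by (intro mult_left_mono) auto
  finally show ?case by (simp add: mult.assoc)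
qed simp

lemma scaling: "\<exists>C>0. \<forall>u\<ge>0. g (m * u) \<le> C * g u" if "m \<ge> 0" for m
proof -
  obtain k where k: "m < 2 ^ k" using real_arch_pow[of 2 m] by auto
  have "g (m * u) \<le> K ^ k * g u" if u: "u \<ge> 0" for u
  proof -
    have "g (m * u) \<le> g (2 ^ k * u)"
      using k u \<open>m \<ge> 0\<close> by (intro g_mono mult_right_mono) auto
    then show ?thesis using doubling_power[OF u, of k] by simp
  qed
  then show ?thesis using K_pos by (intro exI[of _ "K ^ k"]) auto
qed

lemma g_measurable [measurable]: "(\<lambda>x. g \<bar>x\<bar>) \<in> borel_measurable borel"
proof -
  have 1: "mono (\<lambda>x. g (max 0 x))" by (auto intro!: monoI g_mono)
  have "(\<lambda>x. g (max 0 x)) \<in> borel_measurable borel" by (rule borel_measurable_mono[OF 1])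
  then have "(\<lambda>x. g (max 0 \<bar>x\<bar>)) \<in> borel_measurable borel" by measurable
  then show ?thesis by simp
qed

lemma psi_measurable [measurable]: "psi \<in> borel_measurable borel"
  by (intro borel_measurable_continuous_onI continuous_at_imp_continuous_on ballI
      DERIV_isCont[OF psi_deriv])

lemma psi'_measurable [measurable]: "psi' \<in> borel_measurable borel"
  by (intro borel_measurable_continuous_onI continuous_at_imp_continuous_on ballI
      DERIV_isCont[OF psi'_deriv])

lemmas mvt_psi = mvt_between[of psi, OF psi_deriv]
  and mvt_psi' = mvt_between[of psi', OF psi'_deriv]

lemma psi'_mono: "x \<le> y \<Longrightarrow> psi' x \<le> psi' y"
  by (rule DERIV_nonneg_imp_nondecreasing[of x y psi'])
     (use psi'_deriv g_nonneg in \<open>auto intro!: exI\<close>)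

lemma psi'_odd: "psi' (- x) = - psi' x"
proof -
  have "((\<lambda>x. psi' x + psi' (- x)) has_real_derivative 0) (at x)" for x
  proof -
    have "((\<lambda>x. psi' (- x)) has_real_derivative g \<bar>- x\<bar> * (-1)) (at x)"
      by (rule DERIV_chain2[OF psi'_deriv]) (auto intro!: derivative_eq_intros)
    from DERIV_add[OF psi'_deriv this] show ?thesis by simp
  qed
  then have "psi' x + psi' (- x) = psi' 0 + psi' (- 0)"
    by (rule DERIV_isconst_all[rule_format, of "\<lambda>x. psi' x + psi' (- x)"])
  then show ?thesis by (simp add: psi'_0)
qed

lemma psi_even: "psi (- x) = psi x"
proof -
  have "((\<lambda>x. psi x - psi (- x)) has_real_derivative 0) (at x)" for x
  proof -
    have "((\<lambda>x. psi (- x)) has_real_derivative psi' (- x) * (-1)) (at x)"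
      by (rule DERIV_chain2[OF psi_deriv]) (auto intro!: derivative_eq_intros)
    from DERIV_diff[OF psi_deriv this] show ?thesis by (simp add: psi'_odd)
  qed
  then have "psi x - psi (- x) = psi 0 - psi (- 0)"
    by (rule DERIV_isconst_all[rule_format, of "\<lambda>x. psi x - psi (- x)"])
  then show ?thesis by simp
qed

lemma psi_abs: "psi \<bar>x\<bar> = psi x"
  by (simp add: abs_if psi_even)

lemma abs_psi': "\<bar>psi' x\<bar> \<le> \<bar>x\<bar> * g \<bar>x\<bar>"
proof -
  obtain z where z: "\<bar>z\<bar> \<le> max \<bar>0\<bar> \<bar>x\<bar>" "psi' x - psi' 0 = (x - 0) * g \<bar>z\<bar>"
    using mvt_psi'[of 0 x] by blast
  then have "\<bar>psi' x\<bar> = \<bar>x\<bar> * g \<bar>z\<bar>" using g_nonneg[of "\<bar>z\<bar>"] by (simp add: psi'_0 abs_mult)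
  also have "\<dots> \<le> \<bar>x\<bar> * g \<bar>x\<bar>" using z by (intro mult_left_mono g_mono) auto
  finally show ?thesis .
qed

lemma psi_upper: "psi x \<le> x^2 * g \<bar>x\<bar>"
proof -
  obtain z where z: "\<bar>z\<bar> \<le> max \<bar>0\<bar> \<bar>x\<bar>" "psi x - psi 0 = (x - 0) * psi' z"
    using mvt_psi[of 0 x] by blast
  have "psi x = x * psi' z" using z by (simp add: psi_0)
  also have "\<dots> \<le> \<bar>x\<bar> * \<bar>psi' z\<bar>" by (metis abs_ge_self abs_mult)
  also have "\<dots> \<le> \<bar>x\<bar> * (\<bar>x\<bar> * g \<bar>x\<bar>)"
  proof (rule mult_left_mono)
    have "\<bar>psi' z\<bar> \<le> \<bar>z\<bar> * g \<bar>z\<bar>" by (rule abs_psi')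
    also have "\<dots> \<le> \<bar>x\<bar> * g \<bar>x\<bar>" using z by (intro mult_mono g_mono g_nonneg) auto
    finally show "\<bar>psi' z\<bar> \<le> \<bar>x\<bar> * g \<bar>x\<bar>" .
  qed simp
  also have "\<dots> = x^2 * g \<bar>x\<bar>" by (simp add: power2_eq_square flip: mult.assoc)
  finally show ?thesis .
qed

definition lowc :: real where "lowc = 1 / (8 * K ^ 2)"

lemma lowc_pos: "0 < lowc" using K_pos by (simp add: lowc_def)

lemma psi_nonneg: "0 \<le> psi x"
proof (cases "x = 0")
  case False
  then have "0 < \<bar>x\<bar>" by simp
  then obtain z where "0 < z" "z < \<bar>x\<bar>" "psi \<bar>x\<bar> - psi 0 = (\<bar>x\<bar> - 0) * psi' z"
    using MVT2[of 0 "\<bar>x\<bar>" psi psi'] psi_deriv by blast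
  moreover have "0 \<le> psi' z" using psi'_mono[of 0 z] \<open>0 < z\<close> by (simp add: psi'_0)
  ultimately show ?thesis by (simp add: psi_0 psi_abs)
qed (simp add: psi_0)

text \<open>On the upper half of [0, u] the derivative is at least psi' (u/2), which is at least
  (u/4) g (u/4), and two doublings give g (u/4) >= g u / K^2. The product (u/2) (u/4) / K^2 is the
  origin of \<open>lowc\<close>.\<close>

lemma psi_lower: "lowc * (x^2 * g \<bar>x\<bar>) \<le> psi x"
proof (cases "x = 0")
  case False
  define u where "u = \<bar>x\<bar>"
  have u: "0 < u" using False by (simp add: u_def)
  obtain z where z: "u / 2 < z" "z < u" "psi u - psi (u/2) = (u - u/2) * psi' z"
    using MVT2[of "u/2" u psi psi'] psi_deriv u by fastforce
  obtain y where y: "u / 4 < y" "y < u/2" "psi' (u/2) - psi' (u/4) = (u/2 - u/4) * g \<bar>y\<bar>"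
    using MVT2[of "u/4" "u/2" psi' "\<lambda>x. g \<bar>x\<bar>"] psi'_deriv u by fastforce
  have p0: "0 \<le> psi' (u/4)" using psi'_mono[of 0 "u/4"] u by (simp add: psi'_0)
  have "g u = g (2 ^ 2 * (u / 4))" by simp
  also have "\<dots> \<le> K ^ 2 * g (u/4)" using u by (intro doubling_power) auto
  finally have gu: "g u / K ^ 2 \<le> g (u/4)" using K_pos by (simp add: field_simps)
  have "g (u/4) \<le> g \<bar>y\<bar>" using y u by (intro g_mono) auto
  then have "g u / K ^ 2 \<le> g \<bar>y\<bar>" using gu by simp
  then have "(u / 4) * (g u / K ^ 2) \<le> (u/2 - u/4) * g \<bar>y\<bar>"
    using u mult_left_mono[of "g u / K ^ 2" "g \<bar>y\<bar>" "u / 4"] by (simp add: mult.commute)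
  also have "\<dots> \<le> psi' (u/2)" using y p0 by simp
  also have "\<dots> \<le> psi' z" using z by (intro psi'_mono) auto
  finally have "(u / 2) * ((u / 4) * (g u / K ^ 2)) \<le> (u / 2) * psi' z"
    using u by (intro mult_left_mono) auto
  also have "\<dots> \<le> psi u" using z psi_nonneg[of "u/2"] by (simp add: field_simps)
  finally have "lowc * (u^2 * g u) \<le> psi u" by (simp add: lowc_def power2_eq_square field_simps)
  then show ?thesis by (simp add: u_def psi_abs)
qed (simp add: psi_0)

text \<open>For \<open>\<bar>y\<bar> \<le> \<bar>x\<bar>\<close> the intermediate points stay within
  distance 2 |x| of the origin, where one doubling bounds the second derivative by K g |x|.\<close>

lemma taylor_upper:
  assumes "\<bar>y\<bar> \<le> \<bar>x\<bar>"
  shows "psi (x + y) \<le> psi x + psi' x * y + K * g \<bar>x\<bar> * y^2"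
proof -
  obtain z where z: "\<bar>z - x\<bar> \<le> \<bar>x + y - x\<bar>" "psi (x + y) - psi x = (x + y - x) * psi' z"
    using mvt_psi[of x "x + y"] by blast
  obtain t where t: "\<bar>t\<bar> \<le> max \<bar>x\<bar> \<bar>z\<bar>" "psi' z - psi' x = (z - x) * g \<bar>t\<bar>"
    using mvt_psi'[of x z] by blast
  have "\<bar>t\<bar> \<le> 2 * \<bar>x\<bar>" using t z assms by linarith
  then have "g \<bar>t\<bar> \<le> g (2 * \<bar>x\<bar>)" by (intro g_mono) auto
  also have "\<dots> \<le> K * g \<bar>x\<bar>" by (intro doubling) auto
  finally have gt: "g \<bar>t\<bar> \<le> K * g \<bar>x\<bar>" .
  have "psi (x + y) - psi x - psi' x * y = y * (psi' z - psi' x)"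
    using z by (simp add: algebra_simps)
  also have "\<dots> = y * (z - x) * g \<bar>t\<bar>" using t by simp
  also have "\<dots> \<le> y^2 * (K * g \<bar>x\<bar>)"
  proof (rule mult_mono[OF _ gt])
    have "y * (z - x) \<le> \<bar>y\<bar> * \<bar>z - x\<bar>" by (metis abs_ge_self abs_mult)
    also have "\<dots> \<le> \<bar>y\<bar> * \<bar>y\<bar>" using z by (intro mult_left_mono) auto
    finally show "y * (z - x) \<le> y^2" by (simp add: power2_eq_square)
  qed (auto intro: g_nonneg)
  finally show ?thesis by (simp add: algebra_simps)
qed

text \<open>For independent centred arguments both mixed terms \<open>psi' x * y\<close> and
  \<open>psi' y * x\<close> have mean zero, which leaves psi x + psi y with coefficient one. When
  |y| <= |x|, Taylor's formula produces only the first of them, but the second is at least - g |y|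
  x^2.\<close>

lemma two_variable:
  "psi (x + y) \<le> psi x + psi y + psi' x * y + psi' y * x + (K + 1) * (g \<bar>x\<bar> * y^2 + g \<bar>y\<bar> * x^2)"
proof -
  have *: "psi (x + y) \<le> psi x + psi y + psi' x * y + psi' y * x + (K + 1) * (g \<bar>x\<bar> * y^2 + g \<bar>y\<bar> * x^2)"
    if le: "\<bar>y\<bar> \<le> \<bar>x\<bar>" for x y
  proof -
    have "- (psi' y * x) \<le> \<bar>psi' y\<bar> * \<bar>x\<bar>" by (metis abs_ge_minus_self abs_mult)
    also have "\<dots> \<le> \<bar>y\<bar> * g \<bar>y\<bar> * \<bar>x\<bar>" by (intro mult_right_mono abs_psi') auto
    also have "\<dots> \<le> \<bar>x\<bar> * g \<bar>y\<bar> * \<bar>x\<bar>" using le by (intro mult_right_mono g_nonneg) auto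
    also have "\<dots> = g \<bar>y\<bar> * x^2" by (simp add: power2_eq_square)
    finally have 1: "- (psi' y * x) \<le> g \<bar>y\<bar> * x^2" .
    have 2: "0 \<le> K * (g \<bar>y\<bar> * x^2)" "0 \<le> g \<bar>x\<bar> * y^2" using K_pos g_nonneg by auto
    show ?thesis using taylor_upper[OF le] psi_nonneg[of y] 1 2 by (simp add: algebra_simps)
  qed
  show ?thesis
  proof (cases "\<bar>y\<bar> \<le> \<bar>x\<bar>")
    case False
    then show ?thesis using *[of x y] by (simp add: algebra_simps)
  qed (rule *)
qed

lemma psi_dominated: "m \<ge> 0 \<Longrightarrow> \<exists>C>0. \<forall>z b. \<bar>z\<bar> \<le> m * \<bar>b\<bar> \<longrightarrow> psi z \<le> C * psi b"
proof -
  assume m: "m \<ge> 0"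
  obtain C where C: "C > 0" "\<And>u. u \<ge> 0 \<Longrightarrow> g (m * u) \<le> C * g u" using scaling[OF m] by blast
  have "psi z \<le> (m^2 * C / lowc + 1) * psi b" if z: "\<bar>z\<bar> \<le> m * \<bar>b\<bar>" for z b
  proof -
    have "psi z \<le> z^2 * g \<bar>z\<bar>" by (rule psi_upper)
    also have "\<dots> \<le> (m * \<bar>b\<bar>)^2 * g (m * \<bar>b\<bar>)"
    proof (rule mult_mono)
      show "z^2 \<le> (m * \<bar>b\<bar>)^2" using power_mono[OF z abs_ge_zero, of 2] by simp
    qed (use z in \<open>auto intro!: g_mono g_nonneg\<close>)
    also have "\<dots> \<le> (m * \<bar>b\<bar>)^2 * (C * g \<bar>b\<bar>)" by (intro mult_left_mono C) auto
    also have "\<dots> = (m^2 * C / lowc) * (lowc * (b^2 * g \<bar>b\<bar>))"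
      using lowc_pos by (simp add: power_mult_distrib)
    also have "\<dots> \<le> (m^2 * C / lowc) * psi b"
      using lowc_pos C by (intro mult_left_mono psi_lower) auto
    finally show ?thesis using psi_nonneg[of b] by (simp add: algebra_simps)
  qed
  moreover have "m^2 * C / lowc + 1 > 0" using lowc_pos C by (intro add_nonneg_pos) auto
  ultimately show ?thesis by blast
qed

text \<open>Used for adding variables to a sum one at a time: the linear term vanishes in the mean
  when \<open>y\<close> is centred and independent of \<open>x\<close>. For |y| > |x| all terms are
  absorbed by \<open>psi y\<close>.\<close>

lemma one_sided: "\<exists>C>0. \<forall>x y. psi (x + y) \<le> psi x + psi' x * y + C * (g \<bar>x\<bar> * y^2 + psi y)"
proof -
  obtain C where C: "C > 0" "\<And>z b. \<bar>z\<bar> \<le> 2 * \<bar>b\<bar> \<Longrightarrow> psi z \<le> C * psi b"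
    using psi_dominated[of 2] by auto
  have "psi (x + y) \<le> psi x + psi' x * y + (K + C + 1 / lowc) * (g \<bar>x\<bar> * y^2 + psi y)" for x y
  proof (cases "\<bar>y\<bar> \<le> \<bar>x\<bar>")
    case True
    have "0 \<le> (C + 1 / lowc) * (g \<bar>x\<bar> * y^2 + psi y)" "0 \<le> K * psi y"
      using C lowc_pos K_pos psi_nonneg g_nonneg by auto
    then show ?thesis using taylor_upper[OF True] by (simp add: algebra_simps)
  next
    case False
    then have "psi (x + y) \<le> C * psi y" by (intro C) linarith
    have "- (psi' x * y) \<le> \<bar>psi' x\<bar> * \<bar>y\<bar>" by (metis abs_ge_minus_self abs_mult)
    also have "\<dots> \<le> \<bar>x\<bar> * g \<bar>x\<bar> * \<bar>y\<bar>" by (intro mult_right_mono abs_psi') auto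
    also have "\<dots> \<le> \<bar>y\<bar> * g \<bar>y\<bar> * \<bar>y\<bar>" using False by (intro mult_right_mono mult_mono g_nonneg g_mono) auto
    also have "\<dots> = (1 / lowc) * (lowc * (y^2 * g \<bar>y\<bar>))" using lowc_pos by (simp add: power2_eq_square)
    also have "\<dots> \<le> (1 / lowc) * psi y" using lowc_pos by (intro mult_left_mono psi_lower) auto
    finally have 1: "- (psi' x * y) \<le> (1 / lowc) * psi y" .
    have 2: "0 \<le> (K + C + 1 / lowc) * (g \<bar>x\<bar> * y^2)" "0 \<le> K * psi y"
      using C lowc_pos K_pos psi_nonneg g_nonneg by auto
    show ?thesis using \<open>psi (x + y) \<le> C * psi y\<close> 1 2 psi_nonneg[of x] by (simp add: algebra_simps)
  qed
  moreover have "K + C + 1 / lowc > 0" using C lowc_pos K_pos by (simp add: add_pos_pos)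
  ultimately show ?thesis by blast
qed

text \<open>A form of Young's inequality with an arbitrarily small weight on \<open>psi x\<close>,
  by which the mixed terms of a merge are absorbed with almost no loss in the factor 2. If |x| >= m
  r, then r^2 is a small fraction of x^2; otherwise g |x| is at most a multiple of g r.\<close>

lemma young_split:
  assumes "e > 0"
  shows "\<exists>C>0. \<forall>x r. r \<ge> 0 \<longrightarrow> g \<bar>x\<bar> * r^2 \<le> e * psi x + C * (r^2 * g r)"
proof -
  define m where "m = sqrt (1 / (lowc * e))"
  have m: "m > 0" "m^2 = 1 / (lowc * e)" using lowc_pos assms by (auto simp: m_def)
  obtain C where C: "C > 0" "\<And>u. u \<ge> 0 \<Longrightarrow> g (m * u) \<le> C * g u" using scaling[of m] m by auto
  have "g \<bar>x\<bar> * r^2 \<le> e * psi x + C * (r^2 * g r)" if r: "r \<ge> 0" for x r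
  proof (cases "m * r \<le> \<bar>x\<bar>")
    case True
    have "(m * r)^2 \<le> x^2" using power_mono[OF True, of 2] m r by simp
    then have "r^2 \<le> lowc * e * x^2" using m lowc_pos assms by (simp add: power_mult_distrib field_simps)
    then have "g \<bar>x\<bar> * r^2 \<le> g \<bar>x\<bar> * (lowc * e * x^2)" by (intro mult_left_mono g_nonneg) auto
    also have "\<dots> = e * (lowc * (x^2 * g \<bar>x\<bar>))" by simp
    also have "\<dots> \<le> e * psi x" using assms by (intro mult_left_mono psi_lower) auto
    finally show ?thesis using C r g_nonneg[of r] by (smt (verit) mult_nonneg_nonneg zero_le_power2)
  next
    case False
    then have "g \<bar>x\<bar> \<le> g (m * r)" by (intro g_mono) auto
    also have "\<dots> \<le> C * g r" using r by (intro C)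
    finally have "g \<bar>x\<bar> * r^2 \<le> C * (r^2 * g r)"
      by (metis mult.assoc mult.commute mult_right_mono zero_le_power2)
    then show ?thesis using psi_nonneg[of x] assms by (simp add: add_increasing)
  qed
  then show ?thesis using C by blast
qed

text \<open>The coefficient of \<open>psi a\<close> has to be as close to 1 as desired, because it
  is paid at each of the J halvings. Taylor's formula treats \<open>b\<close> that is small against
  \<open>a\<close>; any other \<open>b\<close> dominates the sum up to a constant.\<close>

lemma almost_subadditive:
  assumes "e > 0"
  shows "\<exists>C>0. \<forall>a b. psi (a + b) \<le> (1 + e) * psi a + C * psi b"
proof -
  \<comment> \<open>For |b| \<le> \<eta> |a| the terms of first and second order cost at most \<eta>
    (1 + K) a^2 g |a|; this choice makes that at most e * psi a.\<close>
  define \<eta> where "\<eta> = min 1 (e * lowc / (1 + K))"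
  have \<eta>: "\<eta> > 0" "\<eta> \<le> 1" using K_pos lowc_pos assms by (auto simp: \<eta>_def)
  have "\<eta> \<le> e * lowc / (1 + K)" by (simp add: \<eta>_def)
  then have \<eta>3: "\<eta> * (1 + K) \<le> e * lowc" using K_pos by (simp add: pos_le_divide_eq)
  obtain C where C: "C > 0" "\<And>z b. \<bar>z\<bar> \<le> (1 + 1 / \<eta>) * \<bar>b\<bar> \<Longrightarrow> psi z \<le> C * psi b"
    using psi_dominated[of "1 + 1 / \<eta>"] \<eta> by auto
  have "psi (a + b) \<le> (1 + e) * psi a + C * psi b" for a b
  proof (cases "\<bar>b\<bar> \<le> \<eta> * \<bar>a\<bar>")
    case True
    have ba: "\<bar>b\<bar> \<le> \<bar>a\<bar>" using True \<eta> by (smt (verit) abs_ge_zero mult_left_le_one_le)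
    have "psi' a * b \<le> \<bar>psi' a\<bar> * \<bar>b\<bar>" by (metis abs_ge_self abs_mult)
    also have "\<dots> \<le> (\<bar>a\<bar> * g \<bar>a\<bar>) * (\<eta> * \<bar>a\<bar>)" using True by (intro mult_mono abs_psi') (auto intro!: mult_nonneg_nonneg g_nonneg)
    also have "\<dots> = \<eta> * (a^2 * g \<bar>a\<bar>)" by (simp add: power2_eq_square algebra_simps)
    finally have 1: "psi' a * b \<le> \<eta> * (a^2 * g \<bar>a\<bar>)" .
    have "b^2 = \<bar>b\<bar> * \<bar>b\<bar>" by (simp add: power2_eq_square)
    also have "\<dots> \<le> (\<eta> * \<bar>a\<bar>) * \<bar>a\<bar>" using True ba by (intro mult_mono) (use \<eta> in auto)
    finally have "b^2 \<le> \<eta> * a^2" by (simp add: power2_eq_square algebra_simps)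
    then have "(K * g \<bar>a\<bar>) * b^2 \<le> (K * g \<bar>a\<bar>) * (\<eta> * a^2)"
      using K_pos g_nonneg by (intro mult_left_mono) auto
    then have "psi (a + b) \<le> psi a + \<eta> * (1 + K) * (a^2 * g \<bar>a\<bar>)"
      using taylor_upper[OF ba] 1 by (simp add: algebra_simps)
    also have "\<dots> \<le> psi a + (e * lowc) * (a^2 * g \<bar>a\<bar>)"
      using \<eta>3 g_nonneg by (intro add_left_mono mult_right_mono) auto
    also have "\<dots> = psi a + e * (lowc * (a^2 * g \<bar>a\<bar>))" by simp
    also have "\<dots> \<le> psi a + e * psi a" using assms by (intro add_left_mono mult_left_mono psi_lower) auto
    finally have "psi (a + b) \<le> (1 + e) * psi a" by (simp add: algebra_simps)
    moreover have "0 \<le> C * psi b" using C psi_nonneg[of b] by simp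
    ultimately show ?thesis by linarith
  next
    case False
    then have "\<bar>a\<bar> \<le> \<bar>b\<bar> / \<eta>" using \<eta> by (simp add: field_simps)
    then have "\<bar>a + b\<bar> \<le> (1 + 1 / \<eta>) * \<bar>b\<bar>" by (simp add: algebra_simps)
    then have "psi (a + b) \<le> C * psi b" by (rule C)
    then show ?thesis using psi_nonneg[of a] assms by (smt (verit) mult_nonneg_nonneg)
  qed
  then show ?thesis using C by blast
qed

end

lemma has_antiderivative:
  fixes f :: "real \<Rightarrow> real"
  assumes "\<And>x. isCont f x"
  obtains G where "\<And>x. (G has_real_derivative f x) (at x)" "G 0 = 0"
proof -
  obtain G where G: "\<And>x. (G has_real_derivative f x) (at x)"
    using einterval_antiderivative[of "-\<infinity>" "\<infinity>" f] assms
    by (auto simp: has_real_derivative_iff_has_vector_derivative)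
  have "((\<lambda>x. G x - G 0) has_real_derivative f x) (at x)" for x
    using G[of x] by (auto intro!: derivative_eq_intros)
  then show ?thesis using that[of "\<lambda>x. G x - G 0"] by simp
qed

lemma young_exists:
  assumes "\<And>u. 0 \<le> u \<Longrightarrow> 0 \<le> g u" "\<And>u v. 0 \<le> u \<Longrightarrow> u \<le> v \<Longrightarrow> g u \<le> g v"
    and "\<And>u. 0 \<le> u \<Longrightarrow> g (2 * u) \<le> K * g u" "0 < K"
    and "\<And>x. isCont (\<lambda>x. g \<bar>x\<bar>) x"
  obtains psi psi' where "young g psi psi' K"
proof -
  obtain psi' where 1: "\<And>x. (psi' has_real_derivative g \<bar>x\<bar>) (at x)" "psi' 0 = 0"
    using has_antiderivative[OF assms(5)] by auto
  then have "isCont psi' x" for x by (blast intro: DERIV_isCont)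
  then obtain psi where "\<And>x. (psi has_real_derivative psi' x) (at x)" "psi 0 = 0"
    using has_antiderivative[of psi'] by auto
  with 1 assms show ?thesis by (intro that[of psi psi']) (unfold_locales, auto)
qed

section \<open>Young functions of sums of independent variables\<close>

lemma (in prob_space) indep_var_product_integral:
  fixes f h :: "real \<Rightarrow> real"
  assumes ind: "indep_var borel X borel Y"
    and [measurable]: "f \<in> borel_measurable borel" "h \<in> borel_measurable borel"
    and int: "integrable M (\<lambda>x. f (X x))" "integrable M (\<lambda>x. h (Y x))"
  shows "integrable M (\<lambda>x. f (X x) * h (Y x))"
    and "expectation (\<lambda>x. f (X x) * h (Y x)) = expectation (\<lambda>x. f (X x)) * expectation (\<lambda>x. h (Y x))"
proof -
  have "indep_var borel (f \<circ> X) borel (h \<circ> Y)" by (rule indep_var_compose[OF ind]) auto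
  then have i: "indep_var borel (\<lambda>x. f (X x)) borel (\<lambda>x. h (Y x))" by (simp add: comp_def)
  show "integrable M (\<lambda>x. f (X x) * h (Y x))"
    by (rule indep_var_integrable[OF i int])
  show "expectation (\<lambda>x. f (X x) * h (Y x)) = expectation (\<lambda>x. f (X x)) * expectation (\<lambda>x. h (Y x))"
    by (rule indep_var_lebesgue_integral[OF i int])
qed

context young
begin

lemma w_le: "x^2 * g \<bar>x\<bar> \<le> psi x / lowc"
  using psi_lower[of x] lowc_pos by (simp add: field_simps)

lemma g_le: "g \<bar>x\<bar> \<le> g 1 + psi x / lowc"
proof (cases "\<bar>x\<bar> \<le> 1")
  case True
  then have "g \<bar>x\<bar> \<le> g 1" by (intro g_mono) auto
  then show ?thesis using psi_nonneg[of x] lowc_pos by (simp add: add_increasing2)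
next
  case False
  then have "1 * g \<bar>x\<bar> \<le> x^2 * g \<bar>x\<bar>"
    by (intro mult_right_mono g_nonneg) (use abs_le_square_iff[of 1 x] in auto)
  then show ?thesis using w_le[of x] g_nonneg[of 1] by simp
qed

lemma abs_psi'_le: "\<bar>psi' x\<bar> \<le> g 1 + psi x / lowc"
proof (cases "\<bar>x\<bar> \<le> 1")
  case True
  then have "\<bar>x\<bar> * g \<bar>x\<bar> \<le> 1 * g 1" by (intro mult_mono g_mono g_nonneg) auto
  then show ?thesis using psi_nonneg[of x] lowc_pos abs_psi'[of x] by (simp add: add_increasing2)
next
  case False
  then have "\<bar>x\<bar> * g \<bar>x\<bar> \<le> x^2 * g \<bar>x\<bar>"
    by (intro mult_right_mono g_nonneg) (use mult_right_mono[of 1 "\<bar>x\<bar>" "\<bar>x\<bar>"] in \<open>auto simp: power2_eq_square\<close>)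
  then show ?thesis using w_le[of x] g_nonneg[of 1] abs_psi'[of x] by simp
qed

lemma integrable_g:
  assumes "prob_space M" and [measurable]: "X \<in> borel_measurable M" and "integrable M (\<lambda>x. psi (X x))"
  shows "integrable M (\<lambda>x. g \<bar>X x\<bar>)" "integrable M (\<lambda>x. psi' (X x))"
proof -
  interpret prob_space M by fact
  have i: "integrable M (\<lambda>x. g 1 + psi (X x) / lowc)" using assms by auto
  show "integrable M (\<lambda>x. g \<bar>X x\<bar>)"
    by (rule Bochner_Integration.integrable_bound[OF i])
       (auto intro!: AE_I2 simp: abs_of_nonneg g_nonneg order_trans[OF g_le abs_ge_self])
  show "integrable M (\<lambda>x. psi' (X x))"
    by (rule Bochner_Integration.integrable_bound[OF i])
       (auto intro!: AE_I2 simp: order_trans[OF abs_psi'_le abs_ge_self])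
qed

lemma integrable_psi_add:
  assumes [measurable]: "X \<in> borel_measurable M" "Y \<in> borel_measurable M"
    and "integrable M (\<lambda>x. psi (X x))" "integrable M (\<lambda>x. psi (Y x))"
  shows "integrable M (\<lambda>x. psi (X x + Y x))"
proof -
  obtain C where C: "C > 0" "\<And>a b. psi (a + b) \<le> (1 + 1) * psi a + C * psi b"
    using almost_subadditive[of 1] by auto
  have i: "integrable M (\<lambda>x. (1 + 1) * psi (X x) + C * psi (Y x))" using assms by auto
  show ?thesis
    by (rule Bochner_Integration.integrable_bound[OF i])
       (use C in \<open>auto intro!: AE_I2 simp: abs_of_nonneg psi_nonneg\<close>)
qed

text \<open>The constant precedes the quantifiers over the space and the variables: it depends on
  the Young function only, so it can be used at every step of an induction on the number of
  summands.\<close>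

lemma expectation_one_sided:
  "\<exists>C>0. \<forall>(M :: 'a measure) X Y. prob_space M \<longrightarrow> prob_space.indep_var M borel X borel Y \<longrightarrow>
     integrable M (\<lambda>x. psi (X x)) \<longrightarrow> integrable M (\<lambda>x. psi (Y x)) \<longrightarrow>
     integrable M Y \<longrightarrow> (\<integral>x. Y x \<partial>M) = 0 \<longrightarrow> integrable M (\<lambda>x. (Y x)^2) \<longrightarrow>
     (\<integral>x. psi (X x + Y x) \<partial>M) \<le> (\<integral>x. psi (X x) \<partial>M)
        + C * ((\<integral>x. g \<bar>X x\<bar> \<partial>M) * (\<integral>x. (Y x)^2 \<partial>M) + (\<integral>x. psi (Y x) \<partial>M))"
proof -
  obtain C where C: "C > 0" "\<And>x y. psi (x + y) \<le> psi x + psi' x * y + C * (g \<bar>x\<bar> * y^2 + psi y)"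
    using one_sided by blast
  show ?thesis
  proof (intro exI[of _ C] conjI allI impI)
    fix M :: "'a measure" and X Y
    assume *: "prob_space M" "prob_space.indep_var M borel X borel Y"
      "integrable M (\<lambda>x. psi (X x))" "integrable M (\<lambda>x. psi (Y x))"
      "integrable M Y" "(\<integral>x. Y x \<partial>M) = 0" "integrable M (\<lambda>x. (Y x)^2)"
    interpret prob_space M by fact
    have [measurable]: "X \<in> borel_measurable M" "Y \<in> borel_measurable M"
      using indep_var_rv1[OF *(2)] indep_var_rv2[OF *(2)] by auto
    note g = integrable_g[OF *(1) _ *(3), simplified]
    have m: "(\<lambda>y::real. y) \<in> borel_measurable borel" "(\<lambda>y::real. y^2) \<in> borel_measurable borel" by auto
    note i = indep_var_product_integral[OF *(2)]
    note p1 = i(1)[OF psi'_measurable m(1) g(2) *(5)]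
    note p1' = i(2)[OF psi'_measurable m(1) g(2) *(5)]
    note p2 = i(1)[OF g_measurable m(2) g(1) *(7)]
    note p2' = i(2)[OF g_measurable m(2) g(1) *(7)]
    note int = p1 p2 *(3,4)
    have "(\<integral>x. psi (X x + Y x) \<partial>M) \<le>
        (\<integral>x. psi (X x) + psi' (X x) * Y x + C * (g \<bar>X x\<bar> * (Y x)^2 + psi (Y x)) \<partial>M)"
      by (intro integral_mono integrable_psi_add C(2) Bochner_Integration.integrable_add
          integrable_mult_right int) auto
    also have "\<dots> = (\<integral>x. psi (X x) \<partial>M) + C * ((\<integral>x. g \<bar>X x\<bar> \<partial>M) * (\<integral>x. (Y x)^2 \<partial>M) + (\<integral>x. psi (Y x) \<partial>M))"
      by (simp add: p1' p2' int *(6))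
    finally show "(\<integral>x. psi (X x + Y x) \<partial>M) \<le> \<dots>" .
  qed (use C in auto)
qed

lemma expectation_two_variable:
  assumes "prob_space M" "prob_space.indep_var M borel X borel Y"
     "integrable M (\<lambda>x. psi (X x))" "integrable M (\<lambda>x. psi (Y x))"
     "integrable M X" "integrable M Y" "(\<integral>x. X x \<partial>M) = 0" "(\<integral>x. Y x \<partial>M) = 0"
     "integrable M (\<lambda>x. (X x)^2)" "integrable M (\<lambda>x. (Y x)^2)"
  shows "(\<integral>x. psi (X x + Y x) \<partial>M) \<le> (\<integral>x. psi (X x) \<partial>M) + (\<integral>x. psi (Y x) \<partial>M)
      + (K + 1) * ((\<integral>x. g \<bar>X x\<bar> \<partial>M) * (\<integral>x. (Y x)^2 \<partial>M) + (\<integral>x. g \<bar>Y x\<bar> \<partial>M) * (\<integral>x. (X x)^2 \<partial>M))"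
proof -
  interpret prob_space M by fact
  have [measurable]: "X \<in> borel_measurable M" "Y \<in> borel_measurable M"
    using indep_var_rv1[OF assms(2)] indep_var_rv2[OF assms(2)] by auto
  note g = integrable_g[OF assms(1) _ assms(3), simplified] integrable_g[OF assms(1) _ assms(4), simplified]
  have m: "(\<lambda>y::real. y) \<in> borel_measurable borel" "(\<lambda>y::real. y^2) \<in> borel_measurable borel" by auto
  note i = indep_var_product_integral[OF assms(2)]
  note p1 = i(1)[OF psi'_measurable m(1) g(2) assms(6)]
  note p1' = i(2)[OF psi'_measurable m(1) g(2) assms(6)]
  note p2 = i(1)[OF g_measurable m(2) g(1) assms(10)]
  note p2' = i(2)[OF g_measurable m(2) g(1) assms(10)]
  note p3 = i(1)[OF m(1) psi'_measurable assms(5) g(4)]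
  note p3' = i(2)[OF m(1) psi'_measurable assms(5) g(4)]
  note p4 = i(1)[OF m(2) g_measurable assms(9) g(3)]
  note p4' = i(2)[OF m(2) g_measurable assms(9) g(3)]
  note int = g(1,3) p1 p2 p3 p4 assms(3-6,9,10)
  have ub: "integrable M (\<lambda>x. psi (X x) + psi (Y x) + psi' (X x) * Y x + X x * psi' (Y x)
         + (K + 1) * (g \<bar>X x\<bar> * (Y x)^2 + (X x)^2 * g \<bar>Y x\<bar>))"
    by (intro Bochner_Integration.integrable_add integrable_mult_right int)
  have "(\<integral>x. psi (X x + Y x) \<partial>M) \<le>
      (\<integral>x. psi (X x) + psi (Y x) + psi' (X x) * Y x + X x * psi' (Y x)
         + (K + 1) * (g \<bar>X x\<bar> * (Y x)^2 + (X x)^2 * g \<bar>Y x\<bar>) \<partial>M)"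
  proof (intro integral_mono integrable_psi_add ub assms(3,4))
    fix x
    show "psi (X x + Y x) \<le> psi (X x) + psi (Y x) + psi' (X x) * Y x + X x * psi' (Y x)
         + (K + 1) * (g \<bar>X x\<bar> * (Y x)^2 + (X x)^2 * g \<bar>Y x\<bar>)"
      using two_variable[of "X x" "Y x"] by (simp add: mult.commute)
  qed auto
  also have "\<dots> = (\<integral>x. psi (X x) \<partial>M) + (\<integral>x. psi (Y x) \<partial>M)
      + (K + 1) * ((\<integral>x. g \<bar>X x\<bar> \<partial>M) * (\<integral>x. (Y x)^2 \<partial>M) + (\<integral>x. (X x)^2 \<partial>M) * (\<integral>x. g \<bar>Y x\<bar> \<partial>M))"
    by (simp add: p1' p2' p3' p4' int assms(7,8))
  finally show ?thesis by (simp add: mult.commute)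
qed

text \<open>For independent centred X and Y the linear mixed terms vanish, the others are split at
  the standard deviation \<open>sqrt v\<close>, and the error D is removed at the price of a factor
  1 + e. The gain lies in the factor near 2, since a p-th power grows by 2^(p/2) when the variance
  doubles.\<close>

lemma expectation_merge:
  assumes "\<epsilon> > 0"
  shows "\<exists>C>0. \<forall>(M :: 'a measure) X Y D v. prob_space M \<longrightarrow> prob_space.indep_var M borel X borel Y \<longrightarrow>
     D \<in> borel_measurable M \<longrightarrow>
     integrable M (\<lambda>x. psi (X x)) \<longrightarrow> integrable M (\<lambda>x. psi (Y x)) \<longrightarrow> integrable M (\<lambda>x. psi (D x)) \<longrightarrow>
     integrable M X \<longrightarrow> integrable M Y \<longrightarrow> (\<integral>x. X x \<partial>M) = 0 \<longrightarrow> (\<integral>x. Y x \<partial>M) = 0 \<longrightarrow>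
     integrable M (\<lambda>x. (X x)^2) \<longrightarrow> integrable M (\<lambda>x. (Y x)^2) \<longrightarrow>
     (\<integral>x. (X x)^2 \<partial>M) = v \<longrightarrow> (\<integral>x. (Y x)^2 \<partial>M) = v \<longrightarrow>
     (\<integral>x. psi (Y x) \<partial>M) = (\<integral>x. psi (X x) \<partial>M) \<longrightarrow>
     (\<integral>x. psi (X x + Y x + D x) \<partial>M) \<le> (2 + \<epsilon>) * (\<integral>x. psi (X x) \<partial>M)
        + C * (v * g (sqrt v) + (\<integral>x. psi (D x) \<partial>M))"
proof -
  \<comment> \<open>Removing the error after the merge gives (1 + e) (2 + e) = 2 + 3 e + e^2, at
    most 2 + 4 e for e \<le> 1.\<close>
  define e where "e = min 1 (\<epsilon> / 4)"
  have e: "e > 0" "e \<le> 1" "4 * e \<le> \<epsilon>" using assms by (auto simp: e_def)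
  \<comment> \<open>There are two mixed terms, each with the factor K + 1.\<close>
  define e' where "e' = e / (2 * (K + 1))"
  have e': "e' > 0" "2 * (K + 1) * e' = e" using e K_pos by (auto simp: e'_def)
  obtain C1 where C1: "C1 > 0" "\<And>a b. psi (a + b) \<le> (1 + e) * psi a + C1 * psi b"
    using almost_subadditive[OF e(1)] by auto
  obtain C2 where C2: "C2 > 0" "\<And>x r. r \<ge> 0 \<Longrightarrow> g \<bar>x\<bar> * r^2 \<le> e' * psi x + C2 * (r^2 * g r)"
    using young_split[OF e'(1)] by auto
  define C where "C = C1 + (1 + e) * (K + 1) * (2 * C2)"
  have C: "C > 0" "C1 \<le> C" "(1 + e) * (K + 1) * (2 * C2) \<le> C" using C1 C2 e K_pos by (auto simp: C_def add_pos_pos)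
  show ?thesis
  proof (intro exI[of _ C] conjI allI impI)
    fix M :: "'a measure" and X Y D v
    assume *: "prob_space M" "prob_space.indep_var M borel X borel Y" "D \<in> borel_measurable M"
     "integrable M (\<lambda>x. psi (X x))" "integrable M (\<lambda>x. psi (Y x))" "integrable M (\<lambda>x. psi (D x))"
     "integrable M X" "integrable M Y" "(\<integral>x. X x \<partial>M) = 0" "(\<integral>x. Y x \<partial>M) = 0"
     "integrable M (\<lambda>x. (X x)^2)" "integrable M (\<lambda>x. (Y x)^2)"
     "(\<integral>x. (X x)^2 \<partial>M) = v" "(\<integral>x. (Y x)^2 \<partial>M) = v"
     "(\<integral>x. psi (Y x) \<partial>M) = (\<integral>x. psi (X x) \<partial>M)"
    interpret prob_space M by fact
    have [measurable]: "X \<in> borel_measurable M" "Y \<in> borel_measurable M" "D \<in> borel_measurable M"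
      using indep_var_rv1[OF *(2)] indep_var_rv2[OF *(2)] *(3) by auto
    have v: "v \<ge> 0" unfolding *(13)[symmetric] by (rule Bochner_Integration.integral_nonneg) simp
    define P where "P = (\<integral>x. psi (X x) \<partial>M)"
    define W where "W = v * g (sqrt v)"
    have P: "P \<ge> 0" unfolding P_def by (intro Bochner_Integration.integral_nonneg psi_nonneg)
    have W: "W \<ge> 0" unfolding W_def using v by (intro mult_nonneg_nonneg g_nonneg) auto
    have gb: "(\<integral>x. g \<bar>Z x\<bar> \<partial>M) * v \<le> e' * (\<integral>x. psi (Z x) \<partial>M) + C2 * W"
      if [measurable]: "Z \<in> borel_measurable M" and i: "integrable M (\<lambda>x. psi (Z x))" for Z
    proof -
      have "(\<integral>x. g \<bar>Z x\<bar> \<partial>M) * v = (\<integral>x. g \<bar>Z x\<bar> * (sqrt v)^2 \<partial>M)" using v by simp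
      also have "\<dots> \<le> (\<integral>x. e' * psi (Z x) + C2 * ((sqrt v)^2 * g (sqrt v)) \<partial>M)"
      proof (rule integral_mono)
        show "integrable M (\<lambda>x. g \<bar>Z x\<bar> * (sqrt v)^2)"
          by (rule integrable_mult_left) (rule integrable_g(1)[OF *(1) that])
        show "integrable M (\<lambda>x. e' * psi (Z x) + C2 * ((sqrt v)^2 * g (sqrt v)))" using i by simp
      qed (rule C2(2), use v in simp)
      also have "\<dots> = e' * (\<integral>x. psi (Z x) \<partial>M) + C2 * W"
        using v i by (simp add: W_def prob_space)
      finally show ?thesis .
    qed
    have g1: "(\<integral>x. g \<bar>X x\<bar> \<partial>M) * v \<le> e' * P + C2 * W" using gb[of X] *(4) by (simp add: P_def)
    have g2: "(\<integral>x. g \<bar>Y x\<bar> \<partial>M) * v \<le> e' * P + C2 * W" using gb[of Y] *(5,15) by (simp add: P_def)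
    have "(\<integral>x. psi (X x + Y x) \<partial>M) \<le> P + P
      + (K + 1) * ((\<integral>x. g \<bar>X x\<bar> \<partial>M) * v + (\<integral>x. g \<bar>Y x\<bar> \<partial>M) * v)"
      using expectation_two_variable[OF *(1,2,4,5,7-12)] *(13-15) by (simp add: P_def)
    also have "\<dots> \<le> P + P + (K + 1) * ((e' * P + C2 * W) + (e' * P + C2 * W))"
      using g1 g2 K_pos by (intro add_left_mono mult_left_mono add_mono) auto
    also have "\<dots> = 2 * P + (2 * (K + 1) * e') * P + (K + 1) * (2 * C2) * W" by (simp add: algebra_simps)
    also have "\<dots> = (2 + e) * P + (K + 1) * (2 * C2) * W" unfolding e' by (simp add: algebra_simps)
    finally have 1: "(\<integral>x. psi (X x + Y x) \<partial>M) \<le> (2 + e) * P + (K + 1) * (2 * C2) * W" .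
    have ixy: "integrable M (\<lambda>x. psi (X x + Y x))" by (intro integrable_psi_add *(4,5)) auto
    have "(\<integral>x. psi (X x + Y x + D x) \<partial>M) \<le> (\<integral>x. (1 + e) * psi (X x + Y x) + C1 * psi (D x) \<partial>M)"
      by (intro integral_mono integrable_psi_add[of "\<lambda>x. X x + Y x"] C1(2)) (simp_all add: ixy *(6))
    also have "\<dots> = (1 + e) * (\<integral>x. psi (X x + Y x) \<partial>M) + C1 * (\<integral>x. psi (D x) \<partial>M)"
      by (simp add: ixy *(6))
    also have "\<dots> \<le> (1 + e) * ((2 + e) * P + (K + 1) * (2 * C2) * W) + C1 * (\<integral>x. psi (D x) \<partial>M)"
      using 1 e by (intro add_right_mono mult_left_mono) auto
    also have "\<dots> = (2 + 3 * e + e * e) * P + ((1 + e) * (K + 1) * (2 * C2)) * W + C1 * (\<integral>x. psi (D x) \<partial>M)"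
      by (simp add: algebra_simps)
    also have "\<dots> \<le> (2 + \<epsilon>) * P + C * W + C * (\<integral>x. psi (D x) \<partial>M)"
    proof -
      have "e * e \<le> 1 * e" using e by (intro mult_right_mono) auto
      then have "2 + 3 * e + e * e \<le> 2 + \<epsilon>" using e by linarith
      then have 1: "(2 + 3 * e + e * e) * P \<le> (2 + \<epsilon>) * P" using P by (rule mult_right_mono)
      have 2: "((1 + e) * (K + 1) * (2 * C2)) * W \<le> C * W" using C(3) W by (rule mult_right_mono)
      have "C1 * (\<integral>x. psi (D x) \<partial>M) \<le> C * (\<integral>x. psi (D x) \<partial>M)"
        using C(2) by (intro mult_right_mono Bochner_Integration.integral_nonneg psi_nonneg)
      with 1 2 show ?thesis by linarith
    qed
    finally show "(\<integral>x. psi (X x + Y x + D x) \<partial>M) \<le> (2 + \<epsilon>) * (\<integral>x. psi (X x) \<partial>M)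
        + C * (v * g (sqrt v) + (\<integral>x. psi (D x) \<partial>M))" unfolding P_def W_def by (simp only: distrib_left add.assoc)
  qed (rule C(1))
qed

end

section \<open>Chains of approximate halvings\<close>

lemma integrable_mult_square:
  fixes f h :: "'a \<Rightarrow> real"
  assumes [measurable]: "f \<in> borel_measurable M" "h \<in> borel_measurable M"
    and "integrable M (\<lambda>x. (f x)^2)" "integrable M (\<lambda>x. (h x)^2)"
  shows "integrable M (\<lambda>x. f x * h x)"
proof (rule Bochner_Integration.integrable_bound)
  show "integrable M (\<lambda>x. (f x)^2 + (h x)^2)" using assms by auto
  have "\<bar>a * b\<bar> \<le> a^2 + b^2" for a b :: real
  proof -
    have "2 * (\<bar>a\<bar> * \<bar>b\<bar>) \<le> a^2 + b^2" using sum_squares_bound[of "\<bar>a\<bar>" "\<bar>b\<bar>"] by simp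
    moreover have "0 \<le> \<bar>a\<bar> * \<bar>b\<bar>" by simp
    ultimately show ?thesis unfolding abs_mult by linarith
  qed
  then show "AE x in M. norm (f x * h x) \<le> norm ((f x)^2 + (h x)^2)" by (intro AE_I2) simp
qed measurable

lemma integrable_add_square:
  fixes f h :: "'a \<Rightarrow> real"
  assumes "f \<in> borel_measurable M" "h \<in> borel_measurable M"
    and "integrable M (\<lambda>x. (f x)^2)" "integrable M (\<lambda>x. (h x)^2)"
  shows "integrable M (\<lambda>x. (f x + h x)^2)"
  unfolding power2_sum mult.assoc using integrable_mult_square[OF assms] assms(3,4) by simp

lemma integral_cauchy_schwarz:
  fixes f h :: "'a \<Rightarrow> real"
  assumes [measurable]: "f \<in> borel_measurable M" "h \<in> borel_measurable M"
    and i: "integrable M (\<lambda>x. (f x)^2)" "integrable M (\<lambda>x. (h x)^2)"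
  shows "(\<integral>x. f x * h x \<partial>M)^2 \<le> (\<integral>x. (f x)^2 \<partial>M) * (\<integral>x. (h x)^2 \<partial>M)"
proof -
  define a b c where "a = (\<integral>x. (h x)^2 \<partial>M)" and "b = (\<integral>x. f x * h x \<partial>M)" and "c = (\<integral>x. (f x)^2 \<partial>M)"
  note p = integrable_mult_square[OF assms]
  have q: "0 \<le> c - 2 * l * b + l^2 * a" for l
  proof -
    have "0 \<le> (\<integral>x. (f x - l * h x)^2 \<partial>M)" by simp
    also have "(\<lambda>x. (f x - l * h x)^2) = (\<lambda>x. (f x)^2 - (2 * l) * (f x * h x) + l^2 * (h x)^2)"
      by (auto simp: power2_diff power_mult_distrib)
    also have "(\<integral>x. (f x)^2 - (2 * l) * (f x * h x) + l^2 * (h x)^2 \<partial>M) = c - 2 * l * b + l^2 * a"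
      using i p by (simp add: a_def b_def c_def)
    finally show ?thesis .
  qed
  have "0 \<le> a" by (simp add: a_def)
  show ?thesis
  proof (cases "a = 0")
    case True
    have "b = 0"
    proof (rule ccontr)
      assume "b \<noteq> 0"
      \<comment> \<open>Without a quadratic term the inequality is linear in l; this l produces the
        value -1.\<close>
      then show False using q[of "(c + 1) / (2 * b)"] True by (simp add: field_simps)
    qed
    then show ?thesis using True by (simp flip: a_def b_def c_def)
  next
    case False
    then have "0 < a" using \<open>0 \<le> a\<close> by simp
    then have "0 \<le> c - b^2 / a" using q[of "b / a"] by (simp add: power2_eq_square field_simps)
    then show ?thesis using \<open>0 < a\<close> by (simp add: field_simps flip: a_def b_def c_def)
  qed
qed

lemma (in prob_space) expectation_abs_le:
  assumes [measurable]: "f \<in> borel_measurable M" and i: "integrable M (\<lambda>x. (f x)^2)"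
  shows "integrable M f" "expectation (\<lambda>x. \<bar>f x\<bar>) \<le> sqrt (expectation (\<lambda>x. (f x)^2))"
proof -
  have "integrable M (\<lambda>x. f x * 1)" using i by (intro integrable_mult_square) auto
  then show "integrable M f" by simp
  have "(expectation (\<lambda>x. \<bar>f x\<bar> * 1))^2 \<le> expectation (\<lambda>x. \<bar>f x\<bar>\<^sup>2) * expectation (\<lambda>x. 1^2)"
    using i by (intro integral_cauchy_schwarz) auto
  then have "(expectation (\<lambda>x. \<bar>f x\<bar>))^2 \<le> expectation (\<lambda>x. (f x)^2)"
    by (simp add: prob_space)
  then show "expectation (\<lambda>x. \<bar>f x\<bar>) \<le> sqrt (expectation (\<lambda>x. (f x)^2))"
    by (rule real_le_rsqrt)
qed

lemma cmod_iexp_diff: "cmod (iexp a - iexp b) \<le> \<bar>a - b\<bar>"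
proof -
  have "iexp a - iexp b = iexp b * (iexp (a - b) - 1)"
    by (simp add: algebra_simps flip: exp_add)
  then have "cmod (iexp a - iexp b) = cmod (iexp (a - b) - 1)" by (simp add: norm_mult)
  also have "\<dots> \<le> \<bar>a - b\<bar>" using iexp_approx1[of "a - b" 0] by simp
  finally show ?thesis .
qed

lemma (in prob_space) char_diff_le:
  assumes [measurable]: "X \<in> borel_measurable M" "Y \<in> borel_measurable M"
    and i: "integrable M (\<lambda>x. \<bar>X x - Y x\<bar>)"
  shows "cmod (char (distr M borel X) t - char (distr M borel Y) t) \<le> \<bar>t\<bar> * expectation (\<lambda>x. \<bar>X x - Y x\<bar>)"
proof -
  have ii: "integrable M (\<lambda>x. iexp (t * Z x))" if [measurable]: "Z \<in> borel_measurable M" for Z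
    by (rule integrable_const_bound[of _ 1]) auto
  have "char (distr M borel X) t - char (distr M borel Y) t = expectation (\<lambda>x. iexp (t * X x) - iexp (t * Y x))"
    unfolding char_def by (subst Bochner_Integration.integral_diff[OF ii ii]) (auto simp: integral_distr)
  also have "cmod \<dots> \<le> expectation (\<lambda>x. cmod (iexp (t * X x) - iexp (t * Y x)))"
    by (rule integral_norm_bound)
  also have "\<dots> \<le> expectation (\<lambda>x. \<bar>t\<bar> * \<bar>X x - Y x\<bar>)"
  proof (rule integral_mono)
    show "integrable M (\<lambda>x. cmod (iexp (t * X x) - iexp (t * Y x)))"
      by (intro integrable_norm Bochner_Integration.integrable_diff ii) auto
    fix x
    have "cmod (iexp (t * X x) - iexp (t * Y x)) \<le> \<bar>t * X x - t * Y x\<bar>" by (rule cmod_iexp_diff)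
    also have "\<dots> = \<bar>t\<bar> * \<bar>X x - Y x\<bar>" by (simp add: abs_mult flip: right_diff_distrib)
    finally show "cmod (iexp (t * X x) - iexp (t * Y x)) \<le> \<bar>t\<bar> * \<bar>X x - Y x\<bar>" .
  qed (use i in auto)
  finally show ?thesis by simp
qed

text \<open>The error is recorded through a bound k on its norm in mean square, which controls the
  variance by the Cauchy-Schwarz inequality and the characteristic function through the first
  absolute moment.\<close>

definition centered_merge :: "'a measure \<Rightarrow> real \<Rightarrow> ('a \<Rightarrow> real) \<Rightarrow> ('a \<Rightarrow> real) \<Rightarrow> ('a \<Rightarrow> real) \<Rightarrow> ('a \<Rightarrow> real) \<Rightarrow> bool" where
  "centered_merge M k A B B' E \<longleftrightarrow>
     prob_space.indep_var M borel B borel B' \<and> distr M borel B' = distr M borel B \<and>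
     A \<in> borel_measurable M \<and> E \<in> borel_measurable M \<and> (AE x in M. A x = B x + B' x + E x) \<and>
     integrable M (\<lambda>x. (B x)^2) \<and> (\<integral>x. B x \<partial>M) = 0 \<and>
     integrable M (\<lambda>x. (E x)^2) \<and> (\<integral>x. E x \<partial>M) = 0 \<and> (\<integral>x. (E x)^2 \<partial>M) \<le> k^2"

lemma integral_eq_of_distr_eq:
  fixes f :: "real \<Rightarrow> real"
  assumes "distr M borel X = distr M borel Y" "X \<in> borel_measurable M" "Y \<in> borel_measurable M"
    "f \<in> borel_measurable borel"
  shows "(\<integral>x. f (X x) \<partial>M) = (\<integral>x. f (Y x) \<partial>M)" "integrable M (\<lambda>x. f (X x)) = integrable M (\<lambda>x. f (Y x))"
  using assms integral_distr[of X M borel f] integral_distr[of Y M borel f]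
    integrable_distr_eq[of X M borel f] integrable_distr_eq[of Y M borel f] by auto

context prob_space
begin

lemma centered_mergeD:
  assumes "centered_merge M k A B B' E"
  shows "indep_var borel B borel B'" "A \<in> borel_measurable M" "B \<in> borel_measurable M"
    "B' \<in> borel_measurable M" "E \<in> borel_measurable M" "AE x in M. A x = B x + B' x + E x"
    "integrable M (\<lambda>x. (B x)^2)" "integrable M (\<lambda>x. (B' x)^2)" "integrable M (\<lambda>x. (E x)^2)"
    "expectation B = 0" "expectation B' = 0" "expectation E = 0"
    "expectation (\<lambda>x. (B' x)^2) = expectation (\<lambda>x. (B x)^2)" "expectation (\<lambda>x. (E x)^2) \<le> k^2"
    "integrable M B" "integrable M B'" "integrable M E"
    "\<And>f. f \<in> borel_measurable borel \<Longrightarrow> integrable M (\<lambda>x. f (B' x) :: real) = integrable M (\<lambda>x. f (B x))"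
    "\<And>f. f \<in> borel_measurable borel \<Longrightarrow> expectation (\<lambda>x. f (B' x) :: real) = expectation (\<lambda>x. f (B x))"
proof -
  note a = assms[unfolded centered_merge_def]
  show 1: "indep_var borel B borel B'" "A \<in> borel_measurable M" "E \<in> borel_measurable M"
    "AE x in M. A x = B x + B' x + E x" "integrable M (\<lambda>x. (B x)^2)" "integrable M (\<lambda>x. (E x)^2)"
    "expectation B = 0" "expectation E = 0" "expectation (\<lambda>x. (E x)^2) \<le> k^2"
    using a by auto
  show 2: "B \<in> borel_measurable M" "B' \<in> borel_measurable M"
    using indep_var_rv1[OF 1(1)] indep_var_rv2[OF 1(1)] by auto
  have d: "distr M borel B' = distr M borel B" using a by simp
  note d' = integral_eq_of_distr_eq[OF d 2(2,1)]
  have m: "(\<lambda>y::real. y) \<in> borel_measurable borel" "(\<lambda>y::real. y^2) \<in> borel_measurable borel" by auto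
  show "expectation B' = 0" using d'(1)[OF m(1)] 1(7) by simp
  show sq: "integrable M (\<lambda>x. (B' x)^2)" using d'(2)[OF m(2)] 1(5) by simp
  show "integrable M B" by (rule expectation_abs_le(1)[OF 2(1) 1(5)])
  show "integrable M B'" by (rule expectation_abs_le(1)[OF 2(2) sq])
  show "integrable M E" by (rule expectation_abs_le(1)[OF 1(3) 1(6)])
  show "expectation (\<lambda>x. (B' x)^2) = expectation (\<lambda>x. (B x)^2)" by (rule d'(1)[OF m(2)])
  show "\<And>f. f \<in> borel_measurable borel \<Longrightarrow> integrable M (\<lambda>x. f (B' x) :: real) = integrable M (\<lambda>x. f (B x))"
    "\<And>f. f \<in> borel_measurable borel \<Longrightarrow> expectation (\<lambda>x. f (B' x) :: real) = expectation (\<lambda>x. f (B x))"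
    by (rule d'(2), assumption) (rule d'(1), assumption)
qed

text \<open>The sum of the two independent copies has variance 2 v, and the error enters through the
  Cauchy-Schwarz inequality.\<close>

lemma merge_variance:
  assumes cm: "centered_merge M b A B B' E" and k: "b \<ge> 0"
  defines "v \<equiv> expectation (\<lambda>x. (B x)^2)"
  shows "\<bar>expectation (\<lambda>x. (A x)^2) - 2 * v\<bar> \<le> 2 * sqrt (2 * v) * b + b^2"
proof -
  note c = centered_mergeD[OF cm]
  have [measurable]: "A \<in> borel_measurable M" "B \<in> borel_measurable M" "B' \<in> borel_measurable M" "E \<in> borel_measurable M"
    using c by auto
  have v: "v \<ge> 0" by (simp add: v_def)
  have iBB: "integrable M (\<lambda>x. B x * B' x)" and eBB: "expectation (\<lambda>x. B x * B' x) = 0"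
    using indep_var_integrable[OF c(1,15,16)] indep_var_lebesgue_integral[OF c(1,15,16)] c(10) by auto
  define S where "S = (\<lambda>x. B x + B' x)"
  have [measurable]: "S \<in> borel_measurable M" by (simp add: S_def)
  have S2: "(\<lambda>x. (S x)^2) = (\<lambda>x. (B x)^2 + (B' x)^2 + 2 * (B x * B' x))"
    by (auto simp: S_def power2_sum)
  have iS: "integrable M (\<lambda>x. (S x)^2)" using c iBB by (simp add: S2)
  have eS: "expectation (\<lambda>x. (S x)^2) = 2 * v" using c iBB eBB by (simp add: S2 v_def)
  have iSE: "integrable M (\<lambda>x. S x * E x)" by (intro integrable_mult_square iS c) auto
  have "(expectation (\<lambda>x. S x * E x))^2 \<le> 2 * v * expectation (\<lambda>x. (E x)^2)"
    using integral_cauchy_schwarz[OF _ _ iS c(9)] by (simp add: eS)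
  also have "\<dots> \<le> 2 * v * b^2" using v c by (intro mult_left_mono) auto
  also have "\<dots> = (sqrt (2 * v) * b)^2" using v by (simp add: power_mult_distrib)
  finally have 1: "\<bar>expectation (\<lambda>x. S x * E x)\<bar> \<le> sqrt (2 * v) * b"
    using v k by (metis abs_le_square_iff abs_of_nonneg mult_nonneg_nonneg real_sqrt_ge_zero zero_le_numeral)
  have "expectation (\<lambda>x. (A x)^2) = expectation (\<lambda>x. (S x)^2 + 2 * (S x * E x) + (E x)^2)"
  proof (rule integral_cong_AE)
    show "AE x in M. (A x)^2 = (S x)^2 + 2 * (S x * E x) + (E x)^2"
      using c(6) by eventually_elim (simp add: S_def power2_sum algebra_simps)
  qed measurable
  also have "\<dots> = 2 * v + 2 * expectation (\<lambda>x. S x * E x) + expectation (\<lambda>x. (E x)^2)"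
    using iS iSE c eS by simp
  finally have e: "expectation (\<lambda>x. (A x)^2) - 2 * v = 2 * expectation (\<lambda>x. S x * E x) + expectation (\<lambda>x. (E x)^2)"
    by simp
  have "0 \<le> expectation (\<lambda>x. (E x)^2)" by simp
  moreover have "0 \<le> b^2" by simp
  ultimately show ?thesis unfolding e using 1 c(14) by (simp only: abs_le_iff mult.assoc) linarith
qed

text \<open>Two independent copies square the characteristic function; the error moves it by at most
  |t| times its first absolute moment.\<close>

lemma merge_char:
  assumes cm: "centered_merge M b A B B' E" and k: "b \<ge> 0"
  shows "cmod (char (distr M borel A) t - (char (distr M borel B) t)^2) \<le> \<bar>t\<bar> * b"
proof -
  note c = centered_mergeD[OF cm]
  have [measurable]: "A \<in> borel_measurable M" "B \<in> borel_measurable M" "B' \<in> borel_measurable M" "E \<in> borel_measurable M"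
    using c by auto
  have "distr M borel B' = distr M borel B" using cm by (simp add: centered_merge_def)
  then have 1: "(char (distr M borel B) t)^2 = char (distr M borel (\<lambda>x. B x + B' x)) t"
    using char_distr_add[OF c(1), of t] by (simp add: power2_eq_square)
  have ae: "AE x in M. \<bar>A x - (B x + B' x)\<bar> = \<bar>E x\<bar>" using c(6) by eventually_elim simp
  have "integrable M (\<lambda>x. \<bar>E x\<bar>)" using c by auto
  then have i: "integrable M (\<lambda>x. \<bar>A x - (B x + B' x)\<bar>)"
    using ae by (subst integrable_cong_AE[where g = "\<lambda>x. \<bar>E x\<bar>"]) auto
  have "expectation (\<lambda>x. \<bar>A x - (B x + B' x)\<bar>) = expectation (\<lambda>x. \<bar>E x\<bar>)"
    using ae by (intro integral_cong_AE) auto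
  also have "\<dots> \<le> sqrt (expectation (\<lambda>x. (E x)^2))" by (rule expectation_abs_le(2)[OF c(5,9)])
  also have "\<dots> \<le> b" by (rule real_le_lsqrt[OF k c(14)])
  finally have 2: "\<bar>t\<bar> * expectation (\<lambda>x. \<bar>A x - (B x + B' x)\<bar>) \<le> \<bar>t\<bar> * b" by (rule mult_left_mono) simp
  show ?thesis unfolding 1 by (rule order_trans[OF char_diff_le[OF _ _ i] 2]) auto
qed

end

section \<open>Chains for a Young function with two powers\<close>

text \<open>Both power bounds hold on the whole half-line. The power q is used for quantities known
  to be small, such as H / s, and the power p for the excess, which has only p moments.\<close>

locale young_pq = young +
  fixes p q :: real
  assumes p_gt2: "2 < p" and p_less_q: "p < q"
    and w_le_p: "\<And>u. 0 \<le> u \<Longrightarrow> u^2 * g u \<le> u powr p"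
    and w_le_q: "\<And>u. 0 \<le> u \<Longrightarrow> u^2 * g u \<le> u powr q"
    and g_pos: "\<And>u. 0 < u \<Longrightarrow> 0 < g u"
begin

lemma psi_le_p: "psi x \<le> \<bar>x\<bar> powr p"
  using psi_upper[of x] w_le_p[of "\<bar>x\<bar>"] by simp

lemma psi_le_q: "psi x \<le> \<bar>x\<bar> powr q"
  using psi_upper[of x] w_le_q[of "\<bar>x\<bar>"] by simp

text \<open>A variance bound consists of a geometrically decaying part \<open>a\<close> and an error
  part \<open>b\<close>. The larger of the two decides which power is used: p for the first, whose
  rate has to be matched against R, and q for the second, which becomes very small.\<close>

lemma w_split:
  assumes "0 \<le> a" "0 \<le> b" "0 \<le> v" "v \<le> a + b"
  shows "v * g (sqrt v) \<le> (2 * a) powr (p / 2) + (2 * b) powr (q / 2)"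
proof -
  have e: "sqrt x powr y = x powr (y / 2)" if "0 \<le> x" for x y :: real
    using that by (simp add: powr_half_sqrt[symmetric] powr_powr)
  have w: "v * g (sqrt v) = (sqrt v)^2 * g (sqrt v)" using assms by simp
  show ?thesis
  proof (cases "b \<le> a")
    case True
    have "v * g (sqrt v) \<le> sqrt v powr p" unfolding w using assms by (intro w_le_p) auto
    also have "\<dots> = v powr (p / 2)" using assms by (intro e)
    also have "\<dots> \<le> (2 * a) powr (p / 2)" using assms True p_gt2 by (intro powr_mono2) auto
    finally show ?thesis by (simp add: add_increasing2)
  next
    case False
    have "v * g (sqrt v) \<le> sqrt v powr q" unfolding w using assms by (intro w_le_q) auto
    also have "\<dots> = v powr (q / 2)" using assms by (intro e)
    also have "\<dots> \<le> (2 * b) powr (q / 2)" using assms False p_gt2 p_less_q by (intro powr_mono2) auto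
    finally show ?thesis by (simp add: add_increasing)
  qed
qed

text \<open>This plays the part of Lindeberg's truncation: up to the level u the cube is a small
  multiple of the square, and above it the square is at most a multiple of
  \<open>psi\<close>.\<close>

lemma min_square_cube_le:
  assumes "0 < e"
  shows "\<exists>C>0. \<forall>x. min (6 * x^2) (\<bar>t\<bar> * \<bar>x\<bar> ^ 3) \<le> e * x^2 + C * psi x"
proof -
  define u where "u = e / (\<bar>t\<bar> + 1)"
  have u: "u > 0" "\<bar>t\<bar> * u \<le> e" using assms by (auto simp: u_def field_simps)
  define C where "C = 6 / (lowc * g u)"
  have C: "C > 0" using g_pos[OF u(1)] lowc_pos by (simp add: C_def)
  have "min (6 * x^2) (\<bar>t\<bar> * \<bar>x\<bar> ^ 3) \<le> e * x^2 + C * psi x" for x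
  proof (cases "\<bar>x\<bar> \<le> u")
    case True
    have "\<bar>t\<bar> * \<bar>x\<bar> ^ 3 = (\<bar>t\<bar> * \<bar>x\<bar>) * x^2" by (simp add: power3_eq_cube power2_eq_square)
    also have "\<dots> \<le> e * x^2"
      by (intro mult_right_mono order_trans[OF mult_left_mono[OF True] u(2)]) auto
    finally show ?thesis using C psi_nonneg[of x] by (simp add: min_le_iff_disj add_increasing2)
  next
    case False
    have "lowc * (x^2 * g u) \<le> lowc * (x^2 * g \<bar>x\<bar>)"
      using False u lowc_pos by (intro mult_left_mono g_mono) auto
    also have "\<dots> \<le> psi x" by (rule psi_lower)
    finally have "6 * x^2 \<le> C * psi x" using lowc_pos g_pos[OF u(1)] by (simp add: C_def field_simps)
    then show ?thesis using assms by (simp add: min_le_iff_disj add_increasing)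
  qed
  then show ?thesis using C by blast
qed

text \<open>Level 0 is the whole normalized variable and level J the shortest piece. Bounds on
  \<open>psi\<close>-moments are required only at level J and for the errors; for the other levels
  they are propagated from J towards 0.\<close>

definition cchain :: "'a measure \<Rightarrow> real \<Rightarrow> real \<Rightarrow> nat \<Rightarrow> (nat \<Rightarrow> 'a \<Rightarrow> real) \<Rightarrow> (nat \<Rightarrow> 'a \<Rightarrow> real)
    \<Rightarrow> (nat \<Rightarrow> 'a \<Rightarrow> real) \<Rightarrow> bool" where
  "cchain M k e J A B E \<longleftrightarrow> prob_space M \<and> 0 \<le> k \<and> 0 \<le> e \<and>
     (\<forall>j<J. centered_merge M k (A j) (A (Suc j)) (B j) (E j) \<and>
        integrable M (\<lambda>x. psi (E j x)) \<and> (\<integral>x. psi (E j x) \<partial>M) \<le> e) \<and>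
     integrable M (\<lambda>x. psi (A J x)) \<and> (\<integral>x. psi (A J x) \<partial>M) \<le> e \<and> (\<integral>x. (A 0 x)^2 \<partial>M) = 1"

lemma cchain_merge: "cchain M k e J A B E \<Longrightarrow> j < J \<Longrightarrow> centered_merge M k (A j) (A (Suc j)) (B j) (E j)"
  by (simp add: cchain_def)

lemma cchain_psi_integrable:
  assumes c: "cchain M k e J A B E" and "j \<le> J"
  shows "integrable M (\<lambda>x. psi (A j x))"
  using \<open>j \<le> J\<close>
proof (induction rule: inc_induct)
  case base
  then show ?case using c by (simp add: cchain_def)
next
  case (step n)
  interpret prob_space M using c by (simp add: cchain_def)
  note m = centered_mergeD[OF cchain_merge[OF c step(2)]]
  note [measurable] = m(2-5)
  have iB: "integrable M (\<lambda>x. psi (B n x))" using m(18)[OF psi_measurable] step by simp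
  have iE: "integrable M (\<lambda>x. psi (E n x))" using c step by (simp add: cchain_def)
  have "integrable M (\<lambda>x. psi ((A (Suc n) x + B n x) + E n x))"
    by (intro integrable_psi_add iB iE step) auto
  moreover have "AE x in M. psi (A n x) = psi ((A (Suc n) x + B n x) + E n x)"
    using m(6) by eventually_elim simp
  ultimately show ?case by (subst integrable_cong_AE) auto
qed

lemma cchain_psi_step:
  assumes "2 < R"
  shows "\<exists>C>0. \<forall>(M :: 'a measure) k e J A B E j. cchain M k e J A B E \<longrightarrow> j < J \<longrightarrow>
    (\<integral>x. psi (A j x) \<partial>M) \<le> R * (\<integral>x. psi (A (Suc j) x) \<partial>M)
      + C * ((\<integral>x. (A (Suc j) x)^2 \<partial>M) * g (sqrt (\<integral>x. (A (Suc j) x)^2 \<partial>M)) + e)"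
proof -
  obtain C where C: "C > 0" and merge: "\<forall>(M :: 'a measure) X Y D v. prob_space M \<longrightarrow> prob_space.indep_var M borel X borel Y \<longrightarrow>
     D \<in> borel_measurable M \<longrightarrow>
     integrable M (\<lambda>x. psi (X x)) \<longrightarrow> integrable M (\<lambda>x. psi (Y x)) \<longrightarrow> integrable M (\<lambda>x. psi (D x)) \<longrightarrow>
     integrable M X \<longrightarrow> integrable M Y \<longrightarrow> (\<integral>x. X x \<partial>M) = 0 \<longrightarrow> (\<integral>x. Y x \<partial>M) = 0 \<longrightarrow>
     integrable M (\<lambda>x. (X x)^2) \<longrightarrow> integrable M (\<lambda>x. (Y x)^2) \<longrightarrow>
     (\<integral>x. (X x)^2 \<partial>M) = v \<longrightarrow> (\<integral>x. (Y x)^2 \<partial>M) = v \<longrightarrow>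
     (\<integral>x. psi (Y x) \<partial>M) = (\<integral>x. psi (X x) \<partial>M) \<longrightarrow>
     (\<integral>x. psi (X x + Y x + D x) \<partial>M) \<le> (2 + (R - 2)) * (\<integral>x. psi (X x) \<partial>M)
        + C * (v * g (sqrt v) + (\<integral>x. psi (D x) \<partial>M))"
    using expectation_merge[of "R - 2"] assms by auto
  show ?thesis
  proof (intro exI[of _ C] conjI allI impI)
    fix M :: "'a measure" and k e J A B E j
    assume c: "cchain M k e J A B E" and j: "j < J"
    interpret prob_space M using c by (simp add: cchain_def)
    note m = centered_mergeD[OF cchain_merge[OF c j]]
    note [measurable] = m(2-5)
    have iA: "integrable M (\<lambda>x. psi (A (Suc j) x))" using j by (intro cchain_psi_integrable[OF c]) simp
    have iB: "integrable M (\<lambda>x. psi (B j x))" using m(18)[OF psi_measurable] iA by simp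
    have iE: "integrable M (\<lambda>x. psi (E j x))" and E: "(\<integral>x. psi (E j x) \<partial>M) \<le> e"
      using c j by (auto simp: cchain_def)
    have "(\<integral>x. psi (A j x) \<partial>M) = (\<integral>x. psi (A (Suc j) x + B j x + E j x) \<partial>M)"
      using m(6) by (intro integral_cong_AE) auto
    also have "\<dots> \<le> (2 + (R - 2)) * (\<integral>x. psi (A (Suc j) x) \<partial>M)
        + C * ((\<integral>x. (A (Suc j) x)^2 \<partial>M) * g (sqrt (\<integral>x. (A (Suc j) x)^2 \<partial>M)) + (\<integral>x. psi (E j x) \<partial>M))"
      by (rule merge[rule_format, OF prob_space_axioms m(1,5) iA iB iE m(15,16,10,11,7,8) refl m(13) m(19)[OF psi_measurable]])
    also have "\<dots> \<le> R * (\<integral>x. psi (A (Suc j) x) \<partial>M)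
        + C * ((\<integral>x. (A (Suc j) x)^2 \<partial>M) * g (sqrt (\<integral>x. (A (Suc j) x)^2 \<partial>M)) + e)"
      using E C by simp
    finally show "(\<integral>x. psi (A j x) \<partial>M) \<le> \<dots>" .
  qed (rule C)
qed

lemma cchain_var_step:
  assumes c: "cchain M k e J A B E" and j: "j < J"
  shows "\<bar>(\<integral>x. (A j x)^2 \<partial>M) - 2 * (\<integral>x. (A (Suc j) x)^2 \<partial>M)\<bar> \<le>
    2 * sqrt (2 * (\<integral>x. (A (Suc j) x)^2 \<partial>M)) * k + k^2"
proof -
  interpret prob_space M using c by (simp add: cchain_def)
  show ?thesis using c by (intro merge_variance[OF cchain_merge[OF c j]]) (simp add: cchain_def)
qed

text \<open>The coefficient of k^2 that reproduces itself in the recursion for the variances: adding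
  2 / (2 - r) + 1 to it multiplies it by r.\<close>

definition varc :: "real \<Rightarrow> real" where "varc r = (2 / (2 - r) + 1) / (r - 1)"

lemma varc_pos: "1 < r \<Longrightarrow> r < 2 \<Longrightarrow> 0 < varc r"
  unfolding varc_def by (intro divide_pos_pos add_pos_pos) auto

text \<open>Without errors the variance would halve at each level. The rate is lowered from 2 to r,
  and the difference 2 - r pays for the mixed term of sum and error.\<close>

lemma cchain_var_le:
  assumes c: "cchain M k e J A B E" and r: "1 < r" "r < 2" and "j \<le> J"
  shows "(\<integral>x. (A j x)^2 \<partial>M) \<le> (1 / r) ^ j + varc r * k^2"
  using \<open>j \<le> J\<close>
proof (induction j)
  case 0
  then show ?case using c varc_pos[OF r] by (simp add: cchain_def)
next
  case (Suc j)
  define v where "v = (\<integral>x. (A (Suc j) x)^2 \<partial>M)"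
  define u where "u = (\<integral>x. (A j x)^2 \<partial>M)"
  have v: "v \<ge> 0" by (simp add: v_def)
  \<comment> \<open>The arithmetic-geometric mean inequality, weighted so that the part taken from
    the variance is exactly (2 - r) v.\<close>
  have "2 * (sqrt ((2 - r) * v)) * (sqrt (2 / (2 - r)) * k) \<le> (sqrt ((2 - r) * v))^2 + (sqrt (2 / (2 - r)) * k)^2"
    by (rule sum_squares_bound)
  also have "\<dots> = (2 - r) * v + 2 / (2 - r) * k^2" using v r by (simp add: power_mult_distrib)
  also have "2 * (sqrt ((2 - r) * v)) * (sqrt (2 / (2 - r)) * k) = 2 * sqrt (2 * v) * k"
  proof -
    have "sqrt ((2 - r) * v) * sqrt (2 / (2 - r)) = sqrt (((2 - r) * v) * (2 / (2 - r)))" by (simp only: real_sqrt_mult)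
    also have "((2 - r) * v) * (2 / (2 - r)) = 2 * v" using r by simp
    finally show ?thesis by simp
  qed
  finally have 1: "2 * sqrt (2 * v) * k \<le> (2 - r) * v + 2 / (2 - r) * k^2" .
  have "2 * v - u \<le> 2 * sqrt (2 * v) * k + k^2"
    using cchain_var_step[OF c, of j] Suc by (simp add: u_def v_def abs_le_iff)
  then have "r * v \<le> u + (2 / (2 - r) + 1) * k^2" using 1 by (simp add: algebra_simps)
  also have "u \<le> (1 / r) ^ j + varc r * k^2" using Suc by (simp add: u_def)
  also have "(1 / r) ^ j + varc r * k^2 + (2 / (2 - r) + 1) * k^2 = (1 / r) ^ j + r * varc r * k^2"
  proof -
    have "2 / (2 - r) + 1 = (r - 1) * varc r" using r by (simp add: varc_def)
    then have "varc r + (2 / (2 - r) + 1) = r * varc r" by (simp add: left_diff_distrib)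
    then have "(varc r + (2 / (2 - r) + 1)) * k^2 = r * varc r * k^2" by (simp only:)
    then show ?thesis by (simp only: distrib_right add.assoc)
  qed
  finally have "v \<le> ((1 / r) ^ j + r * varc r * k^2) / r" using r by (simp add: pos_le_divide_eq mult.commute)
  then show ?case using r by (simp add: v_def add_divide_distrib)
qed

text \<open>From level J to level j the \<open>psi\<close>-moment is multiplied by at most R per
  level, while the variances feed in terms of order t^j with t = r^(-p/2). Since R t < 1, all that
  is fed in is dominated by the contribution at level j; only the initial value and the errors keep
  the factor R^(J-j).\<close>

lemma cchain_psi_le:
  assumes r: "1 < r" "r < 2" and R: "2 < R" "R < r powr (p / 2)"
  shows "\<exists>C>0. \<forall>(M :: 'a measure) k \<eta> J A B E j. cchain M k \<eta> J A B E \<longrightarrow> j \<le> J \<longrightarrow>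
    (\<integral>x. psi (A j x) \<partial>M) \<le> C * ((1 / r powr (p / 2)) ^ j + R ^ (J - j) * (\<eta> + k powr q))"
proof -
  define t where "t = 1 / r powr (p / 2)"
  have t: "0 < t" "R * t < 1" using r R by (auto simp: t_def field_simps)
  obtain C where C: "C > 0" and psi_step: "\<And>(M :: 'a measure) k \<eta> J A B E j. cchain M k \<eta> J A B E \<Longrightarrow> j < J \<Longrightarrow>
    (\<integral>x. psi (A j x) \<partial>M) \<le> R * (\<integral>x. psi (A (Suc j) x) \<partial>M)
      + C * ((\<integral>x. (A (Suc j) x)^2 \<partial>M) * g (sqrt (\<integral>x. (A (Suc j) x)^2 \<partial>M)) + \<eta>)"
    using cchain_psi_step[OF R(1)] by blast
  define K0 where "K0 = 1 + C * (2 powr (p / 2) + (2 * varc r) powr (q / 2) + 1)"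
  have K0: "K0 \<ge> 1" "C \<le> K0" "C * 2 powr (p / 2) \<le> K0" "C * (2 * varc r) powr (q / 2) \<le> K0"
    using C by (auto simp: K0_def algebra_simps add_increasing add_increasing2)
  \<comment> \<open>The solution of K1 (R t) + K0 = K1, by which the first term of the bound
    reproduces itself.\<close>
  define K1 where "K1 = K0 / (1 - R * t)"
  have K1: "K1 > 0" "K1 * (1 - R * t) = K0" using t K0 by (auto simp: K1_def)
  \<comment> \<open>The coefficient 2 R^(J-j) - 1 stands in for a geometric sum: one step produces 2
    R^(J-j) - (R - 1), and R - 1 is at least 1.\<close>
  have main: "(\<integral>x. psi (A j x) \<partial>M) \<le> K1 * t ^ j + (2 * R ^ (J - j) - 1) * (K0 * (\<eta> + k powr q))"
    if c: "cchain M k \<eta> J A B E" and "j \<le> J" for M :: "'a measure" and k \<eta> J A B E j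
    using \<open>j \<le> J\<close>
  proof (induction rule: inc_induct)
    case base
    have "0 \<le> \<eta>" "(\<integral>x. psi (A J x) \<partial>M) \<le> \<eta>" using c by (auto simp: cchain_def)
    moreover have "1 * (\<eta> + 0) \<le> K0 * (\<eta> + k powr q)" using K0 \<open>0 \<le> \<eta>\<close> by (intro mult_mono) auto
    moreover have "0 \<le> K1 * t ^ J" using K1 t by simp
    ultimately show ?case by simp
  next
    case (step n)
    define v where "v = (\<integral>x. (A (Suc n) x)^2 \<partial>M)"
    define h where "h = \<eta> + k powr q"
    have e: "0 \<le> \<eta>" "0 \<le> k" using c by (auto simp: cchain_def)
    have "v \<le> (1 / r) ^ Suc n + varc r * k^2"
      unfolding v_def using step by (intro cchain_var_le[OF c r]) auto
    also have "(1 / r) ^ Suc n \<le> (1 / r) ^ n" using r by (intro power_decreasing) auto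
    finally have "v * g (sqrt v) \<le> (2 * (1 / r) ^ n) powr (p / 2) + (2 * (varc r * k^2)) powr (q / 2)"
      using varc_pos[OF r] r by (intro w_split) (auto simp: v_def)
    also have "(2 * (1 / r) ^ n) powr (p / 2) = 2 powr (p / 2) * t ^ n"
      using r by (simp add: t_def powr_mult powr_divide powr_realpow[symmetric] powr_powr powr_power mult.commute)
    also have "(2 * (varc r * k^2)) powr (q / 2) = (2 * varc r) powr (q / 2) * k powr q"
    proof -
      have "(k^2) powr (q / 2) = k powr q"
      proof (cases "k = 0")
        case False
        then have "k^2 = k powr 2" using e by (simp add: powr_numeral)
        then show ?thesis by (simp add: powr_powr)
      qed simp
      then show ?thesis using varc_pos[OF r] by (simp add: powr_mult mult.assoc[symmetric])
    qed
    finally have w: "v * g (sqrt v) \<le> 2 powr (p / 2) * t ^ n + (2 * varc r) powr (q / 2) * k powr q" .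
    have "(\<integral>x. psi (A n x) \<partial>M) \<le> R * (\<integral>x. psi (A (Suc n) x) \<partial>M) + C * (v * g (sqrt v) + \<eta>)"
      unfolding v_def using step by (intro psi_step[OF c])
    also have "\<dots> \<le> R * (K1 * t ^ Suc n + (2 * R ^ (J - Suc n) - 1) * (K0 * h)) + C * (2 powr (p / 2) * t ^ n + (2 * varc r) powr (q / 2) * k powr q + \<eta>)"
      using step.IH w R C unfolding h_def by (intro add_mono mult_left_mono) auto
    also have "\<dots> \<le> R * (K1 * t ^ Suc n + (2 * R ^ (J - Suc n) - 1) * (K0 * h)) + (K0 * t ^ n + K0 * k powr q + K0 * \<eta>)"
    proof -
      have "C * (2 powr (p / 2) * t ^ n) \<le> K0 * t ^ n"
        using mult_right_mono[OF K0(3), of "t ^ n"] t by (simp add: mult.assoc)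
      moreover have "C * ((2 * varc r) powr (q / 2) * k powr q) \<le> K0 * k powr q"
        using mult_right_mono[OF K0(4), of "k powr q"] by (simp add: mult.assoc)
      moreover have "C * \<eta> \<le> K0 * \<eta>" using K0 e by (intro mult_right_mono) auto
      ultimately show ?thesis by (simp add: distrib_left)
    qed
    also have "\<dots> = (K1 * (R * t) + K0) * t ^ n + (2 * (R * R ^ (J - Suc n)) - (R - 1)) * (K0 * h)"
      by (simp add: h_def algebra_simps)
    also have "R * R ^ (J - Suc n) = R ^ (J - n)" using step by (simp add: Suc_diff_Suc flip: power_Suc)
    also have "K1 * (R * t) + K0 = K1" using K1(2) by (simp add: algebra_simps)
    also have "(2 * R ^ (J - n) - (R - 1)) * (K0 * h) \<le> (2 * R ^ (J - n) - 1) * (K0 * h)"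
      using R K0 e by (intro mult_right_mono) (auto simp: h_def)
    finally show ?case by (simp add: h_def)
  qed
  show ?thesis
  proof (intro exI[of _ "K1 + 2 * K0"] conjI allI impI)
    fix M :: "'a measure" and k \<eta> J A B E j
    assume c: "cchain M k \<eta> J A B E" and j: "j \<le> J"
    define h where "h = \<eta> + k powr q"
    have h: "0 \<le> h" using c by (auto simp: cchain_def h_def)
    have "(\<integral>x. psi (A j x) \<partial>M) \<le> K1 * t ^ j + (2 * R ^ (J - j) - 1) * (K0 * h)"
      using main[OF c j] by (simp add: h_def)
    also have "\<dots> \<le> K1 * t ^ j + (2 * R ^ (J - j)) * (K0 * h)" using h K0 by (simp add: mult_right_mono)
    also have "\<dots> \<le> (K1 + 2 * K0) * (t ^ j + R ^ (J - j) * h)"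
      using K1 K0 t R h by (simp add: algebra_simps add_nonneg_nonneg)
    finally show "(\<integral>x. psi (A j x) \<partial>M) \<le> (K1 + 2 * K0) * ((1 / r powr (p / 2)) ^ j + R ^ (J - j) * (\<eta> + k powr q))"
      by (simp add: t_def h_def)
  qed (use K1 K0 in simp)
qed

text \<open>Level l stands for 2^l copies, so its error counts 2^l times, and the sum over the
  levels before L is 2^L - 1. On the unit disc an N-th power is Lipschitz with constant N.\<close>

lemma cchain_char:
  assumes c: "cchain M b e J A B E" and "L \<le> J"
  shows "cmod (char (distr M borel (A 0)) t - char (distr M borel (A L)) t ^ 2 ^ L) \<le> (2 ^ L - 1) * (\<bar>t\<bar> * b)"
  using \<open>L \<le> J\<close>
proof (induction L)
  case (Suc L)
  interpret prob_space M using c by (simp add: cchain_def)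
  have k: "0 \<le> b" using c by (simp add: cchain_def)
  have L: "L < J" using Suc by simp
  note m = cchain_merge[OF c L]
  define x where "x = char (distr M borel (A L)) t"
  define y where "y = char (distr M borel (A (Suc L))) t"
  have x: "cmod x \<le> 1" unfolding x_def
    by (intro real_distribution.cmod_char_le_1 real_distribution_distr centered_mergeD(2)[OF m])
  have y: "cmod (y^2) \<le> 1" unfolding y_def norm_power
    by (intro power_le_one real_distribution.cmod_char_le_1 real_distribution_distr centered_mergeD(3)[OF m]) auto
  have "cmod (x ^ 2 ^ L - (y^2) ^ 2 ^ L) \<le> real (2 ^ L) * cmod (x - y^2)"
    by (rule norm_power_diff[OF x y])
  also have "cmod (x - y^2) \<le> \<bar>t\<bar> * b" unfolding x_def y_def by (rule merge_char[OF m k])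
  finally have 1: "cmod (x ^ 2 ^ L - y ^ 2 ^ Suc L) \<le> 2 ^ L * (\<bar>t\<bar> * b)"
    by (simp add: power_mult[symmetric])
  have "cmod (char (distr M borel (A 0)) t - y ^ 2 ^ Suc L) \<le>
      cmod (char (distr M borel (A 0)) t - x ^ 2 ^ L) + cmod (x ^ 2 ^ L - y ^ 2 ^ Suc L)"
    by (rule norm_diff_triangle_le[OF order_refl order_refl])
  also have "\<dots> \<le> (2 ^ L - 1) * (\<bar>t\<bar> * b) + 2 ^ L * (\<bar>t\<bar> * b)"
    using Suc 1 by (intro add_mono) (auto simp: x_def)
  also have "\<dots> = (2 ^ Suc L - 1) * (\<bar>t\<bar> * b)" by (simp add: algebra_simps)
  finally show ?case by (simp add: y_def)
qed simp

text \<open>Bounds the variance error of one merge by a multiple of b when b \<le> 1, since all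
  variances in the chain are then at most 1 + varc r.\<close>

definition varb :: "real \<Rightarrow> real" where "varb r = 2 * sqrt (2 * (1 + varc r)) + 1"

text \<open>The same count of errors as for the characteristic functions, now for the total variance
  of the 2^L copies at level L.\<close>

lemma cchain_var_scaled:
  assumes c: "cchain M b e J A B E" and r: "1 < r" "r < 2" and k1: "b \<le> 1" and "L \<le> J"
  shows "\<bar>1 - 2 ^ L * (\<integral>x. (A L x)^2 \<partial>M)\<bar> \<le> (2 ^ L - 1) * (varb r * b)"
  using \<open>L \<le> J\<close>
proof (induction L)
  case 0
  then show ?case using c by (simp add: cchain_def)
next
  case (Suc L)
  have k: "0 \<le> b" using c by (simp add: cchain_def)
  define u where "u = (\<integral>x. (A L x)^2 \<partial>M)"
  define v where "v = (\<integral>x. (A (Suc L) x)^2 \<partial>M)"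
  have k2: "b^2 \<le> 1 * b" unfolding power2_eq_square using k k1 by (intro mult_right_mono) auto
  have "v \<le> (1 / r) ^ Suc L + varc r * b^2" unfolding v_def by (rule cchain_var_le[OF c r Suc(2)])
  also have "\<dots> \<le> 1 + varc r * 1"
    using r varc_pos[OF r] k k1 by (intro add_mono mult_left_mono power_le_one) auto
  finally have v: "v \<le> 1 + varc r" by simp
  have "\<bar>u - 2 * v\<bar> \<le> 2 * sqrt (2 * v) * b + b^2"
    unfolding u_def v_def using Suc by (intro cchain_var_step[OF c]) simp
  also have "\<dots> \<le> 2 * sqrt (2 * (1 + varc r)) * b + b"
    using v k k2 by (intro add_mono mult_right_mono mult_left_mono real_sqrt_le_mono) auto
  finally have 1: "\<bar>u - 2 * v\<bar> \<le> varb r * b" by (simp add: varb_def algebra_simps)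
  have "\<bar>1 - 2 ^ Suc L * v\<bar> = \<bar>(1 - 2 ^ L * u) + 2 ^ L * (u - 2 * v)\<bar>" by (simp add: algebra_simps)
  also have "\<dots> \<le> \<bar>1 - 2 ^ L * u\<bar> + \<bar>2 ^ L * (u - 2 * v)\<bar>" by (rule abs_triangle_ineq)
  also have "\<dots> \<le> (2 ^ L - 1) * (varb r * b) + 2 ^ L * (varb r * b)"
    using Suc 1 by (intro add_mono) (auto simp: u_def abs_mult)
  also have "\<dots> = (2 ^ Suc L - 1) * (varb r * b)" by (simp add: algebra_simps)
  finally show ?case by (simp add: v_def)
qed

text \<open>At a level L the sum of 2^L independent copies is compared with the normal law. The
  total \<open>psi\<close>-moment of the copies is at most a multiple of (2 \<theta>)^L + R^J (e +
  b^q), where 2 \<theta> < 1; it takes the place of the Lyapunov fraction.\<close>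

lemma cchain_char_bound:
  assumes r: "1 < r" "r < 2" and R: "2 < R" "R < r powr (p / 2)" and d: "0 < d"
  defines "\<theta> \<equiv> 1 / r powr (p / 2)"
  shows "\<exists>C>0. \<forall>(M :: 'a measure) b e J A B E L. cchain M b e J A B E \<longrightarrow> L < J \<longrightarrow> b \<le> 1 \<longrightarrow>
    t\<^sup>2 \<le> 2 ^ L \<longrightarrow> 2 ^ L * (varb r * b) \<le> 1 \<longrightarrow>
    cmod (char (distr M borel (A 0)) t - (1 - t^2 / 2 / 2 ^ L) ^ 2 ^ L)
      \<le> 2 ^ L * (\<bar>t\<bar> + t^2 / 2 * varb r) * b + t^2 / 6 * (2 * d + C * ((2 * \<theta>) ^ L + R ^ J * (e + b powr q)))"
proof -
  obtain C1 where C1: "C1 > 0" "\<And>x. min (6 * x^2) (\<bar>t\<bar> * \<bar>x\<bar> ^ 3) \<le> d * x^2 + C1 * psi x"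
    using min_square_cube_le[OF d, of t] by blast
  obtain C2 where C2: "C2 > 0" "\<And>(M :: 'a measure) b e J A B E j. cchain M b e J A B E \<Longrightarrow> j \<le> J \<Longrightarrow>
    (\<integral>x. psi (A j x) \<partial>M) \<le> C2 * (\<theta> ^ j + R ^ (J - j) * (e + b powr q))"
    using cchain_psi_le[OF r R] unfolding \<theta>_def by blast
  show ?thesis
  proof (intro exI[of _ "C1 * C2"] conjI allI impI)
    fix M :: "'a measure" and b e J A B E L
    assume c: "cchain M b e J A B E" and L: "L < J" and k1: "b \<le> 1" and tL: "t^2 \<le> 2 ^ L"
      and Lk: "2 ^ L * (varb r * b) \<le> 1"
    let ?c = "char (distr M borel (A 0)) t" and ?q = "(2 * \<theta>) ^ L + R ^ J * (e + b powr q)"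
    interpret prob_space M using c by (simp add: cchain_def)
    have k: "0 \<le> b" "0 \<le> e" using c by (auto simp: cchain_def)
    note m = centered_mergeD[OF cchain_merge[OF c L]]
    have mA: "A L \<in> borel_measurable M" by (rule m(2))
    have sq: "integrable M (\<lambda>x. (A L x)^2)" and mean: "integrable M (A L)" "expectation (A L) = 0"
    proof -
      note [measurable] = m(2-5)
      have "integrable M (\<lambda>x. (A (Suc L) x + B L x + E L x)^2)" using m(7-9) by (intro integrable_add_square) auto
      then show "integrable M (\<lambda>x. (A L x)^2)"
        using m(6) by (subst integrable_cong_AE[where g = "\<lambda>x. (A (Suc L) x + B L x + E L x)^2"]) auto
      then show "integrable M (A L)" by (rule expectation_abs_le(1)[OF mA])
      have "expectation (A L) = expectation (\<lambda>x. A (Suc L) x + B L x + E L x)"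
        using m(6) by (intro integral_cong_AE) auto
      then show "expectation (A L) = 0" using m(10-12,15-17) by simp
    qed
    define N where "N = (2::real) ^ L"
    have N: "N \<ge> 1" by (simp add: N_def)
    let ?z = "complex_of_real (1 - t^2 / 2 / N)"
    define v where "v = expectation (\<lambda>x. (A L x)^2)"
    define P where "P = expectation (\<lambda>x. psi (A L x))"
    define f where "f = char (distr M borel (A L)) t"
    have ip: "integrable M (\<lambda>x. psi (A L x))" using L by (intro cchain_psi_integrable[OF c]) auto
    have "0 \<le> varb r" using varc_pos[OF r] by (simp add: varb_def)
    have b0: "\<bar>1 - N * v\<bar> \<le> N * (varb r * b)"
    proof -
      have "\<bar>1 - N * v\<bar> \<le> (N - 1) * (varb r * b)"
        unfolding N_def v_def using L by (intro cchain_var_scaled[OF c r k1]) auto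
      also have "\<dots> \<le> N * (varb r * b)" using \<open>0 \<le> varb r\<close> k by (intro mult_right_mono) auto
      finally show ?thesis .
    qed
    have Nv: "N * v \<le> 2" using b0 Lk by (simp add: N_def abs_le_iff)
    have v0: "0 \<le> v" by (simp add: v_def)
    have "cmod (f - (1 - t^2 * v / 2)) \<le> (t^2 / 6) * expectation (\<lambda>x. min (6 * (A L x)^2) (\<bar>t\<bar> * \<bar>A L x\<bar> ^ 3))"
      unfolding f_def by (rule char_approx3'[OF mA mean(1) sq mean(2)]) (simp_all add: v_def mean)
    also have "\<dots> \<le> (t^2 / 6) * (d * v + C1 * P)"
    proof (rule mult_left_mono)
      have "expectation (\<lambda>x. min (6 * (A L x)^2) (\<bar>t\<bar> * \<bar>A L x\<bar> ^ 3)) \<le> expectation (\<lambda>x. d * (A L x)^2 + C1 * psi (A L x))"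
      proof (rule integral_mono)
        show "integrable M (\<lambda>x. min (6 * (A L x)^2) (\<bar>t\<bar> * \<bar>A L x\<bar> ^ 3))"
        proof (rule Bochner_Integration.integrable_bound)
          show "integrable M (\<lambda>x. 6 * (A L x)^2)" using sq by simp
        qed (use mA in auto)
      qed (use sq ip C1 in auto)
      also have "\<dots> = d * v + C1 * P" using sq ip by (simp add: v_def P_def)
      finally show "expectation (\<lambda>x. min (6 * (A L x)^2) (\<bar>t\<bar> * \<bar>A L x\<bar> ^ 3)) \<le> d * v + C1 * P" .
    qed simp
    finally have c1: "N * cmod (f - (1 - t^2 * v / 2)) \<le> N * ((t^2 / 6) * (d * v + C1 * P))"
      using N by (intro mult_left_mono) auto
    have "N * P \<le> N * (C2 * (\<theta> ^ L + R ^ (J - L) * (e + b powr q)))"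
      unfolding P_def using L N by (intro mult_left_mono C2(2)[OF c]) auto
    also have "\<dots> = C2 * ((2 * \<theta>) ^ L + N * R ^ (J - L) * (e + b powr q))"
      by (simp add: N_def power_mult_distrib algebra_simps)
    also have "\<dots> \<le> C2 * (?q)"
    proof -
      \<comment> \<open>The number 2^L of copies is absorbed because 2 < R.\<close>
      have "N * R ^ (J - L) \<le> R ^ L * R ^ (J - L)" unfolding N_def using R by (intro mult_right_mono power_mono) auto
      also have "\<dots> = R ^ J" using L by (simp flip: power_add)
      finally show ?thesis using C2 k by (intro mult_left_mono add_left_mono mult_right_mono) auto
    qed
    finally have NP: "N * P \<le> C2 * (?q)" .
    have "N * ((t^2 / 6) * (d * v + C1 * P)) = t^2 / 6 * (d * (N * v) + C1 * (N * P))" by (simp add: algebra_simps)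
    also have "\<dots> \<le> t^2 / 6 * (d * 2 + C1 * (C2 * (?q)))"
      using d C1 Nv NP by (intro mult_left_mono add_mono) auto
    finally have c2': "N * ((t^2 / 6) * (d * v + C1 * P)) \<le> t^2 / 6 * (d * 2 + C1 * (C2 * (?q)))" .
    have c2: "N * cmod (f - (1 - t^2 * v / 2)) \<le> t^2 / 6 * (2 * d + C1 * C2 * (?q))"
      using order_trans[OF c1 c2'] by (simp only: mult.assoc mult.commute[of d 2])
    have "complex_of_real (1 - t^2 * v / 2) - ?z = complex_of_real (t^2 / 2 / N * (1 - N * v))"
      unfolding of_real_diff[symmetric] using N by (simp add: field_simps)
    then have "N * cmod (complex_of_real (1 - t^2 * v / 2) - ?z) = N * (t^2 / 2 / N * \<bar>1 - N * v\<bar>)"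
      using N by (simp only: norm_of_real abs_mult) simp
    also have "\<dots> = t^2 / 2 * \<bar>1 - N * v\<bar>" using N by simp
    also have "\<dots> \<le> t^2 / 2 * (N * (varb r * b))" using b0 by (intro mult_left_mono) auto
    finally have c3: "N * cmod (complex_of_real (1 - t^2 * v / 2) - ?z) \<le> t^2 / 2 * (N * (varb r * b))" .
    have "cmod (f ^ 2 ^ L - ?z ^ 2 ^ L) \<le> real (2 ^ L) * cmod (f - ?z)"
    proof (rule norm_power_diff)
      show "cmod f \<le> 1" unfolding f_def by (intro real_distribution.cmod_char_le_1 real_distribution_distr mA)
      have "t^2 \<le> 2 * 2 ^ L" using tL zero_le_power2[of t] by linarith
      then have "t^2 / 2 / N \<le> 1" using N by (simp add: N_def field_simps)
      moreover have "0 \<le> t^2 / 2 / N" using N by simp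
      ultimately show "cmod (?z) \<le> 1" unfolding norm_of_real by (simp only: abs_le_iff) simp
    qed
    also have "\<dots> \<le> N * (cmod (f - complex_of_real (1 - t^2 * v / 2)) + cmod (complex_of_real (1 - t^2 * v / 2) - ?z))"
      unfolding N_def of_nat_power of_nat_numeral
      by (rule mult_left_mono[OF norm_diff_triangle_le[OF order_refl order_refl]]) simp
    finally have d2: "cmod (f ^ 2 ^ L - ?z ^ 2 ^ L) \<le>
       t\<^sup>2 / 6 * (2 * d + C1 * C2 * (?q)) + t^2 / 2 * (N * (varb r * b))"
      using c2 c3 by (simp add: distrib_left)
    have "cmod (?c - f ^ 2 ^ L) \<le> (N - 1) * (\<bar>t\<bar> * b)"
      unfolding f_def N_def using L by (intro cchain_char[OF c]) auto
    also have "\<dots> \<le> N * (\<bar>t\<bar> * b)" using k by (intro mult_right_mono) auto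
    finally have d1: "cmod (?c - f ^ 2 ^ L) \<le> N * (\<bar>t\<bar> * b)" .
    have "cmod (?c - ?z ^ 2 ^ L)
       \<le> cmod (?c - f ^ 2 ^ L) + cmod (f ^ 2 ^ L - ?z ^ 2 ^ L)"
      by (rule norm_diff_triangle_le[OF order_refl order_refl])
    then have "cmod (?c - ?z ^ 2 ^ L)
       \<le> N * (\<bar>t\<bar> * b) + (t^2 / 6 * (2 * d + C1 * C2 * (?q)) + t^2 / 2 * (N * (varb r * b)))"
      using d1 d2 by linarith
    then show "cmod (?c - (1 - t^2 / 2 / 2 ^ L) ^ 2 ^ L)
      \<le> 2 ^ L * (\<bar>t\<bar> + t^2 / 2 * varb r) * b + t^2 / 6 * (2 * d + C1 * C2 * (?q))"
      by (simp add: N_def algebra_simps)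
  qed (use C1 C2 in simp)
qed

text \<open>L and \<delta> are fixed before the chain is given, so that chains on any space and of
  any length beyond L are covered at once.\<close>

lemma cchain_clt:
  assumes R: "2 < R" "R < 2 powr (p / 2)" and e: "0 < e"
  shows "\<exists>L \<delta>. 0 < \<delta> \<and> (\<forall>(M :: 'a measure) b \<eta> J A B E. cchain M b \<eta> J A B E \<longrightarrow> L < J \<longrightarrow> b \<le> \<delta> \<longrightarrow>
    R ^ J * (\<eta> + b powr q) \<le> \<delta> \<longrightarrow> cmod (char (distr M borel (A 0)) t - exp (- (t^2 / 2))) \<le> e)"
proof -
  \<comment> \<open>The rate r < 2 of the variances must still satisfy R < r^(p/2); continuity at 2
    provides such an r.\<close>
  have "((\<lambda>r::real. r powr (p / 2)) \<longlongrightarrow> 2 powr (p / 2)) (at_left 2)"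
    by (intro tendsto_intros) auto
  then have "\<forall>\<^sub>F r in at_left 2. R < r powr (p / 2)" using R by (intro order_tendstoD(1))
  moreover have "\<forall>\<^sub>F r in at_left (2::real). r \<in> {1<..<2}" by (rule eventually_at_left_real) simp
  ultimately have "\<forall>\<^sub>F r in at_left 2. R < r powr (p / 2) \<and> r \<in> {1<..<2}" by (rule eventually_conj)
  then obtain r where r: "1 < r" "r < 2" "R < r powr (p / 2)"
    using eventually_happens[of _ "at_left (2::real)"] by (auto simp: trivial_limit_at_left_real)
  define \<theta> where "\<theta> = 1 / r powr (p / 2)"
  have \<theta>: "0 < \<theta>" "2 * \<theta> < 1" using r R by (auto simp: \<theta>_def field_simps)
  \<comment> \<open>With this d the quadratic term left by the truncation contributes at most e /
    3.\<close>
  define d where "d = e / (t^2 + 1)"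
  have d: "0 < d" using e by (simp add: d_def add_nonneg_pos)
  have td: "t^2 / 6 * (2 * d) \<le> e / 3"
  proof -
    have "t^2 * d \<le> (t^2 + 1) * d" using d by (intro mult_right_mono) auto
    also have "\<dots> = e" unfolding d_def using zero_le_power2[of t] by (simp add: field_simps add_nonneg_eq_0_iff)
    finally show ?thesis by (simp add: mult.commute)
  qed
  obtain C where C: "C > 0" and bound: "\<And>(M :: 'a measure) b \<eta> J A B E L. cchain M b \<eta> J A B E \<Longrightarrow> L < J \<Longrightarrow> b \<le> 1 \<Longrightarrow>
    t\<^sup>2 \<le> 2 ^ L \<Longrightarrow> 2 ^ L * (varb r * b) \<le> 1 \<Longrightarrow>
    cmod (char (distr M borel (A 0)) t - (1 - t^2 / 2 / 2 ^ L) ^ 2 ^ L)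
      \<le> 2 ^ L * (\<bar>t\<bar> + t^2 / 2 * varb r) * b + t^2 / 6 * (2 * d + C * ((2 * \<theta>) ^ L + R ^ J * (\<eta> + b powr q)))"
    using cchain_char_bound[OF r(1,2) R(1) r(3) d, of t] unfolding \<theta>_def by blast
  have "(\<lambda>n. (1 + (- (t^2 / 2)) / real (2 ^ n)) ^ (2 ^ n)) \<longlonglongrightarrow> exp (- (t^2 / 2))"
    by (rule LIMSEQ_subseq_LIMSEQ[OF tendsto_exp_limit_sequentially, of "\<lambda>n. 2 ^ n", unfolded comp_def])
      (simp add: strict_mono_def)
  then have "\<forall>\<^sub>F L in sequentially. dist ((1 + (- (t^2 / 2)) / real (2 ^ L)) ^ (2 ^ L)) (exp (- (t^2 / 2))) < e / 6"
    by (rule tendstoD) (use e in simp)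
  moreover have "(\<lambda>L. t^2 / 6 * (C * (2 * \<theta>) ^ L)) \<longlonglongrightarrow> t\<^sup>2 / 6 * (C * 0)"
    by (intro tendsto_intros LIMSEQ_power_zero) (use \<theta> in auto)
  then have "\<forall>\<^sub>F L in sequentially. t^2 / 6 * (C * (2 * \<theta>) ^ L) < e / 6"
    by (rule order_tendstoD(2)) (use e in simp)
  moreover have "\<forall>\<^sub>F L in sequentially. t^2 \<le> 2 ^ L"
  proof -
    obtain n0 where n0: "t^2 < 2 ^ n0" using real_arch_pow[of 2 "t^2"] by auto
    show ?thesis
    proof (rule eventually_sequentiallyI)
      fix L assume "n0 \<le> L"
      then have "(2::real) ^ n0 \<le> 2 ^ L" by (intro power_increasing) auto
      then show "t^2 \<le> 2 ^ L" using n0 by linarith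
    qed
  qed
  ultimately have "\<forall>\<^sub>F L in sequentially. dist ((1 + (- (t^2 / 2)) / real (2 ^ L)) ^ (2 ^ L)) (exp (- (t^2 / 2))) < e / 6 \<and>
     t\<^sup>2 / 6 * (C * (2 * \<theta>) ^ L) < e / 6 \<and> t^2 \<le> 2 ^ L" by eventually_elim simp
  then obtain L where L: "dist ((1 + (- (t^2 / 2)) / real (2 ^ L)) ^ (2 ^ L)) (exp (- (t^2 / 2))) < e / 6"
     "t^2 / 6 * (C * (2 * \<theta>) ^ L) < e / 6" "t^2 \<le> 2 ^ L"
    using eventually_happens[of _ sequentially] by auto
  define N where "N = (2::real) ^ L"
  have N: "N \<ge> 1" by (simp add: N_def)
  \<comment> \<open>Collects the coefficients that multiply b or R^J (\<eta> + b^q), so that one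
    \<delta> makes all these contributions small.\<close>
  define a where "a = N * (\<bar>t\<bar> + t^2 / 2 * varb r) + t^2 / 6 * C + N * varb r + 1"
  have vb: "0 \<le> varb r" using varc_pos[OF r(1,2)] by (simp add: varb_def)
  have a: "a \<ge> 1" "N * varb r \<le> a" "N * (\<bar>t\<bar> + t^2 / 2 * varb r) + t^2 / 6 * C \<le> a"
    using vb C N by (auto simp: a_def intro!: add_nonneg_nonneg mult_nonneg_nonneg)
  define \<delta> where "\<delta> = min 1 (e / 6) / a"
  have \<delta>: "0 < \<delta>" "\<delta> \<le> 1" "a * \<delta> \<le> 1" "a * \<delta> \<le> e / 6"
    using e a by (auto simp: \<delta>_def divide_le_eq)
  show ?thesis
  proof (intro exI[of _ L] exI[of _ \<delta>] conjI allI impI)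
    fix M :: "'a measure" and b \<eta> J A B E
    assume c: "cchain M b \<eta> J A B E" and LJ: "L < J" and k: "b \<le> \<delta>" and h: "R ^ J * (\<eta> + b powr q) \<le> \<delta>"
    have k0: "0 \<le> b" using c by (simp add: cchain_def)
    have "(N * varb r) * b \<le> a * \<delta>" using a k k0 by (intro mult_mono) auto
    then have k1: "2 ^ L * (varb r * b) \<le> 1" using \<delta> by (simp add: N_def)
    have "cmod (char (distr M borel (A 0)) t - (1 - t^2 / 2 / 2 ^ L) ^ 2 ^ L)
      \<le> N * (\<bar>t\<bar> + t^2 / 2 * varb r) * b + t^2 / 6 * (2 * d + C * ((2 * \<theta>) ^ L + R ^ J * (\<eta> + b powr q)))"
      unfolding N_def using k \<delta> by (intro bound[OF c LJ _ L(3) k1]) auto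
    also have "\<dots> = N * (\<bar>t\<bar> + t^2 / 2 * varb r) * b + t^2 / 6 * C * (R ^ J * (\<eta> + b powr q)) + t^2 / 6 * (2 * d) + t^2 / 6 * (C * (2 * \<theta>) ^ L)"
      by (simp add: algebra_simps)
    also have "\<dots> \<le> N * (\<bar>t\<bar> + t^2 / 2 * varb r) * \<delta> + t^2 / 6 * C * \<delta> + e / 3 + e / 6"
      using k h N vb C L(2) td by (intro add_mono mult_left_mono) auto
    also have "\<dots> = (N * (\<bar>t\<bar> + t^2 / 2 * varb r) + t^2 / 6 * C) * \<delta> + e / 3 + e / 6" by (simp add: algebra_simps)
    also have "\<dots> \<le> a * \<delta> + e / 3 + e / 6" using a \<delta> by (intro add_mono mult_right_mono) auto
    also have "\<dots> \<le> e / 6 + e / 3 + e / 6" using \<delta> by simp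
    finally have 1: "cmod (char (distr M borel (A 0)) t - (1 - t^2 / 2 / 2 ^ L) ^ 2 ^ L) \<le> 2 * e / 3" by simp
    have 2: "cmod (complex_of_real ((1 - t^2 / 2 / 2 ^ L) ^ 2 ^ L) - complex_of_real (exp (- (t^2 / 2)))) \<le> e / 6"
      unfolding of_real_diff[symmetric] norm_of_real using L(1) by (simp add: dist_real_def)
    have "cmod (char (distr M borel (A 0)) t - exp (- (t^2 / 2))) \<le> 2 * e / 3 + e / 6"
      by (rule norm_diff_triangle_le[OF 1 2])
    then show "cmod (char (distr M borel (A 0)) t - exp (- (t^2 / 2))) \<le> e" using e by simp
  qed (rule \<delta>)
qed

end

section \<open>Errors with p moments and unnormalized chains\<close>

text \<open>H is a number of edges up to a constant. The multiple C * H contains the mean of a sum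
  of that many weights, and the excess over it has the p-th moment that
  \<open>sum_tail_moment\<close> yields. The integral is one of extended nonnegative functions, so
  that integrability comes out as a consequence.\<close>

definition small_tail :: "'a measure \<Rightarrow> real \<Rightarrow> real \<Rightarrow> real \<Rightarrow> ('a \<Rightarrow> real) \<Rightarrow> bool" where
  "small_tail M p C H D \<longleftrightarrow> D \<in> borel_measurable M \<and> (AE x in M. 0 \<le> D x) \<and>
     (\<integral>\<^sup>+x. ennreal (max 0 (D x - C * H) powr p) \<partial>M) \<le> ennreal (C * H powr (p - 1))"

lemma small_tail_tail:
  assumes "small_tail M p C H D" "0 < C"
  shows "integrable M (\<lambda>x. max 0 (D x - C * H) powr p)"
    "(\<integral>x. max 0 (D x - C * H) powr p \<partial>M) \<le> C * H powr (p - 1)"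
proof -
  have [measurable]: "D \<in> borel_measurable M" using assms by (simp add: small_tail_def)
  have n: "(\<integral>\<^sup>+x. ennreal (max 0 (D x - C * H) powr p) \<partial>M) \<le> ennreal (C * H powr (p - 1))"
    using assms by (simp add: small_tail_def)
  show i: "integrable M (\<lambda>x. max 0 (D x - C * H) powr p)"
  proof (rule integrableI_nonneg)
    show "(\<integral>\<^sup>+x. ennreal (max 0 (D x - C * H) powr p) \<partial>M) < \<infinity>"
      using n by (rule order_le_less_trans) simp
  qed auto
  then have "ennreal (\<integral>x. max 0 (D x - C * H) powr p \<partial>M) \<le> ennreal (C * H powr (p - 1))"
    using n by (subst (asm) nn_integral_eq_integral) auto
  then show "(\<integral>x. max 0 (D x - C * H) powr p \<partial>M) \<le> C * H powr (p - 1)"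
    using assms by (subst (asm) ennreal_le_iff) auto
qed

definition sqc :: "real \<Rightarrow> real" where "sqc C = 2 * C^2 + 2 + 2 * C"

text \<open>Interpolation: an excess Z satisfies Z^2 \<le> H^2 + Z^p H^(2-p), and the mean of the
  last term is at most C * H. The three summands of \<open>sqc\<close> belong to C * H, to H^2 and
  to this mean.\<close>

lemma (in prob_space) small_tail_square:
  assumes st: "small_tail M p C H D" and C: "0 < C" and H: "1 \<le> H" and p: "2 < p"
  shows "integrable M (\<lambda>x. (D x)^2)" "expectation (\<lambda>x. (D x)^2) \<le> sqc C * H^2"
proof -
  have [measurable]: "D \<in> borel_measurable M" using st by (simp add: small_tail_def)
  note t = small_tail_tail[OF st C]
  define Z where "Z x = max 0 (D x - C * H)" for x
  have [measurable]: "Z \<in> borel_measurable M" by (simp add: Z_def[abs_def])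
  have Z: "AE x in M. (D x)^2 \<le> 2 * C^2 * H^2 + 2 * (H^2 + Z x powr p * H powr (2 - p))"
  proof -
    have "AE x in M. 0 \<le> D x" using st by (simp add: small_tail_def)
    then show ?thesis
    proof eventually_elim
      case (elim x)
      have Z0: "0 \<le> Z x" by (simp add: Z_def)
      have "D x \<le> C * H + Z x" by (simp add: Z_def)
      then have "(D x)^2 \<le> (C * H + Z x)^2" using elim by (intro power_mono) auto
      also have "\<dots> \<le> 2 * (C * H)^2 + 2 * (Z x)^2"
        using sum_squares_bound[of "C * H" "Z x"] by (simp add: power2_sum)
      also have "(Z x)^2 \<le> H^2 + Z x powr p * H powr (2 - p)"
      proof (cases "Z x \<le> H")
        case True
        then have "(Z x)^2 \<le> H^2" using Z0 by (intro power_mono) auto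
        then show ?thesis by (simp add: add_increasing2)
      next
        case False
        have "(Z x)^2 = Z x powr 2" using False H by (simp add: powr_numeral)
        also have "\<dots> = Z x powr p * Z x powr (2 - p)" by (simp flip: powr_add)
        also have "\<dots> \<le> Z x powr p * H powr (2 - p)"
          using False H p by (intro mult_left_mono powr_mono2') auto
        finally show ?thesis by (simp add: add_increasing)
      qed
      finally show ?case by (simp add: power_mult_distrib)
    qed
  qed
  have i: "integrable M (\<lambda>x. 2 * C^2 * H^2 + 2 * (H^2 + Z x powr p * H powr (2 - p)))"
    using t(1) unfolding Z_def by auto
  show sq: "integrable M (\<lambda>x. (D x)^2)"
    by (rule Bochner_Integration.integrable_bound[OF i]) (use Z in \<open>auto elim!: eventually_mono\<close>)
  have "expectation (\<lambda>x. (D x)^2) \<le> expectation (\<lambda>x. 2 * C^2 * H^2 + 2 * (H^2 + Z x powr p * H powr (2 - p)))"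
    by (rule integral_mono_AE[OF sq i Z])
  also have "\<dots> = 2 * C^2 * H^2 + 2 * (H^2 + expectation (\<lambda>x. Z x powr p) * H powr (2 - p))"
    using t(1) unfolding Z_def by (simp add: prob_space)
  also have "\<dots> \<le> 2 * C^2 * H^2 + 2 * (H^2 + (C * H powr (p - 1)) * H powr (2 - p))"
    using t(2) unfolding Z_def by (intro add_left_mono mult_left_mono mult_right_mono) auto
  also have "(C * H powr (p - 1)) * H powr (2 - p) = C * H"
    using H by (simp add: mult.assoc flip: powr_add)
  also have "2 * C^2 * H^2 + 2 * (H^2 + C * H) \<le> sqc C * H^2"
  proof -
    have "C * H \<le> C * H^2" using C H by (intro mult_left_mono) (auto simp: power2_eq_square)
    then show ?thesis by (simp add: sqc_def algebra_simps)
  qed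
  finally show "expectation (\<lambda>x. (D x)^2) \<le> sqc C * H^2" .
qed

text \<open>The bounded part, C * H together with the mean of D, which is O(H), is measured with the
  power q, and the excess with the power p. These are the two error terms whose product with R^J has
  to vanish.\<close>

lemma (in young_pq) small_tail_psi:
  assumes C: "0 < C"
  shows "\<exists>K>0. \<forall>(M :: 'a measure) H s D. prob_space M \<longrightarrow> 1 \<le> H \<longrightarrow> 0 < s \<longrightarrow> small_tail M p C H D \<longrightarrow>
    integrable M (\<lambda>x. psi ((D x - (\<integral>y. D y \<partial>M)) / s)) \<and>
    (\<integral>x. psi ((D x - (\<integral>y. D y \<partial>M)) / s) \<partial>M) \<le> K * ((H / s) powr q + H powr (p - 1) / s powr p)"
proof -
  define c where "c = C + sqrt (sqc C)"
  have c: "0 < c" using C by (simp add: c_def sqc_def add_pos_nonneg)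
  obtain C2 where C2: "C2 > 0" "\<And>z b. \<bar>z\<bar> \<le> 1 * \<bar>b\<bar> \<Longrightarrow> psi z \<le> C2 * psi b"
    using psi_dominated[of 1] by auto
  obtain C3 where C3: "C3 > 0" "\<And>a b. psi (a + b) \<le> (1 + 1) * psi a + C3 * psi b"
    using almost_subadditive[of 1] by auto
  define K where "K = C2 * (2 * c powr q) + C2 * C3 * C"
  have K: "K > 0" "C2 * (2 * c powr q) \<le> K" "C2 * C3 * C \<le> K" using C C2 C3 c by (auto simp: K_def add_pos_pos)
  show ?thesis
  proof (intro exI[of _ K] conjI allI impI)
    fix M :: "'a measure" and H s :: real and D :: "'a \<Rightarrow> real"
    assume "prob_space M" and H: "1 \<le> H" and s: "0 < s" and st: "small_tail M p C H D"
    interpret prob_space M by fact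
    have [measurable]: "D \<in> borel_measurable M" using st by (simp add: small_tail_def)
    note t = small_tail_tail[OF st C]
    note sq = small_tail_square[OF st C H p_gt2]
    define m where "m = expectation D"
    define Z where "Z x = max 0 (D x - C * H)" for x
    have "\<bar>m\<bar> \<le> expectation (\<lambda>x. \<bar>D x\<bar>)" unfolding m_def by (rule integral_abs_bound)
    also have "\<dots> \<le> sqrt (expectation (\<lambda>x. (D x)^2))" by (rule expectation_abs_le(2)[OF _ sq(1)]) simp
    also have "\<dots> \<le> sqrt (sqc C * H^2)" using sq(2) by (rule real_sqrt_le_mono)
    also have "\<dots> = sqrt (sqc C) * H" using H by (simp add: real_sqrt_mult)
    finally have m: "\<bar>m\<bar> \<le> sqrt (sqc C) * H" .
    have ae: "AE x in M. psi ((D x - m) / s) \<le> C2 * (2 * (c * (H / s)) powr q) + C2 * C3 * (Z x powr p / s powr p)"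
    proof -
      have "AE x in M. 0 \<le> D x" using st by (simp add: small_tail_def)
      then show ?thesis
      proof eventually_elim
        case (elim x)
        have Z0: "0 \<le> Z x" by (simp add: Z_def)
        have "\<bar>D x - m\<bar> \<le> D x + \<bar>m\<bar>" using elim by linarith
        also have "\<dots> \<le> C * H + Z x + sqrt (sqc C) * H" using m by (simp add: Z_def)
        also have "\<dots> = c * H + Z x" by (simp add: c_def algebra_simps)
        finally have "\<bar>D x - m\<bar> / s \<le> (c * H + Z x) / s" using s by (intro divide_right_mono) auto
        then have "\<bar>(D x - m) / s\<bar> \<le> 1 * \<bar>c * (H / s) + Z x / s\<bar>"
          using s c H Z0 by (simp add: abs_div add_divide_distrib)
        then have "psi ((D x - m) / s) \<le> C2 * psi (c * (H / s) + Z x / s)" by (rule C2)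
        also have "\<dots> \<le> C2 * ((1 + 1) * psi (c * (H / s)) + C3 * psi (Z x / s))" using C2 C3 by (intro mult_left_mono) auto
        also have "\<dots> \<le> C2 * ((1 + 1) * \<bar>c * (H / s)\<bar> powr q + C3 * \<bar>Z x / s\<bar> powr p)"
          using C2 C3 by (intro mult_left_mono add_mono psi_le_q psi_le_p) auto
        also have "\<dots> = C2 * (2 * (c * (H / s)) powr q) + C2 * C3 * (Z x powr p / s powr p)"
          using s c H Z0 by (simp add: powr_divide abs_mult algebra_simps)
        finally show ?case .
      qed
    qed
    have i: "integrable M (\<lambda>x. C2 * (2 * (c * (H / s)) powr q) + C2 * C3 * (Z x powr p / s powr p))"
      using t(1) unfolding Z_def by auto
    show ip: "integrable M (\<lambda>x. psi ((D x - m) / s))"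
      by (rule Bochner_Integration.integrable_bound[OF i]) (use ae psi_nonneg in \<open>auto elim!: eventually_mono\<close>)
    have "expectation (\<lambda>x. psi ((D x - m) / s)) \<le> expectation (\<lambda>x. C2 * (2 * (c * (H / s)) powr q) + C2 * C3 * (Z x powr p / s powr p))"
      by (rule integral_mono_AE[OF ip i ae])
    also have "\<dots> = C2 * (2 * (c * (H / s)) powr q) + C2 * C3 * (expectation (\<lambda>x. Z x powr p) / s powr p)"
      using t(1) unfolding Z_def by (simp add: prob_space)
    also have "\<dots> \<le> C2 * (2 * (c * (H / s)) powr q) + C2 * C3 * (C * H powr (p - 1) / s powr p)"
      using t(2) C2 C3 s unfolding Z_def by (intro add_left_mono mult_left_mono divide_right_mono) auto
    also have "\<dots> = (C2 * (2 * c powr q)) * (H / s) powr q + (C2 * C3 * C) * (H powr (p - 1) / s powr p)"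
    proof -
      have "(c * (H / s)) powr q = c powr q * (H / s) powr q" by (rule powr_mult)
      then show ?thesis by (simp only: mult.assoc times_divide_eq_right)
    qed
    also have "\<dots> \<le> K * (H / s) powr q + K * (H powr (p - 1) / s powr p)"
      using K by (intro add_mono mult_right_mono) auto
    finally show "expectation (\<lambda>x. psi ((D x - m) / s)) \<le> K * ((H / s) powr q + H powr (p - 1) / s powr p)"
      by (simp add: distrib_left)
  qed (rule K)
qed

text \<open>The unnormalized form of a chain, in which passage times appear. The mean of
  \<open>X j\<close> is twice that of \<open>X (Suc j)\<close> plus that of \<open>D j\<close>, so
  centring every term preserves the additive relation and leads to \<open>cchain\<close>.\<close>

definition merge_chain :: "'a measure \<Rightarrow> real \<Rightarrow> real \<Rightarrow> real \<Rightarrow> nat \<Rightarrow> (nat \<Rightarrow> 'a \<Rightarrow> real) \<Rightarrow> (nat \<Rightarrow> 'a \<Rightarrow> real)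
    \<Rightarrow> (nat \<Rightarrow> 'a \<Rightarrow> real) \<Rightarrow> bool" where
  "merge_chain M p C H J X Y D \<longleftrightarrow>
     (\<forall>j<J. prob_space.indep_var M borel (X (Suc j)) borel (Y j) \<and>
        distr M borel (Y j) = distr M borel (X (Suc j)) \<and> X j \<in> borel_measurable M \<and>
        (AE x in M. X j x = X (Suc j) x + Y j x + D j x) \<and> small_tail M p C H (D j)) \<and>
     small_tail M p C H (X J)"

context prob_space
begin

lemma merge_chain_square:
  assumes c: "merge_chain M p C H J X Y D" and C: "0 < C" and H: "1 \<le> H" and p: "2 < p" and "j \<le> J"
  shows "X j \<in> borel_measurable M \<and> integrable M (\<lambda>x. (X j x)^2)"
  using \<open>j \<le> J\<close>
proof (induction rule: inc_induct)
  case base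
  have "small_tail M p C H (X J)" using c by (simp add: merge_chain_def)
  then show ?case using small_tail_square(1)[OF _ C H p] by (auto simp: small_tail_def)
next
  case (step n)
  have i: "indep_var borel (X (Suc n)) borel (Y n)" and d: "distr M borel (Y n) = distr M borel (X (Suc n))"
    and mX: "X n \<in> borel_measurable M" and ae: "AE x in M. X n x = X (Suc n) x + Y n x + D n x" and st: "small_tail M p C H (D n)"
    using c step by (auto simp: merge_chain_def)
  have mY: "Y n \<in> borel_measurable M" using indep_var_rv2[OF i] by simp
  have mD: "D n \<in> borel_measurable M" using st by (simp add: small_tail_def)
  have sqY: "integrable M (\<lambda>x. (Y n x)^2)"
    using integral_eq_of_distr_eq(2)[OF d mY, of "\<lambda>x. x^2"] step by simp
  have "integrable M (\<lambda>x. (X (Suc n) x + Y n x + D n x)^2)"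
    using step mY mD sqY small_tail_square(1)[OF st C H p] by (intro integrable_add_square) auto
  moreover have "AE x in M. (X n x)^2 = (X (Suc n) x + Y n x + D n x)^2" using ae by eventually_elim simp
  ultimately have "integrable M (\<lambda>x. (X n x)^2)"
    using step mX mY mD by (subst integrable_cong_AE) auto
  then show ?case using mX by simp
qed

lemma variance_le_square:
  fixes X :: "'a \<Rightarrow> real"
  assumes "integrable M X" "integrable M (\<lambda>x. (X x)^2)"
  shows "variance X \<le> expectation (\<lambda>x. (X x)^2)"
  by (subst variance_eq[OF assms]) simp

lemma integrable_centered_square:
  fixes X :: "'a \<Rightarrow> real"
  assumes "X \<in> borel_measurable M" "integrable M (\<lambda>x. (X x)^2)"
  shows "integrable M (\<lambda>x. (X x - c)^2)"
  using integrable_add_square[of X M "\<lambda>_. - c"] assms by simp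

end

abbreviation sdev :: "'a measure \<Rightarrow> ('a \<Rightarrow> real) \<Rightarrow> real" where
  "sdev M X \<equiv> sqrt (\<integral>x. (X x - (\<integral>x. X x \<partial>M))^2 \<partial>M)"

lemma (in young_pq) merge_chain_cchain:
  assumes C: "0 < C"
  shows "\<exists>K>0. \<forall>(M :: 'a measure) H J X Y D. prob_space M \<longrightarrow> 1 \<le> H \<longrightarrow> merge_chain M p C H J X Y D \<longrightarrow>
    (let s = sdev M (X 0) in 0 < s \<longrightarrow>
      cchain M (sqrt (sqc C) * (H / s)) (K * ((H / s) powr q + H powr (p - 1) / s powr p)) J
        (\<lambda>j x. (X j x - (\<integral>y. X j y \<partial>M)) / s) (\<lambda>j x. (Y j x - (\<integral>y. X (Suc j) y \<partial>M)) / s) (\<lambda>j x. (D j x - (\<integral>y. D j y \<partial>M)) / s))"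
proof -
  obtain K where K: "K > 0" and psi: "\<And>(M :: 'a measure) H s D. prob_space M \<Longrightarrow> 1 \<le> H \<Longrightarrow> 0 < s \<Longrightarrow> small_tail M p C H D \<Longrightarrow>
    integrable M (\<lambda>x. psi ((D x - (\<integral>y. D y \<partial>M)) / s)) \<and>
    (\<integral>x. psi ((D x - (\<integral>y. D y \<partial>M)) / s) \<partial>M) \<le> K * ((H / s) powr q + H powr (p - 1) / s powr p)"
    using small_tail_psi[OF C] by blast
  show ?thesis unfolding Let_def
  proof (intro exI[of _ K] conjI allI impI)
    fix M :: "'a measure" and H :: real and J X Y D
    assume ps: "prob_space M" and H: "1 \<le> H" and c: "merge_chain M p C H J X Y D"
    interpret prob_space M by fact
    define s where "s = sqrt (variance (X 0))"
    assume "0 < sqrt (variance (X 0))"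
    then have s: "0 < s" by (simp add: s_def)
    define b where "b = sqrt (sqc C) * (H / s)"
    have sq0: "0 \<le> sqc C" using C by (simp add: sqc_def)
    have k: "0 \<le> b" using sq0 H s by (simp add: b_def)
    note msq = merge_chain_square[OF c C H p_gt2]
    have iX: "integrable M (X j)" if "j \<le> J" for j using expectation_abs_le(1) msq[OF that] by blast
    let ?A = "\<lambda>j x. (X j x - expectation (X j)) / s"
    have "cchain M b (K * ((H / s) powr q + H powr (p - 1) / s powr p)) J ?A
       (\<lambda>j x. (Y j x - expectation (X (Suc j))) / s) (\<lambda>j x. (D j x - expectation (D j)) / s)"
      unfolding cchain_def
    proof (intro conjI allI impI)
      fix j assume j: "j < J"
      have i: "indep_var borel (X (Suc j)) borel (Y j)" and d: "distr M borel (Y j) = distr M borel (X (Suc j))"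
        and mX: "X j \<in> borel_measurable M" and ae: "AE x in M. X j x = X (Suc j) x + Y j x + D j x" and st: "small_tail M p C H (D j)"
        using c j by (auto simp: merge_chain_def)
      have mXS: "X (Suc j) \<in> borel_measurable M" and sqXS: "integrable M (\<lambda>x. (X (Suc j) x)^2)" using msq[of "Suc j"] j by auto
      have mY: "Y j \<in> borel_measurable M" using indep_var_rv2[OF i] by simp
      have mD: "D j \<in> borel_measurable M" using st by (simp add: small_tail_def)
      note sqD = small_tail_square[OF st C H p_gt2]
      have iD: "integrable M (D j)" by (rule expectation_abs_le(1)[OF mD sqD(1)])
      have iXS: "integrable M (X (Suc j))" using iX[of "Suc j"] j by simp
      note dd = integral_eq_of_distr_eq[OF d mY mXS, of "\<lambda>x. x", simplified]
      have eX: "expectation (X j) = expectation (X (Suc j)) + expectation (X (Suc j)) + expectation (D j)"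
      proof -
        have "expectation (X j) = expectation (\<lambda>x. X (Suc j) x + Y j x + D j x)"
          using ae mX mXS mY mD by (intro integral_cong_AE) auto
        also have "\<dots> = expectation (X (Suc j)) + expectation (Y j) + expectation (D j)" using iXS dd iD by simp
        finally show ?thesis using dd by simp
      qed
      show "integrable M (\<lambda>x. psi ((D j x - expectation (D j)) / s))"
        and "expectation (\<lambda>x. psi ((D j x - expectation (D j)) / s)) \<le> K * ((H / s) powr q + H powr (p - 1) / s powr p)"
        using psi[OF ps H s st] by auto
      show "centered_merge M b (?A j) (?A (Suc j)) (\<lambda>x. (Y j x - expectation (X (Suc j))) / s) (\<lambda>x. (D j x - expectation (D j)) / s)"
        unfolding centered_merge_def
      proof (intro conjI)
        let ?f = "\<lambda>y. (y - expectation (X (Suc j))) / s"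
        have f: "?f \<in> borel_measurable borel" by measurable
        show "indep_var borel (?A (Suc j)) borel (\<lambda>x. ?f (Y j x))"
          using indep_var_compose[OF i f f] by (simp add: comp_def)
        have "distr M borel (\<lambda>x. ?f (Z x)) = distr (distr M borel Z) borel ?f" if "Z \<in> borel_measurable M" for Z
          using that f by (subst distr_distr) (auto simp: comp_def)
        then show "distr M borel (\<lambda>x. ?f (Y j x)) = distr M borel (?A (Suc j))" using mY mXS d by simp
        show "AE x in M. ?A j x = ?A (Suc j) x + ?f (Y j x) + (D j x - expectation (D j)) / s"
          using ae by eventually_elim (simp add: eX diff_divide_distrib add_divide_distrib)
        show "integrable M (\<lambda>x. (?A (Suc j) x)^2)" unfolding power_divide
          using integrable_centered_square[OF mXS sqXS] by simp
        show "expectation (?A (Suc j)) = 0" using iXS by (simp add: prob_space)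
        show "integrable M (\<lambda>x. ((D j x - expectation (D j)) / s)^2)" unfolding power_divide
          using integrable_centered_square[OF mD sqD(1)] by simp
        show "expectation (\<lambda>x. (D j x - expectation (D j)) / s) = 0" using iD by (simp add: prob_space)
        have "expectation (\<lambda>x. ((D j x - expectation (D j)) / s)^2) = variance (D j) / s^2"
          by (simp add: power_divide)
        also have "\<dots> \<le> (sqc C * H^2) / s^2"
          by (intro divide_right_mono order_trans[OF variance_le_square[OF iD sqD(1)] sqD(2)]) simp
        also have "\<dots> = b^2" using sq0 by (simp add: b_def power_mult_distrib power_divide)
        finally show "expectation (\<lambda>x. ((D j x - expectation (D j)) / s)^2) \<le> b^2" .
      qed (use mX mD in measurable)
    next
      have st: "small_tail M p C H (X J)" using c by (simp add: merge_chain_def)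
      show "integrable M (\<lambda>x. psi (?A J x))" "expectation (\<lambda>x. psi (?A J x)) \<le> K * ((H / s) powr q + H powr (p - 1) / s powr p)"
        using psi[OF ps H s st] by auto
      have "expectation (\<lambda>x. (?A 0 x)^2) = variance (X 0) / s^2" by (simp add: power_divide)
      also have "\<dots> = 1" using s by (simp add: s_def)
      finally show "expectation (\<lambda>x. (?A 0 x)^2) = 1" .
    qed (use ps k K in auto)
    then show "cchain M (sqrt (sqc C) * (H / sqrt (variance (X 0)))) (K * ((H / sqrt (variance (X 0))) powr q + H powr (p - 1) / sqrt (variance (X 0)) powr p)) J
        (\<lambda>j x. (X j x - (\<integral>y. X j y \<partial>M)) / sqrt (variance (X 0))) (\<lambda>j x. (Y j x - (\<integral>y. X (Suc j) y \<partial>M)) / sqrt (variance (X 0)))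
        (\<lambda>j x. (D j x - (\<integral>y. D j y \<partial>M)) / sqrt (variance (X 0)))"
      by (simp add: s_def b_def)
  qed (rule K)
qed

text \<open>Since p < q, the minimum is the power q - 2 on [0, 1] and the power p - 2 beyond; the
  larger exponent gives a doubling constant for both.\<close>

lemma young_pq_exists:
  fixes p q :: real
  assumes "2 < p" "p < q"
  obtains psi psi' where "young_pq (\<lambda>u. min (u powr (q - 2)) (u powr (p - 2))) psi psi' (2 powr (q - 2)) p q"
proof -
  define g where "g = (\<lambda>u::real. min (u powr (q - 2)) (u powr (p - 2)))"
  have 1: "0 \<le> g u" for u by (simp add: g_def)
  have 2: "g u \<le> g v" if "0 \<le> u" "u \<le> v" for u v
    unfolding g_def using assms that by (intro min.mono powr_mono2) auto
  have 3: "g (2 * u) \<le> 2 powr (q - 2) * g u" if "0 \<le> u" for u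
  proof -
    have "(2::real) powr (p - 2) * u powr (p - 2) \<le> 2 powr (q - 2) * u powr (p - 2)"
      using assms by (intro mult_right_mono powr_mono) auto
    then show ?thesis using that
      by (auto simp: g_def powr_mult min_mult_distrib_left[of "2 powr (q-2)"] intro: min.mono)
  qed
  have 4: "isCont (\<lambda>x. g \<bar>x\<bar>) x" for x
    unfolding g_def isCont_def using assms
    by (intro tendsto_min tendsto_powr' tendsto_intros) (auto intro!: always_eventually)
  obtain psi psi' where y: "young g psi psi' (2 powr (q - 2))"
    using young_exists[of g "2 powr (q - 2)"] 1 2 3 4 by auto
  have w: "u^2 * g u \<le> u powr p" "u^2 * g u \<le> u powr q" if "0 \<le> u" for u
  proof -
    have e: "u^2 * u powr (a - 2) = u powr a" if "2 < a" for a
    proof (cases "u = 0")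
      case False
      then have "u^2 = u powr 2" using \<open>0 \<le> u\<close> by (simp add: powr_numeral)
      then show ?thesis by (simp flip: powr_add)
    qed (use that in simp)
    have "u^2 * g u \<le> u^2 * u powr (p - 2)" "u^2 * g u \<le> u^2 * u powr (q - 2)"
      by (auto simp: g_def intro!: mult_left_mono)
    then show "u^2 * g u \<le> u powr p" "u^2 * g u \<le> u powr q" using e[of p] e[of q] assms by auto
  qed
  have "young_pq g psi psi' (2 powr (q - 2)) p q"
    using y assms w by (intro young_pq.intro young_pq_axioms.intro) (auto simp: g_def)
  then show ?thesis using that by (simp add: g_def)
qed

section \<open>Convergence in distribution\<close>

lemma satisfies_clt_char:
  assumes ps: "prob_space M" and m: "\<And>n. X n \<in> borel_measurable M"
  defines "Z \<equiv> (\<lambda>n x. (X n x - (\<integral>x. X n x \<partial>M)) / sqrt (\<integral>x. (X n x - (\<integral>x. X n x \<partial>M))^2 \<partial>M))"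
  shows "satisfies_clt M X \<longleftrightarrow> (\<forall>t. (\<lambda>n. char (distr M borel (Z n)) t) \<longlonglongrightarrow> exp (- (t^2 / 2)))"
proof -
  interpret prob_space M by fact
  have mZ: "Z n \<in> borel_measurable M" for n using m[of n] unfolding Z_def by measurable
  have rd: "real_distribution (distr M borel (Z n))" for n using mZ by simp
  have c: "char std_normal_distribution t = complex_of_real (exp (- (t^2 / 2)))" for t
    by (simp add: char_std_normal_distribution)
  show ?thesis
    unfolding satisfies_clt_def Z_def[symmetric]
    using levy_continuity[OF rd real_dist_normal_dist] levy_continuity1[OF rd real_dist_normal_dist] c
    by (auto simp: Z_def)
qed

text \<open>The limits express that the errors are small against the standard deviation and that R^J
  times either part of their \<open>psi\<close>-moment vanishes. The constants depend on the Young
  function and on C, hence serve all n.\<close>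

theorem dyadic_clt:
  fixes M :: "'a measure" and X Y D :: "nat \<Rightarrow> nat \<Rightarrow> 'a \<Rightarrow> real" and H :: "nat \<Rightarrow> real" and J :: "nat \<Rightarrow> nat"
  assumes ps: "prob_space M" and pq: "2 < p" "p < q" and C: "0 < C" and R: "2 < R" "R < 2 powr (p / 2)"
    and m: "\<And>n. X n 0 \<in> borel_measurable M"
    and chain: "\<forall>\<^sub>F n in sequentially. 1 \<le> H n \<and> merge_chain M p C (H n) (J n) (X n) (Y n) (D n)"
    and J: "filterlim J at_top sequentially"
  defines "s \<equiv> (\<lambda>n. sdev M (X n 0))"
  assumes s: "\<forall>\<^sub>F n in sequentially. 0 < s n"
    and lim1: "(\<lambda>n. H n / s n) \<longlonglongrightarrow> 0"
    and lim2: "(\<lambda>n. R ^ J n * (H n / s n) powr q) \<longlonglongrightarrow> 0"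
    and lim3: "(\<lambda>n. R ^ J n * (H n powr (p - 1) / s n powr p)) \<longlonglongrightarrow> 0"
  shows "satisfies_clt M (\<lambda>n. X n 0)"
proof -
  interpret prob_space M by fact
  obtain psi psi' where y: "young_pq (\<lambda>u. min (u powr (q - 2)) (u powr (p - 2))) psi psi' (2 powr (q - 2)) p q"
    using young_pq_exists[OF pq] by blast
  interpret young_pq "\<lambda>u. min (u powr (q - 2)) (u powr (p - 2))" psi psi' "2 powr (q - 2)" p q by (rule y)
  obtain K where K: "K > 0" and cc: "\<And>(M :: 'a measure) H J X Y D. prob_space M \<Longrightarrow> 1 \<le> H \<Longrightarrow> merge_chain M p C H J X Y D \<Longrightarrow>
    0 < sdev M (X 0) \<Longrightarrow>
      cchain M (sqrt (sqc C) * (H / sdev M (X 0)))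
        (K * ((H / sdev M (X 0)) powr q + H powr (p - 1) / sdev M (X 0) powr p)) J
        (\<lambda>j x. (X j x - (\<integral>y. X j y \<partial>M)) / sdev M (X 0))
        (\<lambda>j x. (Y j x - (\<integral>y. X (Suc j) y \<partial>M)) / sdev M (X 0))
        (\<lambda>j x. (D j x - (\<integral>y. D j y \<partial>M)) / sdev M (X 0))"
    using merge_chain_cchain[OF C] unfolding Let_def by blast
  define c where "c = sqrt (sqc C)"
  have c: "0 \<le> c" using C by (simp add: c_def sqc_def)
  show ?thesis
  proof (subst satisfies_clt_char[OF ps m], intro allI tendstoI)
    fix t e :: real assume e: "0 < e"
    obtain L \<delta> where \<delta>: "0 < \<delta>" and clt: "\<And>(M :: 'a measure) \<kappa> \<eta> J A B E. cchain M \<kappa> \<eta> J A B E \<Longrightarrow> L < J \<Longrightarrow> \<kappa> \<le> \<delta> \<Longrightarrow>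
      R ^ J * (\<eta> + \<kappa> powr q) \<le> \<delta> \<Longrightarrow> cmod (char (distr M borel (A 0)) t - exp (- (t^2 / 2))) \<le> e / 2"
      using cchain_clt[OF R half_gt_zero[OF e], of t] by blast
    have "(\<lambda>n. c * (H n / s n)) \<longlonglongrightarrow> c * 0" by (intro tendsto_intros lim1)
    then have "\<forall>\<^sub>F n in sequentially. c * (H n / s n) < \<delta>" by (rule order_tendstoD(2)) (use \<delta> in simp)
    moreover have "(\<lambda>n. (K + c powr q) * (R ^ J n * (H n / s n) powr q) + K * (R ^ J n * (H n powr (p - 1) / s n powr p)))
        \<longlonglongrightarrow> (K + c powr q) * 0 + K * 0" by (intro tendsto_intros lim2 lim3)
    then have "\<forall>\<^sub>F n in sequentially. (K + c powr q) * (R ^ J n * (H n / s n) powr q) + K * (R ^ J n * (H n powr (p - 1) / s n powr p)) < \<delta>"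
      by (rule order_tendstoD(2)) (use \<delta> in simp)
    moreover have "\<forall>\<^sub>F n in sequentially. L < J n" using J unfolding filterlim_at_top
      by (auto elim!: allE[of _ "Suc L"] eventually_mono)
    ultimately show "\<forall>\<^sub>F n in sequentially. dist (char (distr M borel (\<lambda>x. (X n 0 x - (\<integral>x. X n 0 x \<partial>M)) / sdev M (X n 0))) t) (exp (- (t^2 / 2))) < e"
      using chain s
    proof eventually_elim
      case (elim n)
      have "(c * (H n / s n)) powr q = c powr q * (H n / s n) powr q" by (rule powr_mult)
      then have "R ^ J n * (K * ((H n / s n) powr q + H n powr (p - 1) / s n powr p) + (c * (H n / s n)) powr q) \<le> \<delta>"
        using elim(2) by (simp only: distrib_left distrib_right mult.assoc mult.left_commute[of "R ^ J n"] add.assoc)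
      then have "cmod (char (distr M borel (\<lambda>x. (X n 0 x - expectation (X n 0)) / s n)) t - exp (- (t^2 / 2))) \<le> e / 2"
        using elim unfolding c_def s_def by (intro clt[OF cc[OF ps]]) auto
      then show ?case using e by (simp add: dist_norm s_def)
    qed
  qed
qed

text \<open>With standard deviations u and v and a centred difference of norm w, the normalized
  variables differ in mean square by (w^2 - (u - v)^2) / (u v). Centring and scaling are thus
  compared at once.\<close>

lemma clt_of_l2_close:
  assumes ps: "prob_space M" and mX: "\<And>n. X n \<in> borel_measurable M" and mY: "\<And>n. Y n \<in> borel_measurable M"
    and sq: "\<forall>\<^sub>F n in sequentially. integrable M (\<lambda>x. (X n x)^2) \<and> integrable M (\<lambda>x. (Y n x)^2)"
  defines "vX \<equiv> (\<lambda>n. \<integral>x. (X n x - (\<integral>x. X n x \<partial>M))^2 \<partial>M)"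
  assumes pos: "\<forall>\<^sub>F n in sequentially. 0 < vX n"
    and lim: "(\<lambda>n. (\<integral>x. (X n x - Y n x)^2 \<partial>M) / vX n) \<longlonglongrightarrow> 0"
    and clt: "satisfies_clt M X"
  shows "satisfies_clt M Y"
proof -
  interpret prob_space M by fact
  define vY where "vY n = variance (Y n)" for n
  define U where "U n x = (X n x - expectation (X n)) / sqrt (vX n)" for n x
  define V where "V n x = (Y n x - expectation (Y n)) / sqrt (vY n)" for n x
  define d where "d n = (\<integral>x. (X n x - Y n x)^2 \<partial>M) / vX n" for n
  have [measurable]: "U n \<in> borel_measurable M" "V n \<in> borel_measurable M" "X n \<in> borel_measurable M" "Y n \<in> borel_measurable M" for n
    using mX mY unfolding U_def[abs_def] V_def[abs_def] by auto
  have close: "cmod (char (distr M borel (U n)) t - char (distr M borel (V n)) t) \<le> \<bar>t\<bar> * sqrt (2 * d n)"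
    if i: "integrable M (\<lambda>x. (X n x)^2)" "integrable M (\<lambda>x. (Y n x)^2)" and pos: "0 < vX n" and d4: "d n < 1 / 4" for n t
  proof -
    define A where "A x = X n x - expectation (X n)" for x
    define B where "B x = Y n x - expectation (Y n)" for x
    have [measurable]: "A \<in> borel_measurable M" "B \<in> borel_measurable M" unfolding A_def[abs_def] B_def[abs_def] by auto
    have iA: "integrable M (\<lambda>x. (A x)^2)" and iB: "integrable M (\<lambda>x. (B x)^2)"
      unfolding A_def B_def using i by (auto intro!: integrable_centered_square)
    define u v w where "u = sqrt (vX n)" and "v = sqrt (vY n)" and "w = sqrt (expectation (\<lambda>x. (A x - B x)^2))"
    have u: "0 < u" "u^2 = expectation (\<lambda>x. (A x)^2)" using pos by (auto simp: u_def vX_def A_def)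
    have v: "0 \<le> v" "v^2 = expectation (\<lambda>x. (B x)^2)" by (auto simp: v_def vY_def B_def)
    have iAB: "integrable M (\<lambda>x. A x * B x)" by (intro integrable_mult_square iA iB) auto
    define b where "b = expectation (\<lambda>x. A x * B x)"
    have w: "0 \<le> w" "w^2 = u^2 + v^2 - 2 * b"
    proof -
      show "0 \<le> w" by (simp add: w_def)
      have "w^2 = expectation (\<lambda>x. (A x - B x)^2)" by (simp add: w_def)
      also have "(\<lambda>x. (A x - B x)^2) = (\<lambda>x. (A x)^2 + (B x)^2 - 2 * (A x * B x))"
        by (simp add: power2_diff mult.assoc)
      also have "expectation (\<lambda>x. (A x)^2 + (B x)^2 - 2 * (A x * B x)) = u^2 + v^2 - 2 * b" using iA iB iAB u v by (simp add: b_def)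
      finally show "w^2 = u^2 + v^2 - 2 * b" .
    qed
    have "b^2 \<le> (u * v)^2" unfolding b_def power_mult_distrib u v by (rule integral_cauchy_schwarz) (auto simp: iA iB)
    then have "b \<le> u * v" by (rule power2_le_imp_le) (use u(1) v(1) in simp)
    then have uv: "(u - v)^2 \<le> w^2" unfolding w(2) by (simp add: power2_diff)
    have wd: "w^2 \<le> d n * u^2"
    proof -
      have iX: "integrable M (X n)" by (rule expectation_abs_le(1)[OF _ i(1)]) simp
      have iY: "integrable M (Y n)" by (rule expectation_abs_le(1)[OF _ i(2)]) simp
      have iD: "integrable M (\<lambda>x. X n x - Y n x)" using iX iY by simp
      have iXY: "integrable M (\<lambda>x. (X n x - Y n x)^2)"
        using integrable_add_square[of "X n" M "\<lambda>x. - Y n x"] i by simp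
      have e: "expectation (\<lambda>x. X n x - Y n x) = expectation (X n) - expectation (Y n)" using iX iY by simp
      have "w^2 = expectation (\<lambda>x. (A x - B x)^2)" by (simp add: w_def)
      also have "(\<lambda>x. (A x - B x)^2) = (\<lambda>x. (X n x - Y n x - expectation (\<lambda>x. X n x - Y n x))^2)"
        unfolding e by (simp add: A_def B_def algebra_simps)
      also have "expectation (\<lambda>x. (X n x - Y n x - expectation (\<lambda>x. X n x - Y n x))^2)
          \<le> expectation (\<lambda>x. (X n x - Y n x)^2)" by (rule variance_le_square[OF iD iXY])
      also have "\<dots> = d n * u^2" using pos by (simp add: d_def u_def)
      finally show ?thesis .
    qed
    \<comment> \<open>The bound 1/4 on \<open>d n\<close> means w \<le> u / 2, which keeps v away
      from 0.\<close>
    have vu: "u / 2 \<le> v"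
    proof -
      have "w^2 \<le> 1 / 4 * u^2" using wd d4 by (intro order_trans[OF wd mult_right_mono]) auto
      then have "(u - v)^2 \<le> (u / 2)^2" using uv by (simp add: power2_eq_square)
      then have "u - v \<le> u / 2" by (rule power2_le_imp_le) (use u(1) in simp)
      then show ?thesis by simp
    qed
    then have v0: "0 < v" using u by linarith
    have UV: "(\<lambda>x. (U n x - V n x)^2) = (\<lambda>x. (A x)^2 / u^2 + (B x)^2 / v^2 - 2 * (A x * B x) / (u * v))"
      by (auto simp: U_def V_def A_def B_def u_def v_def power2_diff power_divide)
    have "expectation (\<lambda>x. (U n x - V n x)^2) = u^2 / u^2 + v^2 / v^2 - 2 * b / (u * v)"
      unfolding UV using iA iB iAB by (simp add: u(2) v(2) b_def)
    also have "\<dots> = (w^2 - (u - v)^2) / (u * v)" unfolding w(2) using u(1) v0 by (simp add: power2_diff field_simps)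
    also have "\<dots> \<le> w^2 / (u * v)" using u(1) v0 by (intro divide_right_mono) auto
    also have "\<dots> \<le> d n * u^2 / (u * (u / 2))"
      using wd vu u(1) v0 order_trans[OF zero_le_power2 wd] by (intro frac_le mult_left_mono) auto
    also have "\<dots> = 2 * d n" using u(1) by (simp add: power2_eq_square)
    finally have e: "expectation (\<lambda>x. (U n x - V n x)^2) \<le> 2 * d n" .
    have iUV: "integrable M (\<lambda>x. (U n x - V n x)^2)" unfolding UV using iA iB iAB by simp
    have a1: "integrable M (\<lambda>x. \<bar>U n x - V n x\<bar>)" using expectation_abs_le(1)[OF _ iUV] by simp
    have "cmod (char (distr M borel (U n)) t - char (distr M borel (V n)) t) \<le> \<bar>t\<bar> * expectation (\<lambda>x. \<bar>U n x - V n x\<bar>)"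
      by (rule char_diff_le[OF _ _ a1]) auto
    also have "\<dots> \<le> \<bar>t\<bar> * sqrt (expectation (\<lambda>x. (U n x - V n x)^2))"
      by (intro mult_left_mono expectation_abs_le(2)[OF _ iUV]) auto
    also have "\<dots> \<le> \<bar>t\<bar> * sqrt (2 * d n)" using e by (intro mult_left_mono real_sqrt_le_mono) auto
    finally show ?thesis .
  qed
  have cX: "(\<lambda>n. char (distr M borel (U n)) t) \<longlonglongrightarrow> exp (- (t^2 / 2))" for t
    using clt unfolding satisfies_clt_char[OF ps mX] by (simp add: U_def[abs_def] vX_def)
  have "(\<lambda>n. char (distr M borel (V n)) t) \<longlonglongrightarrow> exp (- (t^2 / 2))" for t
  proof -
    have "(\<lambda>n. char (distr M borel (U n)) t - char (distr M borel (V n)) t) \<longlonglongrightarrow> 0"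
    proof (rule Lim_null_comparison)
      have "\<forall>\<^sub>F n in sequentially. d n < 1 / 4" using lim unfolding d_def by (rule order_tendstoD(2)) simp
      then show "\<forall>\<^sub>F n in sequentially. cmod (char (distr M borel (U n)) t - char (distr M borel (V n)) t) \<le> \<bar>t\<bar> * sqrt (2 * d n)"
        using sq pos by eventually_elim (rule close, auto)
      have "(\<lambda>n. \<bar>t\<bar> * sqrt (2 * d n)) \<longlonglongrightarrow> \<bar>t\<bar> * sqrt (2 * 0)"
        unfolding d_def by (intro tendsto_intros lim)
      then show "(\<lambda>n. \<bar>t\<bar> * sqrt (2 * d n)) \<longlonglongrightarrow> 0" by simp
    qed
    from tendsto_diff[OF cX[of t] this] show ?thesis by simp
  qed
  then show ?thesis unfolding satisfies_clt_char[OF ps mY] by (simp add: V_def[abs_def] vY_def)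
qed

section \<open>Bernoulli percolation on finite graphs\<close>

text \<open>The expectation of f at the random set of open edges, when the edges of E are open
  independently with probability q. As a finite sum it is a polynomial in q and is accessible to
  induction on E.\<close>

definition bern :: "real \<Rightarrow> 'e set \<Rightarrow> ('e set \<Rightarrow> real) \<Rightarrow> real" where
  "bern q E f = (\<Sum>A\<in>Pow E. q ^ card A * (1 - q) ^ card (E - A) * f A)"

lemma bern_empty [simp]: "bern q {} f = f {}"
  by (simp add: bern_def)

lemma bern_insert:
  assumes "finite E" "e \<notin> E"
  shows "bern q (insert e E) f = q * bern q E (\<lambda>A. f (insert e A)) + (1 - q) * bern q E f"
proof -
  have inj: "inj_on (insert e) (Pow E)" using assms(2) by (auto simp: inj_on_def)
  have disj: "Pow E \<inter> insert e ` Pow E = {}" using assms(2) by auto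
  have f: "finite A" if "A \<in> Pow E" for A using that assms(1) finite_subset by auto
  have "bern q (insert e E) f = (\<Sum>A\<in>Pow E. q ^ card A * (1 - q) ^ card (insert e E - A) * f A)
      + (\<Sum>A\<in>insert e ` Pow E. q ^ card A * (1 - q) ^ card (insert e E - A) * f A)"
    unfolding bern_def Pow_insert using assms disj by (intro sum.union_disjoint) auto
  also have "(\<Sum>A\<in>insert e ` Pow E. q ^ card A * (1 - q) ^ card (insert e E - A) * f A)
      = (\<Sum>A\<in>Pow E. q ^ card (insert e A) * (1 - q) ^ card (insert e E - insert e A) * f (insert e A))"
    by (simp add: sum.reindex[OF inj])
  also have "\<dots> = (\<Sum>A\<in>Pow E. q * (q ^ card A * (1 - q) ^ card (E - A) * f (insert e A)))"
  proof (rule sum.cong[OF refl])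
    fix A assume A: "A \<in> Pow E"
    have "e \<notin> A" using A assms by auto
    moreover have "insert e E - insert e A = E - A" using assms A by auto
    ultimately show "q ^ card (insert e A) * (1 - q) ^ card (insert e E - insert e A) * f (insert e A) =
        q * (q ^ card A * (1 - q) ^ card (E - A) * f (insert e A))"
      using f[OF A] by simp
  qed
  also have "(\<Sum>A\<in>Pow E. q ^ card A * (1 - q) ^ card (insert e E - A) * f A)
      = (\<Sum>A\<in>Pow E. (1 - q) * (q ^ card A * (1 - q) ^ card (E - A) * f A))"
  proof (rule sum.cong[OF refl])
    fix A assume A: "A \<in> Pow E"
    have "insert e E - A = insert e (E - A)" using assms A by auto
    moreover have "card (insert e (E - A)) = Suc (card (E - A))" using assms by (intro card_insert_disjoint) auto
    ultimately show "q ^ card A * (1 - q) ^ card (insert e E - A) * f A = (1 - q) * (q ^ card A * (1 - q) ^ card (E - A) * f A)"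
      by simp
  qed
  finally show ?thesis by (simp add: bern_def sum_distrib_left)
qed

lemma bern_add: "bern q E (\<lambda>A. f A + h A) = bern q E f + bern q E h"
  by (simp add: bern_def distrib_left sum.distrib)

lemma bern_diff: "bern q E (\<lambda>A. f A - h A) = bern q E f - bern q E h"
  by (simp add: bern_def right_diff_distrib sum_subtractf)

lemma bern_cmult: "bern q E (\<lambda>A. c * f A) = c * bern q E f"
  by (simp add: bern_def sum_distrib_left mult_ac)

lemma bern_sum: "bern q E (\<lambda>A. \<Sum>i\<in>I. f i A) = (\<Sum>i\<in>I. bern q E (f i))"
  unfolding bern_def by (simp add: sum_distrib_left sum.swap[of _ I])

lemma bern_cong: "(\<And>A. A \<subseteq> E \<Longrightarrow> f A = h A) \<Longrightarrow> bern q E f = bern q E h"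
  by (auto simp: bern_def intro!: sum.cong)

lemma bern_mono:
  assumes "0 \<le> q" "q \<le> 1" "\<And>A. A \<subseteq> E \<Longrightarrow> f A \<le> h A"
  shows "bern q E f \<le> bern q E h"
  unfolding bern_def using assms by (intro sum_mono mult_left_mono) auto

lemma bern_const: "finite E \<Longrightarrow> bern q E (\<lambda>_. c) = c"
proof (induction E rule: finite_induct)
  case (insert e E)
  then show ?case by (simp add: bern_insert algebra_simps)
qed simp

lemma bern_nonneg: "0 \<le> q \<Longrightarrow> q \<le> 1 \<Longrightarrow> (\<And>A. A \<subseteq> E \<Longrightarrow> 0 \<le> f A) \<Longrightarrow> 0 \<le> bern q E f"
  unfolding bern_def by (intro sum_nonneg mult_nonneg_nonneg) auto

lemma bern_le_1: "0 \<le> q \<Longrightarrow> q \<le> 1 \<Longrightarrow> finite E \<Longrightarrow> (\<And>A. A \<subseteq> E \<Longrightarrow> f A \<le> 1) \<Longrightarrow> bern q E f \<le> 1"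
  using bern_mono[of q E f "\<lambda>_. 1"] by (simp add: bern_const)

lemma bern_union:
  assumes "finite E1" "finite E2" "E1 \<inter> E2 = {}"
  shows "bern q (E1 \<union> E2) f = bern q E1 (\<lambda>A. bern q E2 (\<lambda>B. f (A \<union> B)))"
  using assms(1,3)
proof (induction E1 arbitrary: f rule: finite_induct)
  case (insert e E1)
  have "bern q (insert e E1 \<union> E2) f = bern q (insert e (E1 \<union> E2)) f" by simp
  also have "\<dots> = q * bern q (E1 \<union> E2) (\<lambda>A. f (insert e A)) + (1 - q) * bern q (E1 \<union> E2) f"
    using insert assms by (intro bern_insert) auto
  also have "\<dots> = bern q (insert e E1) (\<lambda>A. bern q E2 (\<lambda>B. f (A \<union> B)))"
    using insert by (simp add: bern_insert)
  finally show ?case .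
qed simp

lemma bern_marginal:
  assumes "finite E" "E1 \<subseteq> E"
  shows "bern q E (\<lambda>A. f (A \<inter> E1)) = bern q E1 f"
proof -
  have fin: "finite E1" "finite (E - E1)" using assms finite_subset by auto
  have "bern q E (\<lambda>A. f (A \<inter> E1)) = bern q (E1 \<union> (E - E1)) (\<lambda>A. f (A \<inter> E1))"
    using assms by (simp add: Un_absorb1)
  also have "\<dots> = bern q E1 (\<lambda>A. bern q (E - E1) (\<lambda>B. f ((A \<union> B) \<inter> E1)))" using fin by (intro bern_union) auto
  also have "\<dots> = bern q E1 (\<lambda>A. bern q (E - E1) (\<lambda>B. f A))"
  proof (intro bern_cong)
    fix A B assume "A \<subseteq> E1" "B \<subseteq> E - E1"
    then have "(A \<union> B) \<inter> E1 = A" by auto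
    then show "f ((A \<union> B) \<inter> E1) = f A" by simp
  qed
  finally show ?thesis using fin by (simp add: bern_const)
qed

lemma bern_indep:
  assumes "finite E" "E1 \<subseteq> E" "E2 \<subseteq> E" "E1 \<inter> E2 = {}"
  shows "bern q E (\<lambda>A. f (A \<inter> E1) * h (A \<inter> E2)) = bern q E (\<lambda>A. f (A \<inter> E1)) * bern q E (\<lambda>A. h (A \<inter> E2))"
proof -
  have fin: "finite E1" "finite E2" using assms by (auto intro: finite_subset)
  have "bern q E (\<lambda>A. f (A \<inter> E1) * h (A \<inter> E2)) = bern q E (\<lambda>A. f ((A \<inter> (E1 \<union> E2)) \<inter> E1) * h ((A \<inter> (E1 \<union> E2)) \<inter> E2))"
    by (intro bern_cong arg_cong2[of _ _ _ _ "(*)"] arg_cong[of _ _ f] arg_cong[of _ _ h]) auto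
  also have "\<dots> = bern q (E1 \<union> E2) (\<lambda>A. f (A \<inter> E1) * h (A \<inter> E2))"
    using assms by (intro bern_marginal[of E "E1 \<union> E2" q "\<lambda>A. f (A \<inter> E1) * h (A \<inter> E2)"]) auto
  also have "\<dots> = bern q E1 (\<lambda>A. bern q E2 (\<lambda>B. f ((A \<union> B) \<inter> E1) * h ((A \<union> B) \<inter> E2)))"
    using fin assms by (intro bern_union)
  also have "\<dots> = bern q E1 (\<lambda>A. bern q E2 (\<lambda>B. f A * h B))"
  proof (intro bern_cong)
    fix A B assume "A \<subseteq> E1" "B \<subseteq> E2"
    then have "(A \<union> B) \<inter> E1 = A" "(A \<union> B) \<inter> E2 = B" using assms(4) by auto
    then show "f ((A \<union> B) \<inter> E1) * h ((A \<union> B) \<inter> E2) = f A * h B" by simp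
  qed
  also have "\<dots> = bern q E1 f * bern q E2 h" by (simp add: bern_cmult mult.commute[of _ "bern q E2 h"])
  finally show ?thesis using assms bern_marginal[of E E1] bern_marginal[of E E2] by simp
qed

text \<open>Russo's formula, for arbitrary f: the summand of an edge is the mean effect of opening
  it. In the induction the derivative falls either on the factor of the new edge or on the remaining
  ones.\<close>

lemma bern_deriv:
  assumes "finite E"
  shows "((\<lambda>q. bern q E f) has_real_derivative (\<Sum>e\<in>E. bern q E (\<lambda>A. f (insert e A) - f (A - {e})))) (at q)"
  using assms
proof (induction E arbitrary: f rule: finite_induct)
  case (insert e E)
  let ?f1 = "\<lambda>A. f (insert e A)"
  have "((\<lambda>q. q * bern q E ?f1 + (1 - q) * bern q E f) has_real_derivative
      (bern q E ?f1 + q * (\<Sum>e\<in>E. bern q E (\<lambda>A. ?f1 (insert e A) - ?f1 (A - {e}))))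
      + (- bern q E f + (1 - q) * (\<Sum>e\<in>E. bern q E (\<lambda>A. f (insert e A) - f (A - {e}))))) (at q)"
    by (rule derivative_eq_intros refl insert.IH)+ (simp add: algebra_simps)
  also have "(bern q E ?f1 + q * (\<Sum>e\<in>E. bern q E (\<lambda>A. ?f1 (insert e A) - ?f1 (A - {e}))))
      + (- bern q E f + (1 - q) * (\<Sum>e\<in>E. bern q E (\<lambda>A. f (insert e A) - f (A - {e}))))
      = (bern q E ?f1 - bern q E f) + (\<Sum>e'\<in>E. q * bern q E (\<lambda>A. ?f1 (insert e' A) - ?f1 (A - {e'}))
          + (1 - q) * bern q E (\<lambda>A. f (insert e' A) - f (A - {e'})))"
    by (simp add: sum.distrib sum_distrib_left)
  also have "bern q E ?f1 - bern q E f = bern q (insert e E) (\<lambda>A. f (insert e A) - f (A - {e}))"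
  proof -
    have "bern q (insert e E) (\<lambda>A. f (insert e A) - f (A - {e}))
        = q * bern q E (\<lambda>A. f (insert e (insert e A)) - f (insert e A - {e})) + (1 - q) * bern q E (\<lambda>A. f (insert e A) - f (A - {e}))"
      using insert by (intro bern_insert)
    also have "bern q E (\<lambda>A. f (insert e (insert e A)) - f (insert e A - {e})) = bern q E (\<lambda>A. f (insert e A) - f A)"
    proof (rule bern_cong)
      fix A assume "A \<subseteq> E"
      then have "insert e A - {e} = A" using insert by auto
      then show "f (insert e (insert e A)) - f (insert e A - {e}) = f (insert e A) - f A" by simp
    qed
    also have "bern q E (\<lambda>A. f (insert e A) - f (A - {e})) = bern q E (\<lambda>A. f (insert e A) - f A)"
    proof (rule bern_cong)
      fix A assume "A \<subseteq> E"
      then have "A - {e} = A" using insert by auto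
      then show "f (insert e A) - f (A - {e}) = f (insert e A) - f A" by simp
    qed
    finally show ?thesis by (simp add: bern_diff algebra_simps)
  qed
  also have "(\<Sum>e'\<in>E. q * bern q E (\<lambda>A. ?f1 (insert e' A) - ?f1 (A - {e'}))
          + (1 - q) * bern q E (\<lambda>A. f (insert e' A) - f (A - {e'})))
      = (\<Sum>e'\<in>E. bern q (insert e E) (\<lambda>A. f (insert e' A) - f (A - {e'})))"
  proof (rule sum.cong[OF refl])
    fix e' assume e': "e' \<in> E"
    then have "e \<noteq> e'" using insert by auto
    then have "\<And>A. insert e A - {e'} = insert e (A - {e'})" "\<And>A. insert e' (insert e A) = insert e (insert e' A)" by auto
    then show "q * bern q E (\<lambda>A. ?f1 (insert e' A) - ?f1 (A - {e'})) + (1 - q) * bern q E (\<lambda>A. f (insert e' A) - f (A - {e'}))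
       = bern q (insert e E) (\<lambda>A. f (insert e' A) - f (A - {e'}))"
      using insert by (simp add: bern_insert)
  qed
  finally have "((\<lambda>q. q * bern q E ?f1 + (1 - q) * bern q E f) has_real_derivative
     (\<Sum>e'\<in>insert e E. bern q (insert e E) (\<lambda>A. f (insert e' A) - f (A - {e'})))) (at q)"
    using insert by simp
  then show ?case using insert by (simp add: bern_insert)
qed simp

lemma bern_mono_parameter:
  assumes "finite E" "0 \<le> p" "p \<le> q" "q \<le> 1" and mono: "\<And>A B. A \<subseteq> B \<Longrightarrow> f A \<le> f B"
  shows "bern p E f \<le> bern q E f"
proof (rule DERIV_nonneg_imp_nondecreasing[OF \<open>p \<le> q\<close>])
  fix x assume x: "p \<le> x" "x \<le> q"
  have "0 \<le> (\<Sum>e\<in>E. bern x E (\<lambda>A. f (insert e A) - f (A - {e})))"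
    using assms(2,4) x by (intro sum_nonneg bern_nonneg) (auto intro: mono)
  then show "\<exists>y. ((\<lambda>q. bern q E f) has_real_derivative y) (at x) \<and> 0 \<le> y"
    using bern_deriv[OF assms(1)] by blast
qed

lemma bern_mono_edges:
  assumes "finite E" "E1 \<subseteq> E" "0 \<le> q" "q \<le> 1" and mono: "\<And>A B. A \<subseteq> B \<Longrightarrow> f A \<le> f B"
  shows "bern q E1 f \<le> bern q E f"
  using bern_mono[of q E "\<lambda>A. f (A \<inter> E1)" f] bern_marginal[OF assms(1,2), of q f] assms(3,4) by (simp add: mono)

text \<open>Sprinkling: the union of two independent percolations is again a percolation, in which
  an edge is closed with probability (1 - p) (1 - s).\<close>

lemma bern_convolution:
  assumes "finite E"
  shows "bern p E (\<lambda>A. bern s E (\<lambda>R. f (A \<union> R))) = bern (p + s - p * s) E f"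
  using assms
proof (induction E arbitrary: f rule: finite_induct)
  case (insert e E)
  let ?f1 = "\<lambda>A. f (insert e A)"
  have "bern p (insert e E) (\<lambda>A. bern s (insert e E) (\<lambda>R. f (A \<union> R)))
    = bern p (insert e E) (\<lambda>A. s * bern s E (\<lambda>R. f (A \<union> insert e R)) + (1 - s) * bern s E (\<lambda>R. f (A \<union> R)))"
    using insert by (simp add: bern_insert)
  also have "\<dots> = p * bern p E (\<lambda>A. s * bern s E (\<lambda>R. f (insert e A \<union> insert e R)) + (1 - s) * bern s E (\<lambda>R. f (insert e A \<union> R)))
      + (1 - p) * bern p E (\<lambda>A. s * bern s E (\<lambda>R. f (A \<union> insert e R)) + (1 - s) * bern s E (\<lambda>R. f (A \<union> R)))"
    using insert by (intro bern_insert)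
  also have "\<dots> = p * bern p E (\<lambda>A. bern s E (\<lambda>R. ?f1 (A \<union> R)))
      + (1 - p) * (s * bern p E (\<lambda>A. bern s E (\<lambda>R. ?f1 (A \<union> R))) + (1 - s) * bern p E (\<lambda>A. bern s E (\<lambda>R. f (A \<union> R))))"
    by (simp only: Un_insert_left Un_insert_right insert_absorb2 bern_add bern_cmult) (simp add: algebra_simps)
  also have "\<dots> = (p + s - p * s) * bern (p + s - p * s) E ?f1 + (1 - (p + s - p * s)) * bern (p + s - p * s) E f"
    unfolding insert.IH[of f] insert.IH[of ?f1] by (simp add: algebra_simps)
  also have "\<dots> = bern (p + s - p * s) (insert e E) f" using insert by (simp add: bern_insert)
  finally show ?case .
qed simp

lemma bern_superset:
  assumes "finite E" "R \<subseteq> E"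
  shows "bern s E (\<lambda>A. of_bool (R \<subseteq> A)) = s ^ card R"
proof -
  have "bern s E (\<lambda>A. of_bool (R \<subseteq> A)) = bern s E (\<lambda>A. of_bool (R \<subseteq> A \<inter> R))"
    by (intro bern_cong) auto
  also have "\<dots> = bern s R (\<lambda>A. of_bool (R \<subseteq> A))" by (rule bern_marginal[OF assms])
  also have "\<dots> = (\<Sum>A\<in>{R}. s ^ card A * (1 - s) ^ card (R - A) * of_bool (R \<subseteq> A))"
    unfolding bern_def using assms finite_subset by (intro sum.mono_neutral_right) auto
  finally show ?thesis by simp
qed

section \<open>Connections in a random set of edges\<close>

definition conn :: "'v set set \<Rightarrow> ('v \<times> 'v) set" where
  "conn A = {(x, y). {x, y} \<in> A}\<^sup>*"

definition conn_to :: "'v set set \<Rightarrow> 'v \<Rightarrow> 'v set \<Rightarrow> bool" where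
  "conn_to A v B \<longleftrightarrow> (\<exists>b\<in>B. (v, b) \<in> conn A)"

lemma conn_mono: "A \<subseteq> A' \<Longrightarrow> conn A \<subseteq> conn A'"
  unfolding conn_def by (intro rtrancl_mono) auto

lemma conn_to_mono: "A \<subseteq> A' \<Longrightarrow> conn_to A v B \<Longrightarrow> conn_to A' v B"
  unfolding conn_to_def using conn_mono by blast

lemma conn_to_step: "{v, u} \<in> A \<Longrightarrow> conn_to A u B \<Longrightarrow> conn_to A v B"
  unfolding conn_to_def conn_def by (auto intro: converse_rtrancl_into_rtrancl)

lemma conn_to_trans: "(v, u) \<in> conn A \<Longrightarrow> conn_to A u B \<Longrightarrow> conn_to A v B"
  unfolding conn_to_def conn_def by (meson rtrancl_trans)

lemma conn_to_self: "v \<in> B \<Longrightarrow> conn_to A v B"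
  unfolding conn_to_def conn_def by auto

abbreviation inside :: "'v set set \<Rightarrow> 'v set \<Rightarrow> 'v set set" where
  "inside E S \<equiv> {e \<in> E. e \<subseteq> S}"

text \<open>Oriented outwards, because it is the inner endpoint that has to be reached.\<close>

definition bdry :: "'v set set \<Rightarrow> 'v set \<Rightarrow> ('v \<times> 'v) set" where
  "bdry E S = {(x, y). x \<in> S \<and> y \<notin> S \<and> {x, y} \<in> E}"

lemma inj_on_bdry: "inj_on (\<lambda>(x, y). {x, y}) (bdry E S)"
  by (auto simp: inj_on_def bdry_def doubleton_eq_iff)

lemma finite_bdry: "finite E \<Longrightarrow> finite (bdry E S)"
proof -
  assume "finite E"
  moreover have "(\<lambda>(x, y). {x, y}) ` bdry E S \<subseteq> E" by (auto simp: bdry_def)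
  ultimately have "finite ((\<lambda>(x, y). {x, y}) ` bdry E S)" by (rule finite_subset[rotated])
  then show ?thesis using finite_imageD inj_on_bdry by blast
qed

definition unconn :: "'v set \<Rightarrow> 'v set set \<Rightarrow> 'v set \<Rightarrow> 'v set" where
  "unconn V A B = {v \<in> V. \<not> conn_to A v B}"

text \<open>A connection to B visits only vertices joined to B, so it avoids the set S of unjoined
  vertices and uses no edge inside S. Hence the event that S is this set is independent of the edges
  inside S.\<close>

lemma unconn_outside:
  assumes V: "\<Union>E \<subseteq> V" and A: "A \<subseteq> E"
  shows "unconn V A B = S \<longleftrightarrow> unconn V (A \<inter> (E - inside E S)) B = S"
proof -
  let ?A' = "A \<inter> (E - inside E S)"
  have sub: "conn_to ?A' v B \<Longrightarrow> conn_to A v B" for v by (rule conn_to_mono) auto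
  show ?thesis
  proof
    assume S: "unconn V A B = S"
    have *: "conn_to ?A' v B" if c: "conn_to A v B" for v
    proof -
      obtain b where b: "b \<in> B" "(v, b) \<in> conn A" using c unfolding conn_to_def by blast
      from b(2) show ?thesis unfolding conn_def
      proof (induction rule: converse_rtrancl_induct)
        case base
        then show ?case using b by (intro conn_to_self)
      next
        case (step y z)
        have zA: "conn_to A z B" using sub step by blast
        have "{y, z} \<in> A" using step by auto
        moreover have "z \<notin> S" using zA S by (auto simp: unconn_def)
        ultimately have "{y, z} \<in> ?A'" using A by auto
        then show ?case by (rule conn_to_step) (rule step.IH)
      qed
    qed
    then show "unconn V ?A' B = S" using S sub unfolding unconn_def by blast
  next
    assume S: "unconn V ?A' B = S"
    have *: "conn_to ?A' v B" if c: "conn_to A v B" for v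
    proof -
      obtain b where b: "b \<in> B" "(v, b) \<in> conn A" using c unfolding conn_to_def by blast
      from b(2) show ?thesis unfolding conn_def
      proof (induction rule: converse_rtrancl_induct)
        case base
        then show ?case using b by (intro conn_to_self)
      next
        case (step y z)
        have "{y, z} \<in> A" using step by auto
        moreover have "z \<notin> S" using step S by (auto simp: unconn_def)
        ultimately have "{y, z} \<in> ?A'" using A by auto
        then show ?case by (rule conn_to_step) (rule step.IH)
      qed
    qed
    then show "unconn V A B = S" using S sub unfolding unconn_def by blast
  qed
qed

text \<open>The differential inequality of Duminil-Copin and Tassion: given that \<open>o\<close> is not joined to
  \<open>B\<close>, the edges on the boundary of the set of vertices not joined to \<open>B\<close> that are reached from
  \<open>o\<close> are pivotal, and the configuration inside this set is independent of the set itself.\<close>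

lemma dct_derivative:
  fixes E :: "'v set set"
  assumes fin: "finite E" "finite V" and V: "\<Union>E \<subseteq> V" "o' \<in> V" and q: "0 \<le> q" "q \<le> 1"
    and phi: "\<And>S. S \<subseteq> V \<Longrightarrow> o' \<in> S \<Longrightarrow> S \<inter> B = {} \<Longrightarrow>
      1 \<le> (\<Sum>(x, y)\<in>bdry E S. bern q (inside E S) (\<lambda>A. of_bool ((o', x) \<in> conn A)))"
  shows "1 - bern q E (\<lambda>A. of_bool (conn_to A o' B))
    \<le> (\<Sum>e\<in>E. bern q E (\<lambda>A. of_bool (conn_to (insert e A) o' B) - of_bool (conn_to (A - {e}) o' B)))"
proof -
  define Ss where "Ss = {S. S \<subseteq> V \<and> o' \<in> S}"
  have finS: "finite Ss" using fin by (auto simp: Ss_def)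
  \<comment> \<open>\<open>G S e\<close> says that e leaves S from a vertex reached from
    \<open>o'\<close>, and \<open>U\<close> below says that S is the set of vertices not joined to
    B. At most one S satisfies the latter, and then e is pivotal.\<close>
  define G where "G S e A = (if e \<in> (\<lambda>(x, y). {x, y}) ` {(x, y) \<in> bdry E S. (o', x) \<in> conn A} then 1 else 0 :: real)" for S e A
  define U where "U S A = (of_bool (unconn V A B = S) :: real)" for S A
  have piv: "(\<Sum>S\<in>Ss. U S A * G S e (A \<inter> inside E S))
      \<le> of_bool (conn_to (insert e A) o' B) - of_bool (conn_to (A - {e}) o' B)" if A: "A \<subseteq> E" for A e
  proof -
    have nn: "0 \<le> (of_bool (conn_to (insert e A) o' B) - of_bool (conn_to (A - {e}) o' B) :: real)"
      using conn_to_mono[of "A - {e}" "insert e A" o' B] by auto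
    define S where "S = unconn V A B"
    show ?thesis
    proof (cases "o' \<in> S")
      case False
      then have "(\<Sum>S\<in>Ss. U S A * G S e (A \<inter> inside E S)) = 0"
        by (intro sum.neutral) (auto simp: U_def Ss_def S_def)
      then show ?thesis using nn by simp
    next
      case True
      then have "S \<in> Ss" by (auto simp: Ss_def S_def unconn_def)
      have "(\<Sum>S\<in>Ss. U S A * G S e (A \<inter> inside E S)) = (\<Sum>S'\<in>{S}. U S' A * G S' e (A \<inter> inside E S'))"
        using finS \<open>S \<in> Ss\<close> by (intro sum.mono_neutral_right) (auto simp: U_def S_def)
      also have "\<dots> = G S e (A \<inter> inside E S)" by (simp add: U_def S_def)
      also have "\<dots> \<le> of_bool (conn_to (insert e A) o' B) - of_bool (conn_to (A - {e}) o' B)"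
      proof (cases "e \<in> (\<lambda>(x, y). {x, y}) ` {(x, y) \<in> bdry E S. (o', x) \<in> conn (A \<inter> inside E S)}")
        case True
        then obtain x y where xy: "e = {x, y}" "(x, y) \<in> bdry E S" "(o', x) \<in> conn (A \<inter> inside E S)" by auto
        have "y \<in> V" "y \<notin> S" using xy(2) V by (auto simp: bdry_def)
        then have "conn_to A y B" by (auto simp: S_def unconn_def)
        then have "conn_to (insert e A) y B" by (rule conn_to_mono[rotated]) auto
        then have "conn_to (insert e A) x B" using conn_to_step[of x y "insert e A" B] xy by simp
        moreover have "(o', x) \<in> conn (insert e A)" using xy(3) conn_mono[of "A \<inter> inside E S" "insert e A"] by auto
        ultimately have 1: "conn_to (insert e A) o' B" using conn_to_trans by fast
        have "\<not> conn_to A o' B" using \<open>o' \<in> S\<close> by (auto simp: S_def unconn_def)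
        then have "\<not> conn_to (A - {e}) o' B" using conn_to_mono[of "A - {e}" A] by auto
        then show ?thesis using 1 by (simp add: G_def)
      qed (use nn in \<open>simp add: G_def\<close>)
      finally show ?thesis .
    qed
  qed
  have prob: "bern q E (\<lambda>A. U S A * G S e (A \<inter> inside E S)) = bern q E (U S) * bern q (inside E S) (G S e)" for S e
  proof -
    have 1: "U S A = U S (A \<inter> (E - inside E S))" if "A \<subseteq> E" for A
      using unconn_outside[OF V(1) that, of B S] by (simp add: U_def)
    have "bern q E (\<lambda>A. U S A * G S e (A \<inter> inside E S)) = bern q E (\<lambda>A. U S (A \<inter> (E - inside E S)) * G S e (A \<inter> inside E S))"
      using 1 by (intro bern_cong) simp
    also have "\<dots> = bern q E (\<lambda>A. U S (A \<inter> (E - inside E S))) * bern q E (\<lambda>A. G S e (A \<inter> inside E S))"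
      using fin by (intro bern_indep) auto
    also have "bern q E (\<lambda>A. U S (A \<inter> (E - inside E S))) = bern q E (U S)" using 1 by (intro bern_cong) simp
    also have "bern q E (\<lambda>A. G S e (A \<inter> inside E S)) = bern q (inside E S) (G S e)"
      using fin by (intro bern_marginal) auto
    finally show ?thesis .
  qed
  have sumG: "(\<Sum>e\<in>E. bern q (inside E S) (G S e)) = (\<Sum>(x, y)\<in>bdry E S. bern q (inside E S) (\<lambda>A. of_bool ((o', x) \<in> conn A)))" for S
  proof -
    have "(\<Sum>e\<in>E. G S e A) = (\<Sum>(x, y)\<in>bdry E S. of_bool ((o', x) \<in> conn A))" for A
    proof -
      let ?T = "{(x, y) \<in> bdry E S. (o', x) \<in> conn A}"
      have "(\<Sum>e\<in>E. G S e A) = (\<Sum>e\<in>(\<lambda>(x, y). {x, y}) ` ?T. 1)"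
        unfolding G_def using fin by (subst sum.If_cases) (auto simp: bdry_def intro!: arg_cong[of _ _ card])
      also have "\<dots> = (\<Sum>(x, y)\<in>?T. 1)"
        using inj_on_subset[OF inj_on_bdry, of ?T E S] by (subst sum.reindex) (auto simp: case_prod_beta)
      also have "\<dots> = (\<Sum>(x, y)\<in>bdry E S. of_bool ((o', x) \<in> conn A))"
        using finite_bdry[OF fin(1), of S] by (intro sum.mono_neutral_cong_left) auto
      finally show ?thesis .
    qed
    then have "bern q (inside E S) (\<lambda>A. \<Sum>e\<in>E. G S e A) = bern q (inside E S) (\<lambda>A. \<Sum>(x, y)\<in>bdry E S. of_bool ((o', x) \<in> conn A))"
      by simp
    then show ?thesis unfolding case_prod_beta bern_sum .
  qed
  have "1 - bern q E (\<lambda>A. of_bool (conn_to A o' B)) = bern q E (\<lambda>A. 1 - of_bool (conn_to A o' B))"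
    using fin by (simp add: bern_diff bern_const)
  also have "\<dots> = bern q E (\<lambda>A. \<Sum>S\<in>Ss. U S A)"
  proof (rule bern_cong)
    fix A
    define S where "S = unconn V A B"
    show "1 - of_bool (conn_to A o' B) = (\<Sum>S\<in>Ss. U S A)"
    proof (cases "conn_to A o' B")
      case True
      then have "(\<Sum>S\<in>Ss. U S A) = 0" by (intro sum.neutral) (auto simp: U_def Ss_def unconn_def)
      then show ?thesis using True by simp
    next
      case False
      then have "S \<in> Ss" using V by (auto simp: Ss_def S_def unconn_def)
      then have "(\<Sum>S\<in>Ss. U S A) = (\<Sum>S'\<in>{S}. U S' A)"
        using finS by (intro sum.mono_neutral_right) (auto simp: U_def S_def)
      then show ?thesis using False by (simp add: U_def S_def)
    qed
  qed
  also have "\<dots> = (\<Sum>S\<in>Ss. bern q E (U S))" by (rule bern_sum)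
  also have "\<dots> \<le> (\<Sum>S\<in>Ss. bern q E (U S) * (\<Sum>(x, y)\<in>bdry E S. bern q (inside E S) (\<lambda>A. of_bool ((o', x) \<in> conn A))))"
  proof (rule sum_mono)
    fix S assume S: "S \<in> Ss"
    have U0: "0 \<le> bern q E (U S)" using q by (intro bern_nonneg) (auto simp: U_def)
    show "bern q E (U S) \<le> bern q E (U S) * (\<Sum>(x, y)\<in>bdry E S. bern q (inside E S) (\<lambda>A. of_bool ((o', x) \<in> conn A)))"
    proof (cases "S \<inter> B = {}")
      case True
      then show ?thesis using phi[of S] S mult_left_mono[OF phi[of S] U0] by (auto simp: Ss_def)
    next
      case False
      \<comment> \<open>Vertices of B are joined to B, so a set that meets B is never the unjoined
        set.\<close>
      then have "U S A = 0" for A using conn_to_self by (fastforce simp: U_def unconn_def)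
      then have "bern q E (U S) = 0" using fin by (subst bern_cong[of E "U S" "\<lambda>_. 0"]) (auto simp: bern_const)
      then show ?thesis by simp
    qed
  qed
  also have "\<dots> = (\<Sum>S\<in>Ss. \<Sum>e\<in>E. bern q E (\<lambda>A. U S A * G S e (A \<inter> inside E S)))"
    by (simp add: prob sumG flip: sum_distrib_left)
  also have "\<dots> = (\<Sum>e\<in>E. bern q E (\<lambda>A. \<Sum>S\<in>Ss. U S A * G S e (A \<inter> inside E S)))"
    by (subst sum.swap) (simp add: bern_sum)
  also have "\<dots> \<le> (\<Sum>e\<in>E. bern q E (\<lambda>A. of_bool (conn_to (insert e A) o' B) - of_bool (conn_to (A - {e}) o' B)))"
    using q piv by (intro sum_mono bern_mono)
  finally show ?thesis .
qed

text \<open>The inequality 1 - f \<le> f' makes (1 - f q) exp q nonincreasing on [p, p']. A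
  hypothesis at p alone gives the inequality on the whole interval, since the connection
  probabilities increase with q.\<close>

lemma dct_lower_bound:
  fixes E :: "'v set set"
  assumes fin: "finite E" "finite V" and V: "\<Union>E \<subseteq> V" "o' \<in> V" and p: "0 \<le> p" "p \<le> p'" "p' \<le> 1"
    and phi: "\<And>S. S \<subseteq> V \<Longrightarrow> o' \<in> S \<Longrightarrow> S \<inter> B = {} \<Longrightarrow>
      1 \<le> (\<Sum>(x, y)\<in>bdry E S. bern p (inside E S) (\<lambda>A. of_bool ((o', x) \<in> conn A)))"
  shows "1 - exp (- (p' - p)) \<le> bern p' E (\<lambda>A. of_bool (conn_to A o' B))"
proof -
  define f where "f q = bern q E (\<lambda>A. of_bool (conn_to A o' B))" for q
  define f' where "f' q = (\<Sum>e\<in>E. bern q E (\<lambda>A. of_bool (conn_to (insert e A) o' B) - of_bool (conn_to (A - {e}) o' B)))" for q :: real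
  have der: "(f has_real_derivative f' q) (at q)" for q
    unfolding f_def f'_def by (rule bern_deriv[OF fin(1)])
  have "(1 - f p') * exp p' \<le> (1 - f p) * exp p"
  proof (rule DERIV_nonpos_imp_nonincreasing[OF p(2), of "\<lambda>q. (1 - f q) * exp q"])
    fix q assume q: "p \<le> q" "q \<le> p'"
    have "1 - f q \<le> f' q" unfolding f_def f'_def
    proof (rule dct_derivative[OF fin V])
      fix S assume S: "S \<subseteq> V" "o' \<in> S" "S \<inter> B = {}"
      have "1 \<le> (\<Sum>(x, y)\<in>bdry E S. bern p (inside E S) (\<lambda>A. of_bool ((o', x) \<in> conn A)))" by (rule phi[OF S])
      also have "\<dots> \<le> (\<Sum>(x, y)\<in>bdry E S. bern q (inside E S) (\<lambda>A. of_bool ((o', x) \<in> conn A)))"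
        unfolding case_prod_beta using fin p q conn_mono
        by (intro sum_mono bern_mono_parameter) (auto simp: of_bool_def)
      finally show "1 \<le> (\<Sum>(x, y)\<in>bdry E S. bern q (inside E S) (\<lambda>A. of_bool ((o', x) \<in> conn A)))" .
    qed (use p q in auto)
    then have "(1 - f q) * exp q + - f' q * exp q \<le> 0"
      by (simp add: mult_right_mono flip: distrib_right)
    moreover have "((\<lambda>q. (1 - f q) * exp q) has_real_derivative (1 - f q) * exp q + - f' q * exp q) (at q)"
      by (rule derivative_eq_intros der refl)+ simp
    ultimately show "\<exists>y. ((\<lambda>q. (1 - f q) * exp q) has_real_derivative y) (at q) \<and> y \<le> 0" by blast
  qed
  also have "\<dots> \<le> 1 * exp p"
    using p fin bern_nonneg[of p E "\<lambda>A. of_bool (conn_to A o' B)"] by (intro mult_right_mono) (auto simp: f_def)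
  finally have "(1 - f p') * exp p' / exp p' \<le> exp p / exp p'" by (intro divide_right_mono) auto
  then have "1 - f p' \<le> exp (p - p')" by (simp add: exp_diff)
  then show ?thesis by (simp add: f_def)
qed

section \<open>Leaving a finite set, and exponential decay\<close>

definition cluster :: "'v set set \<Rightarrow> 'v \<Rightarrow> 'v set" where
  "cluster A v = {x. (v, x) \<in> conn A}"

text \<open>Neither following nor blocking a path within C involves an edge that avoids C, so the
  event that the cluster is C lives on the edges touching C.\<close>

lemma cluster_touching:
  "cluster A v = C \<longleftrightarrow> cluster {e \<in> A. e \<inter> C \<noteq> {}} v = C"
proof -
  let ?A' = "{e \<in> A. e \<inter> C \<noteq> {}}"
  have sub: "conn ?A' \<subseteq> conn A" by (intro conn_mono) auto
  show ?thesis
  proof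
    assume C: "cluster A v = C"
    have "(v, x) \<in> conn ?A'" if "(v, x) \<in> conn A" for x
      using that unfolding conn_def
    proof (induction rule: rtrancl_induct)
      case (step y z)
      have "y \<in> C" using step(1) C by (auto simp: cluster_def conn_def)
      then have "(y, z) \<in> {(x, y). {x, y} \<in> ?A'}" using step(2) by auto
      then show ?case using step(3) by (rule rtrancl_into_rtrancl[rotated])
    qed simp
    then show "cluster ?A' v = C" using C sub by (auto simp: cluster_def)
  next
    assume C: "cluster ?A' v = C"
    have "x \<in> C" if "(v, x) \<in> conn A" for x
      using that unfolding conn_def
    proof (induction rule: rtrancl_induct)
      case base
      show ?case using C by (auto simp: cluster_def conn_def)
    next
      case (step y z)
      have "(v, y) \<in> {(x, y). {x, y} \<in> ?A'}\<^sup>*" using step(3) C by (auto simp: cluster_def conn_def)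
      moreover have "(y, z) \<in> {(x, y). {x, y} \<in> ?A'}" using step(2,3) by auto
      ultimately have "(v, z) \<in> {(x, y). {x, y} \<in> ?A'}\<^sup>*" by (rule rtrancl_into_rtrancl)
      then show ?case using C by (auto simp: cluster_def conn_def)
    qed
    then show "cluster A v = C" using C sub by (auto simp: cluster_def)
  qed
qed

text \<open>x is the last vertex of the connection in the cluster C of \<open>o'\<close> inside S,
  so what follows avoids C. The step from x leaves S, as otherwise it would be an open edge inside S
  and its other end would belong to C.\<close>

lemma exit_cluster:
  assumes A: "A \<subseteq> E" and o': "o' \<in> S" and SB: "S \<inter> B = {}" and c: "conn_to A o' B"
  defines "C \<equiv> cluster (A \<inter> inside E S) o'"
  shows "\<exists>x y. (x, y) \<in> bdry E S \<and> x \<in> C \<and> {x, y} \<in> A \<and> conn_to {e \<in> A. e \<inter> C = {}} y B"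
proof -
  let ?A' = "{e \<in> A. e \<inter> C = {}}"
  have CS: "C \<subseteq> S"
  proof
    fix x assume "x \<in> C"
    then have "(o', x) \<in> {(x, y). {x, y} \<in> A \<inter> inside E S}\<^sup>*" by (simp add: C_def cluster_def conn_def)
    then show "x \<in> S" by (cases rule: rtranclE) (use o' in auto)
  qed
  have noC: "\<not> conn_to ?A' v B" if v: "v \<in> C" for v
  proof
    assume "conn_to ?A' v B"
    then obtain b where b: "b \<in> B" "(v, b) \<in> {(x, y). {x, y} \<in> ?A'}\<^sup>*" by (auto simp: conn_to_def conn_def)
    from b(2) show False
    proof (cases rule: converse_rtranclE)
      case base
      then show ?thesis using v b CS SB by auto
    next
      case (step y)
      then show ?thesis using v by auto
    qed
  qed
  obtain b where b: "b \<in> B" "(o', b) \<in> conn A" using c unfolding conn_to_def by blast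
  have "conn_to ?A' o' B \<or> (\<exists>x y. x \<in> C \<and> y \<notin> C \<and> {x, y} \<in> A \<and> conn_to ?A' y B)"
    using b(2) unfolding conn_def
  proof (induction rule: converse_rtrancl_induct)
    case base
    show ?case by (rule disjI1) (rule conn_to_self[OF b(1)])
  next
    case (step y z)
    then have yz: "{y, z} \<in> A" by simp
    from step.IH show ?case
    proof (elim disjE)
      assume z: "conn_to ?A' z B"
      then have zC: "z \<notin> C" using noC by blast
      show ?thesis
      proof (cases "y \<in> C")
        case True
        then show ?thesis using yz zC z by (intro disjI2 exI[of _ y] exI[of _ z]) simp
      next
        case False
        then have "{y, z} \<in> ?A'" using yz zC by auto
        then have "conn_to ?A' y B" using z by (rule conn_to_step)
        then show ?thesis ..
      qed
    qed (rule disjI2)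
  qed
  moreover have "o' \<in> C" by (simp add: C_def cluster_def conn_def)
  ultimately obtain x y where xy: "x \<in> C" "y \<notin> C" "{x, y} \<in> A" "conn_to ?A' y B" using noC by blast
  have "y \<notin> S"
  proof
    assume "y \<in> S"
    then have "{x, y} \<in> A \<inter> inside E S" using xy CS A by auto
    then have 1: "(x, y) \<in> {(x, y). {x, y} \<in> A \<inter> inside E S}" by simp
    have "(o', x) \<in> {(x, y). {x, y} \<in> A \<inter> inside E S}\<^sup>*" using xy(1) by (simp add: C_def cluster_def conn_def)
    from rtrancl_into_rtrancl[OF this 1] have "y \<in> C" unfolding C_def cluster_def conn_def by simp
    then show False using xy(2) by simp
  qed
  then have "(x, y) \<in> bdry E S" using xy CS A by (auto simp: bdry_def)
  then show ?thesis using xy by blast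
qed

text \<open>A Simon-Lieb inequality, obtained from independence alone: for a given cluster C, the
  events that C is the cluster, that the exit edge is open, and that its outer end is joined to B
  off C depend on disjoint sets of edges. Summing over the C that contain x gives the connection
  probability inside S.\<close>

lemma cluster_decomposition:
  fixes E :: "'v set set"
  assumes fin: "finite E" and p: "0 \<le> p" "p \<le> 1" and o': "o' \<in> S" and SB: "S \<inter> B = {}" and m: "0 \<le> m"
    and le: "\<And>x y. (x, y) \<in> bdry E S \<Longrightarrow> bern p E (\<lambda>A. of_bool (conn_to A y B)) \<le> m"
  shows "bern p E (\<lambda>A. of_bool (conn_to A o' B))
    \<le> (\<Sum>(x, y)\<in>bdry E S. p * bern p (inside E S) (\<lambda>A. of_bool ((o', x) \<in> conn A))) * m"
proof -
  define Cl where "Cl A = cluster (A \<inter> inside E S) o'" for A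
  define Cs where "Cs = Cl ` Pow E"
  have finC: "finite Cs" using fin by (simp add: Cs_def)
  define U where "U C A = (of_bool (Cl A = C) :: real)" for C A
  define W where "W C y A = (of_bool (conn_to {e \<in> A. e \<inter> C = {}} y B) :: real)" for C y A
  define Op where "Op x y A = (of_bool ({x, y} \<in> A) :: real)" for x y :: 'v and A
  define T where "T x y A = (\<Sum>C\<in>{C\<in>Cs. x \<in> C}. U C A * (Op x y A * W C y A))" for x y A
  have point: "of_bool (conn_to A o' B) \<le> (\<Sum>(x, y)\<in>bdry E S. T x y A)" if A: "A \<subseteq> E" for A
  proof (cases "conn_to A o' B")
    case True
    obtain x y where xy: "(x, y) \<in> bdry E S" "x \<in> Cl A" "{x, y} \<in> A" "conn_to {e \<in> A. e \<inter> Cl A = {}} y B"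
      using exit_cluster[OF A o' SB True] unfolding Cl_def by blast
    have "1 = U (Cl A) A * (Op x y A * W (Cl A) y A)" using xy by (simp add: U_def Op_def W_def)
    also have "\<dots> \<le> T x y A" unfolding T_def
      using xy A finC by (intro member_le_sum) (auto simp: U_def Op_def W_def Cs_def)
    also have "T x y A = T (fst (x, y)) (snd (x, y)) A" by simp
    also have "\<dots> \<le> (\<Sum>z\<in>bdry E S. T (fst z) (snd z) A)"
    proof (rule member_le_sum[OF xy(1) _ finite_bdry[OF fin]])
      fix z show "0 \<le> T (fst z) (snd z) A" unfolding T_def
        by (intro sum_nonneg) (simp add: U_def Op_def W_def)
    qed
    finally show ?thesis using True by (simp add: case_prod_beta)
  next
    case False
    then show ?thesis by (auto simp: T_def U_def Op_def W_def intro!: sum_nonneg)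
  qed
  have prob: "bern p E (\<lambda>A. U C A * (Op x y A * W C y A)) \<le> bern p E (U C) * (p * m)"
    if xy: "(x, y) \<in> bdry E S" and xC: "x \<in> C" for x y C
  proof -
    define E1 where "E1 = {e \<in> inside E S. e \<inter> C \<noteq> {}}"
    define E2 where "E2 = {e \<in> E. e \<inter> C = {}}"
    define u where "u A = (of_bool (cluster A o' = C) :: real)" for A
    have U: "U C A = u (A \<inter> E1)" if "A \<subseteq> E" for A
    proof -
      have "{e \<in> A \<inter> inside E S. e \<inter> C \<noteq> {}} = A \<inter> E1" by (auto simp: E1_def)
      then show ?thesis using cluster_touching[of "A \<inter> inside E S" o' C] by (simp add: U_def u_def Cl_def)
    qed
    have W: "W C y A = W C y (A \<inter> E2)" if "A \<subseteq> E" for A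
    proof -
      have "{e \<in> A. e \<inter> C = {}} = {e \<in> A \<inter> E2. e \<inter> C = {}}" using that by (auto simp: E2_def)
      then show ?thesis by (simp add: W_def)
    qed
    have xyE: "{x, y} \<in> E" "{x, y} \<notin> E1" "{x, y} \<notin> E2" using xy xC by (auto simp: bdry_def E1_def E2_def)
    have Op: "Op x y A = Op x y (A \<inter> {{x, y}})" for A by (simp add: Op_def)
    define R where "R = insert {x, y} E2"
    have RE: "R \<subseteq> E" "E1 \<inter> R = {}" using xyE by (auto simp: R_def E1_def E2_def)
    have "bern p E (\<lambda>A. U C A * (Op x y A * W C y A)) = bern p E (\<lambda>A. u (A \<inter> E1) * (\<lambda>A. Op x y A * W C y A) (A \<inter> R))"
    proof (rule bern_cong)
      fix A assume A: "A \<subseteq> E"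
      have "Op x y (A \<inter> R) = Op x y A" by (simp add: Op_def R_def)
      moreover have "W C y (A \<inter> R) = W C y A"
      proof -
        have "A \<inter> R \<inter> E2 = A \<inter> E2" by (auto simp: R_def)
        then show ?thesis using W[OF A] W[of "A \<inter> R"] A by auto
      qed
      ultimately show "U C A * (Op x y A * W C y A) = u (A \<inter> E1) * (\<lambda>A. Op x y A * W C y A) (A \<inter> R)"
        using U[OF A] by simp
    qed
    also have "\<dots> = bern p E (\<lambda>A. u (A \<inter> E1)) * bern p E (\<lambda>A. (\<lambda>A. Op x y A * W C y A) (A \<inter> R))"
      by (rule bern_indep[OF fin _ RE]) (auto simp: E1_def)
    also have "bern p E (\<lambda>A. u (A \<inter> E1)) = bern p E (U C)" using U by (intro bern_cong) simp
    also have "bern p E (\<lambda>A. (\<lambda>A. Op x y A * W C y A) (A \<inter> R)) = bern p E (\<lambda>A. Op x y (A \<inter> {{x, y}}) * W C y (A \<inter> E2))"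
    proof (rule bern_cong)
      fix A assume A: "A \<subseteq> E"
      have "A \<inter> R \<inter> E2 = A \<inter> E2" by (auto simp: R_def)
      then have "W C y (A \<inter> R) = W C y (A \<inter> E2)" using W[of "A \<inter> R"] A by auto
      then show "(\<lambda>A. Op x y A * W C y A) (A \<inter> R) = Op x y (A \<inter> {{x, y}}) * W C y (A \<inter> E2)"
        by (simp add: Op_def R_def)
    qed
    also have "\<dots> = bern p E (\<lambda>A. Op x y (A \<inter> {{x, y}})) * bern p E (\<lambda>A. W C y (A \<inter> E2))"
      by (rule bern_indep[OF fin]) (use xyE in \<open>auto simp: E2_def\<close>)
    also have "bern p E (\<lambda>A. Op x y (A \<inter> {{x, y}})) = bern p {{x, y}} (Op x y)"
      by (rule bern_marginal[OF fin]) (use xyE in auto)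
    also have "\<dots> = p" using bern_insert[of "{}" "{x, y}" p "Op x y"] by (simp add: Op_def)
    also have "bern p E (U C) * (p * bern p E (\<lambda>A. W C y (A \<inter> E2))) \<le> bern p E (U C) * (p * m)"
    proof (intro mult_left_mono)
      have "bern p E (\<lambda>A. W C y (A \<inter> E2)) \<le> bern p E (\<lambda>A. of_bool (conn_to A y B))"
      proof (rule bern_mono[OF p])
        fix A
        have "conn_to {e \<in> A \<inter> E2. e \<inter> C = {}} y B \<Longrightarrow> conn_to A y B" by (rule conn_to_mono[rotated]) auto
        then show "W C y (A \<inter> E2) \<le> of_bool (conn_to A y B)" by (auto simp: W_def)
      qed
      also have "\<dots> \<le> m" by (rule le[OF xy])
      finally show "bern p E (\<lambda>A. W C y (A \<inter> E2)) \<le> m" .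
    qed (use p in \<open>auto intro!: bern_nonneg simp: U_def\<close>)
    finally show ?thesis .
  qed
  have marg: "(\<Sum>C\<in>{C\<in>Cs. x \<in> C}. bern p E (U C)) = bern p (inside E S) (\<lambda>A. of_bool ((o', x) \<in> conn A))" for x
  proof -
    have "(\<Sum>C\<in>{C\<in>Cs. x \<in> C}. bern p E (U C)) = bern p E (\<lambda>A. \<Sum>C\<in>{C\<in>Cs. x \<in> C}. U C A)" by (simp add: bern_sum)
    also have "\<dots> = bern p E (\<lambda>A. (\<lambda>A. of_bool ((o', x) \<in> conn A)) (A \<inter> inside E S))"
    proof (rule bern_cong)
      fix A assume A: "A \<subseteq> E"
      have "(\<Sum>C\<in>{C\<in>Cs. x \<in> C}. U C A) = (\<Sum>C\<in>{C\<in>Cs. x \<in> C}. if C = Cl A then 1 else 0)"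
        by (intro sum.cong) (auto simp: U_def)
      also have "\<dots> = of_bool (Cl A \<in> {C\<in>Cs. x \<in> C})" using finC by (subst sum.delta) auto
      also have "\<dots> = of_bool ((o', x) \<in> conn (A \<inter> inside E S))" using A by (auto simp: Cs_def Cl_def cluster_def)
      finally show "(\<Sum>C\<in>{C\<in>Cs. x \<in> C}. U C A) = (\<lambda>A. of_bool ((o', x) \<in> conn A)) (A \<inter> inside E S)" .
    qed
    also have "\<dots> = bern p (inside E S) (\<lambda>A. of_bool ((o', x) \<in> conn A))" by (rule bern_marginal[OF fin]) auto
    finally show ?thesis .
  qed
  have "bern p E (\<lambda>A. of_bool (conn_to A o' B)) \<le> bern p E (\<lambda>A. \<Sum>z\<in>bdry E S. T (fst z) (snd z) A)"
    using point by (intro bern_mono[OF p]) (simp add: case_prod_beta)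
  also have "\<dots> = (\<Sum>z\<in>bdry E S. \<Sum>C\<in>{C\<in>Cs. fst z \<in> C}. bern p E (\<lambda>A. U C A * (Op (fst z) (snd z) A * W C (snd z) A)))"
    by (simp add: bern_sum T_def)
  also have "\<dots> \<le> (\<Sum>z\<in>bdry E S. \<Sum>C\<in>{C\<in>Cs. fst z \<in> C}. bern p E (U C) * (p * m))"
    by (intro sum_mono prob) auto
  also have "\<dots> = (\<Sum>z\<in>bdry E S. (p * bern p (inside E S) (\<lambda>A. of_bool ((o', fst z) \<in> conn A))) * m)"
  proof (rule sum.cong[OF refl])
    fix z :: "'v \<times> 'v"
    show "(\<Sum>C\<in>{C\<in>Cs. fst z \<in> C}. bern p E (U C) * (p * m)) = (p * bern p (inside E S) (\<lambda>A. of_bool ((o', fst z) \<in> conn A))) * m"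
      unfolding sum_distrib_right[symmetric] marg by (simp only: mult_ac)
  qed
  also have "\<dots> = (\<Sum>(x, y)\<in>bdry E S. p * bern p (inside E S) (\<lambda>A. of_bool ((o', x) \<in> conn A))) * m"
    by (simp add: sum_distrib_right case_prod_beta)
  finally show ?thesis .
qed

text \<open>The quantity phi_p(S) of Duminil-Copin and Tassion: the mean number of open edges that
  lead out of S from vertices joined to v inside S.\<close>

definition exit_mean :: "real \<Rightarrow> 'v set set \<Rightarrow> 'v set \<Rightarrow> 'v \<Rightarrow> real" where
  "exit_mean p E S v = (\<Sum>(x, y)\<in>bdry E S. p * bern p (inside E S) (\<lambda>A. of_bool ((v, x) \<in> conn A)))"

text \<open>One exit from \<open>S v\<close> costs a factor \<rho> and gains at most L in height, so
  a gain of k * L takes k exits. Replacing LE by a finite subset E only lowers the exit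
  means.\<close>

lemma exponential_decay:
  fixes LE :: "'v set set" and ht :: "'v \<Rightarrow> int" and L :: int
  assumes p: "0 \<le> p" "p \<le> 1" and V: "\<Union>LE \<subseteq> V" and L: "0 < L" and r: "0 \<le> \<rho>"
    and S: "\<And>v. v \<in> V \<Longrightarrow> v \<in> S v \<and> finite (inside LE (S v)) \<and> finite (bdry LE (S v)) \<and>
      exit_mean p LE (S v) v \<le> \<rho> \<and> (\<forall>x\<in>S v. ht x < ht v + L) \<and> (\<forall>(x, y)\<in>bdry LE (S v). ht y \<le> ht v + L)"
    and E: "finite E" "E \<subseteq> LE" and v: "v \<in> V"
  shows "bern p E (\<lambda>A. of_bool (conn_to A v {z. ht v + int k * L \<le> ht z})) \<le> \<rho> ^ k"
  using v
proof (induction k arbitrary: v)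
  case 0
  show ?case using bern_le_1[OF p E(1), of "\<lambda>A. of_bool (conn_to A v {z. ht v + int 0 * L \<le> ht z})"] by simp
next
  case (Suc k)
  note Sv = S[OF Suc.prems]
  let ?B = "{z. ht v + int (Suc k) * L \<le> ht z}"
  have bd: "bdry E (S v) \<subseteq> bdry LE (S v)" using E by (auto simp: bdry_def)
  have "bern p E (\<lambda>A. of_bool (conn_to A v ?B))
      \<le> (\<Sum>(x, y)\<in>bdry E (S v). p * bern p (inside E (S v)) (\<lambda>A. of_bool ((v, x) \<in> conn A))) * \<rho> ^ k"
  proof (rule cluster_decomposition[OF E(1) p])
    have "0 \<le> int k * L" using L by simp
    then show "S v \<inter> ?B = {}" using Sv by (auto simp: algebra_simps)
    fix x y assume "(x, y) \<in> bdry E (S v)"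
    then have y: "y \<in> V" "ht y \<le> ht v + L" using bd Sv V by (auto simp: bdry_def)
    have sub: "?B \<subseteq> {z. ht y + int k * L \<le> ht z}" using y by (auto simp: algebra_simps)
    have "bern p E (\<lambda>A. of_bool (conn_to A y ?B)) \<le> bern p E (\<lambda>A. of_bool (conn_to A y {z. ht y + int k * L \<le> ht z}))"
    proof (rule bern_mono[OF p])
      fix A
      have "conn_to A y ?B \<Longrightarrow> conn_to A y {z. ht y + int k * L \<le> ht z}" using sub unfolding conn_to_def by blast
      then show "(of_bool (conn_to A y ?B) :: real) \<le> of_bool (conn_to A y {z. ht y + int k * L \<le> ht z})" by auto
    qed
    also have "\<dots> \<le> \<rho> ^ k" by (rule Suc.IH[OF y(1)])
    finally show "bern p E (\<lambda>A. of_bool (conn_to A y ?B)) \<le> \<rho> ^ k" .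
  qed (use Sv r in auto)
  also have "\<dots> \<le> \<rho> * \<rho> ^ k"
  proof (rule mult_right_mono)
    have "(\<Sum>(x, y)\<in>bdry E (S v). p * bern p (inside E (S v)) (\<lambda>A. of_bool ((v, x) \<in> conn A)))
       \<le> (\<Sum>(x, y)\<in>bdry E (S v). p * bern p (inside LE (S v)) (\<lambda>A. of_bool ((v, x) \<in> conn A)))"
      unfolding case_prod_beta using Sv p E conn_mono
      by (intro sum_mono mult_left_mono bern_mono_edges) (auto simp: of_bool_def)
    also have "\<dots> \<le> (\<Sum>(x, y)\<in>bdry LE (S v). p * bern p (inside LE (S v)) (\<lambda>A. of_bool ((v, x) \<in> conn A)))"
      unfolding case_prod_beta using Sv p bd by (intro sum_mono2) (auto intro!: mult_nonneg_nonneg bern_nonneg)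
    also have "\<dots> \<le> \<rho>" using Sv by (simp add: exit_mean_def)
    finally show "(\<Sum>(x, y)\<in>bdry E (S v). p * bern p (inside E (S v)) (\<lambda>A. of_bool ((v, x) \<in> conn A))) \<le> \<rho>" .
  qed (use r in simp)
  finally show ?case by simp
qed

text \<open>Opening closed edges independently with probability \<open>s\<close> opens a prescribed set of at most
  \<open>k\<close> edges with probability at least \<open>s ^ k\<close>.\<close>

lemma few_closed_edges:
  assumes E: "finite E" and p: "0 \<le> p" "p \<le> 1" and s: "0 \<le> s" "s \<le> 1"
  shows "bern p E (\<lambda>A. of_bool (\<exists>R\<subseteq>E. card R \<le> k \<and> conn_to (A \<union> R) v B)) * s ^ k
    \<le> bern (p + s - p * s) E (\<lambda>A. of_bool (conn_to A v B))"
proof -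
  have "bern p E (\<lambda>A. of_bool (\<exists>R\<subseteq>E. card R \<le> k \<and> conn_to (A \<union> R) v B)) * s ^ k
      = bern p E (\<lambda>A. s ^ k * of_bool (\<exists>R\<subseteq>E. card R \<le> k \<and> conn_to (A \<union> R) v B))"
    by (simp only: bern_cmult mult.commute)
  also have "\<dots> \<le> bern p E (\<lambda>A. bern s E (\<lambda>R. of_bool (conn_to (A \<union> R) v B)))"
  proof (rule bern_mono[OF p])
    fix A
    show "s ^ k * of_bool (\<exists>R\<subseteq>E. card R \<le> k \<and> conn_to (A \<union> R) v B) \<le> bern s E (\<lambda>R. of_bool (conn_to (A \<union> R) v B))"
    proof (cases "\<exists>R\<subseteq>E. card R \<le> k \<and> conn_to (A \<union> R) v B")
      case True
      then obtain R where R: "R \<subseteq> E" "card R \<le> k" "conn_to (A \<union> R) v B" by blast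
      have "s ^ k \<le> s ^ card R" using R s by (intro power_decreasing) auto
      also have "\<dots> = bern s E (\<lambda>R'. of_bool (R \<subseteq> R'))" using bern_superset[OF E R(1)] by simp
      also have "\<dots> \<le> bern s E (\<lambda>R'. of_bool (conn_to (A \<union> R') v B))"
      proof (rule bern_mono[OF s])
        fix R'
        have "R \<subseteq> R' \<Longrightarrow> conn_to (A \<union> R') v B" using R(3) by (rule conn_to_mono[rotated]) auto
        then show "(of_bool (R \<subseteq> R') :: real) \<le> of_bool (conn_to (A \<union> R') v B)" by auto
      qed
      finally show ?thesis using True by simp
    next
      case False
      have "0 \<le> bern s E (\<lambda>R. of_bool (conn_to (A \<union> R) v B))" using s by (intro bern_nonneg) auto
      then show ?thesis by (simp only: False of_bool_eq mult_zero_right)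
    qed
  qed
  also have "\<dots> = bern (p + s - p * s) E (\<lambda>A. of_bool (conn_to A v B))" by (rule bern_convolution[OF E])
  finally show ?thesis .
qed

lemma bern_image:
  assumes "inj_on T E"
  shows "bern p (T ` E) f = bern p E (\<lambda>A. f (T ` A))"
proof -
  have inj: "inj_on ((`) T) (Pow E)" using assms by (rule inj_on_image_Pow)
  have "Pow (T ` E) = (`) T ` Pow E" by (rule image_Pow_surj[symmetric]) simp
  then have "bern p (T ` E) f = (\<Sum>A\<in>Pow E. p ^ card (T ` A) * (1 - p) ^ card (T ` E - T ` A) * f (T ` A))"
    unfolding bern_def by (simp add: sum.reindex[OF inj])
  also have "\<dots> = bern p E (\<lambda>A. f (T ` A))"
    unfolding bern_def
  proof (rule sum.cong[OF refl])
    fix A assume A: "A \<in> Pow E"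
    have "T ` E - T ` A = T ` (E - A)" using A assms by (simp add: inj_on_image_set_diff[of T E])
    then show "p ^ card (T ` A) * (1 - p) ^ card (T ` E - T ` A) * f (T ` A) = p ^ card A * (1 - p) ^ card (E - A) * f (T ` A)"
      using A assms by (simp add: card_image inj_on_subset[OF assms])
  qed
  finally show ?thesis .
qed

lemma conn_image:
  assumes "inj T"
  shows "(T x, T y) \<in> conn ((`) T ` A) \<longleftrightarrow> (x, y) \<in> conn A"
proof
  assume "(x, y) \<in> conn A"
  then show "(T x, T y) \<in> conn ((`) T ` A)" unfolding conn_def
  proof (induction rule: rtrancl_induct)
    case (step y z)
    have "T ` {y, z} \<in> (`) T ` A" using step by blast
    then have "(T y, T z) \<in> {(x, y). {x, y} \<in> (`) T ` A}" by simp
    then show ?case by (rule rtrancl_into_rtrancl[OF step(3)])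
  qed simp
next
  have "\<exists>y. z = T y \<and> (x, y) \<in> conn A" if "(T x, z) \<in> conn ((`) T ` A)" for z
    using that unfolding conn_def
  proof (induction rule: rtrancl_induct)
    case (step u z)
    then obtain y where y: "u = T y" "(x, y) \<in> {(x, y). {x, y} \<in> A}\<^sup>*" by blast
    obtain e where e: "e \<in> A" "{T y, z} = T ` e" using step(2) y by auto
    then have "z \<in> T ` e" by auto
    then obtain w where w: "w \<in> e" "z = T w" by auto
    have "T ` {y, w} = T ` e" using e w by simp
    then have "{y, w} = e" by (simp only: inj_image_eq_iff[OF assms])
    then have "(y, w) \<in> {(x, y). {x, y} \<in> A}" using e by auto
    then have "(x, w) \<in> {(x, y). {x, y} \<in> A}\<^sup>*" by (rule rtrancl_into_rtrancl[OF y(2)])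
    then show ?case using w by blast
  qed auto
  moreover assume "(T x, T y) \<in> conn ((`) T ` A)"
  ultimately obtain y' where "T y = T y'" "(x, y') \<in> conn A" by blast
  then show "(x, y) \<in> conn A" using injD[OF assms] by blast
qed

lemma exit_mean_image:
  assumes T: "inj T" and LE: "\<And>e. T ` e \<in> LE \<longleftrightarrow> e \<in> LE" and surj: "surj T"
  shows "exit_mean p LE (T ` S) (T v) = exit_mean p LE S v"
    "bdry LE (T ` S) = map_prod T T ` bdry LE S" "inside LE (T ` S) = (`) T ` inside LE S"
proof -
  have ex: "\<exists>x. z = T x" for z using surj by (metis surjD)
  show ins: "inside LE (T ` S) = (`) T ` inside LE S"
  proof (intro set_eqI iffI)
    fix e assume e: "e \<in> inside LE (T ` S)"
    then obtain e' where e': "e = T ` e'" "e' \<subseteq> S" by (auto simp: subset_image_iff)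
    then show "e \<in> (`) T ` inside LE S" using e LE by auto
  qed (use LE in auto)
  show bd: "bdry LE (T ` S) = map_prod T T ` bdry LE S"
  proof (intro set_eqI iffI)
    fix z assume z: "z \<in> bdry LE (T ` S)"
    obtain x y where xy: "z = (T x, T y)" using ex[of "fst z"] ex[of "snd z"] by (metis prod.collapse)
    then have "(x, y) \<in> bdry LE S" using z LE[of "{x, y}"] T by (auto simp: bdry_def inj_image_mem_iff)
    then show "z \<in> map_prod T T ` bdry LE S" using xy by force
  next
    fix z assume "z \<in> map_prod T T ` bdry LE S"
    then obtain x y where "z = (T x, T y)" "(x, y) \<in> bdry LE S" by auto
    then show "z \<in> bdry LE (T ` S)" using LE[of "{x, y}"] T by (auto simp: bdry_def inj_image_mem_iff)
  qed
  have inj2: "inj_on (map_prod T T) (bdry LE S)" using T by (auto simp: inj_on_def)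
  have inj3: "inj_on ((`) T) (inside LE S)" using T by (auto simp: inj_on_def inj_image_eq_iff)
  show "exit_mean p LE (T ` S) (T v) = exit_mean p LE S v"
    unfolding exit_mean_def bd ins by (simp add: sum.reindex[OF inj2] case_prod_beta bern_image[OF inj3] conn_image[OF T])
qed

section \<open>Subcritical percolation on the lattice\<close>

text \<open>The bridge from independent variables to \<open>bern\<close>. It serves bond percolation
  with T = {True} and edge weights with T = {..c}.\<close>

lemma (in prob_space) expectation_open_set:
  fixes X :: "'e \<Rightarrow> 'a \<Rightarrow> 'b"
  assumes ind: "indep_vars (\<lambda>_. N) X I" and E: "finite E" "E \<subseteq> I" and T: "T \<in> sets N"
    and q: "\<And>e. e \<in> E \<Longrightarrow> prob (X e -` T \<inter> space M) = q"
  shows "expectation (\<lambda>x. g {e \<in> E. X e x \<in> T}) = bern q E g"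
    and "(\<lambda>x. g {e \<in> E. X e x \<in> T} :: real) \<in> borel_measurable M"
proof -
  have rv: "X e \<in> measurable M N" if "e \<in> E" for e using ind E that by (auto simp: indep_vars_def)
  define Q where "Q A = {x \<in> space M. {e \<in> E. X e x \<in> T} = A}" for A
  define B where "B A e = (if e \<in> A then T else space N - T)" for A :: "'e set" and e
  have BN: "B A e \<in> sets N" for A e using T by (auto simp: B_def)
  have Q: "Q A = space M \<inter> (\<Inter>e\<in>E. X e -` B A e \<inter> space M)" if "A \<subseteq> E" for A
    using that measurable_space[OF rv] by (auto simp: Q_def B_def split: if_splits)
  have "Q A \<in> events" if "A \<subseteq> E" for A
    unfolding Q[OF that] using E BN rv
    by (cases "E = {}") (auto intro!: sets.Int sets.finite_INT measurable_sets)
  have probQ: "prob (Q A) = q ^ card A * (1 - q) ^ card (E - A)" if A: "A \<subseteq> E" for A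
  proof (cases "E = {}")
    case True
    then have "Q A = space M" using A by (auto simp: Q_def)
    then show ?thesis using True A prob_space by simp
  next
    case False
    have "Q A = (\<Inter>e\<in>E. X e -` B A e \<inter> space M)" using Q[OF A] False by auto
    then have "prob (Q A) = (\<Prod>e\<in>E. prob (X e -` B A e \<inter> space M))"
      using indep_varsD[OF ind False E] BN by simp
    also have "\<dots> = (\<Prod>e\<in>E. if e \<in> A then q else 1 - q)"
    proof (rule prod.cong[OF refl])
      fix e assume e: "e \<in> E"
      show "prob (X e -` B A e \<inter> space M) = (if e \<in> A then q else 1 - q)"
      proof (cases "e \<in> A")
        case False
        have "X e -` B A e \<inter> space M = space M - (X e -` T \<inter> space M)"
          using False measurable_space[OF rv[OF e]] by (auto simp: B_def)
        then show ?thesis using False q[OF e] measurable_sets[OF rv[OF e] T] by (simp add: prob_compl)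
      qed (use q[OF e] in \<open>simp add: B_def\<close>)
    qed
    also have "\<dots> = (\<Prod>e\<in>A. q) * (\<Prod>e\<in>E - A. 1 - q)"
      using E A by (subst prod.If_cases) (auto intro!: arg_cong2[of _ _ _ _ "(*)"] prod.cong simp: Int_absorb1 Diff_eq)
    finally show ?thesis by simp
  qed
  have eq: "g {e \<in> E. X e x \<in> T} = (\<Sum>A\<in>Pow E. g A * indicator (Q A) x)" if "x \<in> space M" for x
  proof -
    let ?A = "{e \<in> E. X e x \<in> T}"
    have "(\<Sum>A\<in>Pow E. g A * indicator (Q A) x) = (\<Sum>A\<in>{?A}. g A * indicator (Q A) x)"
      using E by (intro sum.mono_neutral_right) (auto simp: Q_def indicator_def)
    also have "\<dots> = g ?A" using that by (simp add: Q_def)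
    finally show ?thesis by simp
  qed
  have [measurable]: "Q A \<in> events" if "A \<in> Pow E" for A using that \<open>\<And>A. A \<subseteq> E \<Longrightarrow> Q A \<in> events\<close> by auto
  show "(\<lambda>x. g {e \<in> E. X e x \<in> T} :: real) \<in> borel_measurable M"
    by (subst measurable_cong[OF eq]) (auto intro!: borel_measurable_sum)
  have "expectation (\<lambda>x. g {e \<in> E. X e x \<in> T}) = expectation (\<lambda>x. \<Sum>A\<in>Pow E. g A * indicator (Q A) x)"
    by (intro Bochner_Integration.integral_cong refl eq)
  also have "\<dots> = (\<Sum>A\<in>Pow E. g A * prob (Q A))"
    by (subst Bochner_Integration.integral_sum) (auto intro!: integrable_mult_right simp: less_top[symmetric])
  also have "\<dots> = bern q E g" unfolding bern_def by (intro sum.cong) (auto simp: probQ)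
  finally show "expectation (\<lambda>x. g {e \<in> E. X e x \<in> T}) = bern q E g" .
qed

lemma indep_vars_PiM_components:
  assumes "\<And>i. prob_space (N i)" "I \<noteq> {}"
  shows "prob_space.indep_vars (PiM I N) N (\<lambda>i u. u i) I"
proof -
  interpret P: prob_space "PiM I N" using assms by (intro prob_space_PiM)
  show ?thesis
  proof (subst P.indep_vars_iff_distr_eq_PiM')
    have "distr (PiM I N) (PiM I N) (\<lambda>x. \<lambda>i\<in>I. x i) = distr (PiM I N) (PiM I N) (\<lambda>x. x)"
      by (intro distr_cong) (auto simp: space_PiM PiE_def extensional_restrict)
    also have "\<dots> = PiM I N" by (rule distr_id2) simp
    also have "\<dots> = PiM I (\<lambda>i. distr (PiM I N) (N i) (\<lambda>u. u i))"
      using assms by (intro PiM_cong refl) (simp add: distr_PiM_component)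
    finally show "distr (PiM I N) (PiM I N) (\<lambda>x. \<lambda>i\<in>I. x i) = PiM I (\<lambda>i. distr (PiM I N) (N i) (\<lambda>u. u i))" .
  qed (use assms in auto)
qed

section \<open>Edges and paths of the lattice\<close>

lemma path_edges_single [simp]: "path_edges [x] = []"
  by (simp add: path_edges_def)

lemma path_edges_Cons [simp]: "path_edges (x # y # ys) = {x, y} # path_edges (y # ys)"
  by (simp add: path_edges_def)

lemma path_edges_append:
  "xs \<noteq> [] \<Longrightarrow> ys \<noteq> [] \<Longrightarrow> path_edges (xs @ ys) = path_edges xs @ {last xs, hd ys} # path_edges ys"
proof (induction xs)
  case (Cons x xs)
  show ?case
  proof (cases xs)
    case Nil
    then show ?thesis using Cons by (cases ys) auto
  next
    case (Cons a list)
    then show ?thesis using Cons.IH Cons.prems by simp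
  qed
qed simp

lemma adjacent_sym: "adjacent d x y = adjacent d y x"
  by (simp add: adjacent_def abs_minus_commute)

lemma adjacent_coord: "adjacent d x y \<Longrightarrow> i < d \<Longrightarrow> \<bar>x i - y i\<bar> \<le> 1"
  unfolding adjacent_def using member_le_sum[of i "{..<d}" "\<lambda>i. \<bar>x i - y i\<bar>"] by auto

lemma adjacent_irrefl [simp]: "\<not> adjacent d x x"
  by (simp add: adjacent_def)

lemma lattice_edges_iff: "{x, y} \<in> lattice_edges d \<longleftrightarrow> x \<in> Zd d \<and> y \<in> Zd d \<and> adjacent d x y"
  unfolding lattice_edges_def using adjacent_sym[of d] by (auto simp: doubleton_eq_iff)

lemma lattice_edgesE:
  assumes "e \<in> lattice_edges d"
  obtains x y where "e = {x, y}" "x \<in> Zd d" "y \<in> Zd d" "adjacent d x y"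
  using assms unfolding lattice_edges_def by auto

lemma Union_lattice_edges: "\<Union>(lattice_edges d) \<subseteq> Zd d"
  by (auto simp: lattice_edges_def)

lemma finite_window: "finite {x \<in> Zd d. \<forall>i<d. l i \<le> x i \<and> x i \<le> u i}"
proof -
  let ?W = "{x \<in> Zd d. \<forall>i<d. l i \<le> x i \<and> x i \<le> u i}"
  have "?W \<subseteq> (\<lambda>f i. if i < d then f i else 0) ` (PiE {..<d} (\<lambda>i. {l i..u i}))"
  proof
    fix x assume x: "x \<in> ?W"
    then have "x = (\<lambda>i. if i < d then restrict x {..<d} i else 0)" by (auto simp: Zd_def)
    moreover have "restrict x {..<d} \<in> PiE {..<d} (\<lambda>i. {l i..u i})" using x by auto
    ultimately show "x \<in> (\<lambda>f i. if i < d then f i else 0) ` (PiE {..<d} (\<lambda>i. {l i..u i}))" by blast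
  qed
  then show ?thesis by (rule finite_subset) (intro finite_imageI finite_PiE, auto)
qed

lemma countable_Zd: "countable (Zd d)"
proof -
  have "Zd d \<subseteq> (\<Union>n::nat. {x \<in> Zd d. \<forall>i<d. - int n \<le> x i \<and> x i \<le> int n})"
  proof
    fix x assume x: "x \<in> Zd d"
    have "\<forall>i<d. - int (nat (\<Sum>i<d. \<bar>x i\<bar>)) \<le> x i \<and> x i \<le> int (nat (\<Sum>i<d. \<bar>x i\<bar>))"
    proof (intro allI impI)
      fix i assume "i < d"
      then have "\<bar>x i\<bar> \<le> (\<Sum>i<d. \<bar>x i\<bar>)" by (intro member_le_sum) auto
      then show "- int (nat (\<Sum>i<d. \<bar>x i\<bar>)) \<le> x i \<and> x i \<le> int (nat (\<Sum>i<d. \<bar>x i\<bar>))" by auto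
    qed
    with x show "x \<in> (\<Union>n::nat. {x \<in> Zd d. \<forall>i<d. - int n \<le> x i \<and> x i \<le> int n})" by blast
  qed
  then show ?thesis
    by (rule countable_subset) (auto intro!: countable_UN countable_finite[OF finite_window])
qed

lemma countable_lattice_edges: "countable (lattice_edges d)"
proof -
  have "lattice_edges d \<subseteq> (\<lambda>(x, y). {x, y}) ` (Zd d \<times> Zd d)" by (auto simp: lattice_edges_def)
  then show ?thesis by (rule countable_subset) (intro countable_image countable_SIGMA countable_Zd)
qed

lemma finite_inside: "finite S \<Longrightarrow> finite (inside E S)"
  by (rule finite_subset[of _ "Pow S"]) auto

lemma finite_bdry_lattice:
  assumes "finite S"
  shows "finite (bdry (lattice_edges d) S)"
proof -
  have "bdry (lattice_edges d) S \<subseteq> (SIGMA x:S. {y \<in> Zd d. \<forall>i<d. x i - 1 \<le> y i \<and> y i \<le> x i + 1})"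
    using adjacent_coord by (fastforce simp: bdry_def lattice_edges_iff abs_le_iff)
  then show ?thesis by (rule finite_subset) (intro finite_SigmaI assms finite_window)
qed

lemma conn_lattice_path:
  assumes "A \<subseteq> inside (lattice_edges d) S" "x \<in> S" "(x, y) \<in> conn A"
  shows "\<exists>xs. lattice_path d S xs \<and> hd xs = x \<and> last xs = y \<and> set (path_edges xs) \<subseteq> A"
  using assms(3) unfolding conn_def
proof (induction rule: rtrancl_induct)
  case base
  show ?case using assms(2) by (intro exI[of _ "[x]"]) (simp add: lattice_path_def)
next
  case (step y z)
  then obtain xs where xs: "lattice_path d S xs" "hd xs = x" "last xs = y" "set (path_edges xs) \<subseteq> A" by blast
  have yz: "{y, z} \<in> A" using step by simp
  then have "adjacent d y z" "z \<in> S" using assms(1) by (auto simp: lattice_edges_iff)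
  then show ?case using xs yz
    by (intro exI[of _ "xs @ [z]"]) (auto simp: lattice_path_def successively_append_iff path_edges_append)
qed

lemma lattice_path_conn:
  assumes "successively (adjacent d) xs" "xs \<noteq> []"
  shows "(hd xs, last xs) \<in> conn (set (path_edges xs))"
  using assms
proof (induction xs)
  case (Cons x xs)
  show ?case
  proof (cases xs)
    case Nil
    then show ?thesis by (simp add: conn_def)
  next
    case (Cons y ys)
    then have "(y, last xs) \<in> conn (set (path_edges xs))" using Cons.IH Cons.prems by simp
    then have "(y, last xs) \<in> conn (set (path_edges (x # xs)))"
      using conn_mono[of "set (path_edges xs)" "set (path_edges (x # xs))"] unfolding Cons path_edges_Cons list.set by blast
    moreover have "{x, y} \<in> set (path_edges (x # xs))" using Cons by simp
    ultimately show ?thesis using Cons by (auto simp: conn_def intro: converse_rtrancl_into_rtrancl)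
  qed
qed simp

lemma path_edges_inside:
  assumes "lattice_path d S xs" "S \<subseteq> Zd d"
  shows "set (path_edges xs) \<subseteq> inside (lattice_edges d) S"
proof -
  have "successively (adjacent d) xs \<Longrightarrow> set xs \<subseteq> S \<Longrightarrow> set (path_edges xs) \<subseteq> inside (lattice_edges d) S"
  proof (induction xs)
    case (Cons x xs)
    then show ?case using assms(2) by (cases xs) (auto simp: lattice_edges_iff path_edges_def)
  qed (simp add: path_edges_def)
  then show ?thesis using assms(1) by (simp add: lattice_path_def)
qed

section \<open>Finite sets with exit mean below one\<close>

definition window :: "nat \<Rightarrow> nat \<Rightarrow> vertex set" where
  "window d n = {x \<in> Zd d. \<forall>i<d. - int n \<le> x i \<and> x i \<le> int n}"

definition window_bdry :: "nat \<Rightarrow> nat \<Rightarrow> vertex set" where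
  "window_bdry d n = {x \<in> window d n. \<exists>i<d. \<bar>x i\<bar> = int n}"

lemma finite_vertex_window: "finite (window d n)"
  unfolding window_def by (rule finite_window)

lemma origin_Zd: "axis_point 0 \<in> Zd d"
  by (simp add: axis_point_def Zd_def)

lemma open_cluster_conn:
  "open_cluster d h (axis_point 0) = {y. (axis_point 0, y) \<in> conn {e \<in> lattice_edges d. h e}}"
proof (intro set_eqI iffI)
  fix y assume "y \<in> open_cluster d h (axis_point 0)"
  then obtain xs where xs: "lattice_path d (Zd d) xs" "hd xs = axis_point 0" "last xs = y" "\<forall>e\<in>set (path_edges xs). h e"
    by (auto simp: open_cluster_def)
  then have "set (path_edges xs) \<subseteq> {e \<in> lattice_edges d. h e}" using path_edges_inside[OF xs(1)] by auto
  moreover have "(axis_point 0, y) \<in> conn (set (path_edges xs))"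
    using lattice_path_conn[of d xs] xs by (auto simp: lattice_path_def)
  ultimately show "y \<in> {y. (axis_point 0, y) \<in> conn {e \<in> lattice_edges d. h e}}" using conn_mono by blast
next
  fix y assume "y \<in> {y. (axis_point 0, y) \<in> conn {e \<in> lattice_edges d. h e}}"
  then have y: "(axis_point 0, y) \<in> conn {e \<in> lattice_edges d. h e}" by simp
  have "{e \<in> lattice_edges d. h e} \<subseteq> inside (lattice_edges d) (Zd d)" using Union_lattice_edges by auto
  from conn_lattice_path[OF this origin_Zd y] show "y \<in> open_cluster d h (axis_point 0)"
    unfolding open_cluster_def by blast
qed

text \<open>If the exit means of all finite sets were at least one at some parameter, then the differential
  inequality would bound the probability of reaching distance \<open>n\<close> from below, uniformly in \<open>n\<close>, at
  every larger parameter.\<close>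

lemma subcritical_exit_mean:
  assumes d: "d \<ge> 1" and p: "0 \<le> p" "p < p'" "p' \<le> 1" and theta: "percolation_prob d p' = 0"
  shows "\<exists>S. finite S \<and> S \<subseteq> Zd d \<and> axis_point 0 \<in> S \<and> exit_mean p (lattice_edges d) S (axis_point 0) < 1"
proof (rule ccontr)
  let ?LE = "lattice_edges d" and ?o = "axis_point 0"
  assume no: "\<not> ?thesis"
  define c where "c = 1 - exp (- (p' - p))"
  have c: "c > 0" using p by (simp add: c_def)
  define P where "P = bond_percolation d p'"
  define x1 :: vertex where "x1 = axis_point 1"
  have e1: "{?o, x1} \<in> ?LE"
  proof -
    have "(\<Sum>i<d. \<bar>?o i - x1 i\<bar>) = (\<Sum>i\<in>{0}. \<bar>?o i - x1 i\<bar>)"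
      using d by (intro sum.mono_neutral_right) (auto simp: axis_point_def x1_def)
    also have "\<dots> = 1" by (simp add: axis_point_def x1_def)
    finally show ?thesis using d by (auto simp: lattice_edges_iff adjacent_def Zd_def axis_point_def x1_def)
  qed
  interpret P: prob_space P unfolding P_def bond_percolation_def by (intro prob_space_PiM measure_pmf.prob_space_axioms)
  define N where "N = measure_pmf (bernoulli_pmf p')"
  have PN: "P = PiM ?LE (\<lambda>_. N)" by (simp add: P_def bond_percolation_def N_def)
  have ind: "P.indep_vars (\<lambda>_. N) (\<lambda>e h. h e) ?LE"
    unfolding PN by (intro indep_vars_PiM_components) (use e1 in \<open>auto simp: N_def intro: measure_pmf.prob_space_axioms\<close>)
  have T: "{True} \<in> sets N" by (simp add: N_def)
  have pe: "P.prob ((\<lambda>h. h e) -` {True} \<inter> space P) = p'" if "e \<in> ?LE" for e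
  proof -
    have "distr P N (\<lambda>h. h e) = N" unfolding PN
      using that by (intro distr_PiM_component) (auto simp: N_def intro: measure_pmf.prob_space_axioms)
    then have "P.prob ((\<lambda>h. h e) -` {True} \<inter> space P) = measure N {True}"
      using that by (subst measure_distr[of "\<lambda>h. h e" P N "{True}", symmetric]) (auto simp: PN N_def)
    also have "\<dots> = p'" using p by (simp add: N_def measure_pmf_single)
    finally show ?thesis .
  qed
  define E where "E n = inside ?LE (window d n)" for n
  have finE: "finite (E n)" for n unfolding E_def by (rule finite_inside[OF finite_vertex_window])
  define G where "G n = {h \<in> space P. conn_to {e \<in> E n. h e} ?o (window_bdry d n)}" for n
  have meas: "{h \<in> space P. Q {e \<in> E'. h e}} \<in> P.events" if "finite E'" "E' \<subseteq> ?LE" for E' Q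
  proof -
    have "(\<lambda>h. of_bool (Q {e \<in> E'. h e \<in> {True}}) :: real) \<in> borel_measurable P"
      by (rule P.expectation_open_set(2)[OF ind that T, where g = "\<lambda>A. of_bool (Q A)"]) (use pe that in auto)
    then have "(\<lambda>h. of_bool (Q {e \<in> E'. h e \<in> {True}}) :: real) -` {1} \<inter> space P \<in> P.events" by (rule measurable_sets) simp
    also have "(\<lambda>h. of_bool (Q {e \<in> E'. h e \<in> {True}}) :: real) -` {1} \<inter> space P = {h \<in> space P. Q {e \<in> E'. h e}}"
      by auto
    finally show ?thesis .
  qed
  have Gm: "G n \<in> P.events" for n unfolding G_def by (rule meas[OF finE]) (auto simp: E_def)
  have Gp: "c \<le> P.prob (G n)" if n: "n \<ge> 1" for n
  proof -
    have "c \<le> bern p' (E n) (\<lambda>A. of_bool (conn_to A ?o (window_bdry d n)))"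
      unfolding c_def
    proof (rule dct_lower_bound[OF finE finite_vertex_window[of d n]])
      fix S assume S: "S \<subseteq> window d n" "?o \<in> S" "S \<inter> window_bdry d n = {}"
      have fS: "finite S" using S(1) finite_vertex_window by (rule finite_subset)
      have near: "y \<in> window d n" if xy: "x \<in> S" "{x, y} \<in> ?LE" for x y
      proof -
        have "- int n \<le> y i \<and> y i \<le> int n" if i: "i < d" for i
        proof -
          have xw: "x \<in> window d n" "x \<notin> window_bdry d n" using S xy by auto
          then have "- int n \<le> x i" "x i \<le> int n" using i by (auto simp: window_def)
          moreover have "\<bar>x i\<bar> \<noteq> int n" using xw i by (auto simp: window_bdry_def)
          moreover have "\<bar>x i - y i\<bar> \<le> 1" using xy(2) i by (auto simp: lattice_edges_iff intro: adjacent_coord)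
          ultimately show ?thesis by linarith
        qed
        then show ?thesis using xy(2) by (simp add: window_def lattice_edges_iff)
      qed
      \<comment> \<open>S stays off the boundary of the window, so all its neighbours are in the
        window, and the exits from S are the same as in the whole lattice.\<close>
      have b: "bdry (E n) S = bdry ?LE S" using near S by (auto simp: bdry_def E_def)
      have i: "inside (E n) S = inside ?LE S" using S by (auto simp: E_def)
      have "1 \<le> exit_mean p ?LE S ?o" using no fS S by (auto simp: window_def not_less)
      also have "\<dots> \<le> (\<Sum>(x, y)\<in>bdry ?LE S. bern p (inside ?LE S) (\<lambda>A. of_bool ((?o, x) \<in> conn A)))"
        unfolding exit_mean_def case_prod_beta using p
        by (intro sum_mono mult_left_le_one_le bern_nonneg) auto
      finally show "1 \<le> (\<Sum>(x, y)\<in>bdry (E n) S. bern p (inside (E n) S) (\<lambda>A. of_bool ((?o, x) \<in> conn A)))"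
        unfolding b i .
    next
      show "?o \<in> window d n" by (auto simp: window_def axis_point_def Zd_def)
    qed (use p in \<open>auto simp: E_def\<close>)
    also have "\<dots> = P.expectation (\<lambda>h. of_bool (conn_to {e \<in> E n. h e \<in> {True}} ?o (window_bdry d n)))"
      by (rule P.expectation_open_set(1)[OF ind finE _ T, symmetric, where g = "\<lambda>A. of_bool (conn_to A ?o (window_bdry d n))"]) (auto simp: E_def pe)
    also have "\<dots> = P.expectation (indicator (G n))"
      by (intro Bochner_Integration.integral_cong) (auto simp: G_def indicator_def)
    also have "\<dots> = P.prob (G n)" using Gm by simp
    finally show ?thesis .
  qed
  \<comment> \<open>The decreasing limit of these unions, the event that G n occurs for arbitrarily
    large n, inherits the lower bound c.\<close>
  define U where "U m = (\<Union>n\<in>{Suc m..}. G n)" for m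
  have Um: "U m \<in> P.events" for m unfolding U_def using Gm by auto
  have "decseq U" unfolding U_def decseq_def by fastforce
  have "(\<lambda>m. P.prob (U m)) \<longlonglongrightarrow> P.prob (\<Inter>m. U m)"
    using Um \<open>decseq U\<close> by (intro P.finite_Lim_measure_decseq) auto
  moreover have "c \<le> P.prob (U m)" for m
  proof -
    have "c \<le> P.prob (G (Suc m))" by (rule Gp) simp
    also have "\<dots> \<le> P.prob (U m)" using Um by (intro P.finite_measure_mono) (auto simp: U_def)
    finally show ?thesis .
  qed
  ultimately have cU: "c \<le> P.prob (\<Inter>m. U m)" by (intro LIMSEQ_le_const) auto
  define Inf_ev where "Inf_ev = {h \<in> space P. infinite (open_cluster d h ?o)}"
  have sub: "(\<Inter>m. U m) \<subseteq> Inf_ev"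
  proof
    fix h assume h: "h \<in> (\<Inter>m. U m)"
    then have "h \<in> U 0" by blast
    then have sp: "h \<in> space P" by (auto simp: U_def G_def)
    have "infinite (open_cluster d h ?o)"
    proof
      assume fin: "finite (open_cluster d h ?o)"
      define m where "m = nat (Max ((\<lambda>(x, i). \<bar>x i\<bar>) ` (insert ?o (open_cluster d h ?o) \<times> {..<d})))"
      have bound: "\<bar>x i\<bar> \<le> int m" if "x \<in> open_cluster d h ?o" "i < d" for x i
      proof -
        have "\<bar>x i\<bar> \<le> Max ((\<lambda>(x, i). \<bar>x i\<bar>) ` (insert ?o (open_cluster d h ?o) \<times> {..<d}))"
          using fin that by (intro Max_ge) force+
        then show ?thesis unfolding m_def by linarith
      qed
      obtain n where n: "n \<ge> Suc m" "h \<in> G n" using h unfolding U_def by blast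
      then obtain y where y: "y \<in> window_bdry d n" "(?o, y) \<in> conn {e \<in> E n. h e}"
        by (auto simp: G_def conn_to_def)
      have "(?o, y) \<in> conn {e \<in> ?LE. h e}" using y(2) conn_mono[of "{e \<in> E n. h e}" "{e \<in> ?LE. h e}"] by (auto simp: E_def)
      then have "y \<in> open_cluster d h ?o" by (simp add: open_cluster_conn)
      moreover obtain i where "i < d" "\<bar>y i\<bar> = int n" using y by (auto simp: window_bdry_def)
      ultimately show False using bound[of y i] n by simp
    qed
    then show "h \<in> Inf_ev" using sp by (simp add: Inf_ev_def)
  qed
  \<comment> \<open>\<open>percolation_prob\<close> is the measure of this set, and comparing it
    with that of a subset requires the set to be measurable. That the cluster is infinite is
    expressed through the countably many finite subsets of the lattice.\<close>
  have "Inf_ev \<in> P.events"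
  proof -
    have ev: "{h \<in> space P. y \<in> open_cluster d h ?o} \<in> P.events" for y
    proof -
      define PS where "PS = {xs. lattice_path d (Zd d) xs \<and> hd xs = ?o \<and> last xs = y}"
      have "PS \<subseteq> lists (Zd d)" by (auto simp: PS_def lattice_path_def)
      then have cPS: "countable PS" using countable_lists[OF countable_Zd] countable_subset by blast
      have "{h \<in> space P. \<forall>e\<in>set (path_edges xs). h e} \<in> P.events" if "xs \<in> PS" for xs
      proof -
        have "set (path_edges xs) \<subseteq> ?LE" using that path_edges_inside[of d "Zd d" xs] by (auto simp: PS_def)
        then have "{h \<in> space P. {e \<in> set (path_edges xs). h e} = set (path_edges xs)} \<in> P.events" by (intro meas) auto
        then show ?thesis by (rule back_subst[of "\<lambda>S. S \<in> P.events"]) auto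
      qed
      then have "{h \<in> space P. \<exists>xs\<in>PS. \<forall>e\<in>set (path_edges xs). h e} \<in> P.events"
        by (rule sets.sets_Collect_countable_Ex'[OF _ cPS])
      then show ?thesis by (rule back_subst[of "\<lambda>S. S \<in> P.events"]) (auto simp: PS_def open_cluster_def)
    qed
    have OZ: "open_cluster d h ?o \<subseteq> Zd d" for h
      using last_in_set by (fastforce simp: open_cluster_def lattice_path_def)
    have "infinite (open_cluster d h ?o) \<longleftrightarrow> (\<forall>F\<in>{F. finite F \<and> F \<subseteq> Zd d}. \<exists>y\<in>Zd d - F. y \<in> open_cluster d h ?o)" for h
    proof
      assume inf: "infinite (open_cluster d h ?o)"
      have "\<exists>y\<in>Zd d - F. y \<in> open_cluster d h ?o" if "finite F" for F
        using finite_subset[of "open_cluster d h ?o" F] that inf OZ[of h] by blast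
      then show "\<forall>F\<in>{F. finite F \<and> F \<subseteq> Zd d}. \<exists>y\<in>Zd d - F. y \<in> open_cluster d h ?o" by blast
    qed (use OZ[of h] in blast)
    then have "Inf_ev = {h \<in> space P. \<forall>F\<in>{F. finite F \<and> F \<subseteq> Zd d}. \<exists>y\<in>Zd d - F. y \<in> open_cluster d h ?o}"
      by (simp add: Inf_ev_def)
    also have "\<dots> \<in> P.events"
      by (intro sets.sets_Collect_countable_All' sets.sets_Collect_countable_Ex' ev countable_Collect_finite_subset
          countable_Diff countable_Zd)
    finally show ?thesis .
  qed
  then have "P.prob (\<Inter>m. U m) \<le> P.prob Inf_ev" using sub by (intro P.finite_measure_mono)
  moreover have "P.prob Inf_ev = 0" using theta by (simp add: percolation_prob_def Inf_ev_def P_def)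
  ultimately show False using cU c by linarith
qed

lemma subcritical_exists:
  assumes "d \<ge> 1" "0 \<le> p" "p < p_crit d"
  shows "\<exists>S. finite S \<and> S \<subseteq> Zd d \<and> axis_point 0 \<in> S \<and> exit_mean p (lattice_edges d) S (axis_point 0) < 1"
proof -
  let ?T = "{p \<in> {0..1}. percolation_prob d p = 0}"
  \<comment> \<open>At parameter 0 almost surely no edge is open, so the supremum in
    \<open>p_crit\<close> is not that of the empty set.\<close>
  have "?T \<noteq> {}"
  proof
    assume "?T = {}"
    show False
    proof (cases "percolation_prob d 0 = 0")
      case True
      then show ?thesis using \<open>?T = {}\<close> by auto
    next
      case False
      let ?P = "bond_percolation d 0"
      interpret prob_space ?P unfolding bond_percolation_def by (intro prob_space_PiM measure_pmf.prob_space_axioms)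
      have "AE h in ?P. \<forall>e\<in>lattice_edges d. \<not> h e"
      proof (subst AE_ball_countable[OF countable_lattice_edges], intro ballI)
        fix e assume e: "e \<in> lattice_edges d"
        show "AE h in ?P. \<not> h e" unfolding bond_percolation_def
          by (rule AE_PiM_component[OF measure_pmf.prob_space_axioms e]) (auto simp: AE_measure_pmf_iff set_pmf_iff)
      qed
      then have "AE h in ?P. \<not> infinite (open_cluster d h (axis_point 0))"
      proof eventually_elim
        case (elim h)
        then have e: "{e \<in> lattice_edges d. h e} = {}" by auto
        have "open_cluster d h (axis_point 0) = {axis_point 0}"
          unfolding open_cluster_conn e by (auto simp: conn_def)
        then show ?case by simp
      qed
      then have "percolation_prob d 0 = 0" unfolding percolation_prob_def by (rule prob_eq_0_AE)
      then show ?thesis using False by simp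
    qed
  qed
  moreover have "bdd_above ?T" by (rule bdd_aboveI[of _ 1]) auto
  ultimately obtain p' where "p' \<in> ?T" "p < p'" using assms(3) less_cSup_iff[of ?T p] by (auto simp: p_crit_def)
  then show ?thesis using subcritical_exit_mean[OF assms(1,2), of p'] by auto
qed

section \<open>Sums of independent variables, and thresholds for the weights\<close>

lemma (in prob_space) indep_var_disjoint_functions:
  assumes ind: "indep_vars (\<lambda>_. borel) X I" and E: "E1 \<inter> E2 = {}" "E1 \<subseteq> I" "E2 \<subseteq> I"
    and f: "f1 \<in> borel_measurable (PiM E1 (\<lambda>_. borel))" "f2 \<in> borel_measurable (PiM E2 (\<lambda>_. borel))"
  shows "indep_var borel (\<lambda>x. f1 (\<lambda>e\<in>E1. X e x)) borel (\<lambda>x. f2 (\<lambda>e\<in>E2. X e x))"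
  using indep_var_compose[OF indep_var_restrict[OF ind E] f] by (simp add: comp_def)

text \<open>Adding one variable to a partial sum S multiplies the \<open>psi\<close>-moment by at
  most 1 + c / N and adds a term of order N^(p-2): \<open>g \<bar>S\<bar>\<close> is at most N^(p-2)
  for |S| \<le> N, and at most psi(S) / (lowc N) beyond. After N steps this is exp c times N^(p-1).
  The order is weaker than in Rosenthal's inequality, and it is the one from which the exponent of
  the theorem is computed.\<close>

lemma (in prob_space) sum_tail_moment:
  fixes p m \<sigma> :: real
  assumes p: "2 < p"
  shows "\<exists>K>0. \<forall>(Z :: 'i \<Rightarrow> 'a \<Rightarrow> real) E. finite E \<longrightarrow> E \<noteq> {} \<longrightarrow> indep_vars (\<lambda>_. borel) Z E \<longrightarrow>
     (\<forall>e\<in>E. integrable M (Z e) \<and> expectation (Z e) = 0 \<and> integrable M (\<lambda>x. (Z e x)^2) \<and> expectation (\<lambda>x. (Z e x)^2) \<le> \<sigma> \<and>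
        integrable M (\<lambda>x. \<bar>Z e x\<bar> powr p) \<and> expectation (\<lambda>x. \<bar>Z e x\<bar> powr p) \<le> m) \<longrightarrow>
     integrable M (\<lambda>x. \<bar>\<Sum>e\<in>E. Z e x\<bar> powr p) \<and> expectation (\<lambda>x. \<bar>\<Sum>e\<in>E. Z e x\<bar> powr p) \<le> K * real (card E) powr (p - 1)"
proof -
  define g where "g = (\<lambda>u::real. u powr (p - 2))"
  obtain psi psi' where y: "young g psi psi' (2 powr (p - 2))"
  proof (rule young_exists[of g "2 powr (p - 2)"])
    show "isCont (\<lambda>x. g \<bar>x\<bar>) x" for x
      unfolding g_def isCont_def using p by (intro tendsto_powr' tendsto_intros) (auto intro!: always_eventually)
  qed (use p in \<open>auto simp: g_def powr_mult intro!: powr_mono2\<close>)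
  interpret young g psi psi' "2 powr (p - 2)" by (rule y)
  have w: "x^2 * g \<bar>x\<bar> = \<bar>x\<bar> powr p" for x
  proof (cases "x = 0")
    case False
    have "\<bar>x\<bar> powr p = \<bar>x\<bar> powr 2 * \<bar>x\<bar> powr (p - 2)" using powr_add[of "\<bar>x\<bar>" 2 "p - 2"] by simp
    then show ?thesis using False by (simp add: g_def)
  qed (use p in simp)
  have up: "psi x \<le> \<bar>x\<bar> powr p" for x using psi_upper[of x] w by simp
  have low: "lowc * \<bar>x\<bar> powr p \<le> psi x" for x using psi_lower[of x] w by simp
  obtain C where C: "C > 0" and step: "\<forall>(M :: 'a measure) X Y. prob_space M \<longrightarrow> prob_space.indep_var M borel X borel Y \<longrightarrow>
     integrable M (\<lambda>x. psi (X x)) \<longrightarrow> integrable M (\<lambda>x. psi (Y x)) \<longrightarrow>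
     integrable M Y \<longrightarrow> (\<integral>x. Y x \<partial>M) = 0 \<longrightarrow> integrable M (\<lambda>x. (Y x)^2) \<longrightarrow>
     (\<integral>x. psi (X x + Y x) \<partial>M) \<le> (\<integral>x. psi (X x) \<partial>M)
        + C * ((\<integral>x. g \<bar>X x\<bar> \<partial>M) * (\<integral>x. (Y x)^2 \<partial>M) + (\<integral>x. psi (Y x) \<partial>M))"
    using expectation_one_sided by blast
  define s where "s = max 0 \<sigma>"
  define c where "c = C * s / lowc"
  define b where "b = C * (s + max 0 m)"
  have c: "0 \<le> c" "0 \<le> b" "0 \<le> s" using C lowc_pos by (auto simp: c_def b_def s_def)
  define K where "K = exp c * b / lowc + 1"
  have K: "K > 0" using c lowc_pos by (simp add: K_def add_nonneg_pos)
  show ?thesis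
  proof (intro exI[of _ K] conjI allI impI)
    fix Z :: "'i \<Rightarrow> 'a \<Rightarrow> real" and E0
    assume fin: "finite E0" and ne: "E0 \<noteq> {}" and ind: "indep_vars (\<lambda>_. borel) Z E0"
    assume Z: "\<forall>e\<in>E0. integrable M (Z e) \<and> expectation (Z e) = 0 \<and> integrable M (\<lambda>x. (Z e x)^2) \<and> expectation (\<lambda>x. (Z e x)^2) \<le> \<sigma> \<and>
        integrable M (\<lambda>x. \<bar>Z e x\<bar> powr p) \<and> expectation (\<lambda>x. \<bar>Z e x\<bar> powr p) \<le> m"
    define N where "N = real (card E0)"
    have N: "N \<ge> 1" using fin ne by (simp add: N_def Suc_le_eq card_gt_0_iff)
    define B where "B = b * N powr (p - 2)"
    have B: "0 \<le> B" using c by (simp add: B_def)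
    have mZ: "Z e \<in> borel_measurable M" if "e \<in> E0" for e using ind that by (auto simp: indep_vars_def)
    have mS: "(\<lambda>x. \<Sum>e\<in>E. Z e x) \<in> borel_measurable M" if "E \<subseteq> E0" for E using mZ that by (intro borel_measurable_sum) auto
    have ipsi: "integrable M (\<lambda>x. psi (Z e x))" if "e \<in> E0" for e
    proof (rule Bochner_Integration.integrable_bound)
      show "integrable M (\<lambda>x. \<bar>Z e x\<bar> powr p)" using Z that by blast
      show "(\<lambda>x. psi (Z e x)) \<in> borel_measurable M" using mZ[OF that] by measurable
    qed (use up psi_nonneg in auto)
    have main: "integrable M (\<lambda>x. psi (\<Sum>e\<in>E. Z e x)) \<and>
        expectation (\<lambda>x. psi (\<Sum>e\<in>E. Z e x)) \<le> (1 + c / N) ^ card E * real (card E) * B"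
      if "E \<subseteq> E0" for E
      using finite_subset[OF that fin] that
    proof (induction E rule: finite_induct)
      case empty
      then show ?case by (simp add: psi_0)
    next
      case (insert e E)
      define S where "S = (\<lambda>x. \<Sum>e\<in>E. Z e x)"
      have e: "e \<in> E0" and EE: "E \<subseteq> E0" using insert by auto
      have [measurable]: "S \<in> borel_measurable M" "Z e \<in> borel_measurable M"
        using mS[OF EE] mZ[OF e] by (auto simp: S_def)
      have IH: "integrable M (\<lambda>x. psi (S x))" "expectation (\<lambda>x. psi (S x)) \<le> (1 + c / N) ^ card E * real (card E) * B"
        using insert by (auto simp: S_def)
      have ii: "indep_var borel S borel (Z e)"
      proof -
        have "indep_var borel (\<lambda>x. (\<lambda>f. \<Sum>e\<in>E. f e) (\<lambda>e\<in>E. Z e x)) borel (\<lambda>x. (\<lambda>f. f e) (\<lambda>e\<in>{e}. Z e x))"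
          by (rule indep_var_disjoint_functions[OF ind]) (use insert in auto)
        then show ?thesis by (simp add: S_def cong: sum.cong)
      qed
      have sq: "expectation (\<lambda>x. (Z e x)^2) \<le> s" using Z e by (auto simp: s_def intro: order_trans)
      have zp: "expectation (\<lambda>x. psi (Z e x)) \<le> max 0 m"
      proof -
        have "expectation (\<lambda>x. psi (Z e x)) \<le> expectation (\<lambda>x. \<bar>Z e x\<bar> powr p)"
          using Z e up by (intro integral_mono ipsi) auto
        then show ?thesis using Z e by (auto intro: order_trans)
      qed
      have gS: "expectation (\<lambda>x. g \<bar>S x\<bar>) \<le> N powr (p - 2) + expectation (\<lambda>x. psi (S x)) / (lowc * N)"
      proof -
        have pw: "g \<bar>z\<bar> \<le> N powr (p - 2) + psi z / (lowc * N)" for z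
        proof (cases "\<bar>z\<bar> \<le> N")
          case True
          then have "g \<bar>z\<bar> \<le> N powr (p - 2)" unfolding g_def using p by (intro powr_mono2) auto
          then show ?thesis using psi_nonneg[of z] lowc_pos N by (simp add: add_increasing2)
        next
          case False
          have "N * g \<bar>z\<bar> \<le> z^2 * g \<bar>z\<bar>"
          proof (rule mult_right_mono)
            have "N * 1 \<le> \<bar>z\<bar> * \<bar>z\<bar>" using False N by (intro mult_mono) auto
            then show "N \<le> z^2" by (simp add: power2_eq_square)
          qed (simp add: g_def)
          then have "lowc * (N * g \<bar>z\<bar>) \<le> lowc * (z^2 * g \<bar>z\<bar>)" using lowc_pos by (intro mult_left_mono) auto
          also have "\<dots> \<le> psi z" by (rule psi_lower)
          finally have "g \<bar>z\<bar> \<le> psi z / (lowc * N)" using lowc_pos N by (simp add: field_simps)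
          then show ?thesis by (simp add: add_increasing)
        qed
        have "expectation (\<lambda>x. g \<bar>S x\<bar>) \<le> expectation (\<lambda>x. N powr (p - 2) + psi (S x) / (lowc * N))"
          using pw IH(1) by (intro integral_mono integrable_g(1)[OF prob_space_axioms]) auto
        also have "\<dots> = N powr (p - 2) + expectation (\<lambda>x. psi (S x)) / (lowc * N)"
          using IH(1) by (simp add: prob_space)
        finally show ?thesis .
      qed
      have P0: "0 \<le> expectation (\<lambda>x. psi (S x))" by (intro Bochner_Integration.integral_nonneg psi_nonneg)
      have N1: "1 \<le> N powr (p - 2)" using N p by (simp add: ge_one_powr_ge_zero)
      have "expectation (\<lambda>x. psi (S x + Z e x)) \<le> expectation (\<lambda>x. psi (S x))
          + C * (expectation (\<lambda>x. g \<bar>S x\<bar>) * expectation (\<lambda>x. (Z e x)^2) + expectation (\<lambda>x. psi (Z e x)))"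
        using Z e by (intro step[rule_format, OF prob_space_axioms ii IH(1) ipsi[OF e]]) auto
      also have "\<dots> \<le> expectation (\<lambda>x. psi (S x))
          + C * ((N powr (p - 2) + expectation (\<lambda>x. psi (S x)) / (lowc * N)) * s + max 0 m * N powr (p - 2))"
      proof (intro add_left_mono mult_left_mono add_mono mult_mono)
        show "expectation (\<lambda>x. psi (Z e x)) \<le> max 0 m * N powr (p - 2)"
          using zp N1 mult_left_mono[OF N1, of "max 0 m"] by linarith
      qed (use gS sq C N lowc_pos P0 in \<open>auto intro!: add_nonneg_nonneg\<close>)
      also have "\<dots> = (1 + c / N) * expectation (\<lambda>x. psi (S x)) + B"
        using N lowc_pos by (simp add: c_def B_def b_def field_simps)
      also have "\<dots> \<le> (1 + c / N) * ((1 + c / N) ^ card E * real (card E) * B) + (1 + c / N) ^ Suc (card E) * B"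
      proof (rule add_mono)
        have "1 \<le> (1 + c / N) ^ Suc (card E)" using c N by (intro one_le_power) simp
        then show "B \<le> (1 + c / N) ^ Suc (card E) * B" using B mult_right_mono[of 1 _ B] by simp
      qed (use IH c N in \<open>auto intro!: mult_left_mono\<close>)
      also have "\<dots> = (1 + c / N) ^ Suc (card E) * real (Suc (card E)) * B"
        unfolding power_Suc of_nat_Suc by (simp only: distrib_left distrib_right mult.assoc mult_1_left mult_1_right add.commute)
      finally have "expectation (\<lambda>x. psi (S x + Z e x)) \<le> (1 + c / N) ^ Suc (card E) * real (Suc (card E)) * B" .
      moreover have "integrable M (\<lambda>x. psi (S x + Z e x))" by (intro integrable_psi_add IH(1) ipsi[OF e]) auto
      ultimately show ?case using insert(1,2) by (simp add: S_def add.commute)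
    qed
    have ex: "(1 + c / N) ^ card E0 \<le> exp c"
    proof -
      have "(1 + c / N) ^ card E0 \<le> exp (c / N) ^ card E0" using c N by (intro power_mono exp_ge_add_one_self) auto
      also have "\<dots> = exp c" using N by (simp add: N_def flip: exp_of_nat_mult)
      finally show ?thesis .
    qed
    note m0 = main[OF subset_refl]
    have mSE: "(\<lambda>x. \<Sum>e\<in>E0. Z e x) \<in> borel_measurable M" by (rule mS) simp
    have i1: "integrable M (\<lambda>x. psi (\<Sum>e\<in>E0. Z e x) / lowc)" using m0 by simp
    have l2: "\<bar>z\<bar> powr p \<le> psi z / lowc" for z using low[of z] lowc_pos by (simp add: field_simps)
    show i2: "integrable M (\<lambda>x. \<bar>\<Sum>e\<in>E0. Z e x\<bar> powr p)"
    proof (rule Bochner_Integration.integrable_bound[OF i1])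
      show "AE x in M. norm (\<bar>\<Sum>e\<in>E0. Z e x\<bar> powr p) \<le> norm (psi (\<Sum>e\<in>E0. Z e x) / lowc)"
        using l2 order_trans[OF l2 abs_ge_self] by (intro AE_I2) simp
    qed (use mSE in measurable)
    have "expectation (\<lambda>x. \<bar>\<Sum>e\<in>E0. Z e x\<bar> powr p) \<le> expectation (\<lambda>x. psi (\<Sum>e\<in>E0. Z e x) / lowc)"
      using i1 i2 l2 by (intro integral_mono) auto
    also have "\<dots> = expectation (\<lambda>x. psi (\<Sum>e\<in>E0. Z e x)) / lowc" by simp
    also have "\<dots> \<le> (exp c * N * B) / lowc"
    proof (rule divide_right_mono)
      show "expectation (\<lambda>x. psi (\<Sum>e\<in>E0. Z e x)) \<le> exp c * N * B"
      proof -
        have "(1 + c / N) ^ card E0 * N * B \<le> exp c * N * B" using ex N B by (intro mult_right_mono) auto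
        then show ?thesis using m0 unfolding N_def by linarith
      qed
    qed (use lowc_pos in simp)
    also have "\<dots> = exp c * b / lowc * N powr (p - 1)"
    proof -
      have "N * N powr (p - 2) = N powr (p - 1)" using N powr_add[of N 1 "p - 2"] by simp
      then show ?thesis by (simp add: B_def)
    qed
    also have "\<dots> \<le> K * N powr (p - 1)" by (intro mult_right_mono) (auto simp: K_def)
    finally show "expectation (\<lambda>x. \<bar>\<Sum>e\<in>E0. Z e x\<bar> powr p) \<le> K * real (card E0) powr (p - 1)" by (simp add: N_def)
  qed (rule K)
qed

text \<open>Off the support every point has an open null neighbourhood, and by Lindelof's theorem
  countably many of these suffice.\<close>

lemma null_off_support:
  assumes "real_distribution F" "open U" "U \<inter> dist_support F = {}"
  shows "measure F U = 0"
proof -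
  interpret real_distribution F by fact
  have "\<forall>x\<in>U. \<exists>V. open V \<and> x \<in> V \<and> measure F V = 0"
  proof
    fix x assume "x \<in> U"
    then have "x \<notin> dist_support F" using assms by auto
    then obtain V where "open V" "x \<in> V" "\<not> measure F V > 0" by (auto simp: dist_support_def)
    then show "\<exists>V. open V \<and> x \<in> V \<and> measure F V = 0" by (metis measure_nonneg order_le_less)
  qed
  then obtain V where V: "\<And>x. x \<in> U \<Longrightarrow> open (V x) \<and> x \<in> V x \<and> measure F (V x) = 0" by metis
  obtain \<V> where \<V>: "\<V> \<subseteq> V ` U" "countable \<V>" "\<Union>\<V> = \<Union>(V ` U)"
    using Lindelof[of "V ` U"] V by auto
  have null: "W \<in> null_sets F" if "W \<in> \<V>" for W
    using that \<V>(1) V by (auto simp: null_sets_def emeasure_eq_measure)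
  have "(\<Union>W\<in>\<V>. W) \<in> null_sets F" by (rule null_sets_UN'[OF \<V>(2) null])
  then have W: "(\<Union>W\<in>\<V>. W) \<in> sets F" "measure F (\<Union>W\<in>\<V>. W) = 0" by (auto simp: null_sets_def emeasure_eq_measure)
  have "U \<subseteq> (\<Union>W\<in>\<V>. W)"
  proof
    fix x assume x: "x \<in> U"
    then have "x \<in> \<Union>(V ` U)" using V[OF x] by blast
    then show "x \<in> (\<Union>W\<in>\<V>. W)" unfolding \<V>(3)[symmetric] by simp
  qed
  then have "measure F U \<le> measure F (\<Union>W\<in>\<V>. W)" using W(1) by (rule finite_measure_mono)
  then show ?thesis using W(2) by (simp add: measure_le_0_iff)
qed

lemma nonneg_AE:
  assumes "nonneg_nondegenerate F"
  shows "AE x in F. 0 \<le> x"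
proof -
  have rd: "real_distribution F" and s: "dist_support F \<subseteq> {0..}" using assms by (auto simp: nonneg_nondegenerate_def)
  interpret real_distribution F by fact
  have "measure F {..<0} = 0" by (rule null_off_support[OF rd]) (use s in auto)
  then have "{..<0} \<in> null_sets F" by (auto simp: null_sets_def emeasure_eq_measure)
  then show ?thesis by (rule AE_I') auto
qed

lemma closed_dist_support: "closed (dist_support F)"
  unfolding closed_def
proof (subst open_subopen, rule ballI)
  fix x assume "x \<in> - dist_support F"
  then obtain U where U: "open U" "x \<in> U" "\<not> measure F U > 0" by (auto simp: dist_support_def)
  then have "U \<subseteq> - dist_support F" by (auto simp: dist_support_def)
  then show "\<exists>T. open T \<and> x \<in> T \<and> T \<subseteq> - dist_support F" using U by blast
qed

lemma smallest_support_point: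
  assumes "nonneg_nondegenerate F"
  shows "smallest_support_point F \<in> dist_support F" "0 \<le> smallest_support_point F"
    "x \<in> dist_support F \<Longrightarrow> smallest_support_point F \<le> x"
proof -
  have rd: "real_distribution F" and s: "dist_support F \<subseteq> {0..}" using assms by (auto simp: nonneg_nondegenerate_def)
  interpret real_distribution F by fact
  let ?S = "dist_support F"
  have ne: "?S \<noteq> {}"
  proof
    assume "?S = {}"
    then have "measure F UNIV = 0" by (intro null_off_support[OF rd]) auto
    then show False using prob_space by simp
  qed
  have bdd: "bdd_below ?S" using s by (intro bdd_belowI[of _ 0]) auto
  have "Inf ?S \<in> ?S" by (rule closed_contains_Inf[OF ne bdd closed_dist_support])
  then have e: "smallest_support_point F = Inf ?S"
    unfolding smallest_support_point_def using bdd by (intro Least_equality cInf_lower) auto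
  then show "smallest_support_point F \<in> ?S" using \<open>Inf ?S \<in> ?S\<close> by simp
  then show "0 \<le> smallest_support_point F" using s by auto
  show "smallest_support_point F \<le> x" if "x \<in> ?S" unfolding e using that bdd by (rule cInf_lower)
qed

text \<open>No mass lies below the smallest point of the support, so the value 1 would put all mass
  on that point, against nondegeneracy.\<close>

lemma cdf_smallest_support_point_less_1:
  assumes nn: "nonneg_nondegenerate F"
  shows "cdf F (smallest_support_point F) < 1"
proof (rule ccontr)
  have rd: "real_distribution F" using nn by (auto simp: nonneg_nondegenerate_def)
  interpret real_distribution F by fact
  define l where "l = smallest_support_point F"
  note sp = smallest_support_point[OF nn, folded l_def]
  assume "\<not> cdf F (smallest_support_point F) < 1"
  then have 1: "measure F {..l} = 1" using prob_le_1[of "{..l}"] unfolding cdf_def l_def by linarith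
  have "measure F {..<l} = 0"
  proof (rule null_off_support[OF rd])
    show "{..<l} \<inter> dist_support F = {}" using sp(3) by force
  qed auto
  moreover have "measure F {..l} = measure F {..<l} + measure F {l}"
  proof -
    have "{..l} = {..<l} \<union> {l}" by auto
    then show ?thesis using finite_measure_Union[of "{..<l}" "{l}"] by simp
  qed
  ultimately have "measure F {l} = 1" using 1 by simp
  then show False using nn by (auto simp: nonneg_nondegenerate_def)
qed

text \<open>Two thresholds, because lowering a heavy weight must save a fixed amount: weights above
  c2 are heavy, weights up to c occur with positive probability, and the saving is at least c2 - c.
  Right-continuity at the smallest point of the support leaves room for both.\<close>

lemma cdf_thresholds:
  assumes nn: "nonneg_nondegenerate F" and u: "cdf F (smallest_support_point F) < u"
  obtains c c2 where "0 \<le> c" "c < c2" "0 < cdf F c" "cdf F c2 < u"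
proof -
  have rd: "real_distribution F" using nn by (auto simp: nonneg_nondegenerate_def)
  interpret real_distribution F by fact
  define l where "l = smallest_support_point F"
  note sp = smallest_support_point[OF nn, folded l_def]
  have "(cdf F \<longlongrightarrow> cdf F l) (at_right l)" using cdf_is_right_cont[of l] by (simp add: continuous_within)
  then have "\<forall>\<^sub>F x in at_right l. cdf F x < u" using u by (intro order_tendstoD(2)) (auto simp: l_def)
  then obtain b where b: "b > l" "\<And>x. l < x \<Longrightarrow> x < b \<Longrightarrow> cdf F x < u"
    by (auto simp: eventually_at_right_field)
  obtain c2 where c2: "l < c2" "c2 < b" using dense[OF b(1)] by blast
  obtain c where c: "l < c" "c < c2" using dense[OF c2(1)] by blast
  have "0 < measure F {..<c}" using sp(1) c by (auto simp: dist_support_def)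
  also have "\<dots> \<le> cdf F c" unfolding cdf_def by (intro finite_measure_mono) auto
  finally show ?thesis using sp(2) b(2) c c2 by (intro that[of c c2]) auto
qed

section \<open>Lattice paths in slabs\<close>

definition slab :: "nat \<Rightarrow> int \<Rightarrow> nat \<Rightarrow> nat \<Rightarrow> vertex set" where
  "slab d a m h = {z \<in> cylinder d h. a \<le> z 0 \<and> z 0 \<le> a + int m}"

definition crossings :: "nat \<Rightarrow> int \<Rightarrow> nat \<Rightarrow> nat \<Rightarrow> vertex list set" where
  "crossings d a m h = {xs. lattice_path d (slab d a m h) xs \<and> hd xs 0 = a \<and> last xs 0 = a + int m}"

text \<open>One endpoint strictly inside is required, which excludes all edges of the slabs that end
  at layer a or begin at layer b.\<close>

definition gap_edges :: "nat \<Rightarrow> int \<Rightarrow> int \<Rightarrow> edge set" where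
  "gap_edges d a b = {e \<in> lattice_edges d. \<exists>z\<in>e. a < z 0 \<and> z 0 < b}"

lemma box_eq_slab: "box d n h = slab d 0 n h"
  by (simp add: box_def slab_def)

lemma cylinder_Zd: "cylinder d h \<subseteq> Zd d"
  by (auto simp: cylinder_def)

lemma slab_Zd: "slab d a m h \<subseteq> Zd d"
  by (auto simp: slab_def cylinder_def)

lemma finite_slab: "finite (slab d a m h)"
proof (rule finite_subset)
  show "finite {x \<in> Zd d. \<forall>i<d. (if i = 0 then a else - int h) \<le> x i \<and> x i \<le> (if i = 0 then a + int m else int h)}"
    by (rule finite_window)
  show "slab d a m h \<subseteq> {x \<in> Zd d. \<forall>i<d. (if i = 0 then a else - int h) \<le> x i \<and> x i \<le> (if i = 0 then a + int m else int h)}"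
  proof
    fix z assume z: "z \<in> slab d a m h"
    have "- int h \<le> z i \<and> z i \<le> int h" if "0 < i" "i < d" for i
    proof -
      have "\<bar>z i\<bar> \<le> int h" using z that by (auto simp: slab_def cylinder_def)
      then show ?thesis by linarith
    qed
    then show "z \<in> {x \<in> Zd d. \<forall>i<d. (if i = 0 then a else - int h) \<le> x i \<and> x i \<le> (if i = 0 then a + int m else int h)}"
      using z by (auto simp: slab_def cylinder_def)
  qed
qed

lemma path_edges_split: "path_edges (us @ v # vs) = path_edges (us @ [v]) @ path_edges (v # vs)"
  by (cases "us = []") (simp_all add: path_edges_append)

lemma path_weight_split: "path_weight u (us @ v # vs) = path_weight u (us @ [v]) + path_weight u (v # vs)"
  by (subst path_weight_def, subst path_edges_split) (simp add: path_weight_def)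

lemma path_edges_join:
  assumes "xs \<noteq> []" "ys \<noteq> []" "last xs = hd ys"
  shows "path_edges (xs @ tl ys) = path_edges xs @ path_edges ys"
proof -
  obtain us v where xs: "xs = us @ [v]" using assms(1) by (cases xs rule: rev_cases) auto
  obtain vs where ys: "ys = v # vs" using assms xs by (cases ys) auto
  show ?thesis unfolding xs ys using path_edges_split[of us v vs] by simp
qed

lemma path_weight_join:
  assumes "xs \<noteq> []" "ys \<noteq> []" "last xs = hd ys"
  shows "path_weight u (xs @ tl ys) = path_weight u xs + path_weight u ys"
  by (simp add: path_weight_def path_edges_join[OF assms])

lemma lattice_path_join:
  assumes "lattice_path d S xs" "lattice_path d S' ys" "S \<subseteq> U" "S' \<subseteq> U" "last xs = hd ys"
  shows "lattice_path d U (xs @ tl ys)" "hd (xs @ tl ys) = hd xs" "last (xs @ tl ys) = last ys"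
proof -
  obtain us v where xs: "xs = us @ [v]" using assms(1) by (cases xs rule: rev_cases) (auto simp: lattice_path_def)
  obtain vs where ys: "ys = v # vs" using assms(2,5) xs by (cases ys) (auto simp: lattice_path_def)
  show "lattice_path d U (xs @ tl ys)" using assms(1-4) unfolding xs ys
    by (cases vs) (auto simp: lattice_path_def successively_append_iff)
  show "hd (xs @ tl ys) = hd xs" unfolding xs ys by (cases us) auto
  show "last (xs @ tl ys) = last ys" unfolding xs ys by auto
qed

lemma path_weight_nonneg: "(\<And>e. 0 \<le> u e) \<Longrightarrow> 0 \<le> path_weight u xs"
  unfolding path_weight_def by (intro sum_list_nonneg) auto

lemma successively_ivt:
  assumes "successively (adjacent d) xs" "xs \<noteq> []" "d \<ge> 1" "hd xs 0 \<le> c" "c \<le> last xs 0"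
  shows "\<exists>u\<in>set xs. u 0 = c"
  using assms
proof (induction xs)
  case (Cons x xs)
  show ?case
  proof (cases "x 0 = c \<or> xs = []")
    case True
    then show ?thesis using Cons.prems by auto
  next
    case False
    then obtain y ys where xs: "xs = y # ys" by (cases xs) auto
    have "\<bar>x 0 - y 0\<bar> \<le> 1" using Cons.prems xs by (intro adjacent_coord[of d]) auto
    then have "hd xs 0 \<le> c" using False Cons.prems xs by auto
    moreover have "successively (adjacent d) xs" using Cons.prems xs by auto
    moreover have "c \<le> last xs 0" using Cons.prems xs by auto
    ultimately have "\<exists>u\<in>set xs. u 0 = c" using Cons.IH Cons.prems(3) xs by blast
    then show ?thesis by auto
  qed
qed simp

lemma first_hit:
  assumes "successively (adjacent d) xs" "xs \<noteq> []" "d \<ge> 1" "hd xs 0 \<le> c" "c \<le> last xs 0"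
  shows "\<exists>us v vs. xs = us @ v # vs \<and> v 0 = c \<and> (\<forall>u\<in>set us. u 0 < c)"
proof -
  have "\<exists>u\<in>set xs. u 0 = c" by (rule successively_ivt[OF assms])
  from split_list_first_prop[OF this] obtain us v vs
    where *: "xs = us @ v # vs" "v 0 = c" "\<forall>u\<in>set us. u 0 \<noteq> c" by blast
  have "u 0 < c" if u: "u \<in> set us" for u
  proof (rule ccontr)
    assume "\<not> u 0 < c"
    then have uc: "c \<le> u 0" by simp
    obtain us1 us2 where us: "us = us1 @ u # us2" using u by (auto simp: in_set_conv_decomp)
    have "successively (adjacent d) (us1 @ [u])" using assms(1) unfolding * us
      by (auto simp: successively_append_iff)
    moreover have "hd (us1 @ [u]) = hd xs" unfolding * us by (cases us1) auto
    ultimately have "\<exists>u'\<in>set (us1 @ [u]). u' 0 = c" using assms(3,4) uc by (intro successively_ivt[of d]) auto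
    then show False using *(3) us by auto
  qed
  then show ?thesis using * by blast
qed

lemma last_hit:
  assumes "successively (adjacent d) xs" "xs \<noteq> []" "d \<ge> 1" "hd xs 0 \<le> c" "c \<le> last xs 0"
  shows "\<exists>us v vs. xs = us @ v # vs \<and> v 0 = c \<and> (\<forall>u\<in>set vs. c < u 0)"
proof -
  have "\<exists>u\<in>set xs. u 0 = c" by (rule successively_ivt[OF assms])
  from split_list_last_prop[OF this] obtain us v vs
    where *: "xs = us @ v # vs" "v 0 = c" "\<forall>u\<in>set vs. u 0 \<noteq> c" by blast
  have "c < u 0" if u: "u \<in> set vs" for u
  proof (rule ccontr)
    assume "\<not> c < u 0"
    then have uc: "u 0 \<le> c" by simp
    obtain vs1 vs2 where vs: "vs = vs1 @ u # vs2" using u by (auto simp: in_set_conv_decomp)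
    have "successively (adjacent d) (u # vs2)" using assms(1) unfolding * vs
      by (auto simp: successively_append_iff successively_Cons)
    moreover have "last (u # vs2) = last xs" unfolding * vs by simp
    ultimately have "\<exists>u'\<in>set (u # vs2). u' 0 = c" using assms(3,5) uc by (intro successively_ivt[of d]) auto
    then show False using *(3) vs by auto
  qed
  then show ?thesis using * by blast
qed

lemma lattice_path_prefix: "lattice_path d S (us @ v # vs) \<Longrightarrow> lattice_path d S (us @ [v])"
  by (auto simp: lattice_path_def successively_append_iff)

lemma lattice_path_suffix: "lattice_path d S (us @ v # vs) \<Longrightarrow> lattice_path d S (v # vs)"
  by (auto simp: lattice_path_def successively_append_iff)

lemma lattice_path_subset: "lattice_path d S xs \<Longrightarrow> set xs \<subseteq> S' \<Longrightarrow> lattice_path d S' xs"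
  by (auto simp: lattice_path_def)

text \<open>Start at the last visit to layer a and stop at the first visit to layer a + m after it:
  in between the path leaves the slab on neither side.\<close>

lemma sub_crossing:
  assumes p: "lattice_path d (cylinder d h) xs" and d: "d \<ge> 1" and a: "hd xs 0 \<le> a" "a + int m \<le> last xs 0"
  shows "\<exists>ys\<in>crossings d a m h. set (path_edges ys) \<subseteq> set (path_edges xs) \<and>
    (\<forall>\<omega>. (\<forall>e. 0 \<le> \<omega> e) \<longrightarrow> path_weight \<omega> ys \<le> path_weight \<omega> xs)"
proof -
  have s: "successively (adjacent d) xs" "xs \<noteq> []" using p by (auto simp: lattice_path_def)
  obtain us v vs where 1: "xs = us @ v # vs" "v 0 = a" "\<forall>u\<in>set vs. a < u 0"
    using last_hit[OF s d, of a] a by auto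
  have p1: "lattice_path d (cylinder d h) (v # vs)" using p unfolding 1 by (rule lattice_path_suffix)
  then have s1: "successively (adjacent d) (v # vs)" by (auto simp: lattice_path_def)
  have "last (v # vs) = last xs" using 1 by simp
  then obtain us' v' vs' where 2: "v # vs = us' @ v' # vs'" "v' 0 = a + int m" "\<forall>u\<in>set us'. u 0 < a + int m"
    using first_hit[OF s1 _ d, of "a + int m"] a 1 by auto
  let ?ys = "us' @ [v']"
  have p2: "lattice_path d (cylinder d h) ?ys" using p1 unfolding 2 by (rule lattice_path_prefix)
  have "set ?ys \<subseteq> set (v # vs)" unfolding 2 by auto
  moreover have "\<forall>u\<in>set (v # vs). a \<le> u 0" using 1(2,3) by auto
  ultimately have low: "\<forall>u\<in>set ?ys. a \<le> u 0" by blast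
  have "set ?ys \<subseteq> slab d a m h"
    using low 2 p2 by (auto simp: slab_def lattice_path_def)
  then have "lattice_path d (slab d a m h) ?ys" using p2 lattice_path_subset by blast
  moreover have "hd ?ys = v" using 2(1) by (cases us') auto
  ultimately have "?ys \<in> crossings d a m h" using 1 2 by (simp add: crossings_def)
  moreover have "set (path_edges ?ys) \<subseteq> set (path_edges xs)"
  proof -
    have "set (path_edges (v # vs)) \<subseteq> set (path_edges xs)" unfolding 1 path_edges_split[of us v vs] by auto
    moreover have "set (path_edges ?ys) \<subseteq> set (path_edges (v # vs))" unfolding 2 path_edges_split[of us' v' vs'] by auto
    ultimately show ?thesis by blast
  qed
  moreover have "path_weight \<omega> ?ys \<le> path_weight \<omega> xs" if "\<forall>e. 0 \<le> \<omega> e" for \<omega>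
  proof -
    have "path_weight \<omega> xs = path_weight \<omega> (us @ [v]) + path_weight \<omega> (v # vs)" unfolding 1 by (rule path_weight_split)
    moreover have "path_weight \<omega> (v # vs) = path_weight \<omega> ?ys + path_weight \<omega> (v' # vs')" unfolding 2 by (rule path_weight_split)
    moreover have "0 \<le> path_weight \<omega> (us @ [v])" "0 \<le> path_weight \<omega> (v' # vs')" using that by (auto intro: path_weight_nonneg)
    ultimately show ?thesis by linarith
  qed
  ultimately show ?thesis by blast
qed

text \<open>The cut is the first visit to layer a + m1. The part before it contains a crossing of
  the first slab and the part after it one of the second, even if the path returns to the first slab
  in the meantime.\<close>

lemma crossing_superadditive:
  assumes xs: "xs \<in> crossings d a m h" and d: "d \<ge> 1" and m: "m1 + m2 \<le> m"
  shows "\<exists>ys\<in>crossings d a m1 h. \<exists>zs\<in>crossings d (a + int m - int m2) m2 h.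
    \<forall>\<omega>. (\<forall>e. 0 \<le> \<omega> e) \<longrightarrow> path_weight \<omega> ys + path_weight \<omega> zs \<le> path_weight \<omega> xs"
proof -
  have p: "lattice_path d (slab d a m h) xs" and e: "hd xs 0 = a" "last xs 0 = a + int m" using xs by (auto simp: crossings_def)
  then have pc: "lattice_path d (cylinder d h) xs" by (auto simp: lattice_path_def slab_def)
  have s: "successively (adjacent d) xs" "xs \<noteq> []" using p by (auto simp: lattice_path_def)
  obtain us v vs where 1: "xs = us @ v # vs" "v 0 = a + int m1" "\<forall>u\<in>set us. u 0 < a + int m1"
    using first_hit[OF s d, of "a + int m1"] e m by auto
  have p1: "lattice_path d (cylinder d h) (us @ [v])" using pc unfolding 1 by (rule lattice_path_prefix)
  have p2: "lattice_path d (cylinder d h) (v # vs)" using pc unfolding 1 by (rule lattice_path_suffix)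
  have "hd (us @ [v]) = hd xs" unfolding 1 by (cases us) auto
  then obtain ys where ys: "ys \<in> crossings d a m1 h" "\<forall>\<omega>. (\<forall>e. 0 \<le> \<omega> e) \<longrightarrow> path_weight \<omega> ys \<le> path_weight \<omega> (us @ [v])"
    using sub_crossing[OF p1 d, of a m1] e 1 by auto
  have "last (v # vs) = last xs" unfolding 1 by simp
  then obtain zs where zs: "zs \<in> crossings d (a + int m - int m2) m2 h" "\<forall>\<omega>. (\<forall>e. 0 \<le> \<omega> e) \<longrightarrow> path_weight \<omega> zs \<le> path_weight \<omega> (v # vs)"
    using sub_crossing[OF p2 d, of "a + int m - int m2" m2] e 1 m by auto
  show ?thesis
  proof (intro bexI[OF _ ys(1)] bexI[OF _ zs(1)] allI impI)
    fix \<omega> :: "edge \<Rightarrow> real" assume "\<forall>e. 0 \<le> \<omega> e"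
    then have "path_weight \<omega> ys \<le> path_weight \<omega> (us @ [v])" "path_weight \<omega> zs \<le> path_weight \<omega> (v # vs)" using ys zs by auto
    then show "path_weight \<omega> ys + path_weight \<omega> zs \<le> path_weight \<omega> xs" unfolding 1 path_weight_split[of \<omega> us v vs] by linarith
  qed
qed

text \<open>Moving one coordinate at a time towards y keeps the path in the box spanned by its
  endpoints, hence in every cylinder and between any two layers that contain them.\<close>

lemma hull_path:
  assumes "x \<in> Zd d" "y \<in> Zd d"
  shows "\<exists>xs. successively (adjacent d) xs \<and> xs \<noteq> [] \<and> hd xs = x \<and> last xs = y \<and>
    length xs = Suc (nat (\<Sum>i<d. \<bar>x i - y i\<bar>)) \<and>
    (\<forall>z\<in>set xs. z \<in> Zd d \<and> (\<forall>i. min (x i) (y i) \<le> z i \<and> z i \<le> max (x i) (y i)))"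
proof -
  have "\<exists>xs. successively (adjacent d) xs \<and> xs \<noteq> [] \<and> hd xs = x \<and> last xs = y \<and>
    length xs = Suc k \<and> (\<forall>z\<in>set xs. z \<in> Zd d \<and> (\<forall>i. min (x i) (y i) \<le> z i \<and> z i \<le> max (x i) (y i)))"
    if "(\<Sum>i<d. \<bar>x i - y i\<bar>) = int k" "x \<in> Zd d" for k x
    using that
  proof (induction k arbitrary: x)
    case 0
    have "\<forall>i\<in>{..<d}. \<bar>x i - y i\<bar> = 0"
      using 0(1) sum_nonneg_eq_0_iff[of "{..<d}" "\<lambda>i. \<bar>x i - y i\<bar>"] by simp
    then have "x i = y i" for i using 0(2) assms(2) by (cases "i < d") (auto simp: Zd_def)
    then have "x = y" by auto
    then show ?case using 0(2) by (intro exI[of _ "[x]"]) auto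
  next
    case (Suc k)
    have "\<exists>i<d. x i \<noteq> y i"
    proof (rule ccontr)
      assume "\<not> ?thesis"
      then have "(\<Sum>i<d. \<bar>x i - y i\<bar>) = 0" by (intro sum.neutral) auto
      then show False using Suc(2) by simp
    qed
    then obtain i where i: "i < d" "x i \<noteq> y i" by blast
    define x' where "x' = x(i := x i + sgn (y i - x i))"
    have x': "x' i = x i + sgn (y i - x i)" "\<And>j. j \<noteq> i \<Longrightarrow> x' j = x j" by (auto simp: x'_def)
    have zd: "x' \<in> Zd d" using Suc(3) i by (auto simp: Zd_def x'_def)
    have st: "\<bar>x' i - y i\<bar> = \<bar>x i - y i\<bar> - 1" using i by (auto simp: x'(1) sgn_if)
    have "(\<Sum>j<d. \<bar>x' j - y j\<bar>) = \<bar>x' i - y i\<bar> + (\<Sum>j\<in>{..<d} - {i}. \<bar>x' j - y j\<bar>)"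
      using i by (intro sum.remove) auto
    also have "(\<Sum>j\<in>{..<d} - {i}. \<bar>x' j - y j\<bar>) = (\<Sum>j\<in>{..<d} - {i}. \<bar>x j - y j\<bar>)"
      by (intro sum.cong) (auto simp: x'(2))
    also have "\<bar>x' i - y i\<bar> + (\<Sum>j\<in>{..<d} - {i}. \<bar>x j - y j\<bar>) = (\<Sum>j<d. \<bar>x j - y j\<bar>) - 1"
      using i st by (subst sum.remove[of "{..<d}" i "\<lambda>j. \<bar>x j - y j\<bar>"]) auto
    finally have "(\<Sum>j<d. \<bar>x' j - y j\<bar>) = int k" using Suc(2) by simp
    from Suc.IH[OF this zd] obtain xs where xs: "successively (adjacent d) xs" "xs \<noteq> []" "hd xs = x'" "last xs = y"
      "length xs = Suc k" "\<forall>z\<in>set xs. z \<in> Zd d \<and> (\<forall>i. min (x' i) (y i) \<le> z i \<and> z i \<le> max (x' i) (y i))" by blast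
    have adj: "adjacent d x x'"
    proof -
      have "(\<Sum>j<d. \<bar>x j - x' j\<bar>) = (\<Sum>j\<in>{i}. \<bar>x j - x' j\<bar>)"
        using i by (intro sum.mono_neutral_right) (auto simp: x'(2))
      also have "\<dots> = 1" using i by (auto simp: x'(1) sgn_if)
      finally show ?thesis by (simp add: adjacent_def)
    qed
    have hull: "min (x j) (y j) \<le> min (x' j) (y j) \<and> max (x' j) (y j) \<le> max (x j) (y j)" for j
      using i by (cases "j = i") (auto simp: x' sgn_if)
    have "\<forall>z\<in>set (x # xs). z \<in> Zd d \<and> (\<forall>i. min (x i) (y i) \<le> z i \<and> z i \<le> max (x i) (y i))"
    proof
      fix z assume "z \<in> set (x # xs)"
      then consider "z = x" | "z \<in> set xs" by auto
      then show "z \<in> Zd d \<and> (\<forall>i. min (x i) (y i) \<le> z i \<and> z i \<le> max (x i) (y i))"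
      proof cases
        case 2
        then show ?thesis using xs(6) hull by (meson order_trans)
      qed (use Suc(3) in auto)
    qed
    moreover have "successively (adjacent d) (x # xs)" using xs adj by (cases xs) auto
    ultimately show ?case using xs by (intro exI[of _ "x # xs"]) auto
  qed
  from this[of x "nat (\<Sum>i<d. \<bar>x i - y i\<bar>)"] show ?thesis using assms(1) by (simp add: sum_nonneg)
qed

lemma length_path_edges: "length (path_edges xs) = length xs - 1"
  by (simp add: path_edges_def)

text \<open>A step into layer x 0 + 1, a path within this layer to the transverse position of y, and
  a straight segment to y. Each of these edges has an endpoint strictly inside the gap, which is why
  the gap has width at least two.\<close>

lemma connecting_path:
  assumes x: "x \<in> cylinder d h" and y: "y \<in> cylinder d h" and xy: "x 0 + 2 \<le> y 0" and d: "d \<ge> 1"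
  shows "\<exists>xs. lattice_path d {z \<in> cylinder d h. x 0 \<le> z 0 \<and> z 0 \<le> y 0} xs \<and> hd xs = x \<and> last xs = y \<and>
    set (path_edges xs) \<subseteq> gap_edges d (x 0) (y 0) \<and> length (path_edges xs) \<le> 2 * h * d + nat (y 0 - x 0)"
proof -
  define u where "u = x(0 := x 0 + 1)"
  define v where "v = y(0 := x 0 + 1)"
  have cyl: "z \<in> cylinder d h \<Longrightarrow> z(0 := k) \<in> cylinder d h" for z k using d by (auto simp: cylinder_def Zd_def)
  have uc: "u \<in> cylinder d h" and vc: "v \<in> cylinder d h" using cyl x y by (auto simp: u_def v_def)
  have Z: "x \<in> Zd d" "y \<in> Zd d" "u \<in> Zd d" "v \<in> Zd d" using x y uc vc cylinder_Zd by auto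
  obtain P where P: "successively (adjacent d) P" "P \<noteq> []" "hd P = u" "last P = v"
    "length P = Suc (nat (\<Sum>i<d. \<bar>u i - v i\<bar>))" "\<forall>z\<in>set P. z \<in> Zd d \<and> (\<forall>i. min (u i) (v i) \<le> z i \<and> z i \<le> max (u i) (v i))"
    using hull_path[OF Z(3,4)] by blast
  obtain Q where Q: "successively (adjacent d) Q" "Q \<noteq> []" "hd Q = v" "last Q = y"
    "length Q = Suc (nat (\<Sum>i<d. \<bar>v i - y i\<bar>))" "\<forall>z\<in>set Q. z \<in> Zd d \<and> (\<forall>i. min (v i) (y i) \<le> z i \<and> z i \<le> max (v i) (y i))"
    using hull_path[OF Z(4,2)] by blast
  let ?S = "{z \<in> cylinder d h. x 0 \<le> z 0 \<and> z 0 \<le> y 0}"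
  have hull_cyl: "z \<in> cylinder d h" if "z \<in> Zd d" "a \<in> cylinder d h" "b \<in> cylinder d h" "\<forall>i. min (a i) (b i) \<le> z i \<and> z i \<le> max (a i) (b i)" for z a b
  proof -
    have "\<bar>z i\<bar> \<le> int h" if i: "i \<in> {1..<d}" for i
    proof -
      have "min (a i) (b i) \<le> z i" "z i \<le> max (a i) (b i)" using \<open>\<forall>i. _\<close> by auto
      moreover have "\<bar>a i\<bar> \<le> int h" "\<bar>b i\<bar> \<le> int h" using \<open>a \<in> _\<close> \<open>b \<in> _\<close> i by (auto simp: cylinder_def)
      ultimately show ?thesis by linarith
    qed
    then show ?thesis using that(1) by (auto simp: cylinder_def)
  qed
  have P0: "\<forall>z\<in>set P. z 0 = x 0 + 1"
  proof
    fix z assume "z \<in> set P"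
    then have "min (u 0) (v 0) \<le> z 0 \<and> z 0 \<le> max (u 0) (v 0)" using P(6) by blast
    then show "z 0 = x 0 + 1" by (simp add: u_def v_def)
  qed
  have Q0: "\<forall>z\<in>set Q. x 0 + 1 \<le> z 0 \<and> z 0 \<le> y 0"
  proof
    fix z assume "z \<in> set Q"
    then have "min (v 0) (y 0) \<le> z 0 \<and> z 0 \<le> max (v 0) (y 0)" using Q(6) by blast
    then show "x 0 + 1 \<le> z 0 \<and> z 0 \<le> y 0" using xy by (simp add: v_def)
  qed
  have QS: "lattice_path d ?S Q" unfolding lattice_path_def using Q Q0 hull_cyl[OF _ vc y] by fastforce
  have PS: "lattice_path d ?S P" unfolding lattice_path_def using P P0 hull_cyl[OF _ uc vc] xy by fastforce
  have xu: "adjacent d x u"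
  proof -
    have "(\<Sum>j<d. \<bar>x j - u j\<bar>) = (\<Sum>j\<in>{0}. \<bar>x j - u j\<bar>)"
      using d by (intro sum.mono_neutral_right) (auto simp: u_def)
    then show ?thesis by (simp add: adjacent_def u_def)
  qed
  define R where "R = P @ tl Q"
  have R: "lattice_path d ?S R" "hd R = u" "last R = y"
    unfolding R_def using lattice_path_join[OF PS QS subset_refl subset_refl] P Q by auto
  have Re: "path_edges R = path_edges P @ path_edges Q" unfolding R_def using P Q by (intro path_edges_join) auto
  have Rne: "R \<noteq> []" using R by (auto simp: lattice_path_def)
  have xR: "path_edges (x # R) = {x, u} # path_edges R" using R(2) Rne by (cases R) auto
  have g1: "{x, u} \<in> gap_edges d (x 0) (y 0)"
    using xu Z xy by (auto simp: gap_edges_def lattice_edges_iff u_def)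
  have g2: "set (path_edges P) \<subseteq> gap_edges d (x 0) (y 0)"
  proof -
    have P': "set (path_edges P) \<subseteq> inside (lattice_edges d) {z \<in> Zd d. z 0 = x 0 + 1}"
      using P P0 by (intro path_edges_inside) (auto simp: lattice_path_def)
    show ?thesis
    proof
      fix e assume "e \<in> set (path_edges P)"
      then have e': "e \<in> lattice_edges d" "e \<subseteq> {z \<in> Zd d. z 0 = x 0 + 1}" using P' by auto
      obtain s t where "e = {s, t}" using e'(1) by (rule lattice_edgesE)
      then show "e \<in> gap_edges d (x 0) (y 0)" using e' xy by (auto simp: gap_edges_def)
    qed
  qed
  have g3: "set (path_edges Q) \<subseteq> gap_edges d (x 0) (y 0)"
  proof
    fix e assume e: "e \<in> set (path_edges Q)"
    let ?L = "{z \<in> Zd d. x 0 + 1 \<le> z 0 \<and> z 0 \<le> y 0 \<and> (\<forall>i\<noteq>0. z i = y i)}"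
    have "z i = y i" if "z \<in> set Q" "i \<noteq> 0" for z i
    proof -
      have "min (v i) (y i) \<le> z i \<and> z i \<le> max (v i) (y i)" using Q(6) that by blast
      then show ?thesis using that by (simp add: v_def)
    qed
    then have "lattice_path d ?L Q" using Q Q0 by (auto simp: lattice_path_def)
    from path_edges_inside[OF this] e have e': "e \<in> lattice_edges d" "e \<subseteq> ?L" by auto
    obtain s t where st: "e = {s, t}" "s \<in> Zd d" "t \<in> Zd d" "adjacent d s t" using e'(1) by (rule lattice_edgesE)
    have "s 0 \<noteq> t 0"
    proof
      assume "s 0 = t 0"
      then have "s i = t i" for i using e'(2) st(1) by (cases "i = 0") auto
      then have "s = t" by auto
      then show False using st(4) by simp
    qed
    then have "s 0 < y 0 \<or> t 0 < y 0" using e'(2) st(1) by auto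
    then show "e \<in> gap_edges d (x 0) (y 0)" using e' st(1) by (auto simp: gap_edges_def)
  qed
  have len: "length (path_edges (x # R)) \<le> 2 * h * d + nat (y 0 - x 0)"
  proof -
    have "(\<Sum>i<d. \<bar>u i - v i\<bar>) \<le> (\<Sum>i<d. 2 * int h)"
    proof (rule sum_mono)
      fix i assume "i \<in> {..<d}"
      then have "i = 0 \<or> (\<bar>u i\<bar> \<le> int h \<and> \<bar>v i\<bar> \<le> int h)" using uc vc by (auto simp: cylinder_def)
      then show "\<bar>u i - v i\<bar> \<le> 2 * int h" by (auto simp: u_def v_def)
    qed
    also have "\<dots> = int (2 * h * d)" by simp
    finally have 1: "nat (\<Sum>i<d. \<bar>u i - v i\<bar>) \<le> 2 * h * d" by linarith
    have "(\<Sum>i<d. \<bar>v i - y i\<bar>) = (\<Sum>i\<in>{0}. \<bar>v i - y i\<bar>)"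
      using d by (intro sum.mono_neutral_right) (auto simp: v_def)
    also have "\<dots> = y 0 - x 0 - 1" using xy by (simp add: v_def)
    finally have 2: "nat (\<Sum>i<d. \<bar>v i - y i\<bar>) = nat (y 0 - x 0 - 1)" by simp
    have "length (path_edges (x # R)) = 1 + (length P - 1) + (length Q - 1)" unfolding xR Re by (simp add: length_path_edges)
    moreover have "nat (y 0 - x 0) = Suc (nat (y 0 - x 0 - 1))" using xy by linarith
    ultimately show ?thesis using 1 2 P(5) Q(5) by simp
  qed
  have "lattice_path d ?S (x # R)"
    using R xu x xy Rne by (cases R) (auto simp: lattice_path_def)
  moreover have "last (x # R) = y" using R Rne by simp
  moreover have "set (path_edges (x # R)) \<subseteq> gap_edges d (x 0) (y 0)" unfolding xR Re using g1 g2 g3 by auto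
  ultimately show ?thesis using len by (intro exI[of _ "x # R"]) auto
qed

lemma distinct_lattice_path:
  "lattice_path d S xs \<Longrightarrow> \<exists>ys. lattice_path d S ys \<and> hd ys = hd xs \<and> last ys = last xs \<and> distinct ys \<and>
    set (path_edges ys) \<subseteq> set (path_edges xs)"
proof (induction xs rule: length_induct)
  case (1 xs)
  show ?case
  proof (cases "distinct xs")
    case False
    then obtain as v bs cs where xs: "xs = as @ [v] @ bs @ [v] @ cs" using not_distinct_decomp by blast
    let ?ys = "as @ v # cs"
    have e1: "path_edges xs = path_edges (as @ [v]) @ path_edges (v # bs @ v # cs)"
      unfolding xs using path_edges_split[of as v "bs @ v # cs"] by simp
    have e2: "path_edges (v # bs @ v # cs) = path_edges (v # bs @ [v]) @ path_edges (v # cs)"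
      using path_edges_split[of "v # bs" v cs] by simp
    have sub: "set (path_edges ?ys) \<subseteq> set (path_edges xs)" unfolding e1 e2 path_edges_split[of as v cs] by auto
    have p: "lattice_path d S ?ys" using 1(2) unfolding xs
      by (auto simp: lattice_path_def successively_append_iff successively_Cons)
    have "length ?ys < length xs" unfolding xs by simp
    then obtain ys where ys: "lattice_path d S ys" "hd ys = hd ?ys" "last ys = last ?ys" "distinct ys" "set (path_edges ys) \<subseteq> set (path_edges ?ys)"
      using 1(1) p by blast
    have "hd ?ys = hd xs" "last ?ys = last xs" unfolding xs by (cases as; simp)+
    then show ?thesis using ys sub by (intro exI[of _ ys]) auto
  qed (use 1 in blast)
qed

lemma in_path_edgesD: "e \<in> set (path_edges xs) \<Longrightarrow> e \<subseteq> set xs"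
proof (induction xs)
  case (Cons x xs)
  then show ?case by (cases xs) auto
qed (simp add: path_edges_def)

lemma distinct_path_edges: "distinct xs \<Longrightarrow> distinct (path_edges xs)"
proof (induction xs)
  case (Cons x xs)
  then show ?case using in_path_edgesD[of _ xs] by (cases xs) auto
qed (simp add: path_edges_def)

text \<open>Loops are erased so that the weight is a sum over a set of edges, to which the moment
  bound for independent variables applies.\<close>

lemma connecting_edges:
  assumes "x \<in> cylinder d h" "y \<in> cylinder d h" "x 0 + 2 \<le> y 0" "d \<ge> 1"
  shows "\<exists>xs. lattice_path d {z \<in> cylinder d h. x 0 \<le> z 0 \<and> z 0 \<le> y 0} xs \<and> hd xs = x \<and> last xs = y \<and>
    set (path_edges xs) \<subseteq> gap_edges d (x 0) (y 0) \<and> card (set (path_edges xs)) \<le> 2 * h * d + nat (y 0 - x 0) \<and>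
    (\<forall>u. path_weight u xs = (\<Sum>e\<in>set (path_edges xs). u e))"
proof -
  obtain ys where ys: "lattice_path d {z \<in> cylinder d h. x 0 \<le> z 0 \<and> z 0 \<le> y 0} ys" "hd ys = x" "last ys = y"
    "set (path_edges ys) \<subseteq> gap_edges d (x 0) (y 0)" "length (path_edges ys) \<le> 2 * h * d + nat (y 0 - x 0)"
    using connecting_path[OF assms] by blast
  obtain xs where xs: "lattice_path d {z \<in> cylinder d h. x 0 \<le> z 0 \<and> z 0 \<le> y 0} xs" "hd xs = hd ys" "last xs = last ys" "distinct xs"
    "set (path_edges xs) \<subseteq> set (path_edges ys)" using distinct_lattice_path[OF ys(1)] by blast
  have "card (set (path_edges xs)) \<le> card (set (path_edges ys))" using xs(5) by (intro card_mono) auto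
  also have "\<dots> \<le> length (path_edges ys)" by (rule card_length)
  finally have "card (set (path_edges xs)) \<le> 2 * h * d + nat (y 0 - x 0)" using ys(5) by simp
  moreover have "path_weight u xs = (\<Sum>e\<in>set (path_edges xs). u e)" for u
    unfolding path_weight_def by (rule sum_list_distinct_conv_sum_set[OF distinct_path_edges[OF xs(4)]])
  ultimately show ?thesis using xs ys by (intro exI[of _ xs]) auto
qed

section \<open>Passage times\<close>

text \<open>Passage times for the weights truncated below at zero: almost surely these are the given
  weights, and the infimum is over a set that is bounded below without exceptional null set.\<close>

definition ptime :: "vertex list set \<Rightarrow> (edge \<Rightarrow> real) \<Rightarrow> real" where
  "ptime \<P> u = (INF xs\<in>\<P>. path_weight (\<lambda>e. max 0 (u e)) xs)"

lemma ptime_bdd: "bdd_below ((\<lambda>xs. path_weight (\<lambda>e. max 0 (u e)) xs) ` \<P>)"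
  by (rule bdd_belowI[of _ 0]) (auto intro!: path_weight_nonneg)

lemma ptime_le: "xs \<in> \<P> \<Longrightarrow> ptime \<P> u \<le> path_weight (\<lambda>e. max 0 (u e)) xs"
  unfolding ptime_def by (rule cINF_lower[OF ptime_bdd])

lemma ptime_ge: "\<P> \<noteq> {} \<Longrightarrow> (\<And>xs. xs \<in> \<P> \<Longrightarrow> c \<le> path_weight (\<lambda>e. max 0 (u e)) xs) \<Longrightarrow> c \<le> ptime \<P> u"
  unfolding ptime_def by (rule cINF_greatest)

lemma ptime_nonneg: "\<P> \<noteq> {} \<Longrightarrow> 0 \<le> ptime \<P> u"
  by (rule ptime_ge) (auto intro!: path_weight_nonneg)

lemma ptime_near:
  assumes "\<P> \<noteq> {}" "0 < \<epsilon>"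
  shows "\<exists>xs\<in>\<P>. path_weight (\<lambda>e. max 0 (u e)) xs < ptime \<P> u + \<epsilon>"
proof (rule ccontr)
  assume "\<not> ?thesis"
  then have "ptime \<P> u + \<epsilon> \<le> ptime \<P> u" using assms(1) by (intro ptime_ge) (auto simp: not_less)
  then show False using assms(2) by simp
qed

lemma path_weight_cong: "(\<And>e. e \<in> set (path_edges xs) \<Longrightarrow> \<omega> e = \<omega>' e) \<Longrightarrow> path_weight \<omega> xs = path_weight \<omega>' xs"
  unfolding path_weight_def by (intro arg_cong[of _ _ sum_list] map_cong) auto

lemma ptime_cong:
  assumes "\<And>xs e. xs \<in> \<P> \<Longrightarrow> e \<in> set (path_edges xs) \<Longrightarrow> \<omega> e = \<omega>' e"
  shows "ptime \<P> \<omega> = ptime \<P> \<omega>'"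
  unfolding ptime_def using assms by (intro INF_cong refl path_weight_cong) auto

definition edges_of :: "vertex list set \<Rightarrow> edge set" where
  "edges_of \<P> = (\<Union>xs\<in>\<P>. set (path_edges xs))"

lemma ptime_restrict: "edges_of \<P> \<subseteq> E \<Longrightarrow> ptime \<P> (restrict u E) = ptime \<P> u"
  by (rule ptime_cong) (auto simp: edges_of_def)

text \<open>The weights form a general family W because the lemma is also applied to configurations
  in which one edge has been overwritten by a constant.\<close>

lemma ptime_measurable_gen:
  assumes "countable \<P>" "\<And>e. e \<in> edges_of \<P> \<Longrightarrow> (\<lambda>x. W x e) \<in> borel_measurable N"
  shows "(\<lambda>x. ptime \<P> (W x)) \<in> borel_measurable N"
  unfolding ptime_def
proof (rule borel_measurable_cINF[OF assms(1)])
  fix xs assume xs: "xs \<in> \<P>"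
  have "(\<lambda>x. \<Sum>e\<leftarrow>es. max 0 (W x e)) \<in> borel_measurable N" if "set es \<subseteq> edges_of \<P>" for es
    using that by (induction es) (auto intro!: borel_measurable_add borel_measurable_max assms(2))
  then show "(\<lambda>x. path_weight (\<lambda>e. max 0 (W x e)) xs) \<in> borel_measurable N"
    unfolding path_weight_def using xs by (auto simp: edges_of_def)
qed (rule ptime_bdd)

lemma ptime_measurable_PiM:
  assumes "countable \<P>" "edges_of \<P> \<subseteq> E"
  shows "ptime \<P> \<in> borel_measurable (PiM E (\<lambda>_. borel))"
  using assms by (intro ptime_measurable_gen[of \<P> "\<lambda>x. x"]) auto

lemma countable_lattice_paths: "countable {xs. lattice_path d (Zd d) xs}"
proof (rule countable_subset)
  show "countable (lists (Zd d))" by (intro countable_lists countable_Zd)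
qed (auto simp: lattice_path_def)

lemma crossings_paths: "crossings d a m h \<subseteq> {xs. lattice_path d (Zd d) xs}"
  using slab_Zd by (fastforce simp: crossings_def lattice_path_def)

lemma countable_crossings: "countable (crossings d a m h)"
  by (rule countable_subset[OF crossings_paths countable_lattice_paths])

lemma edges_of_crossings: "edges_of (crossings d a m h) \<subseteq> inside (lattice_edges d) (slab d a m h)"
  using path_edges_inside[OF _ slab_Zd] by (fastforce simp: edges_of_def crossings_def)

lemma straight_crossing:
  assumes d: "d \<ge> 1"
  shows "\<exists>xs. lattice_path d (slab d a m h) xs \<and> hd xs = axis_point a \<and> last xs = axis_point (a + int m) \<and>
    card (set (path_edges xs)) \<le> m \<and> (\<forall>u. path_weight u xs = (\<Sum>e\<in>set (path_edges xs). u e))"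
proof -
  let ?x = "axis_point a" and ?y = "axis_point (a + int m)"
  have Z: "?x \<in> Zd d" "?y \<in> Zd d" using d by (auto simp: Zd_def axis_point_def)
  obtain ys where ys: "successively (adjacent d) ys" "ys \<noteq> []" "hd ys = ?x" "last ys = ?y"
    "length ys = Suc (nat (\<Sum>i<d. \<bar>?x i - ?y i\<bar>))"
    "\<forall>z\<in>set ys. z \<in> Zd d \<and> (\<forall>i. min (?x i) (?y i) \<le> z i \<and> z i \<le> max (?x i) (?y i))"
    using hull_path[OF Z] by blast
  have "z \<in> slab d a m h" if z: "z \<in> set ys" for z
  proof -
    have zz: "min (?x i) (?y i) \<le> z i \<and> z i \<le> max (?x i) (?y i)" for i using ys(6) z by blast
    have "a \<le> z 0 \<and> z 0 \<le> a + int m" using zz[of 0] by (simp add: axis_point_def)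
    moreover have "z i = 0" if "i \<in> {1..<d}" for i using zz[of i] that by (auto simp: axis_point_def)
    ultimately show ?thesis using ys(6) z by (simp add: slab_def cylinder_def)
  qed
  then have p: "lattice_path d (slab d a m h) ys" using ys by (auto simp: lattice_path_def)
  obtain xs where xs: "lattice_path d (slab d a m h) xs" "hd xs = hd ys" "last xs = last ys" "distinct xs"
    "set (path_edges xs) \<subseteq> set (path_edges ys)" using distinct_lattice_path[OF p] by blast
  have "card (set (path_edges xs)) \<le> card (set (path_edges ys))" using xs(5) by (intro card_mono) auto
  also have "\<dots> \<le> length (path_edges ys)" by (rule card_length)
  also have "\<dots> = nat (\<Sum>i<d. \<bar>?x i - ?y i\<bar>)" using ys(5) by (simp add: length_path_edges)
  also have "(\<Sum>i<d. \<bar>?x i - ?y i\<bar>) = (\<Sum>i\<in>{0}. \<bar>?x i - ?y i\<bar>)"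
    using d by (intro sum.mono_neutral_right) (auto simp: axis_point_def)
  also have "nat \<dots> = m" by (simp add: axis_point_def)
  finally have "card (set (path_edges xs)) \<le> m" .
  moreover have "path_weight u xs = (\<Sum>e\<in>set (path_edges xs). u e)" for u
    unfolding path_weight_def by (rule sum_list_distinct_conv_sum_set[OF distinct_path_edges[OF xs(4)]])
  ultimately show ?thesis using xs ys by (intro exI[of _ xs]) auto
qed

lemma crossings_nonempty: "d \<ge> 1 \<Longrightarrow> crossings d a m h \<noteq> {}"
proof -
  assume "d \<ge> 1"
  then obtain xs where "lattice_path d (slab d a m h) xs" "hd xs = axis_point a" "last xs = axis_point (a + int m)"
    using straight_crossing[of d a m h] by blast
  then have "xs \<in> crossings d a m h" by (simp add: crossings_def axis_point_def)
  then show ?thesis by blast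
qed

section \<open>Translations along the first axis\<close>

definition shift0 :: "int \<Rightarrow> vertex \<Rightarrow> vertex" where
  "shift0 a z = z(0 := z 0 + a)"

lemma shift0_inverse [simp]: "shift0 a (shift0 (- a) z) = z" "shift0 (- a) (shift0 a z) = z"
  by (auto simp: shift0_def)

lemma inj_shift0: "inj (shift0 a)"
  by (rule injI) (metis shift0_inverse(2))

lemma shift0_Zd: "d \<ge> 1 \<Longrightarrow> shift0 a z \<in> Zd d \<longleftrightarrow> z \<in> Zd d"
  by (auto simp: shift0_def Zd_def)

lemma shift0_adjacent: "adjacent d (shift0 a x) (shift0 a y) \<longleftrightarrow> adjacent d x y"
proof -
  have "shift0 a x i - shift0 a y i = x i - y i" for i by (simp add: shift0_def)
  then show ?thesis by (simp add: adjacent_def)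
qed

lemma shift0_lattice_edges:
  assumes "d \<ge> 1" "e \<in> lattice_edges d"
  shows "shift0 a ` e \<in> lattice_edges d"
proof -
  obtain x y where "e = {x, y}" "x \<in> Zd d" "y \<in> Zd d" "adjacent d x y" using assms(2) by (rule lattice_edgesE)
  then show ?thesis using assms(1) by (simp add: lattice_edges_iff shift0_Zd shift0_adjacent)
qed

lemma path_edges_map: "path_edges (map f xs) = map ((`) f) (path_edges xs)"
proof (induction xs)
  case (Cons x xs)
  then show ?case by (cases xs) auto
qed (simp add: path_edges_def)

lemma shift0_crossings:
  assumes d: "d \<ge> 1"
  shows "crossings d a m h = map (shift0 a) ` crossings d 0 m h"
proof -
  have sub: "map (shift0 a) xs \<in> crossings d (b + a) m h" if "xs \<in> crossings d b m h" for a b xs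
  proof -
    have xs: "lattice_path d (slab d b m h) xs" "hd xs 0 = b" "last xs 0 = b + int m" using that by (auto simp: crossings_def)
    have ne: "xs \<noteq> []" using xs by (auto simp: lattice_path_def)
    have "shift0 a z \<in> slab d (b + a) m h" if "z \<in> slab d b m h" for z
      using that d by (auto simp: slab_def cylinder_def shift0_def Zd_def)
    moreover have "successively (adjacent d) (map (shift0 a) xs)"
      using xs by (simp add: lattice_path_def successively_map shift0_adjacent)
    ultimately have "lattice_path d (slab d (b + a) m h) (map (shift0 a) xs)" using xs ne by (auto simp: lattice_path_def)
    then show ?thesis using xs ne by (simp add: crossings_def hd_map last_map) (simp add: shift0_def)
  qed
  show ?thesis
  proof (intro set_eqI iffI)
    fix xs assume "xs \<in> crossings d a m h"
    then have "map (shift0 (- a)) xs \<in> crossings d 0 m h" using sub[of xs a "- a"] by simp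
    moreover have "xs = map (shift0 a) (map (shift0 (- a)) xs)" by (simp add: comp_def)
    ultimately show "xs \<in> map (shift0 a) ` crossings d 0 m h" by (rule image_eqI[rotated])
  qed (use sub[of _ 0 a] in auto)
qed

lemma ptime_shift:
  assumes "d \<ge> 1"
  shows "ptime (crossings d a m h) u = ptime (crossings d 0 m h) (\<lambda>e. u (shift0 a ` e))"
  unfolding ptime_def shift0_crossings[OF assms, of a] image_image path_weight_def path_edges_map by (simp add: comp_def)

section \<open>Independent edge weights\<close>

locale fpp = prob_space M for M :: "'a measure" +
  fixes d :: nat and F :: "real measure" and w :: "edge \<Rightarrow> 'a \<Rightarrow> real"
  assumes d2: "d \<ge> 2" and iid: "iid_edge_weights d F M w" and nn: "nonneg_nondegenerate F"
begin

abbreviation "LE \<equiv> lattice_edges d"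

lemma d1: "d \<ge> 1" using d2 by simp

lemma indep: "indep_vars (\<lambda>_. borel) w LE"
  using iid by (simp add: iid_edge_weights_def)

lemma rv: "e \<in> LE \<Longrightarrow> w e \<in> borel_measurable M"
  using indep by (auto simp: indep_vars_def)

lemma law: "e \<in> LE \<Longrightarrow> distr M borel (w e) = F"
  using iid by (simp add: iid_edge_weights_def)

lemma realF: "real_distribution F"
  using nn by (simp add: nonneg_nondegenerate_def)

lemma LE_nonempty: "LE \<noteq> {}"
proof -
  obtain xs where xs: "lattice_path d (slab d 0 1 0) xs" "hd xs = axis_point 0" "last xs = axis_point (0 + int 1)"
    using straight_crossing[OF d1, of 0 1 0] by blast
  have "hd xs \<noteq> last xs"
  proof
    assume "hd xs = last xs"
    then have "axis_point 0 0 = axis_point (0 + int 1) 0" using xs(2,3) by simp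
    then show False by (simp add: axis_point_def)
  qed
  then have "xs \<noteq> []" "tl xs \<noteq> []" using xs(1) by (auto simp: lattice_path_def last_tl neq_Nil_conv)
  then obtain x y ys where "xs = x # y # ys" by (metis list.collapse)
  then have "{x, y} \<in> LE" using path_edges_inside[OF xs(1) slab_Zd] by auto
  then show ?thesis by blast
qed

lemma weights_nonneg: "AE x in M. \<forall>e\<in>LE. 0 \<le> w e x"
proof (subst AE_ball_countable[OF countable_lattice_edges], intro ballI)
  fix e assume e: "e \<in> LE"
  have "AE y in distr M borel (w e). 0 \<le> y" unfolding law[OF e] by (rule nonneg_AE[OF nn])
  then show "AE x in M. 0 \<le> w e x" by (subst (asm) AE_distr_iff[OF rv[OF e]]) auto
qed

lemma ptime_measurable:
  assumes "\<P> \<subseteq> {xs. lattice_path d (Zd d) xs}"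
  shows "(\<lambda>x. ptime \<P> (\<lambda>e. w e x)) \<in> borel_measurable M"
proof (rule ptime_measurable_gen)
  show "countable \<P>" by (rule countable_subset[OF assms countable_lattice_paths])
  fix e assume "e \<in> edges_of \<P>"
  then have "e \<in> LE" using assms path_edges_inside[of d "Zd d"] by (auto simp: edges_of_def)
  then show "(\<lambda>x. w e x) \<in> borel_measurable M" by (rule rv)
qed

lemma ptime_indep:
  assumes "countable \<P>1" "countable \<P>2" "edges_of \<P>1 \<subseteq> E1" "edges_of \<P>2 \<subseteq> E2" "E1 \<inter> E2 = {}" "E1 \<subseteq> LE" "E2 \<subseteq> LE"
  shows "indep_var borel (\<lambda>x. ptime \<P>1 (\<lambda>e. w e x)) borel (\<lambda>x. ptime \<P>2 (\<lambda>e. w e x))"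
  using indep_var_disjoint_functions[OF indep assms(5-7) ptime_measurable_PiM[OF assms(1,3)] ptime_measurable_PiM[OF assms(2,4)]]
  by (simp add: ptime_restrict assms(3,4))

lemma law_PiM: "distr M (PiM LE (\<lambda>_. borel)) (\<lambda>x. \<lambda>e\<in>LE. w e x) = PiM LE (\<lambda>_. F)"
proof -
  have "distr M (PiM LE (\<lambda>_. borel)) (\<lambda>x. \<lambda>e\<in>LE. w e x) = PiM LE (\<lambda>e. distr M borel (w e))"
    using indep_vars_iff_distr_eq_PiM'[where I = LE and M' = "\<lambda>_. borel" and X = w] indep LE_nonempty rv by simp
  also have "\<dots> = PiM LE (\<lambda>_. F)" by (intro PiM_cong refl) (simp add: law)
  finally show ?thesis .
qed

text \<open>The product measure is invariant under reindexing by the injective map that shifts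
  edges, and the shift carries the crossings of one slab to those of the other.\<close>

lemma crossing_time_law:
  "distr M borel (\<lambda>x. ptime (crossings d a m h) (\<lambda>e. w e x)) = distr M borel (\<lambda>x. ptime (crossings d 0 m h) (\<lambda>e. w e x))"
proof -
  let ?B = "PiM LE (\<lambda>_. borel :: real measure)"
  let ?W = "\<lambda>x. \<lambda>e\<in>LE. w e x"
  let ?S = "\<lambda>u. \<lambda>e\<in>LE. u (shift0 a ` e)"
  let ?f = "ptime (crossings d 0 m h)"
  have sF: "sets F = sets borel" using realF by (simp add: real_distribution.events_eq_borel)
  have sB: "sets (PiM LE (\<lambda>_. F)) = sets ?B" by (intro sets_PiM_cong refl) (simp add: sF)
  have W: "?W \<in> measurable M ?B" using rv by (intro measurable_restrict) auto
  have S: "?S \<in> measurable ?B ?B" using shift0_lattice_edges[OF d1] by (intro measurable_restrict) auto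
  have E: "edges_of (crossings d 0 m h) \<subseteq> LE" using edges_of_crossings by blast
  have f: "?f \<in> borel_measurable ?B" by (rule ptime_measurable_PiM[OF countable_crossings E])
  have inj: "inj_on (\<lambda>e. shift0 a ` e) LE" using inj_shift0[of a] by (auto simp: inj_on_def inj_image_eq_iff)
  have into: "(\<lambda>e. shift0 a ` e) \<in> LE \<rightarrow> LE" using shift0_lattice_edges[OF d1] by blast
  have "prob_space F" using realF by (rule real_distribution.axioms(1))
  then have "distr (PiM LE (\<lambda>_. F)) (PiM LE (\<lambda>_. F)) ?S = PiM LE (\<lambda>_. F)"
    by (rule distr_PiM_reindex[where M = "\<lambda>_. F", OF _ inj into])
  moreover have "distr (PiM LE (\<lambda>_. F)) (PiM LE (\<lambda>_. F)) ?S = distr (PiM LE (\<lambda>_. F)) ?B ?S"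
    by (rule distr_cong[OF refl sB refl])
  ultimately have inv: "distr (PiM LE (\<lambda>_. F)) ?B ?S = PiM LE (\<lambda>_. F)" by simp
  have "distr M borel (\<lambda>x. ptime (crossings d a m h) (\<lambda>e. w e x)) = distr M borel (\<lambda>x. ?f (?S (?W x)))"
  proof (intro distr_cong refl)
    fix x
    have "?f (?S (?W x)) = ?f (\<lambda>e. ?W x (shift0 a ` e))" by (rule ptime_restrict[OF E])
    also have "\<dots> = ?f (\<lambda>e. w (shift0 a ` e) x)"
      by (rule ptime_cong) (use E shift0_lattice_edges[OF d1] in \<open>auto simp: edges_of_def\<close>)
    also have "\<dots> = ptime (crossings d a m h) (\<lambda>e. w e x)" by (rule ptime_shift[OF d1, symmetric])
    finally show "ptime (crossings d a m h) (\<lambda>e. w e x) = ?f (?S (?W x))" by simp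
  qed
  also have "\<dots> = distr (distr (distr M ?B ?W) ?B ?S) borel ?f"
    by (subst distr_distr[OF S W], subst distr_distr[OF f measurable_comp[OF W S]]) (simp only: comp_def)
  also have "\<dots> = distr (distr M ?B ?W) borel ?f" unfolding law_PiM inv ..
  also have "\<dots> = distr M borel (\<lambda>x. ?f (?W x))" by (simp only: distr_distr[OF f W] comp_def)
  also have "\<dots> = distr M borel (\<lambda>x. ptime (crossings d 0 m h) (\<lambda>e. w e x))"
    by (intro distr_cong refl) (simp add: ptime_restrict[OF E])
  finally show ?thesis .
qed

lemma weight_integral:
  assumes "e \<in> LE" "f \<in> borel_measurable borel"
  shows "expectation (\<lambda>x. f (w e x) :: real) = (\<integral>y. f y \<partial>F)" "integrable M (\<lambda>x. f (w e x)) \<longleftrightarrow> integrable F f"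
  using integral_distr[OF rv[OF assms(1)] assms(2)] integrable_distr_eq[OF rv[OF assms(1)] assms(2)] law[OF assms(1)] by auto

text \<open>The sum is its mean, at most k * \<mu> * H, plus a centred sum to which
  \<open>sum_tail_moment\<close> applies. One constant serves all sets of edges of the given
  size.\<close>

lemma fresh_sum_tail:
  assumes p: "2 < p" and mom: "integrable F (\<lambda>x. x powr p)" and k: "0 < k"
  shows "\<exists>C>0. \<forall>E H. finite E \<longrightarrow> E \<subseteq> LE \<longrightarrow> 1 \<le> H \<longrightarrow> real (card E) \<le> k * H \<longrightarrow>
    (\<integral>\<^sup>+x. ennreal (max 0 ((\<Sum>e\<in>E. max 0 (w e x)) - C * H) powr p) \<partial>M) \<le> ennreal (C * H powr (p - 1))"
proof -
  interpret F: real_distribution F by (rule realF)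
  have mF [measurable_cong]: "sets F = sets borel" by simp
  define \<mu> where "\<mu> = (\<integral>y. max 0 y \<partial>F)"
  have \<mu>: "0 \<le> \<mu>" unfolding \<mu>_def by (intro Bochner_Integration.integral_nonneg) auto
  define z where "z y = max 0 y - \<mu>" for y :: real
  have [measurable]: "z \<in> borel_measurable borel" by (simp add: z_def[abs_def])
  have ip: "integrable F (\<lambda>y. \<bar>z y\<bar> powr p)"
  proof (rule Bochner_Integration.integrable_bound)
    show "integrable F (\<lambda>y. 2 powr p * (y powr p + \<mu> powr p))" using mom by auto
    have "\<bar>z y\<bar> powr p \<le> 2 powr p * (y powr p + \<mu> powr p)" if "0 \<le> y" for y
    proof -
      have "\<bar>z y\<bar> \<le> 2 * max y \<mu>" using that \<mu> by (auto simp: z_def)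
      then have "\<bar>z y\<bar> powr p \<le> (2 * max y \<mu>) powr p" using p by (intro powr_mono2) auto
      also have "\<dots> = 2 powr p * max y \<mu> powr p" by (rule powr_mult)
      also have "\<dots> \<le> 2 powr p * (y powr p + \<mu> powr p)" by (intro mult_left_mono) (auto simp: max_def)
      finally show ?thesis .
    qed
    then show "AE y in F. norm (\<bar>z y\<bar> powr p) \<le> norm (2 powr p * (y powr p + \<mu> powr p))"
      using nonneg_AE[OF nn] by (auto elim!: eventually_mono)
  qed measurable
  have sq_le: "u^2 \<le> 1 + \<bar>u\<bar> powr p" for u :: real
  proof (cases "\<bar>u\<bar> \<le> 1")
    case True
    then have "u^2 \<le> 1" by (simp add: abs_square_le_1)
    then show ?thesis by (simp add: add_increasing2)
  next
    case False
    then have "\<bar>u\<bar> powr 2 \<le> \<bar>u\<bar> powr p" using p by (intro powr_mono) auto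
    then show ?thesis using False by (simp add: powr_numeral)
  qed
  have isq: "integrable F (\<lambda>y. (z y)^2)"
  proof (rule Bochner_Integration.integrable_bound)
    show "integrable F (\<lambda>y. 1 + \<bar>z y\<bar> powr p)" using ip by auto
    show "AE y in F. norm ((z y)^2) \<le> norm (1 + \<bar>z y\<bar> powr p)" using sq_le by (intro AE_I2) (simp add: order_trans[OF sq_le abs_ge_self])
  qed measurable
  have iz: "integrable F z" by (rule F.expectation_abs_le(1)[OF _ isq]) (simp add: z_def[abs_def])
  have ez: "(\<integral>y. z y \<partial>F) = 0"
  proof -
    have "integrable F (\<lambda>y. z y + \<mu>)" by (rule Bochner_Integration.integrable_add[OF iz F.integrable_const])
    moreover have "(\<lambda>y. z y + \<mu>) = max 0" by (auto simp: z_def)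
    ultimately have im: "integrable F (max 0)" by simp
    have "(\<integral>y. z y \<partial>F) = (\<integral>y. max 0 y \<partial>F) - (\<integral>y. \<mu> \<partial>F)"
      unfolding z_def by (rule Bochner_Integration.integral_diff[OF im F.integrable_const])
    also have "(\<integral>y. \<mu> \<partial>F) = \<mu>" using F.prob_space by simp
    finally show ?thesis unfolding \<mu>_def[symmetric] by simp
  qed
  note stm = sum_tail_moment[OF p, where m = "\<integral>y. \<bar>z y\<bar> powr p \<partial>F" and \<sigma> = "\<integral>y. (z y)^2 \<partial>F", where 'i = edge]
  show ?thesis
  proof (rule exE[OF stm], goal_cases)
    case KK: (1 K)
    have K: "0 < K" by (rule conjunct1[OF KK])
    note tail = conjunct2[OF KK, THEN spec, THEN spec, THEN mp, THEN mp, THEN mp, THEN mp]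
    define C where "C = k * \<mu> + K * k powr (p - 1) + 1"
    have C: "0 < C" "k * \<mu> \<le> C" "K * k powr (p - 1) \<le> C" using k \<mu> K by (auto simp: C_def add_nonneg_pos)
    show ?thesis
    proof (intro exI[of _ C] conjI allI impI)
      fix E H assume E: "finite E" "E \<subseteq> LE" and H: "1 \<le> H" and card: "real (card E) \<le> k * H"
      show "(\<integral>\<^sup>+x. ennreal (max 0 ((\<Sum>e\<in>E. max 0 (w e x)) - C * H) powr p) \<partial>M) \<le> ennreal (C * H powr (p - 1))"
      proof (cases "E = {}")
        case True
        have "max 0 (0 - C * H) = 0" using C H by simp
        then show ?thesis using True by simp
      next
        case False
        define Z where "Z e x = z (w e x)" for e x
        have ind: "indep_vars (\<lambda>_. borel) Z E"
          unfolding Z_def by (rule indep_vars_compose2[OF indep_vars_subset[OF indep E(2)]]) measurable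
        have Z: "integrable M (\<lambda>x. \<bar>\<Sum>e\<in>E. Z e x\<bar> powr p) \<and> expectation (\<lambda>x. \<bar>\<Sum>e\<in>E. Z e x\<bar> powr p) \<le> K * real (card E) powr (p - 1)"
        proof (rule tail[OF E(1) False ind], intro ballI conjI)
          fix e assume "e \<in> E"
          then have e: "e \<in> LE" using E by auto
          note wi = weight_integral[OF e]
          show "integrable M (Z e)" "expectation (Z e) = 0" using wi[of z] iz ez by (auto simp: Z_def[abs_def])
          show "integrable M (\<lambda>x. (Z e x)^2)" "expectation (\<lambda>x. (Z e x)^2) \<le> (\<integral>y. (z y)^2 \<partial>F)"
            using wi[of "\<lambda>y. (z y)^2"] isq by (auto simp: Z_def)
          show "integrable M (\<lambda>x. \<bar>Z e x\<bar> powr p)" "expectation (\<lambda>x. \<bar>Z e x\<bar> powr p) \<le> (\<integral>y. \<bar>z y\<bar> powr p \<partial>F)"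
            using wi[of "\<lambda>y. \<bar>z y\<bar> powr p"] ip by (auto simp: Z_def)
        qed
        have pw: "max 0 ((\<Sum>e\<in>E. max 0 (w e x)) - C * H) powr p \<le> \<bar>\<Sum>e\<in>E. Z e x\<bar> powr p" for x
        proof (rule powr_mono2)
          have "(\<Sum>e\<in>E. max 0 (w e x)) = (\<Sum>e\<in>E. Z e x) + real (card E) * \<mu>"
            by (simp add: Z_def z_def sum_subtractf)
          also have "real (card E) * \<mu> \<le> (k * H) * \<mu>" using card \<mu> by (intro mult_right_mono) auto
          also have "\<dots> = (k * \<mu>) * H" by simp
          also have "\<dots> \<le> C * H" using C H by (intro mult_right_mono) auto
          finally show "max 0 ((\<Sum>e\<in>E. max 0 (w e x)) - C * H) \<le> \<bar>\<Sum>e\<in>E. Z e x\<bar>" by linarith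
        qed (use p in auto)
        have "(\<integral>\<^sup>+x. ennreal (max 0 ((\<Sum>e\<in>E. max 0 (w e x)) - C * H) powr p) \<partial>M) \<le> (\<integral>\<^sup>+x. ennreal (\<bar>\<Sum>e\<in>E. Z e x\<bar> powr p) \<partial>M)"
          using pw by (intro nn_integral_mono ennreal_leI)
        also have "\<dots> = ennreal (expectation (\<lambda>x. \<bar>\<Sum>e\<in>E. Z e x\<bar> powr p))"
          using Z by (intro nn_integral_eq_integral) auto
        also have "\<dots> \<le> ennreal (C * H powr (p - 1))"
        proof (rule ennreal_leI)
          have "expectation (\<lambda>x. \<bar>\<Sum>e\<in>E. Z e x\<bar> powr p) \<le> K * real (card E) powr (p - 1)" using Z by simp
          also have "\<dots> \<le> K * (k * H) powr (p - 1)" using card K p by (intro mult_left_mono powr_mono2) auto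
          also have "\<dots> = K * k powr (p - 1) * H powr (p - 1)" by (simp add: powr_mult)
          also have "\<dots> \<le> C * H powr (p - 1)" using C by (intro mult_right_mono) auto
          finally show "expectation (\<lambda>x. \<bar>\<Sum>e\<in>E. Z e x\<bar> powr p) \<le> C * H powr (p - 1)" .
        qed
        finally show ?thesis .
      qed
    qed (rule C)
  qed
qed

text \<open>The error is dominated by a sum over edges that may be chosen depending on the weights on
  \<open>E1\<close>; conditionally on these, the weights in the sum are still independent.\<close>

lemma small_tail_fresh:
  assumes E: "E1 \<inter> E2 = {}" "E1 \<subseteq> LE" "E2 \<subseteq> LE"
    and f: "f \<in> borel_measurable (PiM (E1 \<union> E2) (\<lambda>_. borel))"
    and nonneg: "\<And>x. 0 \<le> f (\<lambda>e\<in>E1 \<union> E2. w e x)"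
    and fresh: "\<And>u. \<exists>E. finite E \<and> E \<subseteq> E2 \<and> real (card E) \<le> k * H \<and>
      (\<forall>v. f (merge E1 E2 (u, v)) \<le> (\<Sum>e\<in>E. max 0 (v e)))"
    and tail: "\<And>E. finite E \<Longrightarrow> E \<subseteq> LE \<Longrightarrow> real (card E) \<le> k * H \<Longrightarrow>
      (\<integral>\<^sup>+x. ennreal (max 0 ((\<Sum>e\<in>E. max 0 (w e x)) - C * H) powr p) \<partial>M) \<le> ennreal (C * H powr (p - 1))"
    and p: "2 < p"
  shows "small_tail M p C H (\<lambda>x. f (\<lambda>e\<in>E1 \<union> E2. w e x))"
proof -
  let ?B1 = "PiM E1 (\<lambda>_. borel :: real measure)" and ?B2 = "PiM E2 (\<lambda>_. borel :: real measure)"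
  let ?U = "\<lambda>x. \<lambda>e\<in>E1. w e x" and ?V = "\<lambda>x. \<lambda>e\<in>E2. w e x"
  have U [measurable]: "?U \<in> measurable M ?B1" using rv E by (intro measurable_restrict) auto
  have V [measurable]: "?V \<in> measurable M ?B2" using rv E by (intro measurable_restrict) auto
  define G where "G z = ennreal (max 0 (f (merge E1 E2 z) - C * H) powr p)" for z
  have G [measurable]: "G \<in> borel_measurable (?B1 \<Otimes>\<^sub>M ?B2)"
    unfolding G_def[abs_def] using measurable_compose[OF measurable_merge f] by measurable
  have eq: "merge E1 E2 (?U x, ?V x) = (\<lambda>e\<in>E1 \<union> E2. w e x)" for x by (auto simp: merge_def fun_eq_iff)
  have mW: "(\<lambda>x. \<lambda>e\<in>E1 \<union> E2. w e x) \<in> measurable M (PiM (E1 \<union> E2) (\<lambda>_. borel))"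
    using rv E by (intro measurable_restrict) auto
  have ind: "indep_var ?B1 ?U ?B2 ?V" by (rule indep_var_restrict[OF indep E])
  interpret D2: prob_space "distr M ?B2 ?V" by (rule prob_space_distr[OF V])
  interpret D1: prob_space "distr M ?B1 ?U" by (rule prob_space_distr[OF U])
  have inner: "(\<integral>\<^sup>+v. G (u, v) \<partial>distr M ?B2 ?V) \<le> ennreal (C * H powr (p - 1))" if u: "u \<in> space ?B1" for u
  proof -
    obtain E where E': "finite E" "E \<subseteq> E2" "real (card E) \<le> k * H" "\<And>v. f (merge E1 E2 (u, v)) \<le> (\<Sum>e\<in>E. max 0 (v e))"
      using fresh[of u] by blast
    have "(\<lambda>v. G (u, v)) \<in> borel_measurable ?B2" using u by measurable
    then have "(\<integral>\<^sup>+v. G (u, v) \<partial>distr M ?B2 ?V) = (\<integral>\<^sup>+x. G (u, ?V x) \<partial>M)" by (subst nn_integral_distr) auto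
    also have "\<dots> \<le> (\<integral>\<^sup>+x. ennreal (max 0 ((\<Sum>e\<in>E. max 0 (w e x)) - C * H) powr p) \<partial>M)"
    proof (intro nn_integral_mono)
      fix x
      have "f (merge E1 E2 (u, ?V x)) \<le> (\<Sum>e\<in>E. max 0 (?V x e))" by (rule E')
      also have "\<dots> = (\<Sum>e\<in>E. max 0 (w e x))" using E' by (intro sum.cong) auto
      finally show "G (u, ?V x) \<le> ennreal (max 0 ((\<Sum>e\<in>E. max 0 (w e x)) - C * H) powr p)"
        unfolding G_def using p by (intro ennreal_leI powr_mono2) auto
    qed
    also have "\<dots> \<le> ennreal (C * H powr (p - 1))" using E' E by (intro tail) auto
    finally show ?thesis .
  qed
  have "(\<integral>\<^sup>+x. ennreal (max 0 (f (\<lambda>e\<in>E1 \<union> E2. w e x) - C * H) powr p) \<partial>M) = (\<integral>\<^sup>+x. G (?U x, ?V x) \<partial>M)"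
    unfolding G_def eq ..
  also have "\<dots> = (\<integral>\<^sup>+z. G z \<partial>distr M (?B1 \<Otimes>\<^sub>M ?B2) (\<lambda>x. (?U x, ?V x)))"
    by (subst nn_integral_distr) auto
  also have "distr M (?B1 \<Otimes>\<^sub>M ?B2) (\<lambda>x. (?U x, ?V x)) = distr M ?B1 ?U \<Otimes>\<^sub>M distr M ?B2 ?V"
    using ind by (simp add: indep_var_distribution_eq)
  also have "(\<integral>\<^sup>+z. G z \<partial>(distr M ?B1 ?U \<Otimes>\<^sub>M distr M ?B2 ?V)) = (\<integral>\<^sup>+u. \<integral>\<^sup>+v. G (u, v) \<partial>distr M ?B2 ?V \<partial>distr M ?B1 ?U)"
    by (rule D2.nn_integral_fst[symmetric]) measurable
  also have "\<dots> \<le> (\<integral>\<^sup>+u. ennreal (C * H powr (p - 1)) \<partial>distr M ?B1 ?U)"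
    using inner by (intro nn_integral_mono) simp
  also have "\<dots> = ennreal (C * H powr (p - 1))" using D1.emeasure_space_1 by simp
  finally have "(\<integral>\<^sup>+x. ennreal (max 0 (f (\<lambda>e\<in>E1 \<union> E2. w e x) - C * H) powr p) \<partial>M) \<le> ennreal (C * H powr (p - 1))" .
  moreover have "(\<lambda>x. f (\<lambda>e\<in>E1 \<union> E2. w e x)) \<in> borel_measurable M" by (rule measurable_compose[OF mW f])
  ultimately show ?thesis using nonneg by (simp add: small_tail_def)
qed

end

section \<open>Gluing crossings\<close>

text \<open>The infimum defining a passage time is a priori not attained, so near-optimal paths are
  available one tolerance at a time. Their endpoints range over a finite set, hence one choice of
  endpoints serves all tolerances.\<close>

lemma uniform_choice:
  fixes P :: "'i \<Rightarrow> real \<Rightarrow> bool"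
  assumes fin: "finite I" and ex: "\<And>e. 0 < e \<Longrightarrow> \<exists>i\<in>I. P i e" and mono: "\<And>i e e'. P i e \<Longrightarrow> e \<le> e' \<Longrightarrow> P i e'"
  shows "\<exists>i\<in>I. \<forall>e>0. P i e"
proof (rule ccontr)
  assume "\<not> ?thesis"
  then have "\<forall>i\<in>I. \<exists>e>0. \<not> P i e" by blast
  then obtain e where e: "\<And>i. i \<in> I \<Longrightarrow> 0 < e i \<and> \<not> P i (e i)" by metis
  define m where "m = Min (insert 1 (e ` I))"
  have "0 < m" unfolding m_def using fin e by (subst Min_gr_iff) auto
  then obtain i where i: "i \<in> I" "P i m" using ex by blast
  have "m \<le> e i" unfolding m_def using fin i by (intro Min_le) auto
  then show False using mono[OF i(2)] e[OF i(1)] by blast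
qed

lemma gap_edges_slab: "e \<in> gap_edges d a b \<Longrightarrow> e \<subseteq> slab d c m h \<Longrightarrow> c + int m \<le> a \<or> b \<le> c \<Longrightarrow> False"
  by (fastforce simp: gap_edges_def slab_def)

lemma crossing_ends:
  assumes "xs \<in> crossings d a m h"
  shows "hd xs \<in> slab d a 0 h" "last xs \<in> slab d (a + int m) 0 h"
proof -
  have xs: "xs \<noteq> []" "set xs \<subseteq> slab d a m h" "hd xs 0 = a" "last xs 0 = a + int m"
    using assms by (auto simp: crossings_def lattice_path_def)
  have "hd xs \<in> slab d a m h" "last xs \<in> slab d a m h" using xs hd_in_set[of xs] last_in_set[of xs] by blast+
  then show "hd xs \<in> slab d a 0 h" "last xs \<in> slab d (a + int m) 0 h" using xs by (auto simp: slab_def)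
qed

lemma ptime_crossings_le:
  assumes d: "d \<ge> 1" and P: "\<P> \<noteq> {}" "\<And>xs. xs \<in> \<P> \<Longrightarrow> lattice_path d (cylinder d h) xs \<and> hd xs 0 \<le> a \<and> a + int m \<le> last xs 0"
  shows "ptime (crossings d a m h) u \<le> ptime \<P> u"
proof (rule ptime_ge[OF P(1)])
  fix xs assume "xs \<in> \<P>"
  note xs = P(2)[OF this]
  obtain ys where ys: "ys \<in> crossings d a m h" "\<forall>u. (\<forall>e. 0 \<le> u e) \<longrightarrow> path_weight u ys \<le> path_weight u xs"
    using sub_crossing[of d h xs a m] xs d by blast
  have "ptime (crossings d a m h) u \<le> path_weight (\<lambda>e. max 0 (u e)) ys" by (rule ptime_le[OF ys(1)])
  also have "\<dots> \<le> path_weight (\<lambda>e. max 0 (u e)) xs" using ys(2) by simp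
  finally show "ptime (crossings d a m h) u \<le> path_weight (\<lambda>e. max 0 (u e)) xs" .
qed

definition axis_paths :: "nat \<Rightarrow> nat \<Rightarrow> nat \<Rightarrow> vertex list set" where
  "axis_paths d n h = {xs. lattice_path d (box d n h) xs \<and> hd xs = axis_point 0 \<and> last xs = axis_point (int n)}"

lemma axis_paths_crossings: "axis_paths d n h \<subseteq> crossings d 0 n h"
  by (auto simp: axis_paths_def crossings_def box_eq_slab axis_point_def)

lemma axis_paths_nonempty: "d \<ge> 1 \<Longrightarrow> axis_paths d n h \<noteq> {}"
  using straight_crossing[of d 0 n h] by (auto simp: axis_paths_def box_eq_slab)

lemma axis_point_cylinder: "d \<ge> 1 \<Longrightarrow> axis_point k \<in> cylinder d h"
  by (auto simp: cylinder_def Zd_def axis_point_def)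

text \<open>The gap between the two halves has two or three layers, so that its edges meet neither half.\<close>

primrec halve :: "nat \<Rightarrow> nat \<Rightarrow> nat" where
  "halve n 0 = n"
| "halve n (Suc j) = (halve n j - 2) div 2"

context fpp
begin

definition crossing_time :: "int \<Rightarrow> nat \<Rightarrow> nat \<Rightarrow> 'a \<Rightarrow> real" where
  "crossing_time a m h x = ptime (crossings d a m h) (\<lambda>e. w e x)"

definition axis_time :: "nat \<Rightarrow> nat \<Rightarrow> 'a \<Rightarrow> real" where
  "axis_time n h x = ptime (axis_paths d n h) (\<lambda>e. w e x)"

lemma crossing_time_measurable [measurable]: "crossing_time a m h \<in> borel_measurable M"
  unfolding crossing_time_def[abs_def] by (rule ptime_measurable[OF crossings_paths])

text \<open>The factor 4 d + 8 covers all gluings: one connection of at most 2 h d + 3 edges, two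
  connections of at most 2 h d + 2 edges each, or a straight segment of h + 1 edges.\<close>

definition tail_const :: "real \<Rightarrow> real \<Rightarrow> bool" where
  "tail_const p C \<longleftrightarrow> (\<forall>E H. finite E \<longrightarrow> E \<subseteq> LE \<longrightarrow> 1 \<le> H \<longrightarrow> real (card E) \<le> (4 * real d + 8) * H \<longrightarrow>
    (\<integral>\<^sup>+x. ennreal (max 0 ((\<Sum>e\<in>E. max 0 (w e x)) - C * H) powr p) \<partial>M) \<le> ennreal (C * H powr (p - 1)))"

text \<open>\<open>key\<close> extracts from the two pieces the data on which the connecting edges S
  depend, in practice endpoints. The pieces use edges off G and S consists of edges in G, so S is
  chosen by weights that are independent of those summed over it.\<close>

lemma small_tail_glue:
  fixes key :: "vertex list \<Rightarrow> vertex list \<Rightarrow> 'k"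
  assumes tc: "tail_const p C" and p: "2 < p" and ne: "\<P> \<noteq> {}" "\<P>1 \<noteq> {}" "\<P>2 \<noteq> {}"
    and count: "countable \<P>" "countable \<P>1" "countable \<P>2" and E0: "E0 \<subseteq> LE"
    and edges: "edges_of \<P> \<subseteq> E0" "edges_of \<P>1 \<subseteq> E0 - G" "edges_of \<P>2 \<subseteq> E0 - G"
    and super: "\<And>u. ptime \<P>1 u + ptime \<P>2 u \<le> ptime \<P> u"
    and I: "finite I" "\<And>ys zs. ys \<in> \<P>1 \<Longrightarrow> zs \<in> \<P>2 \<Longrightarrow> key ys zs \<in> I"
    and join: "\<And>i. i \<in> I \<Longrightarrow> \<exists>S. finite S \<and> S \<subseteq> E0 \<inter> G \<and> real (card S) \<le> (4 * real d + 8) * (real h + 1) \<and>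
      (\<forall>ys\<in>\<P>1. \<forall>zs\<in>\<P>2. key ys zs = i \<longrightarrow>
        (\<exists>xs\<in>\<P>. \<forall>u. path_weight u xs = path_weight u ys + path_weight u zs + (\<Sum>e\<in>S. u e)))"
  shows "small_tail M p C (real h + 1) (\<lambda>x. ptime \<P> (\<lambda>e. w e x) - ptime \<P>1 (\<lambda>e. w e x) - ptime \<P>2 (\<lambda>e. w e x))"
proof -
  define f where "f u = ptime \<P> u - ptime \<P>1 u - ptime \<P>2 u" for u
  have un: "(E0 - G) \<union> (E0 \<inter> G) = E0" by auto
  have "small_tail M p C (real h + 1) (\<lambda>x. f (\<lambda>e\<in>(E0 - G) \<union> (E0 \<inter> G). w e x))"
  proof (rule small_tail_fresh[where k = "4 * real d + 8"])
    show "f \<in> borel_measurable (PiM ((E0 - G) \<union> (E0 \<inter> G)) (\<lambda>_. borel))"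
      unfolding un f_def[abs_def] using count edges
      by (intro borel_measurable_diff ptime_measurable_PiM) auto
    show "0 \<le> f (\<lambda>e\<in>(E0 - G) \<union> (E0 \<inter> G). w e x)" for x using super by (simp add: f_def algebra_simps)
    show "E0 - G \<subseteq> LE" "E0 \<inter> G \<subseteq> LE" using E0 by auto
    fix u :: "edge \<Rightarrow> real"
    let ?u = "\<lambda>e. max 0 (u e)"
    define P where "P i e \<longleftrightarrow> (\<exists>ys\<in>\<P>1. \<exists>zs\<in>\<P>2. key ys zs = i \<and>
      path_weight ?u ys + path_weight ?u zs \<le> ptime \<P>1 u + ptime \<P>2 u + e)" for i and e :: real
    have "\<exists>i\<in>I. \<forall>e>0. P i e"
    proof (rule uniform_choice[OF I(1)])
      fix e :: real assume e: "0 < e"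
      obtain ys where ys: "ys \<in> \<P>1" "path_weight ?u ys < ptime \<P>1 u + e / 2" using ptime_near[OF ne(2), of "e / 2"] e by auto
      obtain zs where zs: "zs \<in> \<P>2" "path_weight ?u zs < ptime \<P>2 u + e / 2" using ptime_near[OF ne(3), of "e / 2"] e by auto
      have "P (key ys zs) e" unfolding P_def using ys zs by (intro bexI[of _ ys] bexI[of _ zs]) auto
      then show "\<exists>i\<in>I. P i e" using I(2)[OF ys(1) zs(1)] by blast
    next
      fix i e e' assume "P i e" "e \<le> e'"
      then show "P i e'" unfolding P_def by (meson add_left_mono order_trans)
    qed
    then obtain i where i: "i \<in> I" "\<And>e. e > 0 \<Longrightarrow> P i e" by auto
    obtain S where S: "finite S" "S \<subseteq> E0 \<inter> G" "real (card S) \<le> (4 * real d + 8) * (real h + 1)"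
      and S': "\<And>ys zs. ys \<in> \<P>1 \<Longrightarrow> zs \<in> \<P>2 \<Longrightarrow> key ys zs = i \<Longrightarrow>
        \<exists>xs\<in>\<P>. \<forall>u. path_weight u xs = path_weight u ys + path_weight u zs + (\<Sum>e\<in>S. u e)"
      using join[OF i(1)] by blast
    have "f (merge (E0 - G) (E0 \<inter> G) (u, v)) \<le> (\<Sum>e\<in>S. max 0 (v e))" for v
    proof (rule field_le_epsilon)
      \<comment> \<open>The configuration with the given weights off G and fresh ones in G: both
        pieces keep their passage times.\<close>
      define W where "W = merge (E0 - G) (E0 \<inter> G) (u, v)"
      have Wu: "W e = u e" if "e \<in> E0 - G" for e using that by (simp add: W_def merge_def)
      have Wv: "W e = v e" if "e \<in> E0" "e \<in> G" for e using that by (auto simp: W_def merge_def)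
      have p1: "ptime \<P>1 W = ptime \<P>1 u" by (rule ptime_cong) (use Wu edges in \<open>auto simp: edges_of_def\<close>)
      have p2: "ptime \<P>2 W = ptime \<P>2 u" by (rule ptime_cong) (use Wu edges in \<open>auto simp: edges_of_def\<close>)
      fix e :: real assume "0 < e"
      then obtain ys zs where ys: "ys \<in> \<P>1" and zs: "zs \<in> \<P>2" and key: "key ys zs = i"
        and le: "path_weight ?u ys + path_weight ?u zs \<le> ptime \<P>1 u + ptime \<P>2 u + e"
        using i(2)[of e] unfolding P_def by auto
      obtain xs where xs: "xs \<in> \<P>" "\<And>u. path_weight u xs = path_weight u ys + path_weight u zs + (\<Sum>e\<in>S. u e)"
        using S'[OF ys zs key] by blast
      have "ptime \<P> W \<le> path_weight (\<lambda>e. max 0 (W e)) xs" by (rule ptime_le[OF xs(1)])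
      also have "\<dots> = path_weight (\<lambda>e. max 0 (W e)) ys + path_weight (\<lambda>e. max 0 (W e)) zs + (\<Sum>e\<in>S. max 0 (W e))" by (rule xs(2))
      also have "path_weight (\<lambda>e. max 0 (W e)) ys = path_weight ?u ys"
        by (rule path_weight_cong) (use Wu edges ys in \<open>auto simp: edges_of_def\<close>)
      also have "path_weight (\<lambda>e. max 0 (W e)) zs = path_weight ?u zs"
        by (rule path_weight_cong) (use Wu edges zs in \<open>auto simp: edges_of_def\<close>)
      also have "(\<Sum>e\<in>S. max 0 (W e)) = (\<Sum>e\<in>S. max 0 (v e))"
        using subsetD[OF S(2)] by (intro sum.cong refl) (simp add: Wv)
      finally show "f W \<le> (\<Sum>e\<in>S. max 0 (v e)) + e" unfolding f_def p1 p2 using le by linarith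
    qed
    then show "\<exists>E. finite E \<and> E \<subseteq> E0 \<inter> G \<and> real (card E) \<le> (4 * real d + 8) * (real h + 1) \<and>
        (\<forall>v. f (merge (E0 - G) (E0 \<inter> G) (u, v)) \<le> (\<Sum>e\<in>E. max 0 (v e)))" using S by blast
  qed (use tc p in \<open>auto simp: tail_const_def\<close>)
  moreover have "f (\<lambda>e\<in>(E0 - G) \<union> (E0 \<inter> G). w e x) = ptime \<P> (\<lambda>e. w e x) - ptime \<P>1 (\<lambda>e. w e x) - ptime \<P>2 (\<lambda>e. w e x)" for x
    unfolding un f_def using edges by (intro arg_cong2[of _ _ _ _ "(-)"] ptime_restrict) auto
  ultimately show ?thesis by simp
qed

text \<open>A one-vertex path has weight zero and is used where fewer than two pieces are glued.\<close>

lemma ptime_trivial [simp]: "ptime {[v]} u = 0"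
  by (simp add: ptime_def path_weight_def)

lemma edges_of_trivial [simp]: "edges_of {[v]} = {}"
  by (simp add: edges_of_def)

text \<open>A piece of length at most h + 1 is treated as an error itself: it is dominated by a
  straight segment, all of whose edges count as fresh.\<close>

lemma small_tail_base:
  assumes tc: "tail_const p C" and p: "2 < p" and m: "m \<le> h + 1"
  shows "small_tail M p C (real h + 1) (crossing_time a m h)"
proof -
  let ?E = "inside LE (slab d a m h)"
  obtain xs where xs: "lattice_path d (slab d a m h) xs" "hd xs = axis_point a" "last xs = axis_point (a + int m)"
    "card (set (path_edges xs)) \<le> m" "\<forall>u. path_weight u xs = (\<Sum>e\<in>set (path_edges xs). u e)"
    using straight_crossing[OF d1] by blast
  have xc: "xs \<in> crossings d a m h" using xs by (simp add: crossings_def axis_point_def)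
  have "card (set (path_edges xs)) \<le> h + 1" using xs(4) m by linarith
  then have "real (card (set (path_edges xs))) \<le> real (h + 1)" by (rule of_nat_mono)
  also have "\<dots> = 1 * (real h + 1)" by simp
  also have "\<dots> \<le> (4 * real d + 8) * (real h + 1)" by (rule mult_right_mono) auto
  finally have join: "\<exists>S. finite S \<and> S \<subseteq> ?E \<inter> UNIV \<and> real (card S) \<le> (4 * real d + 8) * (real h + 1) \<and>
      (\<forall>ys\<in>{[undefined]}. \<forall>zs\<in>{[undefined]}. () = i \<longrightarrow>
        (\<exists>xs\<in>crossings d a m h. \<forall>u. path_weight u xs = path_weight u ys + path_weight u zs + (\<Sum>e\<in>S. u e)))" for i
    using path_edges_inside[OF xs(1) slab_Zd] xc xs(5)
    by (intro exI[of _ "set (path_edges xs)"]) (auto simp: path_weight_def intro!: bexI[of _ xs])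
  have nn: "0 \<le> ptime (crossings d a m h) u" for u by (rule ptime_nonneg[OF crossings_nonempty[OF d1]])
  show ?thesis
    using small_tail_glue[OF tc p crossings_nonempty[OF d1] _ _ countable_crossings _ _ _ edges_of_crossings _ _ _ _ _ join, of "{()}"]
    by (simp add: nn crossing_time_def[abs_def])
qed

text \<open>The key consists of the end of the first crossing and the start of the second; the path
  connecting them stays in the gap, so its edges belong to neither half.\<close>

lemma small_tail_merge:
  assumes tc: "tail_const p C" and p: "2 < p" and m: "2 * m' + 2 \<le> m" "m \<le> 2 * m' + 3"
  shows "small_tail M p C (real h + 1) (\<lambda>x. crossing_time 0 m h x - crossing_time 0 m' h x - crossing_time (int m - int m') m' h x)"
proof -
  let ?c0 = "crossings d 0 m h" and ?c1 = "crossings d 0 m' h" and ?c2 = "crossings d (int m - int m') m' h"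
  let ?E = "inside LE (slab d 0 m h)" and ?G = "gap_edges d (int m') (int m - int m')"
  let ?I = "slab d (int m') 0 h \<times> slab d (int m - int m') 0 h"
  have s1: "slab d 0 m' h \<subseteq> slab d 0 m h" and s2: "slab d (int m - int m') m' h \<subseteq> slab d 0 m h" using m by (auto simp: slab_def)
  have c1: "edges_of ?c1 \<subseteq> ?E - ?G"
  proof
    fix e assume "e \<in> edges_of ?c1"
    then have e: "e \<in> LE" "e \<subseteq> slab d 0 m' h" using subsetD[OF edges_of_crossings] by blast+
    then show "e \<in> ?E - ?G" using s1 gap_edges_slab[of e d "int m'" "int m - int m'" 0 m' h] by auto
  qed
  have c2: "edges_of ?c2 \<subseteq> ?E - ?G"
  proof
    fix e assume "e \<in> edges_of ?c2"
    then have e: "e \<in> LE" "e \<subseteq> slab d (int m - int m') m' h" using subsetD[OF edges_of_crossings] by blast+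
    then show "e \<in> ?E - ?G" using s2 gap_edges_slab[of e d "int m'" "int m - int m'" "int m - int m'" m' h] by auto
  qed
  have super: "ptime ?c1 u + ptime ?c2 u \<le> ptime ?c0 u" for u
  proof (rule ptime_ge[OF crossings_nonempty[OF d1]])
    fix xs assume "xs \<in> ?c0"
    then obtain ys zs where "ys \<in> ?c1" "zs \<in> ?c2" "\<forall>u. (\<forall>e. 0 \<le> u e) \<longrightarrow> path_weight u ys + path_weight u zs \<le> path_weight u xs"
      using crossing_superadditive[of xs d 0 m h m' m'] d1 m by auto
    moreover have "ptime ?c1 u \<le> path_weight (\<lambda>e. max 0 (u e)) ys" by (rule ptime_le) fact
    moreover have "ptime ?c2 u \<le> path_weight (\<lambda>e. max 0 (u e)) zs" by (rule ptime_le) fact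
    ultimately show "ptime ?c1 u + ptime ?c2 u \<le> path_weight (\<lambda>e. max 0 (u e)) xs"
      by (smt (verit) max.cobounded1)
  qed
  show ?thesis
    unfolding crossing_time_def
  proof (rule small_tail_glue[OF tc p _ _ _ _ _ _ _ edges_of_crossings c1 c2 super, where I = ?I and key = "\<lambda>ys zs. (last ys, hd zs)"])
    show "(last ys, hd zs) \<in> ?I" if "ys \<in> ?c1" "zs \<in> ?c2" for ys zs
      using crossing_ends(2)[OF that(1)] crossing_ends(1)[OF that(2)] by simp
    fix i assume "i \<in> ?I"
    then obtain x y where xy: "i = (x, y)" "x \<in> slab d (int m') 0 h" "y \<in> slab d (int m - int m') 0 h" by auto
    have x: "x \<in> cylinder d h" "x 0 = int m'" and y: "y \<in> cylinder d h" "y 0 = int m - int m'" using xy by (auto simp: slab_def)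
    obtain cs where cs: "lattice_path d {z \<in> cylinder d h. x 0 \<le> z 0 \<and> z 0 \<le> y 0} cs" "hd cs = x" "last cs = y"
      "set (path_edges cs) \<subseteq> gap_edges d (x 0) (y 0)" "card (set (path_edges cs)) \<le> 2 * h * d + nat (y 0 - x 0)"
      "\<forall>u. path_weight u cs = (\<Sum>e\<in>set (path_edges cs). u e)"
      using connecting_edges[OF x(1) y(1) _ d1] x y m by auto
    have sl: "{z \<in> cylinder d h. x 0 \<le> z 0 \<and> z 0 \<le> y 0} \<subseteq> slab d 0 m h" using x y by (auto simp: slab_def)
    have "set (path_edges cs) \<subseteq> ?E" by (rule path_edges_inside[OF lattice_path_subset[OF cs(1)] slab_Zd]) (use cs(1) sl in \<open>auto simp: lattice_path_def\<close>)
    then have sub: "set (path_edges cs) \<subseteq> ?E \<inter> ?G" using cs(4) x y by auto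
    have "card (set (path_edges cs)) \<le> 2 * h * d + 3" using cs(5) x y m by linarith
    then have "real (card (set (path_edges cs))) \<le> real (2 * h * d + 3)" by (rule of_nat_mono)
    also have "\<dots> \<le> (4 * real d + 8) * (real h + 1)" by (simp add: algebra_simps)
    finally have card: "real (card (set (path_edges cs))) \<le> (4 * real d + 8) * (real h + 1)" .
    have "\<exists>xs\<in>?c0. \<forall>u. path_weight u xs = path_weight u ys + path_weight u zs + (\<Sum>e\<in>set (path_edges cs). u e)"
      if ys: "ys \<in> ?c1" and zs: "zs \<in> ?c2" and k: "(last ys, hd zs) = i" for ys zs
    proof -
      have ysl: "lattice_path d (slab d 0 m' h) ys" "hd ys 0 = 0" using ys by (auto simp: crossings_def)
      have zsl: "lattice_path d (slab d (int m - int m') m' h) zs" "last zs 0 = int m" using zs by (auto simp: crossings_def)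
      have ne: "ys \<noteq> []" "cs \<noteq> []" "zs \<noteq> []" "ys @ tl cs \<noteq> []" using ysl zsl cs by (auto simp: lattice_path_def)
      have yc: "last ys = hd cs" using k cs xy by simp
      note j1 = lattice_path_join[OF ysl(1) cs(1) s1 sl yc]
      have cz: "last (ys @ tl cs) = hd zs" using j1(3) cs k xy by simp
      note j2 = lattice_path_join[OF j1(1) zsl(1) subset_refl s2 cz]
      show ?thesis
      proof (intro bexI[of _ "(ys @ tl cs) @ tl zs"] allI)
        show "(ys @ tl cs) @ tl zs \<in> ?c0" using j1 j2 ysl zsl by (simp add: crossings_def)
        show "path_weight u ((ys @ tl cs) @ tl zs) = path_weight u ys + path_weight u zs + (\<Sum>e\<in>set (path_edges cs). u e)" for u
          by (simp only: path_weight_join[OF ne(4,3) cz] path_weight_join[OF ne(1,2) yc] cs(6))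
      qed
    qed
    then show "\<exists>S. finite S \<and> S \<subseteq> ?E \<inter> ?G \<and> real (card S) \<le> (4 * real d + 8) * (real h + 1) \<and>
        (\<forall>ys\<in>?c1. \<forall>zs\<in>?c2. (last ys, hd zs) = i \<longrightarrow>
          (\<exists>xs\<in>?c0. \<forall>u. path_weight u xs = path_weight u ys + path_weight u zs + (\<Sum>e\<in>S. u e)))"
      using sub card by (intro exI[of _ "set (path_edges cs)"]) auto
  qed (use finite_slab crossings_nonempty[OF d1] countable_crossings in auto)
qed

text \<open>The crossing time from layer 2 to layer n - 2 and the time from axis to axis inside the
  box enclose all three passage times. Their difference is paid by one connection at either
  end.\<close>

lemma small_tail_ends:
  assumes tc: "tail_const p C" and p: "2 < p" and n: "5 \<le> n"
  shows "small_tail M p C (real h + 1) (\<lambda>x. axis_time n h x - crossing_time 2 (n - 4) h x)"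
proof -
  let ?c0 = "axis_paths d n h" and ?c1 = "crossings d 2 (n - 4) h"
  let ?E = "inside LE (slab d 0 n h)"
  define G where "G = gap_edges d 0 2 \<union> gap_edges d (int n - 2) (int n)"
  let ?I = "slab d 2 0 h \<times> slab d (int n - 2) 0 h"
  have s1: "slab d 2 (n - 4) h \<subseteq> slab d 0 n h" using n by (auto simp: slab_def)
  have c0: "edges_of ?c0 \<subseteq> ?E"
    using edges_of_crossings[of d 0 n h] axis_paths_crossings[of d n h] unfolding edges_of_def by blast
  have c1: "edges_of ?c1 \<subseteq> ?E - G"
  proof
    fix e assume "e \<in> edges_of ?c1"
    then have e: "e \<in> LE" "e \<subseteq> slab d 2 (n - 4) h" using subsetD[OF edges_of_crossings] by blast+
    then show "e \<in> ?E - G" using s1 n gap_edges_slab[of e d 0 2 2 "n - 4" h] gap_edges_slab[of e d "int n - 2" "int n" 2 "n - 4" h]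
      by (auto simp: G_def)
  qed
  have super: "ptime ?c1 u \<le> ptime ?c0 u" for u
    by (rule ptime_crossings_le[OF d1 axis_paths_nonempty[OF d1]])
      (use n in \<open>auto simp: axis_paths_def box_def lattice_path_def axis_point_def\<close>)
  have "small_tail M p C (real h + 1) (\<lambda>x. ptime ?c0 (\<lambda>e. w e x) - ptime ?c1 (\<lambda>e. w e x) - ptime {[undefined]} (\<lambda>e. w e x))"
  proof (rule small_tail_glue[OF tc p axis_paths_nonempty[OF d1] _ _ countable_subset[OF axis_paths_crossings] _ _ _ c0 c1, where I = ?I and key = "\<lambda>ys _. (hd ys, last ys)"])
    show "(hd ys, last ys) \<in> ?I" if "ys \<in> ?c1" for ys using crossing_ends[OF that] n by simp
    fix i assume "i \<in> ?I"
    then obtain x y where xy: "i = (x, y)" "x \<in> slab d 2 0 h" "y \<in> slab d (int n - 2) 0 h" by auto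
    have x: "x \<in> cylinder d h" "x 0 = 2" and y: "y \<in> cylinder d h" "y 0 = int n - 2" using xy by (auto simp: slab_def)
    have a0: "axis_point 0 \<in> cylinder d h" "axis_point 0 0 = 0" and an: "axis_point (int n) \<in> cylinder d h" "axis_point (int n) 0 = int n"
      using axis_point_cylinder[OF d1] by (blast, simp add: axis_point_def, blast, simp add: axis_point_def)
    obtain cs where cs: "lattice_path d {z \<in> cylinder d h. axis_point 0 0 \<le> z 0 \<and> z 0 \<le> x 0} cs" "hd cs = axis_point 0" "last cs = x"
      "set (path_edges cs) \<subseteq> gap_edges d (axis_point 0 0) (x 0)" "card (set (path_edges cs)) \<le> 2 * h * d + nat (x 0 - axis_point 0 0)"
      "\<forall>u. path_weight u cs = (\<Sum>e\<in>set (path_edges cs). u e)"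
      using connecting_edges[OF a0(1) x(1) _ d1] x a0 by auto
    obtain es where es: "lattice_path d {z \<in> cylinder d h. y 0 \<le> z 0 \<and> z 0 \<le> axis_point (int n) 0} es" "hd es = y" "last es = axis_point (int n)"
      "set (path_edges es) \<subseteq> gap_edges d (y 0) (axis_point (int n) 0)" "card (set (path_edges es)) \<le> 2 * h * d + nat (axis_point (int n) 0 - y 0)"
      "\<forall>u. path_weight u es = (\<Sum>e\<in>set (path_edges es). u e)"
      using connecting_edges[OF y(1) an(1) _ d1] y an by auto
    let ?S1 = "set (path_edges cs)" and ?S2 = "set (path_edges es)"
    have sl1: "{z \<in> cylinder d h. axis_point 0 0 \<le> z 0 \<and> z 0 \<le> x 0} \<subseteq> slab d 0 n h" using x a0 n by (auto simp: slab_def)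
    have sl2: "{z \<in> cylinder d h. y 0 \<le> z 0 \<and> z 0 \<le> axis_point (int n) 0} \<subseteq> slab d 0 n h" using y an n by (auto simp: slab_def)
    have "?S1 \<subseteq> ?E" by (rule path_edges_inside[OF lattice_path_subset[OF cs(1)] slab_Zd]) (use cs(1) sl1 in \<open>auto simp: lattice_path_def\<close>)
    moreover have "?S2 \<subseteq> ?E" by (rule path_edges_inside[OF lattice_path_subset[OF es(1)] slab_Zd]) (use es(1) sl2 in \<open>auto simp: lattice_path_def\<close>)
    ultimately have sub: "?S1 \<union> ?S2 \<subseteq> ?E \<inter> G" using cs(4) es(4) unfolding x y a0 an by (auto simp: G_def)
    \<comment> \<open>A common edge would meet the layers 1 and n - 1, which are too far apart.
      Being disjoint, the two connections together have as weight the sum over one set.\<close>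
    have disj: "?S1 \<inter> ?S2 = {}"
    proof (rule ccontr)
      assume "?S1 \<inter> ?S2 \<noteq> {}"
      then obtain e where "e \<in> gap_edges d 0 2" "e \<in> gap_edges d (int n - 2) (int n)" using cs(4) es(4) unfolding x y a0 an by auto
      then obtain z z' where z: "e \<in> LE" "z \<in> e" "z' \<in> e" "z 0 = 1" "z' 0 = int n - 1" by (auto simp: gap_edges_def)
      obtain s t where "e = {s, t}" "adjacent d s t" using z(1) by (rule lattice_edgesE)
      then have "\<bar>z 0 - z' 0\<bar> \<le> 1" using z adjacent_coord[of d s t 0] d1 by auto
      then show False using z n by linarith
    qed
    have "card (?S1 \<union> ?S2) \<le> card ?S1 + card ?S2" by (rule card_Un_le)
    also have "\<dots> \<le> (2 * h * d + 2) + (2 * h * d + 2)" using cs(5) es(5) unfolding x y a0 an by linarith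
    finally have "real (card (?S1 \<union> ?S2)) \<le> real (4 * h * d + 4)" by (intro of_nat_mono) (simp add: algebra_simps)
    also have "\<dots> \<le> (4 * real d + 8) * (real h + 1)" by (simp add: algebra_simps)
    finally have card: "real (card (?S1 \<union> ?S2)) \<le> (4 * real d + 8) * (real h + 1)" .
    have "\<exists>xs\<in>?c0. \<forall>u. path_weight u xs = path_weight u ys + (\<Sum>e\<in>?S1 \<union> ?S2. u e)"
      if ys: "ys \<in> ?c1" and k: "(hd ys, last ys) = i" for ys
    proof -
      have ysl: "lattice_path d (slab d 2 (n - 4) h) ys" using ys by (auto simp: crossings_def)
      have ne: "ys \<noteq> []" "cs \<noteq> []" "es \<noteq> []" "cs @ tl ys \<noteq> []" using ysl es cs by (auto simp: lattice_path_def)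
      have cy: "last cs = hd ys" using k cs xy by simp
      note j1 = lattice_path_join[OF cs(1) ysl sl1 s1 cy]
      have ye: "last (cs @ tl ys) = hd es" using j1(3) es k xy by simp
      note j2 = lattice_path_join[OF j1(1) es(1) subset_refl sl2 ye]
      show ?thesis
      proof (intro bexI[of _ "(cs @ tl ys) @ tl es"] allI)
        show "(cs @ tl ys) @ tl es \<in> ?c0" using j1 j2 cs es by (simp add: axis_paths_def box_eq_slab)
        have "(\<Sum>e\<in>?S1 \<union> ?S2. u e) = (\<Sum>e\<in>?S1. u e) + (\<Sum>e\<in>?S2. u e)" for u :: "edge \<Rightarrow> real"
          by (rule sum.union_disjoint[OF _ _ disj]) auto
        then show "path_weight u ((cs @ tl ys) @ tl es) = path_weight u ys + (\<Sum>e\<in>?S1 \<union> ?S2. u e)" for u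
          by (simp only: path_weight_join[OF ne(4,3) ye] path_weight_join[OF ne(2,1) cy] cs(6) es(6))
      qed
    qed
    then show "\<exists>S. finite S \<and> S \<subseteq> ?E \<inter> G \<and> real (card S) \<le> (4 * real d + 8) * (real h + 1) \<and>
        (\<forall>ys\<in>?c1. \<forall>zs\<in>{[undefined]}. (hd ys, last ys) = i \<longrightarrow>
          (\<exists>xs\<in>?c0. \<forall>u. path_weight u xs = path_weight u ys + path_weight u zs + (\<Sum>e\<in>S. u e)))"
      using sub card by (intro exI[of _ "?S1 \<union> ?S2"]) (simp add: path_weight_def)
  qed (use finite_slab crossings_nonempty[OF d1] countable_crossings super in auto)
  then show ?thesis by (simp add: axis_time_def crossing_time_def)
qed

text \<open>The halves lie in disjoint slabs, which gives independence, and are translates of each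
  other, which gives equality in law.\<close>

lemma halving_chain:
  assumes tc: "tail_const p C" and p: "2 < p" and J: "\<And>j. j < J \<Longrightarrow> h + 1 < halve n j" "halve n J \<le> h + 1"
  shows "merge_chain M p C (real h + 1) J (\<lambda>j. crossing_time 0 (halve n j) h)
    (\<lambda>j. crossing_time (int (halve n j) - int (halve n (Suc j))) (halve n (Suc j)) h)
    (\<lambda>j x. crossing_time 0 (halve n j) h x - crossing_time 0 (halve n (Suc j)) h x
       - crossing_time (int (halve n j) - int (halve n (Suc j))) (halve n (Suc j)) h x)"
  unfolding merge_chain_def
proof (intro conjI allI impI)
  fix j assume j: "j < J"
  define m where "m = halve n j"
  define m' where "m' = halve n (Suc j)"
  have m2: "2 \<le> m" using J(1)[OF j] by (simp add: m_def)
  have m: "2 * m' + 2 \<le> m" "m \<le> 2 * m' + 3" using m2 by (auto simp: m'_def m_def)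
  show "small_tail M p C (real h + 1) (\<lambda>x. crossing_time 0 (halve n j) h x - crossing_time 0 (halve n (Suc j)) h x
       - crossing_time (int (halve n j) - int (halve n (Suc j))) (halve n (Suc j)) h x)"
    using small_tail_merge[OF tc p m] by (simp only: m_def m'_def)
  show "distr M borel (crossing_time (int (halve n j) - int (halve n (Suc j))) (halve n (Suc j)) h) = distr M borel (crossing_time 0 (halve n (Suc j)) h)"
    unfolding crossing_time_def[abs_def] by (rule crossing_time_law)
  show "indep_var borel (crossing_time 0 (halve n (Suc j)) h) borel (crossing_time (int (halve n j) - int (halve n (Suc j))) (halve n (Suc j)) h)"
    unfolding crossing_time_def[abs_def] m_def[symmetric] m'_def[symmetric]
  proof (rule ptime_indep[OF countable_crossings countable_crossings edges_of_crossings edges_of_crossings])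
    have "slab d 0 m' h \<inter> slab d (int m - int m') m' h = {}" using m by (auto simp: slab_def)
    moreover have "e \<noteq> {}" if "e \<in> LE" for e using that by (rule lattice_edgesE) auto
    ultimately show "inside LE (slab d 0 m' h) \<inter> inside LE (slab d (int m - int m') m' h) = {}" by blast
  qed auto
qed (use small_tail_base[OF tc p J(2)] in auto)

end

section \<open>The lower bound for the variance\<close>

lemma sum_set_le_sum_list:
  fixes f :: "'b \<Rightarrow> real"
  assumes "\<And>x. 0 \<le> f x"
  shows "(\<Sum>x\<in>set xs. f x) \<le> (\<Sum>x\<leftarrow>xs. f x)"
proof (induction xs)
  case (Cons x xs)
  have "(\<Sum>x\<in>set (x # xs). f x) \<le> f x + (\<Sum>x\<in>set xs. f x)"
    using assms[of x] by (cases "x \<in> set xs") (simp_all add: insert_absorb)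
  then show ?case using Cons.IH by simp
qed simp

lemma sum_list_drop_le:
  fixes f g :: "'b \<Rightarrow> real"
  assumes "\<And>x. g x \<le> f x" "y \<in> set xs"
  shows "(\<Sum>x\<leftarrow>xs. g x) \<le> (\<Sum>x\<leftarrow>xs. f x) - (f y - g y)"
  using assms(2)
proof (induction xs)
  case (Cons x xs)
  have "(\<Sum>x\<leftarrow>xs. g x) \<le> (\<Sum>x\<leftarrow>xs. f x)" using assms(1) by (rule sum_list_mono)
  then show ?case using Cons assms(1)[of x] by (cases "x = y") auto
qed simp

lemma ptime_mono:
  assumes "\<P> \<noteq> {}" "\<And>e. max 0 (\<omega> e) \<le> max 0 (\<omega>' e)"
  shows "ptime \<P> \<omega> \<le> ptime \<P> \<omega>'"
proof (rule ptime_ge[OF assms(1)])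
  fix xs assume xs: "xs \<in> \<P>"
  have "ptime \<P> \<omega> \<le> path_weight (\<lambda>e. max 0 (\<omega> e)) xs" by (rule ptime_le[OF xs])
  also have "\<dots> \<le> path_weight (\<lambda>e. max 0 (\<omega>' e)) xs" unfolding path_weight_def using assms(2) by (rule sum_list_mono)
  finally show "ptime \<P> \<omega> \<le> path_weight (\<lambda>e. max 0 (\<omega>' e)) xs" .
qed

text \<open>A path may use e several times; its loops are erased first, so that c is paid at most
  once.\<close>

lemma ptime_upd_le:
  assumes d: "d \<ge> 1" and c: "0 \<le> c"
  shows "ptime (crossings d a m h) (u(e := c)) \<le> ptime (crossings d a m h) u + c"
proof -
  let ?P = "crossings d a m h" and ?g = "\<lambda>e'. max 0 ((u(e := c)) e')"
  have "ptime ?P (u(e := c)) - c \<le> ptime ?P u"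
  proof (rule ptime_ge[OF crossings_nonempty[OF d]])
    fix xs assume "xs \<in> ?P"
    then have xs: "lattice_path d (slab d a m h) xs" "hd xs 0 = a" "last xs 0 = a + int m" by (auto simp: crossings_def)
    obtain ys where ys: "lattice_path d (slab d a m h) ys" "hd ys = hd xs" "last ys = last xs" "distinct ys"
      "set (path_edges ys) \<subseteq> set (path_edges xs)" using distinct_lattice_path[OF xs(1)] by blast
    have "ys \<in> ?P" using xs ys by (simp add: crossings_def)
    then have "ptime ?P (u(e := c)) \<le> path_weight ?g ys" by (rule ptime_le)
    also have "\<dots> = (\<Sum>e'\<in>set (path_edges ys). ?g e')"
      unfolding path_weight_def by (rule sum_list_distinct_conv_sum_set[OF distinct_path_edges[OF ys(4)]])
    also have "\<dots> \<le> (\<Sum>e'\<in>set (path_edges ys). max 0 (u e') + (if e' = e then c else 0))"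
      using c by (intro sum_mono) auto
    also have "\<dots> \<le> (\<Sum>e'\<in>set (path_edges ys). max 0 (u e')) + c"
      using c by (simp add: sum.distrib)
    also have "(\<Sum>e'\<in>set (path_edges ys). max 0 (u e')) \<le> (\<Sum>e'\<in>set (path_edges xs). max 0 (u e'))"
      by (rule sum_mono2) (use ys in auto)
    also have "\<dots> \<le> path_weight (\<lambda>e. max 0 (u e)) xs" unfolding path_weight_def by (rule sum_set_le_sum_list) simp
    finally show "ptime ?P (u(e := c)) - c \<le> path_weight (\<lambda>e. max 0 (u e)) xs" by simp
  qed
  then show ?thesis by simp
qed

lemma ptime_upd_drop:
  assumes P: "\<P> \<noteq> {}" and c: "0 \<le> c" and xs: "xs \<in> \<P>" "path_weight (\<lambda>e. max 0 (u e)) xs \<le> ptime \<P> u + \<epsilon>"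
    and e: "e \<in> set (path_edges xs)" "c \<le> u e"
  shows "u e - c - \<epsilon> \<le> ptime \<P> u - ptime \<P> (u(e := c))"
proof -
  have "ptime \<P> (u(e := c)) \<le> path_weight (\<lambda>e'. max 0 ((u(e := c)) e')) xs" by (rule ptime_le[OF xs(1)])
  also have "\<dots> \<le> path_weight (\<lambda>e. max 0 (u e)) xs - (max 0 (u e) - max 0 ((u(e := c)) e))"
    unfolding path_weight_def using e by (intro sum_list_drop_le) auto
  also have "\<dots> = path_weight (\<lambda>e. max 0 (u e)) xs - (u e - c)" using e c by simp
  finally show ?thesis using xs(2) by linarith
qed

context fpp
begin

lemma prob_le: "e \<in> LE \<Longrightarrow> prob (w e -` {..c} \<inter> space M) = cdf F c"
  using measure_distr[OF rv, of e "{..c}"] law[of e] by (simp add: cdf_def)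

text \<open>Overwriting the weight of e by c yields a passage time \<open>Te e\<close> that is
  independent of the centred indicator \<open>\<phi> e\<close>, so in the covariance T may be
  replaced by T - Te e. The resulting product is never negative, by monotonicity, and on the heavy
  edges of a near-optimal path it is at least q (c2 - c) up to the tolerance. The sum of all
  \<open>\<phi> e\<close> has variance at most the number of edges.\<close>

lemma variance_lower_bound:
  fixes n h
  defines "T \<equiv> crossing_time 0 n h" and "E \<equiv> inside LE (slab d 0 n h)"
  assumes sqT: "integrable M (\<lambda>x. (T x)^2)" and c: "0 \<le> c" "c < c2"
    and R [measurable]: "R \<in> borel_measurable M" and R0: "\<And>x. 0 \<le> R x"
    and Rle: "\<And>x xs. xs \<in> crossings d 0 n h \<Longrightarrow> R x \<le> real (card {e \<in> set (path_edges xs). c2 < w e x})"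
  shows "(cdf F c * (c2 - c) * expectation R)^2 \<le> variance T * real (card E)"
proof -
  let ?P = "crossings d 0 n h"
  define q where "q = cdf F c"
  have finE: "finite E" unfolding E_def by (intro finite_inside finite_slab)
  have EL: "E \<subseteq> LE" by (auto simp: E_def)
  have ed: "edges_of ?P \<subseteq> E" unfolding E_def by (rule edges_of_crossings)
  have ne: "?P \<noteq> {}" by (rule crossings_nonempty[OF d1])
  have q: "0 \<le> q" "q \<le> 1" using real_distribution.axioms(1)[OF realF] by (auto simp: q_def cdf_def prob_space.prob_le_1)
  have T [measurable]: "T \<in> borel_measurable M" by (simp add: T_def)
  have iT: "integrable M T" by (rule expectation_abs_le(1)[OF T sqT])
  define Te where "Te e x = ptime ?P ((\<lambda>e. w e x)(e := c))" for e x
  \<comment> \<open>Equals the indicator of a weight above c minus its mean 1 - q.\<close>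
  define \<phi> where "\<phi> e x = q - of_bool (w e x \<le> c)" for e x
  define \<Phi> where "\<Phi> x = (\<Sum>e\<in>E. \<phi> e x)" for x
  have T_eq: "T x = ptime ?P (\<lambda>e. w e x)" for x by (simp add: T_def crossing_time_def)
  have w [measurable]: "w e \<in> borel_measurable M" if "e \<in> E" for e using rv EL that by auto
  have \<phi>m [measurable]: "\<phi> e \<in> borel_measurable M" if "e \<in> E" for e
    unfolding \<phi>_def[abs_def] using w[OF that] by measurable
  have \<phi>b: "\<bar>\<phi> e x\<bar> \<le> 1" for e x using q by (auto simp: \<phi>_def of_bool_def)
  have \<phi>\<phi>b: "\<bar>\<phi> e x * \<phi> e' x\<bar> \<le> 1" for e e' x unfolding abs_mult using \<phi>b by (intro mult_le_one) auto
  note \<phi>\<phi>1 = abs_le_D1[OF \<phi>\<phi>b]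
  have i\<phi>: "integrable M (\<phi> e)" if "e \<in> E" for e
    by (rule integrable_const_bound[where B = 1]) (use \<phi>b \<phi>m[OF that] in auto)
  have E\<phi>: "expectation (\<phi> e) = 0" if e: "e \<in> E" for e
  proof -
    have S: "w e -` {..c} \<inter> space M \<in> events" using w[OF e] by measurable
    have "expectation (\<lambda>x. of_bool (w e x \<le> c)) = expectation (indicator (w e -` {..c} \<inter> space M))"
      by (intro Bochner_Integration.integral_cong) (auto simp: indicator_def)
    also have "\<dots> = q" using S prob_le[of e c] e EL by (auto simp: q_def)
    finally have *: "expectation (\<lambda>x. of_bool (w e x \<le> c)) = q" .
    have "integrable M (\<lambda>x. of_bool (w e x \<le> c) :: real)"
      by (rule integrable_const_bound[where B = 1]) (use w[OF e] in \<open>auto\<close>)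
    then have "expectation (\<phi> e) = q - expectation (\<lambda>x. of_bool (w e x \<le> c))"
      unfolding \<phi>_def by (simp add: prob_space)
    then show ?thesis using * by simp
  qed
  have Te0: "0 \<le> Te e x" for e x unfolding Te_def by (rule ptime_nonneg[OF ne])
  have Te_m [measurable]: "Te e \<in> borel_measurable M" for e
    unfolding Te_def by (rule ptime_measurable_gen[OF countable_crossings]) (use ed w in auto)
  have iTe: "integrable M (Te e)" for e
  proof (rule Bochner_Integration.integrable_bound)
    show "integrable M (\<lambda>x. T x + c)" using iT by simp
    show "AE x in M. norm (Te e x) \<le> norm (T x + c)"
      using ptime_upd_le[OF d1 c(1)] Te0 c by (intro AE_I2) (auto simp: Te_def T_eq intro: order_trans[OF _ abs_ge_self])
  qed measurable
  have ind: "expectation (\<lambda>x. Te e x * \<phi> e x) = 0 \<and> integrable M (\<lambda>x. Te e x * \<phi> e x)" if e: "e \<in> E" for e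
  proof -
    define f1 where "f1 u = ptime ?P (u(e := c))" for u :: "edge \<Rightarrow> real"
    define f2 where "f2 v = q - of_bool (v e \<le> c)" for v :: "edge \<Rightarrow> real"
    have f1: "f1 \<in> borel_measurable (PiM (E - {e}) (\<lambda>_. borel))"
      unfolding f1_def
    proof (rule ptime_measurable_gen[OF countable_crossings])
      fix e' assume "e' \<in> edges_of ?P"
      then show "(\<lambda>u. (u(e := c)) e') \<in> borel_measurable (PiM (E - {e}) (\<lambda>_. borel))"
      proof (cases "e' = e")
        case False
        then have "e' \<in> E - {e}" using \<open>e' \<in> edges_of ?P\<close> ed by blast
        then show ?thesis using False measurable_component_singleton[of e' "E - {e}" "\<lambda>_. borel :: real measure"] by simp
      qed simp
    qed
    have f2: "f2 \<in> borel_measurable (PiM {e} (\<lambda>_. borel))"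
      unfolding f2_def by measurable
    have "indep_var borel (\<lambda>x. f1 (\<lambda>e\<in>E - {e}. w e x)) borel (\<lambda>x. f2 (\<lambda>e\<in>{e}. w e x))"
      by (rule indep_var_disjoint_functions[OF indep _ _ _ f1 f2]) (use e EL in auto)
    moreover have "f1 (\<lambda>e\<in>E - {e}. w e x) = Te e x" for x
      unfolding f1_def Te_def by (rule ptime_cong) (use ed in \<open>auto simp: edges_of_def\<close>)
    moreover have "f2 (\<lambda>e\<in>{e}. w e x) = \<phi> e x" for x by (simp add: f2_def \<phi>_def)
    ultimately have iv: "indep_var borel (Te e) borel (\<phi> e)" by simp
    from indep_var_lebesgue_integral[OF this iTe i\<phi>[OF e]] indep_var_integrable[OF this iTe i\<phi>[OF e]] show ?thesis
      using E\<phi>[OF e] by simp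
  qed
  have \<phi>\<phi>: "expectation (\<lambda>x. \<phi> e x * \<phi> e' x) \<le> of_bool (e = e')" if e: "e \<in> E" "e' \<in> E" for e e'
  proof (cases "e = e'")
    case True
    have "expectation (\<lambda>x. \<phi> e x * \<phi> e x) \<le> expectation (\<lambda>x. 1)"
    proof (rule integral_mono)
      show "integrable M (\<lambda>x. \<phi> e x * \<phi> e x)"
        by (rule integrable_const_bound[where B = 1]) (use \<phi>\<phi>1 \<phi>m[OF e(1)] in auto)
      show "\<phi> e x * \<phi> e x \<le> 1" for x
        by (rule \<phi>\<phi>1)
    qed simp
    then show ?thesis using True by (simp add: prob_space)
  next
    case False
    define f where "f e u = q - of_bool (u e \<le> c)" for e and u :: "edge \<Rightarrow> real"
    have f: "f e \<in> borel_measurable (PiM {e} (\<lambda>_. borel))" for e unfolding f_def by measurable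
    have "indep_var borel (\<lambda>x. f e (\<lambda>e\<in>{e}. w e x)) borel (\<lambda>x. f e' (\<lambda>e\<in>{e'}. w e x))"
      by (rule indep_var_disjoint_functions[OF indep _ _ _ f f]) (use e EL False in auto)
    then have "indep_var borel (\<phi> e) borel (\<phi> e')" by (simp add: f_def \<phi>_def[abs_def])
    from indep_var_lebesgue_integral[OF this i\<phi>[OF e(1)] i\<phi>[OF e(2)]] show ?thesis using E\<phi> e False by simp
  qed
  have \<Phi>m [measurable]: "\<Phi> \<in> borel_measurable M" unfolding \<Phi>_def[abs_def] by measurable
  have i\<phi>\<phi>: "integrable M (\<lambda>x. \<phi> e x * \<phi> e' x)" if e: "e \<in> E" "e' \<in> E" for e e'
    by (rule integrable_const_bound[where B = 1]) (use \<phi>\<phi>b \<phi>m[OF e(1)] \<phi>m[OF e(2)] in auto)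
  have \<Phi>2: "(\<Phi> x)^2 = (\<Sum>e\<in>E. \<Sum>e'\<in>E. \<phi> e x * \<phi> e' x)" for x
    by (simp add: \<Phi>_def power2_eq_square sum_product)
  have i\<Phi>2: "integrable M (\<lambda>x. (\<Phi> x)^2)" unfolding \<Phi>2 using i\<phi>\<phi> by auto
  have E\<Phi>2: "expectation (\<lambda>x. (\<Phi> x)^2) \<le> real (card E)"
  proof -
    have "expectation (\<lambda>x. (\<Phi> x)^2) = (\<Sum>e\<in>E. \<Sum>e'\<in>E. expectation (\<lambda>x. \<phi> e x * \<phi> e' x))"
      unfolding \<Phi>2 using i\<phi>\<phi> by (subst Bochner_Integration.integral_sum; intro sum.cong refl Bochner_Integration.integral_sum Bochner_Integration.integrable_sum) auto
    also have "\<dots> \<le> (\<Sum>e\<in>E. \<Sum>e'\<in>E. of_bool (e = e'))" using \<phi>\<phi> by (intro sum_mono)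
    also have "\<dots> = real (card E)" using finE by (simp add: of_bool_def)
    finally show ?thesis .
  qed
  have i\<Phi>: "integrable M \<Phi>" unfolding \<Phi>_def[abs_def] using i\<phi> by auto
  have E\<Phi>: "expectation \<Phi> = 0" unfolding \<Phi>_def using i\<phi> E\<phi> by (subst Bochner_Integration.integral_sum) auto
  have iT\<phi>: "integrable M (\<lambda>x. T x * \<phi> e x)" if "e \<in> E" for e
  proof (rule Bochner_Integration.integrable_bound[OF iT])
    show "AE x in M. norm (T x * \<phi> e x) \<le> norm (T x)" using \<phi>b by (intro AE_I2) (simp add: abs_mult mult_left_le)
  qed (use \<phi>m[OF that] in measurable)
  have pw: "q * (c2 - c) * R x \<le> (\<Sum>e\<in>E. (T x - Te e x) * \<phi> e x)" for x
  proof (rule field_le_epsilon)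
    fix r :: real assume r: "0 < r"
    \<comment> \<open>The infimum need not be attained; each of the at most card E heavy edges on
      the chosen path loses the tolerance once.\<close>
    define \<epsilon> where "\<epsilon> = r / (real (card E) + 1)"
    have "real (card E) * r \<le> r * (real (card E) + 1)" using r by (simp add: algebra_simps)
    then have \<epsilon>: "0 < \<epsilon>" "real (card E) * \<epsilon> \<le> r" using r by (simp_all add: \<epsilon>_def pos_divide_le_eq)
    obtain xs where xs: "xs \<in> ?P" "path_weight (\<lambda>e. max 0 (w e x)) xs < T x + \<epsilon>"
      using ptime_near[OF ne \<epsilon>(1), of "\<lambda>e. w e x", folded T_eq] by blast
    let ?A = "{e \<in> set (path_edges xs). c2 < w e x}"
    have AE: "?A \<subseteq> E" using xs ed by (auto simp: edges_of_def)
    have nonneg: "0 \<le> (T x - Te e x) * \<phi> e x" for e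
    proof (cases "w e x \<le> c")
      case True
      have "T x \<le> Te e x" unfolding T_eq Te_def by (rule ptime_mono[OF ne]) (use True in auto)
      then show ?thesis using True q by (simp add: \<phi>_def mult_nonpos_nonpos)
    next
      case False
      have "Te e x \<le> T x" unfolding T_eq Te_def by (rule ptime_mono[OF ne]) (use False in auto)
      then show ?thesis using False q by (simp add: \<phi>_def)
    qed
    have big: "q * (c2 - c) - \<epsilon> \<le> (T x - Te e x) * \<phi> e x" if e: "e \<in> ?A" for e
    proof -
      have "w e x - c - \<epsilon> \<le> T x - Te e x"
        unfolding T_eq Te_def by (rule ptime_upd_drop[OF ne c(1) xs(1)]) (use xs e c in \<open>auto simp: T_eq\<close>)
      then have "q * (c2 - c - \<epsilon>) \<le> q * (T x - Te e x)" using q e by (intro mult_left_mono) auto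
      moreover have "q * \<epsilon> \<le> \<epsilon>" using q \<epsilon> by (simp add: mult_left_le_one_le)
      moreover have "\<phi> e x = q" using e c by (auto simp: \<phi>_def)
      ultimately show ?thesis by (simp add: algebra_simps)
    qed
    have "q * (c2 - c) * R x \<le> q * (c2 - c) * real (card ?A)" using Rle[OF xs(1), of x] q c by (intro mult_left_mono) auto
    also have "\<dots> = (\<Sum>e\<in>?A. q * (c2 - c) - \<epsilon>) + real (card ?A) * \<epsilon>" by (simp add: algebra_simps)
    also have "(\<Sum>e\<in>?A. q * (c2 - c) - \<epsilon>) \<le> (\<Sum>e\<in>?A. (T x - Te e x) * \<phi> e x)" using big by (rule sum_mono)
    also have "\<dots> \<le> (\<Sum>e\<in>E. (T x - Te e x) * \<phi> e x)" using finE AE nonneg by (intro sum_mono2) auto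
    also have "real (card ?A) * \<epsilon> \<le> real (card E) * \<epsilon>" using card_mono[OF finE AE] \<epsilon> by (intro mult_right_mono) auto
    also note \<epsilon>(2)
    finally show "q * (c2 - c) * R x \<le> (\<Sum>e\<in>E. (T x - Te e x) * \<phi> e x) + r" by simp
  qed
  have iR: "integrable M R"
  proof (rule integrable_const_bound[where B = "real (card E)"])
    obtain xs where xs: "xs \<in> ?P" using ne by blast
    have "R x \<le> real (card E)" for x
    proof -
      have "card {e \<in> set (path_edges xs). c2 < w e x} \<le> card E"
        using xs ed by (intro card_mono[OF finE]) (auto simp: edges_of_def)
      then show ?thesis using Rle[OF xs, of x] by linarith
    qed
    then show "AE x in M. norm (R x) \<le> real (card E)" using R0 by auto
  qed measurable
  have iD: "integrable M (\<lambda>x. (T x - Te e x) * \<phi> e x)" "expectation (\<lambda>x. (T x - Te e x) * \<phi> e x) = expectation (\<lambda>x. T x * \<phi> e x)" if "e \<in> E" for e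
    using iT\<phi>[OF that] ind[OF that] by (simp_all add: left_diff_distrib)
  have "q * (c2 - c) * expectation R = expectation (\<lambda>x. q * (c2 - c) * R x)" by simp
  also have "\<dots> \<le> expectation (\<lambda>x. \<Sum>e\<in>E. (T x - Te e x) * \<phi> e x)"
    using pw iR iD by (intro integral_mono) auto
  also have "\<dots> = (\<Sum>e\<in>E. expectation (\<lambda>x. T x * \<phi> e x))"
    using iD by (subst Bochner_Integration.integral_sum) auto
  also have "\<dots> = expectation (\<lambda>x. \<Sum>e\<in>E. T x * \<phi> e x)" using iT\<phi> by (subst Bochner_Integration.integral_sum) auto
  also have "\<dots> = expectation (\<lambda>x. T x * \<Phi> x)" by (simp add: \<Phi>_def sum_distrib_left)
  also have "\<dots> = expectation (\<lambda>x. (T x - expectation T) * \<Phi> x)"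
    using i\<Phi> E\<Phi> integrable_mult_square[OF T \<Phi>m sqT i\<Phi>2] by (simp add: left_diff_distrib)
  finally have 1: "q * (c2 - c) * expectation R \<le> expectation (\<lambda>x. (T x - expectation T) * \<Phi> x)" .
  have "0 \<le> q * (c2 - c) * expectation R" using q c R0 by (intro mult_nonneg_nonneg integral_nonneg_AE) auto
  then have "(q * (c2 - c) * expectation R)^2 \<le> (expectation (\<lambda>x. (T x - expectation T) * \<Phi> x))^2" using 1 by (rule power_mono[rotated])
  also have "\<dots> \<le> variance T * expectation (\<lambda>x. (\<Phi> x)^2)"
    by (rule integral_cauchy_schwarz[OF _ \<Phi>m integrable_centered_square[OF T sqT] i\<Phi>2]) measurable
  also have "\<dots> \<le> variance T * real (card E)" using E\<Phi>2 by (intro mult_left_mono) auto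
  finally show ?thesis by (simp add: q_def)
qed

end

section \<open>Counting edges, and decay of connections on the lattice\<close>

lemma card_slab:
  assumes d: "d \<ge> 1"
  shows "card (slab d a m h) \<le> (m + 1) * (2 * h + 1) ^ (d - 1)"
proof -
  let ?B = "\<lambda>i. if i = 0 then {a..a + int m} else {- int h..int h}"
  have "card (slab d a m h) \<le> card (PiE {..<d} ?B)"
  proof (rule card_inj_on_le[where f = "\<lambda>z. restrict z {..<d}"])
    show "inj_on (\<lambda>z. restrict z {..<d}) (slab d a m h)"
    proof (rule inj_onI, rule ext)
      fix x y i assume *: "x \<in> slab d a m h" "y \<in> slab d a m h" "restrict x {..<d} = restrict y {..<d}"
      show "x i = y i"
      proof (cases "i < d")
        case True
        then show ?thesis using fun_cong[OF *(3), of i] by simp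
      qed (use *(1,2) in \<open>simp add: slab_def cylinder_def Zd_def\<close>)
    qed
    show "(\<lambda>z. restrict z {..<d}) ` slab d a m h \<subseteq> PiE {..<d} ?B"
      unfolding image_subset_iff restrict_PiE_iff by (auto simp: slab_def cylinder_def abs_le_iff minus_le_iff)
  qed (intro finite_PiE; simp)
  also have "\<dots> = (\<Prod>i<d. card (?B i))" by (rule card_PiE) simp
  also have "{..<d} = insert 0 {1..<d}" using d by auto
  also have "(\<Prod>i\<in>insert 0 {1..<d}. card (?B i)) = (m + 1) * (2 * h + 1) ^ (d - 1)"
  proof -
    have "card {a..a + int m} = m + 1" "card {- int h..int h} = 2 * h + 1"
      by (subst card_atLeastAtMost_int, linarith)+
    then show ?thesis by (subst prod.insert) (auto intro: prod.cong)
  qed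
  finally show ?thesis .
qed

lemma lattice_edge_step:
  assumes "e \<in> lattice_edges d"
  shows "\<exists>x i. i < d \<and> e = {x, x(i := x i + 1)}"
proof -
  obtain x y where e: "e = {x, y}" and Z: "x \<in> Zd d" "y \<in> Zd d" and adj: "adjacent d x y" using assms by (rule lattice_edgesE)
  have s1: "(\<Sum>j<d. \<bar>x j - y j\<bar>) = 1" using adj by (simp add: adjacent_def)
  have "\<exists>i<d. x i \<noteq> y i"
  proof (rule ccontr)
    assume "\<not> ?thesis"
    then have "(\<Sum>j<d. \<bar>x j - y j\<bar>) = 0" by (intro sum.neutral) auto
    then show False using s1 by simp
  qed
  then obtain i where i: "i < d" "x i \<noteq> y i" by blast
  have sp: "(\<Sum>j<d. \<bar>x j - y j\<bar>) = \<bar>x i - y i\<bar> + (\<Sum>j\<in>{..<d} - {i}. \<bar>x j - y j\<bar>)"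
    using i by (intro sum.remove) auto
  have nn: "0 \<le> (\<Sum>j\<in>{..<d} - {i}. \<bar>x j - y j\<bar>)" by (intro sum_nonneg) auto
  have "(\<Sum>j\<in>{..<d} - {i}. \<bar>x j - y j\<bar>) = 0" and xi: "\<bar>x i - y i\<bar> = 1" using sp s1 nn i by linarith+
  then have "\<forall>j\<in>{..<d} - {i}. \<bar>x j - y j\<bar> = 0" by (subst (asm) sum_nonneg_eq_0_iff) auto
  then have eq: "x j = y j" if "j \<noteq> i" for j using Z that by (cases "j < d") (auto simp: Zd_def)
  consider "y i = x i + 1" | "x i = y i + 1" using xi by linarith
  then show ?thesis
  proof cases
    case 1
    then have "y = x(i := x i + 1)" using eq by auto
    then show ?thesis using i e by blast
  next
    case 2
    then have "x = y(i := y i + 1)" using eq by auto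
    then show ?thesis using i e by (intro exI[of _ y] exI[of _ i]) auto
  qed
qed

lemma card_inside:
  assumes "finite S"
  shows "card (inside (lattice_edges d) S) \<le> d * card S"
proof -
  have "inside (lattice_edges d) S \<subseteq> (\<lambda>(x, i). {x, x(i := x i + 1)}) ` (S \<times> {..<d})"
  proof
    fix e assume e: "e \<in> inside (lattice_edges d) S"
    then obtain x i where xi: "i < d" "e = {x, x(i := x i + 1)}" using lattice_edge_step[of e d] by blast
    then have "x \<in> S" using e by auto
    then show "e \<in> (\<lambda>(x, i). {x, x(i := x i + 1)}) ` (S \<times> {..<d})" using xi by (intro image_eqI[of _ _ "(x, i)"]) auto
  qed
  then have "card (inside (lattice_edges d) S) \<le> card ((\<lambda>(x, i). {x, x(i := x i + 1)}) ` (S \<times> {..<d}))"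
    using assms by (intro card_mono) auto
  also have "\<dots> \<le> card (S \<times> {..<d})" using assms by (intro card_image_le) auto
  also have "\<dots> = d * card S" by (simp add: card_cartesian_product)
  finally show ?thesis .
qed

lemma card_inside_slab:
  assumes d: "d \<ge> 1"
  shows "card (inside (lattice_edges d) (slab d a m h)) \<le> d * ((m + 1) * (2 * h + 1) ^ (d - 1))"
  by (rule order_trans[OF card_inside[OF finite_slab]]) (intro mult_left_mono card_slab[OF d], simp)

definition translate :: "vertex \<Rightarrow> vertex \<Rightarrow> vertex" where
  "translate v z = (\<lambda>i. z i + v i)"

lemma inj_translate: "inj (translate v)"
  by (rule injI) (auto simp: translate_def fun_eq_iff)

lemma surj_translate: "surj (translate v)"
proof (rule surjI)
  show "translate v (\<lambda>i. z i - v i) = z" for z by (simp add: translate_def)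
qed

lemma translate_lattice_edges:
  assumes "v \<in> Zd d"
  shows "translate v ` e \<in> lattice_edges d \<longleftrightarrow> e \<in> lattice_edges d"
proof -
  have Z: "translate v z \<in> Zd d \<longleftrightarrow> z \<in> Zd d" for z using assms by (auto simp: Zd_def translate_def)
  have adj: "adjacent d (translate v x) (translate v y) \<longleftrightarrow> adjacent d x y" for x y
    by (simp add: adjacent_def translate_def)
  show ?thesis
  proof
    assume "e \<in> lattice_edges d"
    then obtain x y where "e = {x, y}" "x \<in> Zd d" "y \<in> Zd d" "adjacent d x y" by (rule lattice_edgesE)
    then show "translate v ` e \<in> lattice_edges d" by (simp add: lattice_edges_iff Z adj)
  next
    assume "translate v ` e \<in> lattice_edges d"
    then obtain x' y' where xy': "translate v ` e = {x', y'}" "x' \<in> Zd d" "y' \<in> Zd d" "adjacent d x' y'" by (rule lattice_edgesE)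
    obtain x y where xy: "x' = translate v x" "y' = translate v y" using surjD[OF surj_translate] by blast
    have "translate v ` e = translate v ` {x, y}" by (simp only: xy'(1) xy image_insert image_empty)
    then have "e = {x, y}" by (rule inj_image_eq_iff[OF inj_translate, THEN iffD1])
    then show "e \<in> lattice_edges d" using xy' xy by (simp add: lattice_edges_iff Z adj)
  qed
qed

text \<open>One finite set around the origin has exit mean below 1; its translates have the same
  exit mean and serve at every vertex. L is one more than the largest first coordinate in the set,
  so that also the exit edges gain at most L.\<close>

lemma subcritical_decay:
  assumes d: "d \<ge> 1" and p: "0 \<le> p" "p \<le> 1" "p < p_crit d"
  shows "\<exists>L>0. \<exists>\<rho>\<ge>0. \<rho> < 1 \<and> (\<forall>E v k. finite E \<longrightarrow> E \<subseteq> lattice_edges d \<longrightarrow> v \<in> Zd d \<longrightarrow>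
    bern p E (\<lambda>A. of_bool (conn_to A v {z. v 0 + int (k * L) \<le> z 0})) \<le> \<rho> ^ k)"
proof -
  let ?o = "axis_point 0" and ?LE = "lattice_edges d"
  obtain S where S: "finite S" "S \<subseteq> Zd d" "?o \<in> S" "exit_mean p ?LE S ?o < 1"
    using subcritical_exists[OF d p(1,3)] by blast
  define \<rho> where "\<rho> = max 0 (exit_mean p ?LE S ?o)"
  define m where "m = Max ((\<lambda>z. z 0) ` S)"
  have m: "z 0 \<le> m" if "z \<in> S" for z unfolding m_def using S that by (intro Max_ge) auto
  have m0: "0 \<le> m" using m[OF S(3)] by (simp add: axis_point_def)
  define L where "L = nat (m + 1)"
  have L: "int L = m + 1" "0 < L" using m0 by (auto simp: L_def)
  have dec: "bern p E (\<lambda>A. of_bool (conn_to A v {z. v 0 + int k * int L \<le> z 0})) \<le> \<rho> ^ k"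
    if E: "finite E" "E \<subseteq> ?LE" and v: "v \<in> Zd d" for E v k
  proof (rule exponential_decay[where S = "\<lambda>v. translate v ` S" and V = "Zd d" and LE = ?LE])
    fix v assume v: "v \<in> Zd d"
    note im = exit_mean_image[OF inj_translate translate_lattice_edges[OF v] surj_translate]
    have o: "translate v ?o = v" by (simp add: translate_def axis_point_def)
    show "v \<in> translate v ` S \<and> finite (inside ?LE (translate v ` S)) \<and> finite (bdry ?LE (translate v ` S)) \<and>
      exit_mean p ?LE (translate v ` S) v \<le> \<rho> \<and> (\<forall>x\<in>translate v ` S. x 0 < v 0 + int L) \<and>
      (\<forall>(x, y)\<in>bdry ?LE (translate v ` S). y 0 \<le> v 0 + int L)"
    proof (intro conjI)
      show "v \<in> translate v ` S" using S(3) o by force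
      show "finite (inside ?LE (translate v ` S))" "finite (bdry ?LE (translate v ` S))"
        using S by (auto intro!: finite_inside finite_bdry_lattice)
      show "exit_mean p ?LE (translate v ` S) v \<le> \<rho>" using im(1)[of p S ?o] by (simp add: o \<rho>_def)
      show "\<forall>x\<in>translate v ` S. x 0 < v 0 + int L" using m L by (fastforce simp: translate_def)
      show "\<forall>(x, y)\<in>bdry ?LE (translate v ` S). y 0 \<le> v 0 + int L"
      proof clarify
        fix x y assume xy: "(x, y) \<in> bdry ?LE (translate v ` S)"
        then have "adjacent d x y" by (auto simp: bdry_def lattice_edges_iff)
        then have "\<bar>x 0 - y 0\<bar> \<le> 1" using d by (intro adjacent_coord) auto
        moreover obtain z where "z \<in> S" "x = translate v z" using xy by (auto simp: bdry_def)
        ultimately show "y 0 \<le> v 0 + int L" using m[of z] L by (auto simp: translate_def)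
      qed
    qed
  qed (use p E v L Union_lattice_edges in \<open>auto simp: \<rho>_def\<close>)
  show ?thesis
    using L(2) S(4) dec by (intro exI[of _ L] conjI exI[of _ \<rho>] allI impI) (auto simp: \<rho>_def)
qed

text \<open>For the union bound over the starting points of a crossing, of which there are at most
  (2 n + 1)^d when h \<le> n.\<close>

lemma poly_times_geometric_small:
  assumes N: "0 < N"
  shows "\<forall>\<^sub>F n in sequentially. real (2 * n + 1) ^ d * (1/2) ^ (n div N) \<le> (1/2 :: real)"
proof -
  define a where "a = ln 2 / real N"
  have a: "0 < a" using N by (simp add: a_def)
  have "filterlim (\<lambda>n. a * real n) at_top sequentially"
    by (rule filterlim_tendsto_pos_mult_at_top[OF tendsto_const a filterlim_real_sequentially])
  from tendsto_mult[OF tendsto_const filterlim_compose[OF tendsto_power_div_exp_0[of d] this]]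
  have "(\<lambda>n. (2 * (3 / a) ^ d) * ((a * real n) ^ d / exp (a * real n))) \<longlonglongrightarrow> (2 * (3 / a) ^ d) * 0" .
  then have "\<forall>\<^sub>F n in sequentially. (2 * (3 / a) ^ d) * ((a * real n) ^ d / exp (a * real n)) < 1/2"
    by (rule order_tendstoD) simp
  then show ?thesis using eventually_ge_at_top[of 1]
  proof eventually_elim
    case (elim n)
    have "n < N * (n div N + 1)" using N dividend_less_times_div[of N n] by simp
    then have "real n < real (N * (n div N + 1))" by (rule of_nat_less_iff[THEN iffD2])
    then have "real n \<le> real N * (real (n div N) + 1)" by (simp add: algebra_simps)
    then have "a * real n \<le> a * (real N * (real (n div N) + 1))" using a by (intro mult_left_mono) auto
    also have "\<dots> = ln 2 * (real (n div N) + 1)" using N by (simp add: a_def)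
    finally have "exp (a * real n) \<le> exp (ln 2 * (real (n div N) + 1))" by simp
    also have "\<dots> = 2 powr (real (n div N + 1))" by (simp add: powr_def algebra_simps)
    also have "\<dots> = 2 ^ (n div N + 1)" by (subst powr_realpow) auto
    finally have "exp (a * real n) * (1/2) ^ (n div N) \<le> 2 ^ (n div N + 1) * (1/2) ^ (n div N)" by (intro mult_right_mono) auto
    also have "\<dots> = 2" by (simp only: power_add power_one_right power_one_over) simp
    finally have half: "(1/2) ^ (n div N) \<le> 2 / exp (a * real n)" by (simp only: pos_le_divide_eq exp_gt_zero mult.commute)
    have "real (2 * n + 1) ^ d \<le> (3 * real n) ^ d" using elim by (intro power_mono) auto
    also have "3 * real n = (3 / a) * (a * real n)" using a by simp
    also have "\<dots> ^ d = (3 / a) ^ d * (a * real n) ^ d" by (rule power_mult_distrib)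
    finally have "real (2 * n + 1) ^ d * (1/2) ^ (n div N) \<le> ((3 / a) ^ d * (a * real n) ^ d) * (2 / exp (a * real n))"
      using half by (intro mult_mono) (use a in auto)
    also have "\<dots> = (2 * (3 / a) ^ d) * ((a * real n) ^ d / exp (a * real n))" by simp
    finally show ?case using elim by linarith
  qed
qed

lemma path_step_edge:
  assumes "successively (adjacent d) xs" "xs \<noteq> []" "d \<ge> 1" "hd xs 0 \<le> c" "c < last xs 0"
  shows "\<exists>x y. {x, y} \<in> set (path_edges xs) \<and> x 0 = c \<and> y 0 = c + 1"
  using assms
proof (induction xs)
  case (Cons x xs)
  then obtain y ys where xs: "xs = y # ys" by (cases xs) auto
  show ?case
  proof (cases "y 0 \<le> c")
    case True
    have "\<exists>x y. {x, y} \<in> set (path_edges xs) \<and> x 0 = c \<and> y 0 = c + 1"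
      by (rule Cons.IH) (use Cons.prems True xs in auto)
    then show ?thesis unfolding xs by auto
  next
    case False
    have "\<bar>x 0 - y 0\<bar> \<le> 1" using Cons.prems xs by (intro adjacent_coord[of d]) auto
    then have "x 0 = c" "y 0 = c + 1" using False Cons.prems(4) by auto
    then show ?thesis unfolding xs by (intro exI[of _ x] exI[of _ y]) simp
  qed
qed simp

section \<open>Heavy edges on every crossing\<close>

context fpp
begin

text \<open>Closed edges are those of weight above c. A minorant R that is valid for all crossings
  at once takes the place of the number of closed edges on a near-optimal crossing, which would
  depend on how the crossing is selected.\<close>

definition closed_bound :: "real \<Rightarrow> nat \<Rightarrow> nat \<Rightarrow> ('a \<Rightarrow> real) \<Rightarrow> bool" where
  "closed_bound c n h R \<longleftrightarrow> R \<in> borel_measurable M \<and> (\<forall>x. 0 \<le> R x) \<and>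
    (\<forall>x. \<forall>xs\<in>crossings d 0 n h. R x \<le> real (card {e \<in> set (path_edges xs). c < w e x}))"

lemma cdf_bounds: "0 \<le> cdf F c" "cdf F c \<le> 1"
  using real_distribution.axioms(1)[OF realF] by (auto simp: cdf_def prob_space.prob_le_1)

lemma closed_edges_law:
  assumes "finite E" "E \<subseteq> LE"
  shows "expectation (\<lambda>x. g {e \<in> E. w e x \<in> {..c}}) = bern (cdf F c) E g"
    "(\<lambda>x. g {e \<in> E. w e x \<in> {..c}} :: real) \<in> borel_measurable M"
proof -
  have T: "{..c} \<in> sets (borel :: real measure)" by simp
  have q: "prob (w e -` {..c} \<inter> space M) = cdf F c" if "e \<in> E" for e using prob_le that assms by blast
  show "expectation (\<lambda>x. g {e \<in> E. w e x \<in> {..c}}) = bern (cdf F c) E g"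
    "(\<lambda>x. g {e \<in> E. w e x \<in> {..c}} :: real) \<in> borel_measurable M"
    using expectation_open_set[OF indep assms T q, of g] by blast+
qed

text \<open>Only the edges from layer i to layer i + 1 are considered in slice i, so different
  slices share no edge, and each slice that is entirely closed contributes an edge of its own to
  every crossing.\<close>

lemma closed_slices:
  "\<exists>R. closed_bound c n h R \<and> real n * (1 - cdf F c) ^ (d * (2 * (2 * h + 1) ^ (d - 1))) \<le> expectation R"
proof -
  define Es where "Es i = {e \<in> inside LE (slab d (int i) 1 h). \<exists>z\<in>e. \<exists>z'\<in>e. z 0 = int i \<and> z' 0 = int i + 1}" for i
  let ?q = "cdf F c"
  have fin: "finite (Es i)" for i
    by (rule finite_subset[OF _ finite_inside[OF finite_slab[of d "int i" 1 h], of LE]]) (auto simp: Es_def)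
  have EL: "Es i \<subseteq> LE" for i by (auto simp: Es_def)
  have disj: "i = j" if "e \<in> Es i" "e \<in> Es j" for i j e
  proof -
    obtain z z' where z: "z \<in> e" "z' \<in> e" "z 0 = int j" "z' 0 = int j + 1" using \<open>e \<in> Es j\<close> by (auto simp: Es_def)
    have "e \<subseteq> slab d (int i) 1 h" using \<open>e \<in> Es i\<close> by (auto simp: Es_def)
    then have "int i \<le> z 0" "z' 0 \<le> int i + 1" using z by (auto simp: slab_def)
    then show ?thesis using z by simp
  qed
  define g where "g A = (of_bool (A = {}) :: real)" for A :: "edge set"
  define R where "R x = (\<Sum>i<n. g {e \<in> Es i. w e x \<in> {..c}})" for x
  have meas: "R \<in> borel_measurable M"
    unfolding R_def by (intro borel_measurable_sum closed_edges_law(2) fin EL)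
  have le: "R x \<le> real (card {e \<in> set (path_edges xs). c < w e x})" if xs: "xs \<in> crossings d 0 n h" for x xs
  proof -
    have p: "lattice_path d (slab d 0 n h) xs" "hd xs 0 = 0" "last xs 0 = int n" using xs by (auto simp: crossings_def)
    have pe: "set (path_edges xs) \<subseteq> inside LE (slab d 0 n h)" by (rule path_edges_inside[OF p(1) slab_Zd])
    have ex: "\<exists>e. e \<in> set (path_edges xs) \<and> e \<in> Es i" if i: "i < n" for i
    proof -
      obtain z z' where z: "{z, z'} \<in> set (path_edges xs)" "z 0 = int i" "z' 0 = int i + 1"
        using path_step_edge[of d xs "int i"] p i d1 by (auto simp: lattice_path_def)
      have "{z, z'} \<in> LE" "{z, z'} \<subseteq> slab d 0 n h" using z(1) pe by blast+
      then have "{z, z'} \<in> Es i" using z(2,3) by (auto simp: Es_def slab_def)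
      then show ?thesis using z(1) by blast
    qed
    define f where "f i = (SOME e. e \<in> set (path_edges xs) \<and> e \<in> Es i)" for i
    have f: "f i \<in> set (path_edges xs)" "f i \<in> Es i" if "i < n" for i
      using someI_ex[OF ex[OF that]] by (auto simp: f_def)
    let ?I = "{i. i < n \<and> {e \<in> Es i. w e x \<in> {..c}} = {}}"
    have "card ?I \<le> card {e \<in> set (path_edges xs). c < w e x}"
    proof (rule card_inj_on_le[where f = f])
      show "inj_on f ?I" using f disj by (intro inj_onI) (metis (no_types, lifting) mem_Collect_eq)
      show "f ` ?I \<subseteq> {e \<in> set (path_edges xs). c < w e x}"
      proof clarify
        fix i assume i: "i < n" "{e \<in> Es i. w e x \<in> {..c}} = {}"
        then have "\<not> w (f i) x \<le> c" using f[OF i(1)] by blast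
        then show "f i \<in> set (path_edges xs) \<and> c < w (f i) x" using f[OF i(1)] by simp
      qed
    qed simp
    moreover have "R x = real (card ?I)"
    proof -
      have "?I = {..<n} \<inter> {i. {e \<in> Es i. w e x \<in> {..c}} = {}}" by auto
      then show ?thesis unfolding R_def g_def of_bool_def by (simp add: sum.If_cases)
    qed
    ultimately show ?thesis by linarith
  qed
  have each: "(1 - ?q) ^ (d * (2 * (2 * h + 1) ^ (d - 1))) \<le> bern ?q (Es i) g" for i
  proof -
    have "bern ?q (Es i) g = (\<Sum>A\<in>{{}}. ?q ^ card A * (1 - ?q) ^ card (Es i - A) * g A)"
      unfolding bern_def by (rule sum.mono_neutral_right) (use fin in \<open>auto simp: g_def\<close>)
    then have eq: "bern ?q (Es i) g = (1 - ?q) ^ card (Es i)" by (simp add: g_def)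
    have "card (Es i) \<le> card (inside LE (slab d (int i) 1 h))"
      by (rule card_mono[OF finite_inside[OF finite_slab]]) (auto simp: Es_def)
    also have "\<dots> \<le> d * ((1 + 1) * (2 * h + 1) ^ (d - 1))" by (rule card_inside_slab[OF d1])
    finally have card: "card (Es i) \<le> d * (2 * (2 * h + 1) ^ (d - 1))" by (simp only: one_add_one)
    show ?thesis unfolding eq using card cdf_bounds[of c] by (intro power_decreasing) auto
  qed
  have "expectation R = (\<Sum>i<n. expectation (\<lambda>x. g {e \<in> Es i. w e x \<in> {..c}}))"
    unfolding R_def
  proof (rule Bochner_Integration.integral_sum)
    fix i
    show "integrable M (\<lambda>x. g {e \<in> Es i. w e x \<in> {..c}})"
      by (rule integrable_const_bound[where B = 1, OF _ closed_edges_law(2)[OF fin EL]]) (auto simp: g_def)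
  qed
  also have "\<dots> = (\<Sum>i<n. bern ?q (Es i) g)" by (intro sum.cong refl closed_edges_law(1) fin EL)
  also have "\<dots> \<ge> (\<Sum>i<n. (1 - ?q) ^ (d * (2 * (2 * h + 1) ^ (d - 1))))" by (intro sum_mono each)
  finally have "real n * (1 - ?q) ^ (d * (2 * (2 * h + 1) ^ (d - 1))) \<le> expectation R" by simp
  moreover have "0 \<le> R x" for x by (auto simp: R_def g_def intro!: sum_nonneg)
  ultimately show ?thesis using meas le by (intro exI[of _ R]) (auto simp: closed_bound_def)
qed

text \<open>If a crossing had at most k closed edges, sprinkling with probability s would open them
  at the price s^k and produce a connection over the distance K k L at the still subcritical
  parameter p; such connections have probability at most \<rho>^(K k). For K large the quotient is
  at most 2^(-k). With k proportional to n this beats the number of starting points.\<close>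

lemma closed_edges_subcritical:
  assumes q: "cdf F c < 1" "cdf F c < p_crit d"
  shows "\<exists>b>0. \<forall>\<^sub>F n in sequentially. \<forall>h\<le>n. \<exists>R. closed_bound c n h R \<and> b * real n \<le> expectation R"
proof -
  let ?q = "cdf F c"
  define p where "p = (?q + min 1 (p_crit d)) / 2"
  have p: "?q < p" "0 \<le> p" "p \<le> 1" "p < p_crit d" "p < 1" using q cdf_bounds[of c] by (auto simp: p_def min_def field_simps)
  \<comment> \<open>Chosen so that sprinkling raises the parameter from \<open>cdf F c\<close>
    exactly to p.\<close>
  define s where "s = (p - ?q) / (1 - ?q)"
  have s: "0 < s" "s \<le> 1" "?q + s - ?q * s = p"
  proof -
    show "0 < s" "s \<le> 1" using p q by (auto simp: s_def divide_le_eq)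
    have "s * (1 - ?q) = p - ?q" using q by (simp add: s_def)
    then show "?q + s - ?q * s = p" by (simp add: algebra_simps)
  qed
  obtain L \<rho> where L: "0 < L" and \<rho>: "0 \<le> \<rho>" "\<rho> < 1"
    and dec: "\<And>E v k. finite E \<Longrightarrow> E \<subseteq> LE \<Longrightarrow> v \<in> Zd d \<Longrightarrow>
      bern p E (\<lambda>A. of_bool (conn_to A v {z. v 0 + int (k * L) \<le> z 0})) \<le> \<rho> ^ k"
    using subcritical_decay[OF d1 p(2-4)] by metis
  obtain K0 where K0: "\<rho> ^ K0 < s / 2" using real_arch_pow_inv[of "s / 2" \<rho>] s \<rho> by auto
  \<comment> \<open>The successor keeps K and hence N positive, as division by N requires.\<close>
  define K where "K = Suc K0"
  have "\<rho> ^ K \<le> \<rho> ^ K0" unfolding K_def using \<rho> by (intro power_decreasing) auto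
  then have K: "0 < K" "\<rho> ^ K \<le> s / 2" using K0 by (auto simp: K_def)
  define N where "N = K * L"
  have N: "0 < N" using K L by (simp add: N_def)
  show ?thesis
  proof (intro exI[of _ "1 / (2 * real N)"] conjI)
    show "0 < 1 / (2 * real N)" using N by simp
    show "\<forall>\<^sub>F n in sequentially. \<forall>h\<le>n. \<exists>R. closed_bound c n h R \<and> 1 / (2 * real N) * real n \<le> expectation R"
      using poly_times_geometric_small[OF N, of d]
    proof (eventually_elim, intro allI impI)
      fix n h assume small: "real (2 * n + 1) ^ d * (1/2) ^ (n div N) \<le> (1/2 :: real)" and hn: "h \<le> n"
      define k where "k = n div N"
      define E where "E = inside LE (slab d 0 n h)"
      define B where "B v = {z :: vertex. v 0 + int ((K * k) * L) \<le> z 0}" for v :: vertex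
      define Ev where "Ev v A \<longleftrightarrow> (\<exists>R\<subseteq>E. card R \<le> k \<and> conn_to (A \<union> R) v (B v))" for v A
      let ?S0 = "slab d 0 0 h"
      \<comment> \<open>If no starting point has a connection with at most k closed edges, then
        every crossing has at least k + 1 of them.\<close>
      define g where "g A = real (k + 1) * of_bool (\<forall>v\<in>?S0. \<not> Ev v A)" for A
      define R where "R x = g {e \<in> E. w e x \<in> {..c}}" for x
      have finE: "finite E" and EL: "E \<subseteq> LE" unfolding E_def using finite_inside[OF finite_slab] by auto
      have Evb: "bern ?q E (\<lambda>A. of_bool (Ev v A)) \<le> (1/2) ^ k" if v: "v \<in> ?S0" for v
      proof -
        have vZ: "v \<in> Zd d" using v slab_Zd by blast
        have "bern ?q E (\<lambda>A. of_bool (Ev v A)) * s ^ k \<le> bern (?q + s - ?q * s) E (\<lambda>A. of_bool (conn_to A v (B v)))"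
          unfolding Ev_def using s cdf_bounds[of c] by (intro few_closed_edges[OF finE]) auto
        also have "\<dots> \<le> \<rho> ^ (K * k)" unfolding s(3) B_def by (rule dec[OF finE EL vZ])
        also have "\<dots> = (\<rho> ^ K) ^ k" by (rule power_mult)
        also have "\<dots> \<le> (s / 2) ^ k" using K \<rho> by (intro power_mono) auto
        also have "\<dots> = (1/2) ^ k * s ^ k" by (simp add: power_divide)
        finally show ?thesis using s by (subst (asm) mult_le_cancel_right_pos) auto
      qed
      have le: "R x \<le> real (card {e \<in> set (path_edges xs). c < w e x})" if xs: "xs \<in> crossings d 0 n h" for x xs
      proof (rule ccontr)
        assume *: "\<not> ?thesis"
        let ?C = "{e \<in> set (path_edges xs). c < w e x}" and ?A = "{e \<in> E. w e x \<in> {..c}}"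
        have p': "lattice_path d (slab d 0 n h) xs" "hd xs 0 = 0" "last xs 0 = int n" using xs by (auto simp: crossings_def)
        have pe: "set (path_edges xs) \<subseteq> E" unfolding E_def by (rule path_edges_inside[OF p'(1) slab_Zd])
        have h0: "hd xs \<in> ?S0" by (rule crossing_ends(1)[OF xs])
        have none: "\<forall>v\<in>?S0. \<not> Ev v ?A"
        proof (rule ccontr)
          assume "\<not> ?thesis"
          then have "R x = 0" by (simp only: R_def g_def of_bool_eq mult_zero_right)
          then show False using * by simp
        qed
        have "R x = real (k + 1)" by (simp only: R_def g_def eqTrueI[OF none] of_bool_eq mult_1_right)
        then have card: "card ?C \<le> k" using * by linarith
        have "n div N * N \<le> n" by (rule div_times_less_eq_dividend)
        then have "(K * k) * L \<le> n" by (simp add: k_def N_def algebra_simps)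
        then have "int ((K * k) * L) \<le> int n" by (rule of_nat_mono)
        then have "last xs \<in> B (hd xs)" using p' by (simp add: B_def)
        moreover have "(hd xs, last xs) \<in> conn (set (path_edges xs))"
          using p'(1) by (intro lattice_path_conn) (auto simp: lattice_path_def)
        moreover have "conn (set (path_edges xs)) \<subseteq> conn (?A \<union> ?C)" by (rule conn_mono) (use pe in auto)
        ultimately have "conn_to (?A \<union> ?C) (hd xs) (B (hd xs))" unfolding conn_to_def by blast
        then have "Ev (hd xs) ?A" unfolding Ev_def using pe card by (intro exI[of _ ?C]) auto
        then show False using none h0 by blast
      qed
      have "real (k + 1) * (1 - real (card ?S0) * (1/2) ^ k) \<le> real (k + 1) * (1 - (\<Sum>v\<in>?S0. bern ?q E (\<lambda>A. of_bool (Ev v A))))"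
      proof (intro mult_left_mono diff_mono order_refl)
        have "(\<Sum>v\<in>?S0. bern ?q E (\<lambda>A. of_bool (Ev v A))) \<le> (\<Sum>v\<in>?S0. (1/2) ^ k)" using Evb by (intro sum_mono)
        then show "(\<Sum>v\<in>?S0. bern ?q E (\<lambda>A. of_bool (Ev v A))) \<le> real (card ?S0) * (1/2) ^ k" by simp
      qed simp
      also have "\<dots> = bern ?q E (\<lambda>A. real (k + 1) * (1 - (\<Sum>v\<in>?S0. of_bool (Ev v A))))"
        by (simp only: bern_cmult bern_diff bern_sum bern_const[OF finE])
      also have "\<dots> \<le> bern ?q E g"
      proof (rule bern_mono[OF cdf_bounds])
        fix A
        have "1 - (\<Sum>v\<in>?S0. of_bool (Ev v A)) \<le> (of_bool (\<forall>v\<in>?S0. \<not> Ev v A) :: real)"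
        proof (cases "\<forall>v\<in>?S0. \<not> Ev v A")
          case True
          have "0 \<le> (\<Sum>v\<in>?S0. of_bool (Ev v A) :: real)" by (intro sum_nonneg) simp
          then show ?thesis using True by simp
        next
          case False
          then obtain v where v: "v \<in> ?S0" "Ev v A" by blast
          have "(of_bool (Ev v A) :: real) \<le> (\<Sum>v\<in>?S0. of_bool (Ev v A))"
            by (rule member_le_sum) (use v finite_slab in auto)
          then show ?thesis using v False by simp
        qed
        then show "real (k + 1) * (1 - (\<Sum>v\<in>?S0. of_bool (Ev v A))) \<le> g A" unfolding g_def by (rule mult_left_mono) simp
      qed
      also have "\<dots> = expectation R" unfolding R_def by (rule closed_edges_law(1)[OF finE EL, symmetric])
      finally have ER: "real (k + 1) * (1 - real (card ?S0) * (1/2) ^ k) \<le> expectation R" .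
      have "card ?S0 \<le> (0 + 1) * (2 * h + 1) ^ (d - 1)" by (rule card_slab[OF d1])
      also have "\<dots> \<le> (2 * n + 1) ^ (d - 1)" using hn by (simp add: power_mono)
      also have "\<dots> \<le> (2 * n + 1) ^ d" by (rule power_increasing) auto
      finally have "real (card ?S0) \<le> real (2 * n + 1) ^ d" by (metis of_nat_le_iff of_nat_power)
      then have "real (card ?S0) * (1/2) ^ k \<le> real (2 * n + 1) ^ d * (1/2) ^ k" by (intro mult_right_mono) auto
      also have "\<dots> \<le> 1/2" using small by (simp only: k_def)
      finally have "1/2 \<le> 1 - real (card ?S0) * (1/2) ^ k" by simp
      then have "real (k + 1) * (1/2) \<le> real (k + 1) * (1 - real (card ?S0) * (1/2) ^ k)" by (intro mult_left_mono) auto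
      then have ER2: "real (k + 1) * (1/2) \<le> expectation R" using ER by linarith
      have "n < N * (k + 1)" using N dividend_less_times_div[of N n] by (simp add: k_def)
      then have "real n < real (N * (k + 1))" by (rule of_nat_less_iff[THEN iffD2])
      then have "1 / (2 * real N) * real n \<le> 1 / (2 * real N) * real (N * (k + 1))" by (intro mult_left_mono) auto
      also have "\<dots> = real (k + 1) * (1/2)" using N by (simp add: field_simps)
      finally have "1 / (2 * real N) * real n \<le> expectation R" using ER2 by linarith
      moreover have "closed_bound c n h R"
        unfolding closed_bound_def
      proof (intro conjI allI ballI)
        show "R \<in> borel_measurable M" unfolding R_def by (rule closed_edges_law(2)[OF finE EL])
        show "0 \<le> R x" for x by (simp add: R_def g_def)
      qed (rule le)
      ultimately show "\<exists>R. closed_bound c n h R \<and> 1 / (2 * real N) * real n \<le> expectation R" by blast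
    qed
  qed
qed

end

section \<open>The central limit theorem\<close>

lemma halve_upper: "halve n j * 2 ^ j \<le> n"
proof (induction j)
  case (Suc j)
  have "halve n (Suc j) * 2 ^ Suc j \<le> (2 * ((halve n j - 2) div 2)) * 2 ^ j" by simp
  also have "\<dots> \<le> halve n j * 2 ^ j" by (intro mult_right_mono) auto
  finally show ?case using Suc by linarith
qed simp

text \<open>Adding 3 turns the relation m \<le> 2 m' + 3 into a homogeneous one.\<close>

lemma halve_lower: "n + 3 \<le> (halve n j + 3) * 2 ^ j"
proof (induction j)
  case (Suc j)
  have "halve n j + 3 \<le> (halve n (Suc j) + 3) * 2" unfolding halve.simps by presburger
  then have "(halve n j + 3) * 2 ^ j \<le> ((halve n (Suc j) + 3) * 2) * 2 ^ j" by (rule mult_right_mono) simp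
  also have "((halve n (Suc j) + 3) * 2) * 2 ^ j = (halve n (Suc j) + 3) * 2 ^ Suc j" by simp
  finally show ?case using Suc by linarith
qed simp

definition levels :: "nat \<Rightarrow> nat \<Rightarrow> nat" where
  "levels n h = (LEAST j. halve n j \<le> h + 1)"

text \<open>The last two bounds say that 2^J is of the order n / (h + 1). The upper one controls
  R^J, and the lower one makes the number of halvings tend to infinity.\<close>

lemma levels:
  shows "halve n (levels n h) \<le> h + 1" "\<And>j. j < levels n h \<Longrightarrow> h + 1 < halve n j"
    and "h + 1 \<le> n \<Longrightarrow> 2 ^ levels n h * (h + 1) \<le> 2 * n" "n \<le> (h + 4) * 2 ^ levels n h"
proof -
  \<comment> \<open>After n halvings the length is 0, so a least j exists.\<close>
  have "halve n n * 2 ^ n < 2 ^ n" using halve_upper[of n n] less_exp[of n] by linarith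
  then have "halve n n \<le> h + 1" by (cases "halve n n") auto
  then show 1: "halve n (levels n h) \<le> h + 1" unfolding levels_def by (rule LeastI)
  show 2: "h + 1 < halve n j" if "j < levels n h" for j using not_less_Least[of j "\<lambda>j. halve n j \<le> h + 1"] that by (simp add: levels_def)
  show "2 ^ levels n h * (h + 1) \<le> 2 * n" if "h + 1 \<le> n"
  proof (cases "levels n h")
    case (Suc j)
    have "(h + 1) * 2 ^ j \<le> halve n j * 2 ^ j" using 2[of j] Suc by (intro mult_right_mono) auto
    then have "(h + 1) * 2 ^ j \<le> n" using halve_upper[of n j] by linarith
    then have "2 * ((h + 1) * 2 ^ j) \<le> 2 * n" by (rule mult_left_mono) simp
    then show ?thesis unfolding Suc power_Suc by (simp only: mult_ac)
  qed (use that in simp)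
  have "(halve n (levels n h) + 3) * 2 ^ levels n h \<le> (h + 4) * 2 ^ levels n h" using 1 by (intro mult_right_mono) auto
  then show "n \<le> (h + 4) * 2 ^ levels n h" using halve_lower[of n "levels n h"] by linarith
qed

section \<open>Powers of n\<close>

lemma neg_powr_tendsto_0:
  assumes "0 < e"
  shows "(\<lambda>n. c * real n powr (- e)) \<longlonglongrightarrow> 0"
  using tendsto_mult_right_zero[OF tendsto_neg_powr[OF _ filterlim_real_sequentially, of "- e"]] assms by simp

text \<open>All quantities are compared with powers of n through H \<le> n^a, 1 / s \<le> k n^(-1/2)
  H^((d-1)/2) and 2^J \<le> 2 n / H.\<close>

lemma rate_limits:
  fixes H s :: "nat \<Rightarrow> real" and J :: "nat \<Rightarrow> nat" and d :: nat and p a c :: real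
  assumes d: "2 \<le> d" and p: "2 < p" and a: "0 < a" "a * (real d + 1 + 2 * (real d - 1) / (p - 2)) < 1" and c: "0 < c"
    and ev: "\<forall>\<^sub>F n in sequentially. 1 \<le> H n \<and> H n \<le> real n powr a \<and> 2 ^ J n * H n \<le> 2 * real n \<and>
      c * real n \<le> (s n)^2 * H n ^ (d - 1) \<and> 0 < s n"
  shows "\<exists>R q. 2 < R \<and> R < 2 powr (p / 2) \<and> p < q \<and> (\<lambda>n. H n / s n) \<longlonglongrightarrow> 0 \<and>
    (\<lambda>n. R ^ J n * (H n / s n) powr q) \<longlonglongrightarrow> 0 \<and> (\<lambda>n. R ^ J n * (H n powr (p - 1) / s n powr p)) \<longlonglongrightarrow> 0"
proof -
  define \<beta> where "\<beta> = real d + 1 + 2 * (real d - 1) / (p - 2)"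
  \<comment> \<open>The last limit has the exponent e - (p - 2)/2 * (1 - a \<beta>), which equals -
    e for this choice.\<close>
  define e where "e = (p - 2) / 4 * (1 - a * \<beta>)"
  \<comment> \<open>The rate of the first limit: H / s is at most a multiple of n^(-r).\<close>
  define r where "r = (1 - a * (real d + 1)) / 2"
  \<comment> \<open>Large enough for n^(1 + e) times the q-th power of n^(-r) to be at most 1 /
    n.\<close>
  define q where "q = max (p + 1) ((2 + e) / r)"
  define R where "R = 2 powr (1 + e)"
  define k where "k = c powr (- 1/2)"
  have ab: "a * \<beta> < 1" using a by (simp add: \<beta>_def)
  have e: "0 < e" "e < (p - 2) / 2"
  proof -
    show "0 < e" using ab p by (simp add: e_def)
    have "0 < a * \<beta>" using a d p by (auto simp: \<beta>_def intro!: mult_pos_pos add_pos_nonneg)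
    then have "e \<le> (p - 2) / 4 * 1" unfolding e_def using p by (intro mult_left_mono) auto
    then have "e \<le> (p - 2) / 4" by simp
    also have "\<dots> < (p - 2) / 2" using p by (intro divide_strict_left_mono) auto
    finally show "e < (p - 2) / 2" .
  qed
  have r: "0 < r"
  proof -
    have "a * (real d + 1) \<le> a * \<beta>" using a p d by (intro mult_left_mono) (auto simp: \<beta>_def)
    then show ?thesis using ab by (simp add: r_def)
  qed
  have q: "p < q" "2 + e \<le> r * q"
  proof -
    show "p < q" by (simp add: q_def)
    have "r * ((2 + e) / r) \<le> r * q" using r by (intro mult_left_mono) (auto simp: q_def)
    then show "2 + e \<le> r * q" using r by simp
  qed
  have R: "2 < R" "R < 2 powr (p / 2)"
  proof -
    have "(2::real) powr 1 < 2 powr (1 + e)" using e by (intro powr_less_mono) auto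
    then show "2 < R" by (simp add: R_def)
    show "R < 2 powr (p / 2)" unfolding R_def using e by (intro powr_less_mono) auto
  qed
  define D where "D = (real d - 1) / 2"
  have D: "0 < D" using d by (simp add: D_def)
  have main: "\<forall>\<^sub>F n in sequentially. 0 \<le> H n / s n \<and> H n / s n \<le> k * real n powr (- r) \<and>
      0 \<le> R ^ J n \<and> R ^ J n \<le> (2 * real n) powr (1 + e) \<and>
      R ^ J n * (H n powr (p - 1) / s n powr p) \<le> 2 powr (1 + e) * k powr p * real n powr (- e)"
    using ev eventually_ge_at_top[of 1]
  proof eventually_elim
    case (elim n)
    then have n: "1 \<le> real n" and H: "1 \<le> H n" "H n \<le> real n powr a" and J: "2 ^ J n * H n \<le> 2 * real n"
      and s: "0 < s n" "c * real n \<le> (s n)^2 * H n ^ (d - 1)" by auto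
    have HD: "H n ^ (d - 1) = (H n powr D)^2"
    proof -
      have "H n ^ (d - 1) = H n powr real (d - 1)" using H by (subst powr_realpow) auto
      also have "real (d - 1) = D + D" using d by (simp add: D_def of_nat_diff)
      also have "H n powr (D + D) = (H n powr D)^2" by (simp only: powr_add power2_eq_square)
      finally show ?thesis .
    qed
    have "1 / s n \<le> k * real n powr (- 1/2) * H n powr D"
    proof -
      have "c powr (1/2) * real n powr (1/2) \<le> s n * H n powr D"
      proof (rule power2_le_imp_le)
        have "(c powr (1/2) * real n powr (1/2))^2 = c * real n" using c n
          by (simp add: power_mult_distrib powr_half_sqrt)
        also have "\<dots> \<le> (s n * H n powr D)^2" using s HD by (simp add: power_mult_distrib)
        finally show "(c powr (1/2) * real n powr (1/2))^2 \<le> (s n * H n powr D)^2" .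
      qed (use s in simp)
      then have "(c powr (1/2) * real n powr (1/2)) * (k * real n powr (- 1/2)) \<le> (s n * H n powr D) * (k * real n powr (- 1/2))"
        by (rule mult_right_mono) (simp add: k_def)
      moreover have "(c powr (1/2) * real n powr (1/2)) * (k * real n powr (- 1/2)) = 1"
        using c n by (simp add: k_def powr_minus field_simps)
      ultimately show ?thesis using s by (simp add: divide_le_eq mult_ac)
    qed
    then have inv: "1 / s n \<le> k * (real n powr (- 1/2) * H n powr D)" by simp
    have Hs: "H n / s n \<le> k * real n powr (- r)"
    proof -
      have "H n * (1 / s n) \<le> H n * (k * (real n powr (- 1/2) * H n powr D))" using inv H by (intro mult_left_mono) auto
      also have "\<dots> = k * (real n powr (- 1/2) * (H n powr (1 + D)))" using H by (simp add: powr_add)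
      also have "\<dots> \<le> k * (real n powr (- 1/2) * (real n powr a) powr (1 + D))"
        using H D by (intro mult_left_mono powr_mono2) (auto simp: k_def)
      also have "\<dots> = k * real n powr (- 1/2 + a * (1 + D))" by (simp only: powr_powr powr_add[symmetric])
      also have "- 1/2 + a * (1 + D) = - r" by (simp add: r_def D_def field_simps)
      finally show ?thesis by simp
    qed
    have RJ: "R ^ J n = (2 ^ J n) powr (1 + e)"
    proof -
      have "R ^ J n = R powr real (J n)" using R by (subst powr_realpow) auto
      also have "\<dots> = (2 powr real (J n)) powr (1 + e)" by (simp add: R_def powr_powr mult.commute)
      also have "2 powr real (J n) = (2 ^ J n :: real)" by (rule powr_realpow) simp
      finally show ?thesis .
    qed
    have J': "2 ^ J n \<le> 2 * real n / H n" using J H by (simp add: le_divide_eq)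
    have RJ1: "R ^ J n \<le> (2 * real n) powr (1 + e) * H n powr (- 1)"
    proof -
      have "R ^ J n \<le> (2 * real n / H n) powr (1 + e)" unfolding RJ using J' e by (intro powr_mono2) auto
      also have "\<dots> = (2 * real n) powr (1 + e) / H n powr (1 + e)" using H n by (simp add: powr_divide)
      also have "\<dots> = (2 * real n) powr (1 + e) * H n powr (- (1 + e))" by (simp only: powr_minus divide_inverse)
      \<comment> \<open>The factor 1 / H that is kept here lowers the exponent p - 1 of H to p - 2,
        as the stated bound on \<alpha> demands.\<close>
      also have "\<dots> \<le> (2 * real n) powr (1 + e) * H n powr (- 1)" using H e by (intro mult_left_mono powr_mono) auto
      finally show ?thesis .
    qed
    also have "\<dots> \<le> (2 * real n) powr (1 + e) * 1"
      using H by (intro mult_left_mono) (auto simp: powr_minus inverse_le_1_iff)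
    finally have RJ2: "R ^ J n \<le> (2 * real n) powr (1 + e)" by simp
    have "H n powr (p - 1) / s n powr p = H n powr (p - 1) * (1 / s n) powr p" using s by (simp add: powr_divide)
    also have "\<dots> \<le> H n powr (p - 1) * (k * (real n powr (- 1/2) * H n powr D)) powr p"
      using inv s p by (intro mult_left_mono powr_mono2) auto
    also have "\<dots> = k powr p * real n powr (- p/2) * (H n powr (p - 1) * H n powr (D * p))"
      by (simp add: powr_mult powr_powr k_def)
    finally have Q: "H n powr (p - 1) / s n powr p \<le> k powr p * real n powr (- p/2) * (H n powr (p - 1) * H n powr (D * p))" .
    have "R ^ J n * (H n powr (p - 1) / s n powr p)
        \<le> ((2 * real n) powr (1 + e) * H n powr (- 1)) * (k powr p * real n powr (- p/2) * (H n powr (p - 1) * H n powr (D * p)))"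
      using RJ1 Q by (rule mult_mono) auto
    also have "\<dots> = 2 powr (1 + e) * k powr p * (real n powr (1 + e) * real n powr (- p/2)) * (H n powr (- 1) * H n powr (p - 1) * H n powr (D * p))"
      by (simp add: powr_mult mult_ac)
    also have "real n powr (1 + e) * real n powr (- p/2) = real n powr (1 + e - p / 2)" by (simp flip: powr_add)
    also have "H n powr (- 1) * H n powr (p - 1) * H n powr (D * p) = H n powr (p - 2 + D * p)" by (simp only: powr_add[symmetric]) (simp add: algebra_simps)
    also have "2 powr (1 + e) * k powr p * real n powr (1 + e - p / 2) * H n powr (p - 2 + D * p)
        \<le> 2 powr (1 + e) * k powr p * real n powr (1 + e - p / 2) * (real n powr a) powr (p - 2 + D * p)"
      using H p D by (intro mult_left_mono powr_mono2) auto
    also have "\<dots> = 2 powr (1 + e) * k powr p * real n powr (1 + e - p / 2 + a * (p - 2 + D * p))" by (simp only: powr_powr powr_add[symmetric] mult.assoc)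
    also have "1 + e - p / 2 + a * (p - 2 + D * p) = - e"
    proof -
      have "(p - 2) * \<beta> = (p - 2) * (real d + 1) + 2 * (real d - 1)" using p by (simp add: \<beta>_def distrib_left)
      then have "p - 2 + D * p = (p - 2) / 2 * \<beta>" by (simp add: D_def field_simps)
      then have "1 + e - p / 2 + a * (p - 2 + D * p) = e - (p - 2) / 2 * (1 - a * \<beta>)"
        by (simp only:) (simp add: field_simps)
      then show ?thesis by (simp add: e_def)
    qed
    finally have last: "R ^ J n * (H n powr (p - 1) / s n powr p) \<le> 2 powr (1 + e) * k powr p * real n powr (- e)" .
    show ?case using Hs RJ2 last H s R by auto
  qed
  have l1: "(\<lambda>n. H n / s n) \<longlonglongrightarrow> 0"
    by (rule tendsto_sandwich[OF _ _ tendsto_const neg_powr_tendsto_0[OF r, of k]]) (use main in \<open>auto elim: eventually_mono\<close>)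
  have l2: "(\<lambda>n. R ^ J n * (H n / s n) powr q) \<longlonglongrightarrow> 0"
  proof (rule tendsto_sandwich[OF _ _ tendsto_const neg_powr_tendsto_0[of 1 "2 powr (1 + e) * k powr q"]])
    show "\<forall>\<^sub>F n in sequentially. R ^ J n * (H n / s n) powr q \<le> 2 powr (1 + e) * k powr q * real n powr (- 1)"
      using main eventually_ge_at_top[of 1]
    proof eventually_elim
      case (elim n)
      have "R ^ J n * (H n / s n) powr q \<le> (2 * real n) powr (1 + e) * (k * real n powr (- r)) powr q"
        using elim p q by (intro mult_mono powr_mono2) auto
      also have "\<dots> = 2 powr (1 + e) * k powr q * (real n powr (1 + e) * real n powr (- (r * q)))"
        by (simp add: powr_mult powr_powr k_def mult_ac)
      also have "real n powr (1 + e) * real n powr (- (r * q)) = real n powr (1 + e - r * q)" by (simp flip: powr_add)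
      also have "2 powr (1 + e) * k powr q * real n powr (1 + e - r * q) \<le> 2 powr (1 + e) * k powr q * real n powr (- 1)"
        using elim q by (intro mult_left_mono powr_mono) auto
      finally show ?case .
    qed
  qed (use R in auto)
  have l3: "(\<lambda>n. R ^ J n * (H n powr (p - 1) / s n powr p)) \<longlonglongrightarrow> 0"
    by (rule tendsto_sandwich[OF _ _ tendsto_const neg_powr_tendsto_0[OF e(1), of "2 powr (1 + e) * k powr p"]])
      (use main R in \<open>auto elim: eventually_mono\<close>)
  show ?thesis using R q l1 l2 l3 by blast
qed

lemma satisfies_clt_cong_AE:
  assumes "\<And>n. X n \<in> borel_measurable M" "\<And>n. Y n \<in> borel_measurable M" "\<And>n. AE x in M. X n x = Y n x" "satisfies_clt M X"
  shows "satisfies_clt M Y"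
proof -
  have e: "(\<integral>x. X n x \<partial>M) = (\<integral>x. Y n x \<partial>M)" for n by (rule integral_cong_AE) (use assms in auto)
  have v: "(\<integral>x. (X n x - (\<integral>x. Y n x \<partial>M))^2 \<partial>M) = (\<integral>x. (Y n x - (\<integral>x. Y n x \<partial>M))^2 \<partial>M)" for n
    by (rule integral_cong_AE) (use assms(1,2) in \<open>auto intro: eventually_mono[OF assms(3)[of n]]\<close>)
  have "distr M borel (\<lambda>x. (X n x - (\<integral>x. X n x \<partial>M)) / sqrt (\<integral>x. (X n x - (\<integral>x. X n x \<partial>M))^2 \<partial>M))
      = distr M borel (\<lambda>x. (Y n x - (\<integral>x. Y n x \<partial>M)) / sqrt (\<integral>x. (Y n x - (\<integral>x. Y n x \<partial>M))^2 \<partial>M))" for n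
    unfolding e v by (rule distr_cong_AE) (use assms(1,2) in \<open>auto intro: eventually_mono[OF assms(3)[of n]]\<close>)
  then show ?thesis using assms(4) by (simp add: satisfies_clt_def)
qed

section \<open>Comparison of the three passage times\<close>

definition cylinder_paths :: "nat \<Rightarrow> nat \<Rightarrow> nat \<Rightarrow> vertex list set" where
  "cylinder_paths d n h = {xs. lattice_path d (cylinder d h) xs \<and> hd xs = axis_point 0 \<and> last xs = axis_point (int n)}"

lemma axis_paths_cylinder: "axis_paths d n h \<subseteq> cylinder_paths d n h"
  by (auto simp: axis_paths_def cylinder_paths_def box_def lattice_path_def)

lemma ptime_antimono: "\<P> \<noteq> {} \<Longrightarrow> \<P> \<subseteq> \<Q> \<Longrightarrow> ptime \<Q> u \<le> ptime \<P> u"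
  by (rule ptime_ge) (auto intro: ptime_le)

lemma passage_times_eq_INF:
  "fpp_a d n h u = (INF xs\<in>cylinder_paths d n h. path_weight u xs)"
  "fpp_t d n h u = (INF xs\<in>axis_paths d n h. path_weight u xs)"
  "fpp_T d n h u = (INF xs\<in>crossings d 0 n h. path_weight u xs)"
  by (simp_all add: fpp_a_def fpp_t_def fpp_T_def cylinder_paths_def axis_paths_def crossings_def box_eq_slab setcompr_eq_image)

context fpp
begin

lemma INF_path_weight:
  assumes P: "\<P> \<subseteq> {xs. lattice_path d (Zd d) xs}"
  shows "(\<lambda>x. INF xs\<in>\<P>. path_weight (\<lambda>e. w e x) xs) \<in> borel_measurable M"
    "AE x in M. ptime \<P> (\<lambda>e. w e x) = (INF xs\<in>\<P>. path_weight (\<lambda>e. w e x) xs)"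
proof -
  have LE: "set (path_edges xs) \<subseteq> LE" if "xs \<in> \<P>" for xs
    using path_edges_inside[of d "Zd d" xs] P that by blast
  show "(\<lambda>x. INF xs\<in>\<P>. path_weight (\<lambda>e. w e x) xs) \<in> borel_measurable M"
  proof (rule borel_measurable_cINF_real[OF countable_subset[OF P countable_lattice_paths]])
    fix xs assume "xs \<in> \<P>"
    from LE[OF this] have "(\<lambda>x. \<Sum>e\<leftarrow>es. w e x) \<in> borel_measurable M" if "set es \<subseteq> set (path_edges xs)" for es
      using that by (induction es) (auto intro!: borel_measurable_add rv)
    then show "(\<lambda>x. path_weight (\<lambda>e. w e x) xs) \<in> borel_measurable M" unfolding path_weight_def by blast
  qed
  show "AE x in M. ptime \<P> (\<lambda>e. w e x) = (INF xs\<in>\<P>. path_weight (\<lambda>e. w e x) xs)"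
    using weights_nonneg
  proof eventually_elim
    case (elim x)
    show ?case unfolding ptime_def
    proof (intro INF_cong refl path_weight_cong)
      fix xs e assume "xs \<in> \<P>" "e \<in> set (path_edges xs)"
      then have "e \<in> LE" using LE by blast
      then show "max 0 (w e x) = w e x" using elim by simp
    qed
  qed
qed

text \<open>The slab has at most d 2^d n (h + 1)^(d-1) edges; the square of the mean of R is of
  order n^2, and one factor n cancels.\<close>

lemma crossing_variance_ge:
  assumes sq: "integrable M (\<lambda>x. (crossing_time 0 n h x)^2)" and c: "0 \<le> c" "c < c2" and n: "1 \<le> n"
    and R: "closed_bound c2 n h R" "k * real n \<le> expectation R" and k: "0 \<le> k"
  shows "(cdf F c * (c2 - c) * k)^2 / (real d * 2 ^ d) * real n \<le> variance (crossing_time 0 n h) * (real h + 1) ^ (d - 1)"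
proof -
  let ?E = "inside LE (slab d 0 n h)" and ?v = "variance (crossing_time 0 n h)"
  have R': "R \<in> borel_measurable M" "\<And>x. 0 \<le> R x"
    "\<And>x xs. xs \<in> crossings d 0 n h \<Longrightarrow> R x \<le> real (card {e \<in> set (path_edges xs). c2 < w e x})"
    using R(1) by (auto simp: closed_bound_def)
  have "real (card ?E) \<le> real (d * ((n + 1) * (2 * h + 1) ^ (d - 1)))"
    by (intro of_nat_mono card_inside_slab d1)
  also have "\<dots> \<le> real d * ((2 * real n) * (2 * (real h + 1)) ^ (d - 1))"
  proof -
    have "real (n + 1) * real (2 * h + 1) ^ (d - 1) \<le> (2 * real n) * (2 * (real h + 1)) ^ (d - 1)"
      using n by (intro mult_mono power_mono) auto
    then show ?thesis unfolding of_nat_mult of_nat_power by (rule mult_left_mono) simp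
  qed
  also have "\<dots> = real d * (2 * 2 ^ (d - 1)) * real n * (real h + 1) ^ (d - 1)"
    unfolding power_mult_distrib by (simp only: mult_ac)
  also have "(2 :: real) * 2 ^ (d - 1) = 2 ^ d" using d1 by (simp flip: power_Suc)
  finally have card: "real (card ?E) \<le> real d * 2 ^ d * real n * (real h + 1) ^ (d - 1)" .
  have "(cdf F c * (c2 - c) * k)^2 * real n * real n = (cdf F c * (c2 - c) * (k * real n))^2"
    by (simp add: power_mult_distrib power2_eq_square)
  also have "\<dots> \<le> (cdf F c * (c2 - c) * expectation R)^2"
    using R(2) k c cdf_bounds[of c] by (intro power_mono mult_left_mono mult_nonneg_nonneg) auto
  also have "\<dots> \<le> ?v * real (card ?E)" by (rule variance_lower_bound[OF sq c R'])
  also have "\<dots> \<le> ?v * (real d * 2 ^ d * real n * (real h + 1) ^ (d - 1))"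
    using card by (rule mult_left_mono) simp
  finally have "(cdf F c * (c2 - c) * k)^2 * real n * real n \<le> ?v * (real d * 2 ^ d * real n * (real h + 1) ^ (d - 1))" .
  then have "((cdf F c * (c2 - c) * k)^2 * real n) * real n \<le> (?v * (real h + 1) ^ (d - 1) * (real d * 2 ^ d)) * real n"
    by (simp only: mult_ac)
  then have "(cdf F c * (c2 - c) * k)^2 * real n \<le> ?v * (real h + 1) ^ (d - 1) * (real d * 2 ^ d)"
    using n by (subst (asm) mult_le_cancel_right_pos) auto
  moreover have "0 < real d * 2 ^ d" using d1 by simp
  ultimately show ?thesis by (simp add: pos_divide_le_eq)
qed

text \<open>The common end of all cases: they differ only in the source of the minorant R and in the
  choice of the exponent a.\<close>

lemma clt_of_closed_bound:
  assumes p: "2 < p" and mom: "integrable F (\<lambda>x. x powr p)"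
    and a: "0 < a" "a * (real d + 1 + 2 * (real d - 1) / (p - 2)) < 1"
    and h: "\<forall>\<^sub>F n in sequentially. real (h n) + 1 \<le> real n powr a"
    and c: "0 \<le> c" "c < c2" "0 < cdf F c" and k: "0 < k"
    and R: "\<forall>\<^sub>F n in sequentially. \<exists>R. closed_bound c2 n (h n) R \<and> k * real n \<le> expectation R"
  shows "fpp_clts d M w h"
proof -
  obtain C where C: "0 < C" and tc: "tail_const p C"
    using fresh_sum_tail[OF p mom, of "4 * real d + 8"] by (auto simp: tail_const_def)
  define H where "H n = real (h n) + 1" for n
  define J where "J n = levels n (h n)" for n
  define T where "T n = crossing_time 0 n (h n)" for n
  define X where "X n j = crossing_time 0 (halve n j) (h n)" for n j
  define Y where "Y n j = crossing_time (int (halve n j) - int (halve n (Suc j))) (halve n (Suc j)) (h n)" for n j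
  define s where "s n = sqrt (variance (T n))" for n
  define c1 where "c1 = (cdf F c * (c2 - c) * k)^2 / (real d * 2 ^ d)"
  have c1: "0 < c1" using c k d1 by (simp add: c1_def)
  have H1: "1 \<le> H n" for n by (simp add: H_def)
  have X0: "X n 0 = T n" for n by (simp add: X_def T_def)
  have Tm [measurable]: "T n \<in> borel_measurable M" for n by (simp add: T_def)
  have chain: "merge_chain M p C (H n) (J n) (X n) (Y n) (\<lambda>j x. X n j x - X n (Suc j) x - Y n j x)" for n
    unfolding H_def J_def X_def Y_def by (rule halving_chain[OF tc p]) (rule levels; assumption)+
  have sqT: "integrable M (\<lambda>x. (T n x)^2)" for n
    using merge_chain_square[OF chain[of n] C H1 p, of 0] by (simp add: X0)
  have s2: "(s n)^2 = variance (T n)" for n by (simp add: s_def)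
  have lower: "\<forall>\<^sub>F n in sequentially. c1 * real n \<le> (s n)^2 * H n ^ (d - 1)"
    using R eventually_ge_at_top[of 1]
  proof eventually_elim
    case (elim n)
    then obtain R where R: "closed_bound c2 n (h n) R" "k * real n \<le> expectation R" by blast
    show ?case unfolding s2 c1_def H_def T_def
      by (rule crossing_variance_ge[OF sqT[of n, unfolded T_def] c(1,2) _ R]) (use elim k in auto)
  qed
  have a1: "a \<le> 1"
  proof -
    have "a * 1 \<le> a * (real d + 1 + 2 * (real d - 1) / (p - 2))"
      using a p d2 by (intro mult_left_mono) (auto simp: add_increasing2)
    from le_less_trans[OF this a(2)] show ?thesis by simp
  qed
  have ev: "\<forall>\<^sub>F n in sequentially. 1 \<le> H n \<and> H n \<le> real n powr a \<and> 2 ^ J n * H n \<le> 2 * real n \<and>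
      c1 * real n \<le> (s n)^2 * H n ^ (d - 1) \<and> 0 < s n"
    using h lower eventually_ge_at_top[of 1]
  proof eventually_elim
    case (elim n)
    have "real n powr a \<le> real n powr 1" using a1 elim by (intro powr_mono) auto
    then have "h n + 1 \<le> n" using elim by (simp add: H_def)
    then have "2 ^ levels n (h n) * (h n + 1) \<le> 2 * n" by (rule levels)
    then have "real (2 ^ levels n (h n) * (h n + 1)) \<le> real (2 * n)" by (rule of_nat_mono)
    then have "2 ^ J n * H n \<le> 2 * real n" by (simp add: J_def H_def algebra_simps)
    moreover have "0 < s n"
    proof (rule ccontr)
      assume "\<not> 0 < s n"
      then have "s n = 0" unfolding s_def using real_sqrt_ge_zero[of "variance (T n)"] by (metis antisym not_less variance_positive)
      then have "c1 * real n \<le> 0" using elim by simp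
      then show False using c1 elim by (simp add: mult_le_0_iff)
    qed
    ultimately show ?case using elim H1 by (simp add: H_def)
  qed
  obtain R q where Rq: "2 < R" "R < 2 powr (p / 2)" "p < q" and lim: "(\<lambda>n. H n / s n) \<longlonglongrightarrow> 0"
    "(\<lambda>n. R ^ J n * (H n / s n) powr q) \<longlonglongrightarrow> 0" "(\<lambda>n. R ^ J n * (H n powr (p - 1) / s n powr p)) \<longlonglongrightarrow> 0"
    using rate_limits[OF d2 p a c1 ev] by blast
  \<comment> \<open>Since n \<le> (h + 4) 2^J and h + 4 \<le> 4 n^a with a < 1, J cannot stay
    bounded along a subsequence.\<close>
  have Jlim: "filterlim J at_top sequentially"
  proof (rule filterlim_at_top[THEN iffD2], rule allI)
    fix Z :: nat
    have "filterlim (\<lambda>n. real n powr (1 - a)) at_top sequentially"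
    proof -
      have "a * 1 < a * (real d + 1 + 2 * (real d - 1) / (p - 2))"
        using a p d2 by (intro mult_strict_left_mono) (auto intro!: add_pos_nonneg)
      from less_trans[OF this a(2)] have "0 < 1 - a" by simp
      then show ?thesis by (rule real_powr_at_top[THEN filterlim_compose, OF _ filterlim_real_sequentially])
    qed
    then have "\<forall>\<^sub>F n in sequentially. 4 * 2 ^ Z < real n powr (1 - a)" by (simp add: filterlim_at_top_dense)
    then show "\<forall>\<^sub>F n in sequentially. Z \<le> J n" using h eventually_ge_at_top[of 1]
    proof eventually_elim
      case (elim n)
      show ?case
      proof (rule ccontr)
        assume "\<not> Z \<le> J n"
        have "n \<le> (h n + 4) * 2 ^ J n" unfolding J_def by (rule levels)
        also have "\<dots> \<le> (h n + 4) * 2 ^ Z" using \<open>\<not> Z \<le> J n\<close> by (intro mult_left_mono power_increasing) auto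
        finally have "real n \<le> real ((h n + 4) * 2 ^ Z)" by (rule of_nat_mono)
        also have "\<dots> \<le> (4 * real n powr a) * 2 ^ Z" using elim by simp
        also have "\<dots> = real n powr a * (4 * 2 ^ Z)" by simp
        also have "\<dots> < real n powr a * real n powr (1 - a)" using elim by (intro mult_strict_left_mono) auto
        also have "\<dots> = real n" using elim by (simp flip: powr_add)
        finally show False by simp
      qed
    qed
  qed
  have cltT: "satisfies_clt M T"
  proof -
    have "satisfies_clt M (\<lambda>n. X n 0)"
    proof (rule dyadic_clt[OF prob_space_axioms p Rq(3) C Rq(1,2) _ _ Jlim, where H = H and Y = Y and D = "\<lambda>n j x. X n j x - X n (Suc j) x - Y n j x"])
      show "\<forall>\<^sub>F n in sequentially. 1 \<le> H n \<and> merge_chain M p C (H n) (J n) (X n) (Y n) (\<lambda>j x. X n j x - X n (Suc j) x - Y n j x)"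
        using H1 chain by simp
      show "\<forall>\<^sub>F n in sequentially. 0 < sqrt (variance (X n 0))"
        unfolding X0 s_def[symmetric] using ev by eventually_elim simp
    qed (use lim in \<open>simp_all add: X0 s_def\<close>)
    then show ?thesis by (simp add: X0)
  qed
  \<comment> \<open>Any variable between the crossing time of the slab and the time from axis to
    axis is at distance O(H) from the former in mean square, because
    \<open>crossing_time 2 (n - 4)\<close> lies below both.\<close>
  have close: "satisfies_clt M Z" if Zm: "\<And>n. Z n \<in> borel_measurable M"
    and Z: "\<And>n x. T n x \<le> Z n x" "\<And>n x. Z n x \<le> axis_time n (h n) x" for Z
  proof -
    have sqZ: "integrable M (\<lambda>x. (Z n x)^2) \<and> expectation (\<lambda>x. (T n x - Z n x)^2) \<le> sqc C * (H n)^2" if n: "5 \<le> n" for n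
    proof -
      define D where "D x = axis_time n (h n) x - crossing_time 2 (n - 4) (h n) x" for x
      have st: "small_tail M p C (H n) D" unfolding D_def H_def by (rule small_tail_ends[OF tc p n])
      note sqD = small_tail_square[OF st C H1 p]
      have [measurable]: "D \<in> borel_measurable M" using st by (simp add: small_tail_def)
      have inner: "crossing_time 2 (n - 4) (h n) x \<le> T n x" for x
        unfolding crossing_time_def T_def
        by (rule ptime_crossings_le[OF d1 crossings_nonempty[OF d1]])
          (use n in \<open>auto simp: crossings_def lattice_path_def slab_def\<close>)
      have le: "(T n x - Z n x)^2 \<le> (D x)^2" for x
      proof -
        have "\<bar>T n x - Z n x\<bar> \<le> \<bar>D x\<bar>" using Z(1)[of n x] Z(2)[of n x] inner[of x] unfolding D_def by linarith
        then show ?thesis by (rule abs_le_square_iff[THEN iffD1])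
      qed
      have iD: "integrable M (\<lambda>x. (T n x - Z n x)^2)"
        by (rule Bochner_Integration.integrable_bound[OF sqD(1)]) (use le Zm in auto)
      have "integrable M (\<lambda>x. (Z n x - T n x)^2)" using iD by (simp add: power2_commute)
      from integrable_add_square[OF _ Tm[of n] this sqT[of n]] have "integrable M (\<lambda>x. (Z n x)^2)" using Zm by simp
      moreover have "expectation (\<lambda>x. (T n x - Z n x)^2) \<le> expectation (\<lambda>x. (D x)^2)"
        using le by (intro integral_mono iD sqD(1)) auto
      ultimately show ?thesis using sqD(2) by linarith
    qed
    show ?thesis
    proof (rule clt_of_l2_close[OF prob_space_axioms Tm Zm _ _ _ cltT])
      show "\<forall>\<^sub>F n in sequentially. integrable M (\<lambda>x. (T n x)^2) \<and> integrable M (\<lambda>x. (Z n x)^2)"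
        using eventually_ge_at_top[of 5] by eventually_elim (use sqT sqZ in blast)
      show "\<forall>\<^sub>F n in sequentially. 0 < variance (T n)" using ev by eventually_elim (simp add: s_def)
      have "(\<lambda>n. sqc C * (H n / s n)^2) \<longlonglongrightarrow> sqc C * 0^2" by (intro tendsto_intros lim)
      then have lim2: "(\<lambda>n. sqc C * (H n / s n)^2) \<longlonglongrightarrow> 0" by simp
      show "(\<lambda>n. expectation (\<lambda>x. (T n x - Z n x)^2) / variance (T n)) \<longlonglongrightarrow> 0"
      proof (rule tendsto_sandwich[OF _ _ tendsto_const lim2])
        show "\<forall>\<^sub>F n in sequentially. 0 \<le> expectation (\<lambda>x. (T n x - Z n x)^2) / variance (T n)" by simp
        show "\<forall>\<^sub>F n in sequentially. expectation (\<lambda>x. (T n x - Z n x)^2) / variance (T n) \<le> sqc C * (H n / s n)^2"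
          using eventually_ge_at_top[of 5]
        proof eventually_elim
          case (elim n)
          have "expectation (\<lambda>x. (T n x - Z n x)^2) / variance (T n) \<le> (sqc C * (H n)^2) / variance (T n)"
            using sqZ[OF elim] by (intro divide_right_mono) auto
          then show ?case by (simp add: power_divide flip: s2)
        qed
      qed
    qed
  qed
  have sub: "crossings d 0 n m \<subseteq> {xs. lattice_path d (Zd d) xs}" "axis_paths d n m \<subseteq> {xs. lattice_path d (Zd d) xs}"
    "cylinder_paths d n m \<subseteq> {xs. lattice_path d (Zd d) xs}" for n m
    using crossings_paths axis_paths_crossings cylinder_Zd by (blast, blast, fastforce simp: cylinder_paths_def lattice_path_def)
  have ax: "axis_paths d n m \<noteq> {}" for n m by (rule axis_paths_nonempty[OF d1])
  then have cyl: "cylinder_paths d n m \<noteq> {}" for n m using axis_paths_cylinder by blast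
  have T_le_cyl: "T n x \<le> ptime (cylinder_paths d n (h n)) (\<lambda>e. w e x)" for n x
    unfolding T_def crossing_time_def
    by (rule ptime_crossings_le[OF d1 cyl]) (auto simp: cylinder_paths_def axis_point_def)
  have cyl_le: "ptime (cylinder_paths d n (h n)) (\<lambda>e. w e x) \<le> axis_time n (h n) x" for n x
    unfolding axis_time_def by (rule ptime_antimono[OF ax axis_paths_cylinder])
  have cyl_m: "(\<lambda>x. ptime (cylinder_paths d n (h n)) (\<lambda>e. w e x)) \<in> borel_measurable M" for n
    by (rule ptime_measurable[OF sub(3)])
  have ax_m: "axis_time n (h n) \<in> borel_measurable M" for n
    unfolding axis_time_def[abs_def] by (rule ptime_measurable[OF sub(2)])
  have clt_a: "satisfies_clt M (\<lambda>n x. ptime (cylinder_paths d n (h n)) (\<lambda>e. w e x))"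
    by (rule close[OF cyl_m T_le_cyl cyl_le])
  have clt_t: "satisfies_clt M (\<lambda>n. axis_time n (h n))"
    by (rule close[OF ax_m _ order_refl]) (rule order_trans[OF T_le_cyl cyl_le])
  show ?thesis
    unfolding fpp_clts_def passage_times_eq_INF
  proof (intro conjI)
    show "satisfies_clt M (\<lambda>n x. INF xs\<in>cylinder_paths d n (h n). path_weight (\<lambda>e. w e x) xs)"
      by (rule satisfies_clt_cong_AE[OF cyl_m INF_path_weight(1)[OF sub(3)] INF_path_weight(2)[OF sub(3)] clt_a])
    show "satisfies_clt M (\<lambda>n x. INF xs\<in>axis_paths d n (h n). path_weight (\<lambda>e. w e x) xs)"
      by (rule satisfies_clt_cong_AE[OF ax_m INF_path_weight(1)[OF sub(2)] _ clt_t]) (unfold axis_time_def, rule INF_path_weight(2)[OF sub(2)])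
    show "satisfies_clt M (\<lambda>n x. INF xs\<in>crossings d 0 n (h n). path_weight (\<lambda>e. w e x) xs)"
      by (rule satisfies_clt_cong_AE[OF Tm INF_path_weight(1)[OF sub(1)] _ cltT]) (unfold T_def crossing_time_def, rule INF_path_weight(2)[OF sub(1)])
  qed
qed

lemma clt_admissible:
  assumes adm: "admissible d F" and p: "2 < p" "integrable F (\<lambda>x. x powr p)"
    and \<alpha>: "\<alpha> < 1 / (real d + 1 + 2 * (real d - 1) / (p - 2))"
    and h: "(\<lambda>n. real (h n)) \<in> o(\<lambda>n. real n powr \<alpha>)"
  shows "fpp_clts d M w h"
proof -
  define \<beta> where "\<beta> = real d + 1 + 2 * (real d - 1) / (p - 2)"
  have \<beta>: "0 < \<beta>" "1 \<le> \<beta>" using p d2 by (auto simp: \<beta>_def add_pos_nonneg add_increasing2)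
  have "max \<alpha> 0 < 1 / \<beta>" using \<alpha> \<beta> by (simp add: \<beta>_def)
  \<comment> \<open>\<alpha> may be zero or negative; a > max \<alpha> 0 leaves a positive power of
    n to absorb the additional 1 in h + 1.\<close>
  then obtain a where a1: "max \<alpha> 0 < a" "a < 1 / \<beta>" using dense by blast
  then have a: "max \<alpha> 0 < a" "0 < a" "a * \<beta> < 1" using \<beta> by (auto simp: less_divide_eq)
  have "filterlim (\<lambda>n. real n powr (a - max \<alpha> 0)) at_top sequentially"
    using a(1) by (intro real_powr_at_top[THEN filterlim_compose, OF _ filterlim_real_sequentially]) simp
  then have big: "\<forall>\<^sub>F n in sequentially. 2 < real n powr (a - max \<alpha> 0)" by (simp add: filterlim_at_top_dense)
  have hb: "\<forall>\<^sub>F n in sequentially. real (h n) \<le> real n powr \<alpha>"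
    using landau_o.smallD[OF h, of 1] by simp
  have ha: "\<forall>\<^sub>F n in sequentially. real (h n) + 1 \<le> real n powr a"
    using big hb eventually_ge_at_top[of 1]
  proof eventually_elim
    case (elim n)
    have "real n powr \<alpha> \<le> real n powr max \<alpha> 0" using elim by (intro powr_mono) auto
    moreover have "1 \<le> real n powr max \<alpha> 0" using elim by (intro ge_one_powr_ge_zero) auto
    ultimately have "real (h n) + 1 \<le> real n powr max \<alpha> 0 * 2" using elim by linarith
    also have "\<dots> \<le> real n powr max \<alpha> 0 * real n powr (a - max \<alpha> 0)" using elim by (intro mult_left_mono) auto
    also have "\<dots> = real n powr a" by (simp flip: powr_add)
    finally show ?case .
  qed
  \<comment> \<open>Below 1 as well as below the critical value, so that closed edges have positive
    probability.\<close>
  have "cdf F (smallest_support_point F) < min 1 (p_crit d)"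
    using cdf_smallest_support_point_less_1[OF nn] adm by (simp add: admissible_def)
  from cdf_thresholds[OF nn this] obtain c c2 where c: "0 \<le> c" "c < c2" "0 < cdf F c" "cdf F c2 < min 1 (p_crit d)" .
  have q: "cdf F c2 < 1" "cdf F c2 < p_crit d" using c by auto
  obtain k where k: "0 < k" "\<forall>\<^sub>F n in sequentially. \<forall>h\<le>n. \<exists>R. closed_bound c2 n h R \<and> k * real n \<le> expectation R"
    using closed_edges_subcritical[OF q] by blast
  show ?thesis
  proof (rule clt_of_closed_bound[OF p a(2) a(3)[unfolded \<beta>_def] ha c(1-3)])
    show "\<forall>\<^sub>F n in sequentially. \<exists>R. closed_bound c2 n (h n) R \<and> k * real n \<le> expectation R"
      using k(2) ha eventually_ge_at_top[of 1]
    proof eventually_elim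
      case (elim n)
      have "a * 1 \<le> a * \<beta>" using a \<beta> by (intro mult_left_mono) auto
      from le_less_trans[OF this a(3)] have "real n powr a \<le> real n powr 1" using elim by (intro powr_mono) auto
      then have "h n \<le> n" using elim by simp
      then show ?case using elim by blast
    qed
  qed (rule k)
qed

text \<open>As p grows, 2 (d - 1) / (p - 2) tends to 0, so p can be fixed according to the distance
  of \<alpha> from 1 / (d + 1).\<close>

lemma clt_admissible_all_moments:
  assumes adm: "admissible d F" and mom: "\<And>p. 1 \<le> p \<Longrightarrow> integrable F (\<lambda>x. x powr p)"
    and \<alpha>: "\<alpha> < 1 / (real d + 1)" and h: "(\<lambda>n. real (h n)) \<in> o(\<lambda>n. real n powr \<alpha>)"
  shows "fpp_clts d M w h"
proof -
  have "\<exists>p>2. \<alpha> < 1 / (real d + 1 + 2 * (real d - 1) / (p - 2))"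
  proof (cases "\<alpha> \<le> 0")
    case True
    have "0 < 1 / (real d + 1 + 2 * (real d - 1) / (3 - 2))" using d2 by (auto intro!: divide_pos_pos add_pos_nonneg)
    then show ?thesis using True by (intro exI[of _ 3]) linarith
  next
    case False
    define \<mu> where "\<mu> = 1 - \<alpha> * (real d + 1)"
    have \<mu>: "0 < \<mu>" using \<alpha> by (simp add: \<mu>_def less_divide_eq)
    \<comment> \<open>With p - 2 = t the additional term costs \<alpha> * 2 (d - 1) / t, which is
      less than the slack \<mu>.\<close>
    define t where "t = 2 * real d * \<alpha> / \<mu>"
    have t: "0 < t" "t * \<mu> = 2 * real d * \<alpha>" using False \<mu> d1 by (auto simp: t_def)
    have "\<alpha> * (2 * (real d - 1)) < t * \<mu>" unfolding t(2) using False by (simp add: algebra_simps)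
    then have "\<alpha> * (2 * (real d - 1) / t) < \<mu>" using t(1) by (simp add: divide_less_eq mult.commute)
    then have "\<alpha> * (real d + 1 + 2 * (real d - 1) / t) < 1" by (simp add: \<mu>_def distrib_left)
    moreover have "0 < real d + 1 + 2 * (real d - 1) / t" using t d2 by (intro add_pos_nonneg) auto
    ultimately have "\<alpha> < 1 / (real d + 1 + 2 * (real d - 1) / t)" by (simp add: less_divide_eq)
    then show ?thesis using t by (intro exI[of _ "t + 2"]) simp
  qed
  then obtain p where p: "2 < p" "\<alpha> < 1 / (real d + 1 + 2 * (real d - 1) / (p - 2))" by blast
  show ?thesis by (rule clt_admissible[OF adm p(1) mom p(2) h]) (use p in simp)
qed

text \<open>With bounded width the entirely closed slices have a positive density, so the heavy
  threshold is chosen by its distribution function lying below 1 instead of below the critical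
  value.\<close>

lemma clt_bounded_width:
  assumes p: "2 < p" "integrable F (\<lambda>x. x powr p)" and h: "(\<lambda>n. real (h n)) \<in> O(\<lambda>n. 1)"
  shows "fpp_clts d M w h"
proof -
  define \<beta> where "\<beta> = real d + 1 + 2 * (real d - 1) / (p - 2)"
  have \<beta>: "0 < \<beta>" using p d2 by (auto simp: \<beta>_def add_pos_nonneg)
  \<comment> \<open>Any a > 0 with a * \<beta> < 1 would do: h + 1 is bounded and n^a is
    not.\<close>
  define a where "a = 1 / (2 * \<beta>)"
  have a: "0 < a" "a * \<beta> < 1" using \<beta> by (auto simp: a_def)
  obtain b where b: "\<forall>\<^sub>F n in sequentially. real (h n) \<le> b" using h by (auto elim!: landau_o.bigE)
  define B where "B = nat \<lceil>b\<rceil>"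
  have hB: "\<forall>\<^sub>F n in sequentially. h n \<le> B" using b by eventually_elim (simp add: B_def nat_le_iff le_nat_iff; linarith)
  obtain e e2 where e: "0 \<le> e" "e < e2" "0 < cdf F e" "cdf F e2 < 1" by (rule cdf_thresholds[OF nn cdf_smallest_support_point_less_1[OF nn]])
  define k where "k = (1 - cdf F e2) ^ (d * (2 * (2 * B + 1) ^ (d - 1)))"
  show ?thesis
  proof (rule clt_of_closed_bound[OF p a(1) a(2)[unfolded \<beta>_def] _ e(1-3)])
    have "filterlim (\<lambda>n. real n powr a) at_top sequentially"
      by (rule real_powr_at_top[THEN filterlim_compose, OF a(1) filterlim_real_sequentially])
    then have "\<forall>\<^sub>F n in sequentially. real B + 1 < real n powr a" by (simp add: filterlim_at_top_dense)
    then show "\<forall>\<^sub>F n in sequentially. real (h n) + 1 \<le> real n powr a"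
      using hB by eventually_elim linarith
    show "0 < k" using e by (simp add: k_def)
    show "\<forall>\<^sub>F n in sequentially. \<exists>R. closed_bound e2 n (h n) R \<and> k * real n \<le> expectation R"
      using hB
    proof eventually_elim
      case (elim n)
      obtain R where R: "closed_bound e2 n (h n) R" "real n * (1 - cdf F e2) ^ (d * (2 * (2 * h n + 1) ^ (d - 1))) \<le> expectation R"
        using closed_slices by blast
      have "k \<le> (1 - cdf F e2) ^ (d * (2 * (2 * h n + 1) ^ (d - 1)))"
        unfolding k_def using elim cdf_bounds[of e2] by (intro power_decreasing mult_left_mono power_mono) auto
      then have "k * real n \<le> (1 - cdf F e2) ^ (d * (2 * (2 * h n + 1) ^ (d - 1))) * real n" by (rule mult_right_mono) simp
      then have "k * real n \<le> expectation R" using R(2) by (simp only: mult.commute)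
      then show ?case using R(1) by blast
    qed
  qed
qed

end

theorem theorem1p1:
  fixes d :: nat and F :: "real measure" and M :: "'a measure"
    and w :: "edge \<Rightarrow> 'a \<Rightarrow> real" and h :: "nat \<Rightarrow> nat"
  assumes "d \<ge> 2" and "iid_edge_weights d F M w"
  shows
    "(\<forall>p \<alpha> :: real. admissible d F \<longrightarrow> p > 2 \<longrightarrow> integrable F (\<lambda>x. x powr p) \<longrightarrow>
        \<alpha> < 1 / (real d + 1 + 2 * (real d - 1) / (p - 2)) \<longrightarrow>
        (\<lambda>n. real (h n)) \<in> o(\<lambda>n. real n powr \<alpha>) \<longrightarrow> fpp_clts d M w h) \<and>
     (\<forall>\<alpha> :: real. admissible d F \<longrightarrow> (\<forall>p\<ge>1. integrable F (\<lambda>x. x powr p)) \<longrightarrow>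
        \<alpha> < 1 / (real d + 1) \<longrightarrow>
        (\<lambda>n. real (h n)) \<in> o(\<lambda>n. real n powr \<alpha>) \<longrightarrow> fpp_clts d M w h) \<and>
     (\<forall>p :: real. nonneg_nondegenerate F \<longrightarrow> p > 2 \<longrightarrow> integrable F (\<lambda>x. x powr p) \<longrightarrow>
        (\<lambda>n. real (h n)) \<in> O(\<lambda>n. 1) \<longrightarrow> fpp_clts d M w h)"
proof -
  have fpp: "fpp M d F w" if "nonneg_nondegenerate F"
    using assms that by (simp add: fpp_def fpp_axioms_def iid_edge_weights_def)
  have adm: "nonneg_nondegenerate F" if "admissible d F" using that by (simp add: admissible_def)
  show ?thesis
    using fpp.clt_admissible[OF fpp[OF adm]] fpp.clt_admissible_all_moments[OF fpp[OF adm]] fpp.clt_bounded_width[OF fpp]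
    by blast
qed

end
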